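(* Assume that $\liminf_{n\to\infty}S_n=-\infty$ a.s. and $\limsup_{n\to\infty}S_n'=+\infty$ a.s. Then the following is true. (a) The switching random walk $Y$ is topologically recurrent on $\operatorname{supp}\mu$ when $I<\infty$, where $$I:=\int_0^\infty\mathbb P(D\le-x)\,\mathbb P(A'\ge x)\,dx.$$ We have $I<\infty$ when $\mathbb E|D|^r+\mathbb E(A')^{1-r}<\infty$ for some $r\in[0,1]$ (by convention, $0^0:=1$). (b) The transition kernel $P$ is topologically recurrent on $\operatorname{supp}\mu$ if and only if the transition kernel $P_H$ is topologically recurrent on $\operatorname{supp}\nu$.
   Context: Setting. $X_1,X_1'$ are real random variables, neither a.s. equal to $0$, and $\alpha\in[0,1]$. $(X_n)_{n\ge1}$ and $(X_n')_{n\ge1}$ are sequences of i.i.d. random variables, jointly independent; $S_n:=X_1+\dots+X_n$, $S_n':=X_1'+\dots+X_n'$. The switching random walk $Y=(Y_n)_{n\ge0}$ is the time-homogeneous Markov chain with transition kernel $P=P[X_1,X_1',\alpha]$: $P(x,dy)=\mathbb P(x+X_1\in dy)$ if $x>0$; $P(x,dy)=\mathbb P(x+X_1'\in dy)$ if $x<0$; $P(0,dy)=\alpha\,\mathbb P(X_1\in dy)+(1-\alpha)\,\mathbb P(X_1'\in dy)$. $\mathbb P_x$ means that the chain starts at $x$. State space. $\mathcal Z_0:=\mathbb R$, $\mathcal Z_u:=u\mathbb Z$ for $u>0$; $d:=\max\{u\ge0:\mathbb P(X_1\in\mathcal Z_u)\,\mathbb P(X_1'\in\mathcal Z_u)=1\}$;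 $\mathcal Z:=\mathcal Z_d$ is the state space of $Y$. $\lambda$ is the Haar measure on $\mathcal Z$ normalized so that $\lambda([0,x)\cap\mathcal Z)=x$ for positive $x\in\mathcal Z$. Measures are Borel; $\operatorname{supp}$ is the topological support; $*$ is convolution. Ladder heights. $D:=S_{\gamma_-}$ with $\gamma_-:=\inf\{k\ge1:S_k\le0\}$; $A':=S'_{\gamma_+'}$ with $\gamma_+':=\inf\{k\ge1:S_k'\ge0\}$; $A_s$ is the value of $S$ at the first $k\ge1$ with $S_k>0$ (if any), $D_s'$ is the value of $S'$ at the first $k\ge1$ with $S_k'<0$ (if any), both possibly defective; $\mathcal L(\cdot)$ denotes (sub-probability) distribution. $U_+:=\delta_0+\sum_{n\ge1}\mathcal L(A_s)^{*n}$, $U_-':=\delta_0+\sum_{n\ge1}\mathcal L(D_s')^{*n}$. $P_H:=P[D,A',\alpha]$ is the kernel obtained by replacing $X_1$ by $D$ and $X_1'$ by $A'$ in $P$. For a measure $\varphi$ on $\mathcal Z$: $\varphi_\alpha^+(dx):=[\mathbf 1(x>0)+\alpha\mathbf 1(x=0)]\varphi(dx)$, $\varphi_\alpha^-(dx):=[\mathbf 1(x<0)+(1-\alpha)\mathbf 1(x=0)]\varphi(dx)$. With $p:=\mathbb P(D<0)$, $p':=\mathbb P(A'>0)$, $a:=\frac{p\alpha}{p\alpha+p'(1-\alpha)}$, $$\nu(dx):=\big[\mathbb P(D<x)+\mathbb P(A'>x)-1+a\mathbb P(D=x)+(1-a)\mathbb P(A'=x)\big]\lambda(dx),\qquad \mu:=U_+*\nu_\alpha^++U_-'*\nu_\alpha^-.$$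 A point $x\in\mathcal Z$ is topologically recurrent for a chain $Z$ on $\mathcal Z$ if $\mathbb P_x(Z_n\in G\text{ for some }n\ge1)=1$ for every open $G\subset\mathcal Z$ containing $x$. The chain (or its transition kernel) is topologically recurrent on an absorbing set $E$ (i.e. a Borel $E$ with $\mathbb P_x(Z_1\in E)=1$ for all $x\in E$) if every point of $E$ is topologically recurrent. The sets $\operatorname{supp}\mu$ and $\operatorname{supp}\nu$ are absorbing for $P$ and $P_H$, respectively. *)

theory Defs
  imports "HOL-Probability.Probability"
begin

subsection \<open>Sums of measures\<close>

definition add_measure :: "'a measure \<Rightarrow> 'a measure \<Rightarrow> 'a measure" where
  "add_measure M N = measure_of (space M) (sets M) (\<lambda>A. emeasure M A + emeasure N A)"

definition suminf_measure :: "(nat \<Rightarrow> 'a measure) \<Rightarrow> 'a measure" where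
  "suminf_measure F = measure_of (space (F 0)) (sets (F 0)) (\<lambda>A. \<Sum>n. emeasure (F n) A)"

lemma space_add_measure [simp]: "space (add_measure M N) = space M"
  by (simp add: add_measure_def)

lemma sets_add_measure [simp, measurable_cong]: "sets (add_measure M N) = sets M"
  by (simp add: add_measure_def)

lemma space_suminf_measure [simp]: "space (suminf_measure F) = space (F 0)"
  by (simp add: suminf_measure_def)

lemma sets_suminf_measure [simp, measurable_cong]: "sets (suminf_measure F) = sets (F 0)"
  by (simp add: suminf_measure_def)

lemma emeasure_suminf_measure:
  assumes "\<And>n. sets (F n) = sets (F 0)" and A: "A \<in> sets (F 0)"
  shows "emeasure (suminf_measure F) A = (\<Sum>n. emeasure (F n) A)"
  unfolding suminf_measure_def
proof (rule emeasure_measure_of_sigma[OF _ _ _ A])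
  show "sigma_algebra (space (F 0)) (sets (F 0))" ..
  show "positive (sets (F 0)) (\<lambda>A. \<Sum>n. emeasure (F n) A)"
    by (simp add: positive_def)
  show "countably_additive (sets (F 0)) (\<lambda>A. \<Sum>n. emeasure (F n) A)"
  proof (rule countably_additiveI)
    fix B :: "nat \<Rightarrow> 'a set"
    assume B: "range B \<subseteq> sets (F 0)" "disjoint_family B"
    have "(\<Sum>i. \<Sum>n. emeasure (F n) (B i)) = (\<integral>\<^sup>+i. (\<Sum>n. emeasure (F n) (B i)) \<partial>count_space UNIV)"
      by (simp add: nn_integral_count_space_nat)
    also have "\<dots> = (\<Sum>n. \<integral>\<^sup>+i. emeasure (F n) (B i) \<partial>count_space UNIV)"
      by (rule nn_integral_suminf) simp
    also have "\<dots> = (\<Sum>n. \<Sum>i. emeasure (F n) (B i))"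
      by (simp add: nn_integral_count_space_nat)
    also have "\<dots> = (\<Sum>n. emeasure (F n) (\<Union>i. B i))"
      using B assms(1) by (intro suminf_cong suminf_emeasure) auto
    finally show "(\<Sum>i. \<Sum>n. emeasure (F n) (B i)) = (\<Sum>n. emeasure (F n) (\<Union>i. B i))" .
  qed
qed

lemma emeasure_add_measure:
  assumes "sets N = sets M" and A: "A \<in> sets M"
  shows "emeasure (add_measure M N) A = emeasure M A + emeasure N A"
  unfolding add_measure_def
proof (rule emeasure_measure_of_sigma[OF _ _ _ A])
  show "sigma_algebra (space M) (sets M)" ..
  show "positive (sets M) (\<lambda>A. emeasure M A + emeasure N A)"
    by (simp add: positive_def)
  show "countably_additive (sets M) (\<lambda>A. emeasure M A + emeasure N A)"
  proof (rule countably_additiveI)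
    fix B :: "nat \<Rightarrow> 'a set"
    assume B: "range B \<subseteq> sets M" "disjoint_family B"
    have "(\<Sum>i. emeasure M (B i) + emeasure N (B i)) = (\<Sum>i. emeasure M (B i)) + (\<Sum>i. emeasure N (B i))"
      by (intro suminf_add[symmetric]) auto
    also have "(\<Sum>i. emeasure M (B i)) = emeasure M (\<Union>i. B i)"
      using B by (intro suminf_emeasure) auto
    also have "(\<Sum>i. emeasure N (B i)) = emeasure N (\<Union>i. B i)"
      using B assms(1) by (intro suminf_emeasure) auto
    finally show "(\<Sum>i. emeasure M (B i) + emeasure N (B i)) = emeasure M (\<Union>i. B i) + emeasure N (\<Union>i. B i)" .
  qed
qed


subsection \<open>State space and its Haar measure\<close>

text \<open>All measures on a state space \<open>\<Z>\<^sub>u\<close> are rendered as Borel measures on the real line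
  (concentrated on \<open>\<Z>\<^sub>u\<close>); openness and supports are relative to \<open>\<Z>\<^sub>u\<close>.\<close>

definition lattice_set :: "real \<Rightarrow> real set" where
  "lattice_set u = (if u = 0 then UNIV else range (\<lambda>k::int. u * of_int k))"

definition lattice_span :: "real measure \<Rightarrow> real measure \<Rightarrow> real" where
  "lattice_span F F' =
    (GREATEST u. 0 \<le> u \<and> measure F (lattice_set u) * measure F' (lattice_set u) = 1)"

definition haar_measure :: "real \<Rightarrow> real measure" where
  "haar_measure d =
    (if d = 0 then lborel
     else scale_measure (ennreal d) (distr (count_space UNIV) borel (\<lambda>k::int. d * of_int k)))"

lemma space_haar_measure [simp]: "space (haar_measure d) = UNIV"
  by (simp add: haar_measure_def space_scale_measure)

lemma sets_haar_measure [simp, measurable_cong]: "sets (haar_measure d) = sets borel"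
  by (simp add: haar_measure_def)

lemma sets_lattice_set [measurable, simp]: "lattice_set d \<in> sets borel"
proof (cases "d = 0")
  case False
  have "countable (range (\<lambda>k::int. d * of_int k))" by simp
  then show ?thesis using False unfolding lattice_set_def
    by (auto intro: sets.countable)
qed (simp add: lattice_set_def)

text \<open>The next three facts identify \<^const>\<open>haar_measure\<close> as the Haar measure of
  \<^term>\<open>lattice_set d\<close> in the normalization \<open>\<lambda>([0,x) \<inter> \<Z>) = x\<close>.\<close>

lemma emeasure_haar_measure_Compl: "emeasure (haar_measure d) (- lattice_set d) = 0"
proof (cases "d = 0")
  case False
  have "(\<lambda>k::int. d * of_int k) -` (- lattice_set d) = {}"
    using False by (auto simp: lattice_set_def)
  then show ?thesis using False
    by (simp add: haar_measure_def emeasure_distr Compl_eq_Diff_UNIV sets.Diff)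
qed (simp add: lattice_set_def)

lemma haar_measure_normalized:
  assumes "0 \<le> d" "x \<in> lattice_set d" "0 < x"
  shows "emeasure (haar_measure d) ({0..<x} \<inter> lattice_set d) = ennreal x"
proof (cases "d = 0")
  case True
  then show ?thesis using assms by (simp add: haar_measure_def lattice_set_def)
next
  case False
  with assms have d: "0 < d" by simp
  from assms False obtain m :: int where m: "x = d * of_int m"
    by (auto simp: lattice_set_def)
  with assms d have "0 < m" by (simp add: zero_less_mult_iff)
  have *: "(\<lambda>k::int. d * of_int k) -` ({0..<x} \<inter> lattice_set d) = {0..<m}"
    using d by (auto simp: lattice_set_def m zero_le_mult_iff)
  have "{0..<x} \<inter> lattice_set d \<in> sets borel" by (intro sets.Int) auto
  then have "emeasure (haar_measure d) ({0..<x} \<inter> lattice_set d)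
      = ennreal d * emeasure (count_space UNIV) {0..<m}"
    using False by (simp add: haar_measure_def emeasure_distr * del: vimage_Int)
  also have "\<dots> = ennreal d * ennreal (real (nat m))"
    by (simp add: ennreal_of_nat_eq_real_of_nat)
  also have "\<dots> = ennreal x"
    using d \<open>0 < m\<close> by (simp add: m ennreal_mult[symmetric])
  finally show ?thesis .
qed

lemma haar_measure_translation:
  assumes "z \<in> lattice_set d"
  shows "distr (haar_measure d) borel (\<lambda>x. z + x) = haar_measure d"
proof (cases "d = 0")
  case True
  then show ?thesis
    by (simp add: haar_measure_def lborel_distr_plus)
next
  case False
  with assms obtain m :: int where m: "z = d * of_int m"
    by (auto simp: lattice_set_def)
  define C where "C = distr (count_space UNIV) borel (\<lambda>k::int. d * of_int k)"
  have "distr C borel (\<lambda>x. z + x) = distr (count_space UNIV) borel ((\<lambda>k::int. d * of_int k) \<circ> (\<lambda>k. m + k))"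
    unfolding C_def by (subst distr_distr) (auto simp: m o_def algebra_simps intro!: distr_cong)
  also have "\<dots> = distr (distr (count_space UNIV) (count_space UNIV) (\<lambda>k. m + k)) borel (\<lambda>k::int. d * of_int k)"
    by (subst distr_distr) auto
  also have "distr (count_space UNIV) (count_space UNIV) (\<lambda>k. m + k) = count_space (UNIV::int set)"
    by (rule distr_bij_count_space) (simp add: bij_plus_right)
  finally have C: "distr C borel (\<lambda>x. z + x) = C" by (simp add: C_def)
  have shift: "emeasure C ((\<lambda>x. z + x) -` A) = emeasure C A" if "A \<in> sets borel" for A
  proof -
    have "emeasure (distr C borel (\<lambda>x. z + x)) A = emeasure C ((\<lambda>x. z + x) -` A \<inter> space C)"
      by (rule emeasure_distr) (auto simp: C_def that)
    then show ?thesis by (simp add: C) (simp add: C_def)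
  qed
  have "distr (scale_measure (ennreal d) C) borel (\<lambda>x. z + x) = scale_measure (ennreal d) C"
  proof (rule measure_eqI)
    fix A assume "A \<in> sets (distr (scale_measure (ennreal d) C) borel (\<lambda>x. z + x))"
    then have A: "A \<in> sets borel" by simp
    have m: "(\<lambda>x. z + x) \<in> scale_measure (ennreal d) C \<rightarrow>\<^sub>M borel"
      by (simp add: measurable_cong_sets[of "scale_measure (ennreal d) C" borel borel borel] C_def)
    have sp: "space (scale_measure (ennreal d) C) = UNIV"
      by (simp add: C_def space_scale_measure)
    show "emeasure (distr (scale_measure (ennreal d) C) borel (\<lambda>x. z + x)) A
        = emeasure (scale_measure (ennreal d) C) A"
      by (subst emeasure_distr[OF m A]) (simp add: sp shift[OF A])
  qed (simp add: C_def)
  then show ?thesis using False by (simp add: haar_measure_def C_def)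
qed

text \<open>Topological support, relative to the state space \<open>Z\<close>.\<close>

definition msupport :: "real set \<Rightarrow> real measure \<Rightarrow> real set" where
  "msupport Z \<phi> = {x \<in> Z. \<forall>G. openin (top_of_set Z) G \<longrightarrow> x \<in> G \<longrightarrow> 0 < emeasure \<phi> G}"


subsection \<open>Markov chains, recurrence, and the switching kernel\<close>

text \<open>Law on the path space of the chain with kernel \<open>K\<close> started at \<open>x\<close>, by the
  Ionescu-Tulcea theorem: coordinate \<open>0\<close> is \<open>x\<close>, and coordinate \<open>n + 1\<close> has
  conditional law \<open>K (\<omega> n)\<close> given the coordinates \<open>\<omega> 0, \<dots>, \<omega> n\<close>.\<close>

definition chain_step :: "(real \<Rightarrow> real measure) \<Rightarrow> real \<Rightarrow> nat \<Rightarrow> (nat \<Rightarrow> real) \<Rightarrow> real measure" where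
  "chain_step K x n \<omega> = (case n of 0 \<Rightarrow> return borel x | Suc m \<Rightarrow> K (\<omega> m))"

definition chain_law :: "(real \<Rightarrow> real measure) \<Rightarrow> real \<Rightarrow> (nat \<Rightarrow> real) measure" where
  "chain_law K x =
    projective_family.lim UNIV (Ionescu_Tulcea.CI (chain_step K x) (\<lambda>_. borel)) (\<lambda>_. borel)"

definition topologically_recurrent_at ::
    "(real \<Rightarrow> real measure) \<Rightarrow> real set \<Rightarrow> real \<Rightarrow> bool" where
  "topologically_recurrent_at K Z x \<longleftrightarrow>
    (\<forall>G. openin (top_of_set Z) G \<longrightarrow> x \<in> G \<longrightarrow> \<P>(z in chain_law K x. \<exists>n\<ge>1. z n \<in> G) = 1)"

definition absorbing :: "(real \<Rightarrow> real measure) \<Rightarrow> real set \<Rightarrow> real set \<Rightarrow> bool" where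
  "absorbing K Z E \<longleftrightarrow>
    E \<in> sets borel \<and> E \<subseteq> Z \<and> (\<forall>x\<in>E. \<P>(z in chain_law K x. z 1 \<in> E) = 1)"

definition topologically_recurrent_on ::
    "(real \<Rightarrow> real measure) \<Rightarrow> real set \<Rightarrow> real set \<Rightarrow> bool" where
  "topologically_recurrent_on K Z E \<longleftrightarrow>
    absorbing K Z E \<and> (\<forall>x\<in>E. topologically_recurrent_at K Z x)"

text \<open>The kernel \<open>P[X\<^sub>1, X\<^sub>1', \<alpha>]\<close>, in terms of the laws \<open>F\<close> of \<open>X\<^sub>1\<close> and \<open>F'\<close> of \<open>X\<^sub>1'\<close>.\<close>

definition switching_kernel :: "real measure \<Rightarrow> real measure \<Rightarrow> real \<Rightarrow> real \<Rightarrow> real measure" where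
  "switching_kernel F F' \<alpha> x =
    (if x > 0 then distr F borel (\<lambda>y. x + y)
     else if x < 0 then distr F' borel (\<lambda>y. x + y)
     else add_measure (scale_measure (ennreal \<alpha>) F) (scale_measure (ennreal (1 - \<alpha>)) F'))"

lemma prob_space_switching_kernel:
  assumes "prob_space F" "sets F = sets borel" "prob_space F'" "sets F' = sets borel"
    and "0 \<le> \<alpha>" "\<alpha> \<le> 1"
  shows "prob_space (switching_kernel F F' \<alpha> x)"
    and "sets (switching_kernel F F' \<alpha> x) = sets borel"
proof -
  interpret F: prob_space F by fact
  interpret F': prob_space F' by fact
  have sp: "space F = UNIV" "space F' = UNIV"
    using assms(2,4) by (auto dest: sets_eq_imp_space_eq)
  have "emeasure (add_measure (scale_measure (ennreal \<alpha>) F) (scale_measure (ennreal (1 - \<alpha>)) F')) UNIV = 1"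
    using assms sp F.emeasure_space_1 F'.emeasure_space_1
    by (subst emeasure_add_measure) (simp_all add: ennreal_plus[symmetric] del: ennreal_plus)
  then have "prob_space (add_measure (scale_measure (ennreal \<alpha>) F) (scale_measure (ennreal (1 - \<alpha>)) F'))"
    by (intro prob_spaceI) (simp add: space_scale_measure sp)
  moreover have "prob_space (distr F borel (\<lambda>y. x + y))" "prob_space (distr F' borel (\<lambda>y. x + y))"
    by (intro F.prob_space_distr F'.prob_space_distr;
        simp add: measurable_cong_sets[OF assms(2) refl] measurable_cong_sets[OF assms(4) refl])+
  ultimately show "prob_space (switching_kernel F F' \<alpha> x)"
    by (simp add: switching_kernel_def)
  show "sets (switching_kernel F F' \<alpha> x) = sets borel"
    using assms by (simp add: switching_kernel_def)
qed

lemma measurable_switching_kernel: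
  assumes "prob_space F" "sets F = sets borel" "prob_space F'" "sets F' = sets borel"
    and "0 \<le> \<alpha>" "\<alpha> \<le> 1"
  shows "switching_kernel F F' \<alpha> \<in> borel \<rightarrow>\<^sub>M subprob_algebra borel"
proof -
  have F: "F \<in> space (subprob_algebra borel)" "F' \<in> space (subprob_algebra borel)"
    using assms by (auto simp: space_subprob_algebra prob_space_imp_subprob_space)
  have D: "(\<lambda>x. distr G borel (\<lambda>y. x + y)) \<in> borel \<rightarrow>\<^sub>M subprob_algebra borel"
    if "G \<in> space (subprob_algebra borel)" for G :: "real measure"
    by (rule measurable_distr2[where M = borel]) (use that in \<open>auto simp: case_prod_unfold\<close>)
  have S: "add_measure (scale_measure (ennreal \<alpha>) F) (scale_measure (ennreal (1 - \<alpha>)) F')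
      \<in> space (subprob_algebra borel)"
    using prob_space_switching_kernel[OF assms, of 0]
    by (auto simp: switching_kernel_def space_subprob_algebra prob_space_imp_subprob_space)
  show ?thesis unfolding switching_kernel_def[abs_def]
    using D[OF F(1)] D[OF F(2)] S by (intro measurable_If) auto
qed

text \<open>Hence \<^const>\<open>chain_law\<close> is the law supplied by the Ionescu-Tulcea theorem.\<close>

lemma Ionescu_Tulcea_chain_step:
  assumes K: "K \<in> borel \<rightarrow>\<^sub>M subprob_algebra borel" "\<And>x. prob_space (K x)"
  shows "Ionescu_Tulcea (chain_step K x) (\<lambda>_. borel)"
proof (rule Ionescu_Tulcea.intro)
  show "chain_step K x i \<in> Pi\<^sub>M {0..<i} (\<lambda>_. borel) \<rightarrow>\<^sub>M subprob_algebra borel" for i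
  proof (cases i)
    case 0
    then show ?thesis
      by (auto simp: chain_step_def[abs_def] space_subprob_algebra subprob_space_return)
  next
    case (Suc m)
    have "(\<lambda>\<omega>. \<omega> m) \<in> Pi\<^sub>M {0..<i} (\<lambda>_. borel) \<rightarrow>\<^sub>M (borel :: real measure)"
      by (rule measurable_component_singleton) (simp add: Suc)
    from measurable_compose[OF this K(1)] show ?thesis
      by (simp add: chain_step_def[abs_def] Suc)
  qed
  show "prob_space (chain_step K x i \<omega>)" for i \<omega>
    by (cases i) (auto simp: chain_step_def K(2) prob_space_return)
qed


subsection \<open>Ladder heights\<close>

definition partial_sum :: "(nat \<Rightarrow> 'w \<Rightarrow> real) \<Rightarrow> nat \<Rightarrow> 'w \<Rightarrow> real" where
  "partial_sum X n \<omega> = (\<Sum>k=1..n. X k \<omega>)"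

text \<open>Value of the walk at its first positive time in \<open>B\<close>; unspecified on the event that
  \<open>B\<close> is never hit, an event discarded in \<open>first_value_law\<close>.\<close>

definition first_value :: "real set \<Rightarrow> (nat \<Rightarrow> 'w \<Rightarrow> real) \<Rightarrow> 'w \<Rightarrow> real" where
  "first_value B X \<omega> =
    partial_sum X (LEAST k. 1 \<le> k \<and> partial_sum X k \<omega> \<in> B) \<omega>"

definition first_value_law ::
    "'w measure \<Rightarrow> real set \<Rightarrow> (nat \<Rightarrow> 'w \<Rightarrow> real) \<Rightarrow> real measure" where
  "first_value_law M B X =
    distr (restrict_space M {\<omega> \<in> space M. \<exists>k\<ge>1. partial_sum X k \<omega> \<in> B}) borel (first_value B X)"

text \<open>The heights \<open>D\<close> of the first walk and \<open>A'\<close> of the second.\<close>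

definition weak_descent :: "(nat \<Rightarrow> 'w \<Rightarrow> real) \<Rightarrow> 'w \<Rightarrow> real" where
  "weak_descent X = first_value {..0} X"

definition weak_ascent :: "(nat \<Rightarrow> 'w \<Rightarrow> real) \<Rightarrow> 'w \<Rightarrow> real" where
  "weak_ascent X' = first_value {0..} X'"

primrec convolution_power :: "real measure \<Rightarrow> nat \<Rightarrow> real measure" where
  "convolution_power L 0 = return borel 0"
| "convolution_power L (Suc n) = (convolution_power L n \<star> L)"

definition renewal_measure :: "real measure \<Rightarrow> real measure" where
  "renewal_measure L = suminf_measure (convolution_power L)"

definition U_plus :: "'w measure \<Rightarrow> (nat \<Rightarrow> 'w \<Rightarrow> real) \<Rightarrow> real measure" where
  "U_plus M X = renewal_measure (first_value_law M {0<..} X)"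

definition U_minus :: "'w measure \<Rightarrow> (nat \<Rightarrow> 'w \<Rightarrow> real) \<Rightarrow> real measure" where
  "U_minus M X' = renewal_measure (first_value_law M {..<0} X')"


subsection \<open>The switching walk and the measures \<open>\<nu>\<close> and \<open>\<mu>\<close>\<close>

definition walk_kernel ::
    "'w measure \<Rightarrow> (nat \<Rightarrow> 'w \<Rightarrow> real) \<Rightarrow> (nat \<Rightarrow> 'w \<Rightarrow> real) \<Rightarrow> real \<Rightarrow> real \<Rightarrow> real measure" where
  "walk_kernel M X X' \<alpha> = switching_kernel (distr M borel (X 1)) (distr M borel (X' 1)) \<alpha>"

definition ladder_kernel ::
    "'w measure \<Rightarrow> (nat \<Rightarrow> 'w \<Rightarrow> real) \<Rightarrow> (nat \<Rightarrow> 'w \<Rightarrow> real) \<Rightarrow> real \<Rightarrow> real \<Rightarrow> real measure" where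
  "ladder_kernel M X X' \<alpha> =
    switching_kernel (distr M borel (weak_descent X)) (distr M borel (weak_ascent X')) \<alpha>"

definition walk_span ::
    "'w measure \<Rightarrow> (nat \<Rightarrow> 'w \<Rightarrow> real) \<Rightarrow> (nat \<Rightarrow> 'w \<Rightarrow> real) \<Rightarrow> real" where
  "walk_span M X X' = lattice_span (distr M borel (X 1)) (distr M borel (X' 1))"

definition state_space ::
    "'w measure \<Rightarrow> (nat \<Rightarrow> 'w \<Rightarrow> real) \<Rightarrow> (nat \<Rightarrow> 'w \<Rightarrow> real) \<Rightarrow> real set" where
  "state_space M X X' = lattice_set (walk_span M X X')"

definition nu_measure ::
    "'w measure \<Rightarrow> (nat \<Rightarrow> 'w \<Rightarrow> real) \<Rightarrow> (nat \<Rightarrow> 'w \<Rightarrow> real) \<Rightarrow> real \<Rightarrow> real measure" where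
  "nu_measure M X X' \<alpha> =
    (let D = weak_descent X; A' = weak_ascent X';
         p = \<P>(\<omega> in M. D \<omega> < 0); p' = \<P>(\<omega> in M. A' \<omega> > 0);
         a = p * \<alpha> / (p * \<alpha> + p' * (1 - \<alpha>))
     in density (haar_measure (walk_span M X X'))
          (\<lambda>x. ennreal (\<P>(\<omega> in M. D \<omega> < x) + \<P>(\<omega> in M. A' \<omega> > x) - 1
                 + a * \<P>(\<omega> in M. D \<omega> = x) + (1 - a) * \<P>(\<omega> in M. A' \<omega> = x))))"

definition pos_part_measure :: "real \<Rightarrow> real measure \<Rightarrow> real measure" where
  "pos_part_measure \<alpha> \<phi> = density \<phi> (\<lambda>x. ennreal (indicator {0<..} x + \<alpha> * indicator {0} x))"

definition neg_part_measure :: "real \<Rightarrow> real measure \<Rightarrow> real measure" where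
  "neg_part_measure \<alpha> \<phi> = density \<phi> (\<lambda>x. ennreal (indicator {..<0} x + (1 - \<alpha>) * indicator {0} x))"

definition mu_measure ::
    "'w measure \<Rightarrow> (nat \<Rightarrow> 'w \<Rightarrow> real) \<Rightarrow> (nat \<Rightarrow> 'w \<Rightarrow> real) \<Rightarrow> real \<Rightarrow> real measure" where
  "mu_measure M X X' \<alpha> =
    add_measure (U_plus M X \<star> pos_part_measure \<alpha> (nu_measure M X X' \<alpha>))
                (U_minus M X' \<star> neg_part_measure \<alpha> (nu_measure M X X' \<alpha>))"

definition ladder_integral ::
    "'w measure \<Rightarrow> (nat \<Rightarrow> 'w \<Rightarrow> real) \<Rightarrow> (nat \<Rightarrow> 'w \<Rightarrow> real) \<Rightarrow> ennreal" where
  "ladder_integral M X X' =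
    (\<integral>\<^sup>+x\<in>{0..}. ennreal (\<P>(\<omega> in M. weak_descent X \<omega> \<le> - x) * \<P>(\<omega> in M. weak_ascent X' \<omega> \<ge> x)) \<partial>lborel)"

text \<open>Real powers with \<open>0\<^sup>0 = 1\<close>, in contrast to \<open>0 powr 0 = 0\<close>.\<close>

definition rpow :: "real \<Rightarrow> real \<Rightarrow> real" where
  "rpow x r = (if r = 0 then 1 else x powr r)"

text \<open>The two sequences are indexed from \<open>1\<close>; the values at index \<open>0\<close> are irrelevant.\<close>

definition iid_pair ::
    "'w measure \<Rightarrow> (nat \<Rightarrow> 'w \<Rightarrow> real) \<Rightarrow> (nat \<Rightarrow> 'w \<Rightarrow> real) \<Rightarrow> bool" where
  "iid_pair M X X' \<longleftrightarrow>
    prob_space.indep_vars M (\<lambda>_. borel) (case_sum X X') ({1..} <+> {1..}) \<and>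
    (\<forall>n\<ge>1. distr M borel (X n) = distr M borel (X 1)) \<and>
    (\<forall>n\<ge>1. distr M borel (X' n) = distr M borel (X' 1))"

end

theory Submission
  imports Defs
begin

text \<open>Observed at the times at which it leaves a half-line weakly, the switching walk becomes the chain
  with kernel \<open>Q = P[D, A', \<alpha>]\<close>, whose increments always point towards \<open>0\<close>. By optional stopping,
  bounded \<open>P\<close>-subharmonic functions are \<open>Q\<close>-subharmonic, and \<open>Q\<close>-subharmonic functions are dominated by
  \<open>P\<close>-subharmonic ones. Applied to the probability of never hitting an open set, this transfers
  recurrence in both directions, once the chain \<open>Q\<close> is known to be irreducible on \<open>supp \<nu>\<close>.

  For the sufficient condition, \<open>\<nu>\<close> is invariant for \<open>Q\<close> and \<open>I < \<infinity>\<close> says that the stationary flux of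
  crossings of \<open>0\<close> is finite. A path that never returns to \<open>B\<close> crosses \<open>0\<close> infinitely often, whereas
  by invariance the crossings between visits to \<open>B\<close> have finite expectation under \<open>\<nu>\<close> restricted to
  \<open>B\<close>; so \<open>\<nu>\<close>-almost every point of \<open>B\<close> returns to \<open>B\<close>. A coupling in which both chains use the same
  stacks of positive and negative increments extends this to every point of \<open>supp \<nu>\<close>.\<close>

subsection \<open>Return and avoidance probabilities of a Markov kernel\<close>

text \<open>Path space enters only to identify hitting probabilities with the iterated integrals
  \<open>ret\<close>; from then on stopping times are replaced by bounded subharmonic functions and
  sub-Markov operators. The recurring argument is a contraction: if almost sure entrance into A
  forces sup phi to be at most q times itself with q < 1, then phi = 0. It needs a q that is uniform
  near a point, and continuity cannot supply it, because the kernel jumps at 0 and the increment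
  laws are arbitrary. Two substitutes do: with inward increments the order in which two fixed stacks
  are consumed hardly matters, so chains with nearby starts are exact translates away from 0; and
  positivity of an excursion probability into an open set persists under small moves of the start.
  The renewal measures matter through their null sets, which are all that a support depends on;
  reversal of the increments compares them with walks killed on leaving a half-line. The lattice
  case runs separately: there single points are open and charged, but within supp nu an extreme
  point may be entered only by a jump from 0.\<close>

primrec ret :: "(real \<Rightarrow> real measure) \<Rightarrow> real set \<Rightarrow> nat \<Rightarrow> real \<Rightarrow> ennreal" where
  "ret K B 0 x = 1"
| "ret K B (Suc n) x = (\<integral>\<^sup>+y. indicator (- B) y * ret K B n y \<partial>K x)"

text \<open>\<open>ret K B n x\<close> is the probability of staying outside B at times 1 to n, so
  despite its name it measures non-return; \<open>noret\<close> is its decreasing limit. Time 0 is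
  ignored here and counted in \<open>avoid\<close>.\<close>

definition noret :: "(real \<Rightarrow> real measure) \<Rightarrow> real set \<Rightarrow> real \<Rightarrow> ennreal" where
  "noret K B x = (INF n. ret K B n x)"

definition avoid :: "(real \<Rightarrow> real measure) \<Rightarrow> real set \<Rightarrow> real \<Rightarrow> ennreal" where
  "avoid K B x = indicator (- B) x * noret K B x"

text \<open>One-step absorption phrased on the kernel itself; \<open>absorbing_iff\<close>
  identifies it with the path-space notion.\<close>

definition closed_set :: "(real \<Rightarrow> real measure) \<Rightarrow> real set \<Rightarrow> bool" where
  "closed_set K E \<longleftrightarrow> E \<in> sets borel \<and> (\<forall>x\<in>E. AE y in K x. y \<in> E)"

text \<open>The vanishing arguments below end here, with s a supremum. Finiteness is essential: s =
  \<top> satisfies s \<le> q * s whenever q > 0.\<close>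

lemma ennreal_le_contract:
  fixes s q :: ennreal
  assumes "s \<le> q * s" "q < 1" "s < \<infinity>" shows "s = 0"
proof (rule ccontr)
  assume "s \<noteq> 0"
  then have "q * s < 1 * s"
    using assms by (intro ennreal_mult_strict_right_mono) (auto simp: zero_less_iff_neq_zero)
  then show False using assms by simp
qed

locale prob_kernel =
  fixes K :: "real \<Rightarrow> real measure"
  assumes K_meas [measurable]: "K \<in> borel \<rightarrow>\<^sub>M subprob_algebra borel"
    and K_prob: "prob_space (K x)"
begin

lemma sets_K [simp, measurable_cong]: "sets (K x) = sets borel"
  using K_meas by (rule subprob_measurableD) simp

lemma space_K [simp]: "space (K x) = UNIV"
  using sets_eq_imp_space_eq[OF sets_K] by simp

lemma ret_meas [measurable]:
  assumes [measurable]: "B \<in> sets borel"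
  shows "ret K B n \<in> borel_measurable borel"
proof (induction n)
  case 0 then show ?case by (simp add: ret.simps(1)[abs_def])
next
  case (Suc n)
  note [measurable] = Suc
  show ?case unfolding ret.simps(2)[abs_def] by measurable
qed

lemma noret_meas [measurable]:
  assumes [measurable]: "B \<in> sets borel"
  shows "noret K B \<in> borel_measurable borel"
  unfolding noret_def[abs_def] by measurable

lemma avoid_meas [measurable]:
  assumes [measurable]: "B \<in> sets borel"
  shows "avoid K B \<in> borel_measurable borel"
  unfolding avoid_def[abs_def] by measurable

lemma emeasure_K_UNIV [simp]: "emeasure (K x) UNIV = 1"
  using prob_space.emeasure_space_1[OF K_prob, of x] by simp

lemma nn_K_le:
  assumes "\<And>y. f y \<le> c" shows "(\<integral>\<^sup>+y. f y \<partial>K x) \<le> c"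
  using nn_integral_mono[of "K x" f "\<lambda>_. c"] assms by simp

lemma ret_le_1: "ret K B n x \<le> 1"
proof (induction n arbitrary: x)
  case (Suc n)
  then show ?case
    by (auto intro!: nn_K_le split: split_indicator)
qed simp

lemma ret_Suc_le: "ret K B (Suc n) x \<le> ret K B n x"
proof (induction n arbitrary: x)
  case 0 then show ?case using ret_le_1[of B "Suc 0" x] by simp
next
  case (Suc n) then show ?case
    by (subst (1 2) ret.simps(2)) (intro nn_integral_mono mult_left_mono; simp)
qed

lemma noret_le_1: "noret K B x \<le> 1"
  unfolding noret_def by (rule INF_lower2[of 0]) auto

lemma noret_le_ret: "noret K B x \<le> ret K B n x"
  unfolding noret_def by (rule INF_lower) auto

lemma avoid_le_1: "avoid K B x \<le> 1"
  using noret_le_1[of B x] by (auto simp: avoid_def split: split_indicator)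

lemma avoid_le_noret: "avoid K B x \<le> noret K B x"
  by (auto simp: avoid_def split: split_indicator)

lemma avoid_in [simp]: "x \<in> B \<Longrightarrow> avoid K B x = 0"
  by (simp add: avoid_def)

lemma avoid_notin: "x \<notin> B \<Longrightarrow> avoid K B x = noret K B x"
  by (simp add: avoid_def)

text \<open>First-step decomposition. The infimum passes under the integral because the integrands
  decrease and are bounded by 1; the state after one step counts, hence \<open>avoid\<close> on the
  right.\<close>

lemma noret_eq:
  assumes [measurable]: "B \<in> sets borel"
  shows "noret K B x = (\<integral>\<^sup>+y. avoid K B y \<partial>K x)"
proof -
  have "(INF n. ret K B n x) = (INF n. ret K B (Suc n) x)"
  proof (intro antisym INF_greatest)
    show "(INF n. ret K B n x) \<le> ret K B (Suc n) x" for n by (rule INF_lower) simp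
    show "(INF n. ret K B (Suc n) x) \<le> ret K B n x" for n
      by (rule INF_lower2[of n]) (simp_all add: ret_Suc_le del: ret.simps)
  qed
  also have "\<dots> = (\<integral>\<^sup>+y. (INF n. indicator (- B) y * ret K B n y) \<partial>K x)"
    unfolding ret.simps
  proof (rule nn_integral_monotone_convergence_INF_decseq[symmetric])
    show "decseq (\<lambda>n y. indicator (- B) y * ret K B n y)"
      by (intro decseq_SucI le_funI mult_left_mono ret_Suc_le) auto
    show "(\<integral>\<^sup>+y. indicator (- B) y * ret K B 0 y \<partial>K x) < \<infinity>"
      by (rule le_less_trans[OF nn_K_le[of _ 1]]) (auto split: split_indicator)
  qed measurable
  also have "\<dots> = (\<integral>\<^sup>+y. avoid K B y \<partial>K x)"
    by (intro nn_integral_cong) (auto simp: avoid_def noret_def split: split_indicator)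
  finally show ?thesis by (simp add: noret_def)
qed

lemma avoid_subharmonic:
  assumes "B \<in> sets borel"
  shows "avoid K B x \<le> (\<integral>\<^sup>+y. avoid K B y \<partial>K x)"
  using avoid_le_noret noret_eq[OF assms] by metis

lemma closed_set_UNIV: "closed_set K UNIV"
  by (simp add: closed_set_def)

text \<open>Optional stopping for a bounded subharmonic function at the entrance time of \<open>A\<close>.\<close>

lemma subharmonic_le_avoid:
  assumes E: "closed_set K E" and [measurable]: "A \<in> sets borel" "\<phi> \<in> borel_measurable borel"
    and sub: "\<And>x. x \<in> E \<Longrightarrow> x \<notin> A \<Longrightarrow> \<phi> x \<le> (\<integral>\<^sup>+y. \<phi> y \<partial>K x)"
    and s: "\<And>x. x \<in> E \<Longrightarrow> \<phi> x \<le> s" and q: "\<And>x. x \<in> E \<Longrightarrow> x \<in> A \<Longrightarrow> \<phi> x \<le> q"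
    and x: "x \<in> E" and sfin: "s < \<infinity>"
  shows "\<phi> x \<le> q + s * avoid K A x"
proof -
  \<comment> \<open>Stopping at the earlier of the entrance into A and time n: the value is at most
    q at entrance, and at most s on the event that A has not been met, whose probability is
    \<open>indicator (- A) x * ret K A n x\<close>.\<close>
  have *: "\<phi> x \<le> q + s * (indicator (- A) x * ret K A n x)" if "x \<in> E" for x n
    using that
  proof (induction n arbitrary: x)
    case 0
    then show ?case using s q by (auto split: split_indicator intro: add_increasing)
  next
    case (Suc n)
    show ?case
    proof (cases "x \<in> A")
      case False
      have "\<phi> x \<le> (\<integral>\<^sup>+y. \<phi> y \<partial>K x)" using sub Suc.prems False by auto
      also have "\<dots> \<le> (\<integral>\<^sup>+y. q + s * (indicator (- A) y * ret K A n y) \<partial>K x)"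
        using E Suc by (intro nn_integral_mono_AE) (auto simp: closed_set_def)
      also have "\<dots> = q + s * ret K A (Suc n) x"
        by (simp add: nn_integral_add nn_integral_cmult)
      finally show ?thesis using False by simp
    qed (use q Suc.prems in auto)
  qed
  show ?thesis
  proof (cases "x \<in> A")
    case False
    have "\<phi> x \<le> (INF n. q + s * ret K A n x)"
      using *[OF x] False by (intro INF_greatest) simp
    also have "\<dots> = q + s * (INF n. ret K A n x)"
    proof -
      \<comment> \<open>The infimum is moved inside by uniqueness of limits; multiplication by s is
        continuous because s is finite.\<close>
      have d: "decseq (\<lambda>n. ret K A n x)" by (intro decseq_SucI ret_Suc_le)
      have "(\<lambda>n. ret K A n x) \<longlonglongrightarrow> (INF n. ret K A n x)" by (rule LIMSEQ_INF[OF d])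
      then have "(\<lambda>n. q + s * ret K A n x) \<longlonglongrightarrow> q + s * (INF n. ret K A n x)"
        using sfin by (intro tendsto_add tendsto_const ennreal_tendsto_cmult) auto
      moreover have "decseq (\<lambda>n. q + s * ret K A n x)"
        by (intro decseq_SucI add_left_mono mult_left_mono ret_Suc_le) auto
      then have "(\<lambda>n. q + s * ret K A n x) \<longlonglongrightarrow> (INF n. q + s * ret K A n x)" by (rule LIMSEQ_INF)
      ultimately show ?thesis by (rule LIMSEQ_unique[rotated])
    qed
    finally show ?thesis using False by (simp add: avoid_notin noret_def)
  qed (use q x in auto)
qed

text \<open>Since A is entered almost surely from E, the optional stopping bound loses its second
  term, and the supremum over E is at most q times itself.\<close>

lemma subharmonic_zero:
  assumes E: "closed_set K E" and m: "A \<in> sets borel" "\<phi> \<in> borel_measurable borel"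
    and sub: "\<And>x. x \<in> E \<Longrightarrow> x \<notin> A \<Longrightarrow> \<phi> x \<le> (\<integral>\<^sup>+y. \<phi> y \<partial>K x)"
    and fin: "\<And>x. \<phi> x \<le> 1"
    and q: "\<And>x. x \<in> E \<Longrightarrow> x \<in> A \<Longrightarrow> \<phi> x \<le> q * (SUP x\<in>E. \<phi> x)" "q < 1"
    and A: "\<And>x. x \<in> E \<Longrightarrow> avoid K A x = 0"
    and x: "x \<in> E"
  shows "\<phi> x = 0"
proof -
  let ?s = "SUP x\<in>E. \<phi> x"
  have s1: "?s \<le> 1" using fin by (intro SUP_least)
  then have s: "?s < \<infinity>" using le_less_trans[OF s1, of \<top>] by simp
  have "\<phi> x \<le> q * ?s + ?s * avoid K A x" if "x \<in> E" for x
    by (rule subharmonic_le_avoid[OF E m sub _ q(1) that s]) (auto intro: SUP_upper)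
  then have "?s \<le> q * ?s" using A by (intro SUP_least) auto
  then have "?s = 0" by (rule ennreal_le_contract[OF _ q(2) s])
  then show ?thesis using SUP_upper[OF x, of \<phi>] by simp
qed

text \<open>Optional stopping of \<open>avoid K B\<close> at its own target B, where it vanishes.
  This is a zero-one law in multiplicative form: the supremum over a closed set is 0 or 1, and
  wherever the function is at most q it gains the factor q against the supremum.\<close>

lemma avoid_le_sup_mult:
  assumes E: "closed_set K E" and B: "B \<in> sets borel" and x: "x \<in> E"
  shows "avoid K B x \<le> (SUP x\<in>E. avoid K B x) * avoid K B x"
proof -
  have s1: "(SUP x\<in>E. avoid K B x) \<le> 1" using avoid_le_1 by (intro SUP_least)
  then have s: "(SUP x\<in>E. avoid K B x) < \<infinity>" using le_less_trans[OF s1, of \<top>] by simp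
  have "avoid K B x \<le> 0 + (SUP x\<in>E. avoid K B x) * avoid K B x"
    by (rule subharmonic_le_avoid[OF E B]) (use x s B in \<open>auto intro: SUP_upper avoid_subharmonic\<close>)
  then show ?thesis by simp
qed

text \<open>A uniform bound below 1 leaves only the value 0 in the zero-one law.\<close>

lemma avoid_zero:
  assumes E: "closed_set K E" and B: "B \<in> sets borel"
    and s: "\<And>x. x \<in> E \<Longrightarrow> avoid K B x \<le> q" "q < 1" and x: "x \<in> E"
  shows "avoid K B x = 0"
proof -
  let ?s = "SUP x\<in>E. avoid K B x"
  have sq: "?s \<le> q" using s by (intro SUP_least)
  have "?s \<le> q * ?s"
  proof (rule SUP_least)
    fix y assume y: "y \<in> E"
    have "avoid K B y \<le> ?s * avoid K B y" by (rule avoid_le_sup_mult[OF E B y])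
    also have "\<dots> \<le> q * ?s" using sq y by (intro mult_mono) (auto intro: SUP_upper)
    finally show "avoid K B y \<le> q * ?s" .
  qed
  moreover have "?s < \<infinity>" using sq s(2) by (metis ennreal_one_less_top infinity_ennreal_def order.strict_trans order.strict_trans1)
  ultimately have "?s = 0" using s(2) by (intro ennreal_le_contract[of ?s q]) auto
  then show ?thesis using SUP_upper[OF x, of "avoid K B"] by simp
qed

text \<open>Each of the infinitely many visits to A gives a chance of at least 1 - q to meet
  B.\<close>

lemma recurrent_hits:
  assumes E: "closed_set K E" and A [measurable]: "A \<in> sets borel" and B [measurable]: "B \<in> sets borel"
    and ret: "\<And>x. x \<in> A \<Longrightarrow> x \<in> E \<Longrightarrow> noret K A x = 0"
    and q: "\<And>x. x \<in> A \<Longrightarrow> x \<in> E \<Longrightarrow> avoid K B x \<le> q" "q < 1"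
    and x: "x \<in> A" "x \<in> E"
  shows "avoid K B x = 0"
proof -
  have [measurable]: "E \<in> sets borel" using E by (simp add: closed_set_def)
  \<comment> \<open>The points from which A is entered almost surely. Certain return from A makes
    this set closed, so the supremum argument can be run inside it.\<close>
  let ?E = "{x \<in> E. avoid K A x = 0}"
  have cl: "closed_set K ?E"
    unfolding closed_set_def
  proof (intro conjI ballI)
    show "?E \<in> sets borel" by measurable
    fix x assume x: "x \<in> ?E"
    have "noret K A x = 0" using ret[of x] avoid_notin[of x A] x by (cases "x \<in> A") auto
    then have "(\<integral>\<^sup>+y. avoid K A y \<partial>K x) = 0" using noret_eq[OF A] by simp
    then have "AE y in K x. avoid K A y = 0" by (subst (asm) nn_integral_0_iff_AE) auto
    moreover have "AE y in K x. y \<in> E" using E x by (auto simp: closed_set_def)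
    ultimately show "AE y in K x. y \<in> ?E" by eventually_elim simp
  qed
  show ?thesis
  proof (rule subharmonic_zero[OF cl A, where q=q])
    fix y assume y: "y \<in> ?E" "y \<in> A"
    have "avoid K B y \<le> (SUP x\<in>?E. avoid K B x) * avoid K B y" by (rule avoid_le_sup_mult[OF cl B y(1)])
    also have "\<dots> \<le> (SUP x\<in>?E. avoid K B x) * q" using q y by (intro mult_left_mono) auto
    finally show "avoid K B y \<le> q * (SUP x\<in>?E. avoid K B x)" by (simp add: mult.commute)
  qed (use x q avoid_le_1 avoid_subharmonic in auto)
qed

text \<open>Accessibility composes without any uniformity over A: if \<open>avoid K B\<close> is 1
  at a point outside A, it is 1 at almost every successor, and iterating this contradicts the
  accessibility of A within finitely many steps.\<close>

lemma avoid_less_1_trans: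
  assumes A [measurable]: "A \<in> sets borel" and B [measurable]: "B \<in> sets borel"
    and E: "closed_set K E" and x: "x \<in> E" "avoid K A x < 1"
    and AB: "\<And>y. y \<in> A \<Longrightarrow> y \<in> E \<Longrightarrow> avoid K B y < 1"
  shows "avoid K B x < 1"
proof -
  have [measurable]: "E \<in> sets borel" using E by (simp add: closed_set_def)
  have *: "avoid K B x < 1" if "indicator (- A) x * ret K A n x < 1" "x \<in> E" for n x
    using that
  proof (induction n arbitrary: x)
    case 0 then show ?case using AB by (auto split: split_indicator_asm)
  next
    case (Suc n)
    show ?case
    proof (cases "x \<in> A")
      case False
      show ?thesis
      proof (rule ccontr)
        assume "\<not> avoid K B x < 1"
        then have "1 \<le> (\<integral>\<^sup>+y. avoid K B y \<partial>K x)"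
          using avoid_subharmonic[OF B, of x] by (meson not_less order_trans)
        moreover have "(\<integral>\<^sup>+y. avoid K B y \<partial>K x) + (\<integral>\<^sup>+y. (1 - avoid K B y) \<partial>K x) = 1"
          by (subst nn_integral_add[symmetric]) (auto simp: avoid_le_1 add_diff_inverse_ennreal)
        ultimately have "(\<integral>\<^sup>+y. (1 - avoid K B y) \<partial>K x) = 0"
          using nn_K_le[of "avoid K B" 1 x] avoid_le_1
          by (metis (no_types, lifting) add.right_neutral antisym ennreal_add_left_cancel ennreal_one_neq_top infinity_ennreal_def)
        then have "AE y in K x. 1 - avoid K B y = 0" by (subst (asm) nn_integral_0_iff_AE) auto
        moreover have "AE y in K x. y \<in> E" using E Suc.prems by (auto simp: closed_set_def)
        ultimately have "AE y in K x. 1 \<le> indicator (- A) y * ret K A n y"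
        proof eventually_elim
          case (elim y)
          then have "\<not> avoid K B y < 1" by (metis diff_gt_0_iff_gt_ennreal less_irrefl)
          then show ?case using Suc.IH[of y] elim(2) by (meson not_less)
        qed
        then have "(\<integral>\<^sup>+y. 1 \<partial>K x) \<le> ret K A (Suc n) x"
          unfolding ret.simps by (rule nn_integral_mono_AE)
        then show False using Suc.prems(1) False by simp
      qed
    qed (use AB Suc.prems in auto)
  qed
  show ?thesis
  proof (cases "x \<in> A")
    case False
    then obtain n where "ret K A n x < 1"
      using x by (auto simp: avoid_notin noret_def INF_less_iff)
    then show ?thesis using *[of x n] x False by simp
  qed (use AB x in auto)
qed


text \<open>The bridge from path space: integrating out the last coordinate repeatedly turns the
  finite-dimensional law into the recursion of \<open>ret\<close>.\<close>

lemma emeasure_chain_law_not_in: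
  assumes [measurable]: "B \<in> sets borel"
  shows "emeasure (chain_law K x) {z \<in> space (chain_law K x). \<forall>k\<in>{1..n}. z k \<notin> B} = ret K B n x"
proof -
  interpret IT: Ionescu_Tulcea "chain_step K x" "\<lambda>_. borel"
    by (rule Ionescu_Tulcea_chain_step) (auto simp: K_prob)
  let ?u = "\<lambda>_::nat. undefined :: real"
  let ?I = "\<lambda>n \<omega>. indicator {\<omega>. \<forall>k\<in>{1..n}. \<omega> k \<notin> B} \<omega> :: ennreal"
  have und: "?u \<in> space (PiM {0..<0} (\<lambda>_. borel))" by (auto simp: space_PiM)
  have a0: "(\<integral>\<^sup>+\<omega>. ?I 0 \<omega> * f (\<omega> 0) \<partial>IT.C 0 (Suc 0) ?u) = f x" if [measurable]: "f \<in> borel_measurable borel" for f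
  proof -
    have "(\<integral>\<^sup>+\<omega>. ?I 0 \<omega> * f (\<omega> 0) \<partial>IT.C 0 (Suc 0) ?u) = (\<integral>\<^sup>+\<omega>. f (\<omega> 0) \<partial>IT.C 0 (Suc 0) ?u)"
      by simp
    also have "\<dots> = (\<integral>\<^sup>+\<omega>. f (\<omega> 0) \<partial>IT.eP 0 ?u)"
      by (simp only: IT.C.simps add_0_right bind_return[OF IT.measurable_eP und])
    also have "\<dots> = (\<integral>\<^sup>+y. f ((?u(0 := y)) 0) \<partial>chain_step K x 0 ?u)"
      using und by (subst IT.nn_integral_eP) auto
    also have "\<dots> = f x" by (simp add: chain_step_def nn_integral_return)
    finally show ?thesis .
  qed
  have aS: "(\<integral>\<^sup>+\<omega>. ?I (Suc n) \<omega> * f (\<omega> (Suc n)) \<partial>IT.C 0 (Suc (Suc n)) ?u)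
     = (\<integral>\<^sup>+\<omega>. ?I n \<omega> * (\<integral>\<^sup>+y. indicator (- B) y * f y \<partial>K (\<omega> n)) \<partial>IT.C 0 (Suc n) ?u)"
    if [measurable]: "f \<in> borel_measurable borel" for f n
  proof -
    have mk: "(\<lambda>y. indicator (- B) y * f y) \<in> borel_measurable borel" by measurable
    have [measurable]: "(\<lambda>\<omega>. \<omega> k) \<in> borel_measurable (Pi\<^sub>M {0..<Suc (Suc n)} (\<lambda>_. borel))" if "k \<le> Suc n" for k
      using that by (intro measurable_component_singleton) auto
    have pm: "Measurable.pred (Pi\<^sub>M {0..<Suc (Suc n)} (\<lambda>_. borel)) (\<lambda>\<omega>. \<forall>k\<in>{1..Suc n}. \<omega> k \<notin> B)"
      by (intro pred_intros_finite) (auto intro: measurable_compose[where N=borel])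
    have mI: "(\<lambda>\<omega>. ?I (Suc n) \<omega> * f (\<omega> (Suc n))) \<in> borel_measurable (Pi\<^sub>M {0..<Suc (Suc n)} (\<lambda>_. borel))"
    proof -
      have "(\<lambda>\<omega>. ?I (Suc n) \<omega>) = (\<lambda>\<omega>. if (\<forall>k\<in>{1..Suc n}. \<omega> k \<notin> B) then 1 else 0)" by (auto simp: fun_eq_iff)
      then have "(\<lambda>\<omega>. ?I (Suc n) \<omega>) \<in> borel_measurable (Pi\<^sub>M {0..<Suc (Suc n)} (\<lambda>_. borel))"
        using pm by (simp only:) measurable
      then show ?thesis by measurable
    qed
    have "(\<integral>\<^sup>+\<omega>. ?I (Suc n) \<omega> * f (\<omega> (Suc n)) \<partial>IT.C 0 (Suc (Suc n)) ?u)
      = (\<integral>\<^sup>+\<omega>. \<integral>\<^sup>+\<omega>'. ?I (Suc n) \<omega>' * f (\<omega>' (Suc n)) \<partial>IT.eP (0 + Suc n) \<omega> \<partial>IT.C 0 (Suc n) ?u)"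
      unfolding IT.C.simps(2)[of 0 "Suc n"]
      by (rule nn_integral_bind[where B="PiM {0..<Suc (Suc n)} (\<lambda>_. borel)"])
         (use mI IT.measurable_eP[of "Suc n"] in \<open>auto simp: measurable_cong_sets[OF IT.sets_C[OF und]] simp del: IT.C.simps\<close>)
    also have "\<dots> = (\<integral>\<^sup>+\<omega>. ?I n \<omega> * (\<integral>\<^sup>+y. indicator (- B) y * f y \<partial>K (\<omega> n)) \<partial>IT.C 0 (Suc n) ?u)"
    proof (rule nn_integral_cong)
      fix \<omega> assume "\<omega> \<in> space (IT.C 0 (Suc n) ?u)"
      then have w: "\<omega> \<in> space (PiM {0..<Suc n} (\<lambda>_. borel))" by (simp only: IT.space_C[OF und]) simp
      have "(\<integral>\<^sup>+\<omega>'. ?I (Suc n) \<omega>' * f (\<omega>' (Suc n)) \<partial>IT.eP (0 + Suc n) \<omega>)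
        = (\<integral>\<^sup>+y. ?I (Suc n) (fun_upd \<omega> (Suc n) y) * f ((fun_upd \<omega> (Suc n) y) (Suc n)) \<partial>chain_step K x (Suc n) \<omega>)"
        using IT.nn_integral_eP[OF w mI] by simp
      also have "\<dots> = (\<integral>\<^sup>+y. ?I n \<omega> * (indicator (- B) y * f y) \<partial>K (\<omega> n))"
        unfolding chain_step_def nat.case
      proof (intro nn_integral_cong)
        fix y
        have "(\<forall>k\<in>{1..Suc n}. (fun_upd \<omega> (Suc n) y) k \<notin> B) \<longleftrightarrow> (\<forall>k\<in>{1..n}. \<omega> k \<notin> B) \<and> y \<notin> B"
          by (auto simp: atLeastAtMostSuc_conv)
        then show "?I (Suc n) (fun_upd \<omega> (Suc n) y) * f ((fun_upd \<omega> (Suc n) y) (Suc n)) = ?I n \<omega> * (indicator (- B) y * f y)"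
          by (simp add: indicator_def)
      qed
      also have "\<dots> = ?I n \<omega> * (\<integral>\<^sup>+y. indicator (- B) y * f y \<partial>K (\<omega> n))"
        by (rule nn_integral_cmult) (simp only: measurable_cong_sets[OF sets_K refl] mk)
      finally show "(\<integral>\<^sup>+\<omega>'. ?I (Suc n) \<omega>' * f (\<omega>' (Suc n)) \<partial>IT.eP (0 + Suc n) \<omega>) = \<dots>" .
    qed
    finally show ?thesis .
  qed
  \<comment> \<open>The index m counts the steps already integrated out at the end of the path;
    \<open>aS\<close> moves one more step from n to m.\<close>
  have an: "(\<integral>\<^sup>+\<omega>. ?I n \<omega> * ret K B m (\<omega> n) \<partial>IT.C 0 (Suc n) ?u) = ret K B (n + m) x" for n m
  proof (induction n arbitrary: m)
    case 0 then show ?case using a0[of "ret K B m"] by simp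
  next
    case (Suc n) show ?case
      using aS[of "ret K B m" n] Suc[of "Suc m"] by (simp del: IT.C.simps)
  qed
  let ?J = "{0..<Suc n}"
  define S where "S = {\<omega> \<in> space (PiM ?J (\<lambda>_. borel :: real measure)). \<forall>k\<in>{1..n}. \<omega> k \<notin> B}"
  have [measurable]: "(\<lambda>\<omega>. \<omega> k) \<in> borel_measurable (Pi\<^sub>M ?J (\<lambda>_. borel))" if "k \<le> n" for k
    using that by (intro measurable_component_singleton) auto
  have S: "S \<in> sets (PiM ?J (\<lambda>_. borel))"
    unfolding S_def by (rule sets.sets_Collect_finite_All) (auto intro!: measurable_sets_borel measurable_compose[where N=borel])
  have "IT.PF.emb UNIV ?J S = {z \<in> space (chain_law K x). \<forall>k\<in>{1..n}. z k \<notin> B}"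
    unfolding chain_law_def IT.PF.space_lim S_def prod_emb_def
    by (auto simp: space_PiM PiE_iff)
  then have "emeasure (chain_law K x) {z \<in> space (chain_law K x). \<forall>k\<in>{1..n}. z k \<notin> B} = emeasure (IT.CI ?J) S"
    using IT.lim[OF _ S] by (simp add: chain_law_def)
  also have "\<dots> = emeasure (IT.C 0 (Suc n) ?u) S"
    using IT.emeasure_CI[OF subset_refl S] prod_emb_id[OF sets.sets_into_space[OF S, unfolded space_PiM]]
    by (simp del: IT.C.simps)
  also have "\<dots> = (\<integral>\<^sup>+\<omega>. indicator S \<omega> \<partial>IT.C 0 (Suc n) ?u)"
    using S by (subst nn_integral_indicator) (simp_all only: IT.sets_C[OF und], simp)
  also have "\<dots> = (\<integral>\<^sup>+\<omega>. ?I n \<omega> * ret K B 0 (\<omega> n) \<partial>IT.C 0 (Suc n) ?u)"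
  proof (rule nn_integral_cong)
    fix \<omega> assume "\<omega> \<in> space (IT.C 0 (Suc n) ?u)"
    then have w: "\<omega> \<in> space (PiM {0..<Suc n} (\<lambda>_. borel))" by (simp only: IT.space_C[OF und]) simp
    then show "indicator S \<omega> = ?I n \<omega> * ret K B 0 (\<omega> n)" by (simp add: S_def indicator_def)
  qed
  also have "\<dots> = ret K B n x" using an[of n 0] by simp
  finally show ?thesis .
qed

lemma chain_law_sets: "sets (chain_law K x) = sets (PiM UNIV (\<lambda>_. borel))"
proof -
  interpret IT: Ionescu_Tulcea "chain_step K x" "\<lambda>_. borel"
    by (rule Ionescu_Tulcea_chain_step) (auto simp: K_prob)
  show ?thesis by (simp add: chain_law_def)
qed

lemma chain_law_component: "(\<lambda>z. z k) \<in> borel_measurable (chain_law K x)"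
  by (simp add: measurable_cong_sets[OF chain_law_sets refl])

lemma prob_space_chain_law: "prob_space (chain_law K x)"
proof
  show "emeasure (chain_law K x) (space (chain_law K x)) = 1"
    using emeasure_chain_law_not_in[of "{}" x 0] by simp
qed

lemma topologically_recurrent_at_iff:
  assumes Z: "Z \<in> sets borel"
  shows "topologically_recurrent_at K Z x \<longleftrightarrow>
    (\<forall>G. openin (top_of_set Z) G \<longrightarrow> x \<in> G \<longrightarrow> noret K G x = 0)"
proof -
  note [measurable] = chain_law_component
  interpret C: prob_space "chain_law K x" by (rule prob_space_chain_law)
  have "\<P>(z in chain_law K x. \<exists>n\<ge>1. z n \<in> G) = 1 \<longleftrightarrow> noret K G x = 0"
    if [measurable]: "G \<in> sets borel" for G
  proof -
    have "\<P>(z in chain_law K x. \<exists>n\<ge>1. z n \<in> G) = 1 \<longleftrightarrow> \<P>(z in chain_law K x. \<forall>n\<ge>1. z n \<notin> G) = 0"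
      using C.prob_neg[of "\<lambda>z. \<forall>n\<ge>1. z n \<notin> G"] by simp
    also have "\<dots> \<longleftrightarrow> emeasure (chain_law K x) {z \<in> space (chain_law K x). \<forall>n\<ge>1. z n \<notin> G} = 0"
      by (simp add: C.emeasure_eq_measure)
    also have "{z \<in> space (chain_law K x). \<forall>n\<ge>1. z n \<notin> G}
        = (\<Inter>n. {z \<in> space (chain_law K x). \<forall>k\<in>{1..n}. z k \<notin> G})"
      by force
    also have "emeasure (chain_law K x) \<dots> = (INF n. emeasure (chain_law K x) {z \<in> space (chain_law K x). \<forall>k\<in>{1..n}. z k \<notin> G})"
      by (rule INF_emeasure_decseq[symmetric]) (auto simp: decseq_def C.emeasure_eq_measure)
    finally show ?thesis by (simp only: emeasure_chain_law_not_in[OF that] noret_def)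
  qed
  moreover have "G \<in> sets borel" if "openin (top_of_set Z) G" for G
    using that Z by (auto simp: openin_open)
  ultimately show ?thesis by (auto simp: topologically_recurrent_at_def)
qed

lemma absorbing_iff: "absorbing K Z E \<longleftrightarrow> E \<subseteq> Z \<and> closed_set K E"
proof -
  have "\<P>(z in chain_law K x. z 1 \<in> E) = 1 \<longleftrightarrow> (AE y in K x. y \<in> E)" if [measurable]: "E \<in> sets borel" for x
  proof -
    note [measurable] = chain_law_component
    interpret C: prob_space "chain_law K x" by (rule prob_space_chain_law)
    interpret Kx: prob_space "K x" by (rule K_prob)
    have "\<P>(z in chain_law K x. z 1 \<in> E) = 1 \<longleftrightarrow> \<P>(z in chain_law K x. z 1 \<notin> E) = 0"
      using C.prob_neg[of "\<lambda>z. z 1 \<notin> E"] by simp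
    also have "\<dots> \<longleftrightarrow> emeasure (chain_law K x) {z \<in> space (chain_law K x). \<forall>k\<in>{1..1}. z k \<notin> E} = 0"
      by (simp add: C.emeasure_eq_measure)
    also have "\<dots> \<longleftrightarrow> (\<integral>\<^sup>+y. indicator (- E) y \<partial>K x) = 0"
      by (simp only: emeasure_chain_law_not_in[OF that]) simp
    also have "\<dots> \<longleftrightarrow> (AE y in K x. indicator (- E) y = (0::ennreal))"
      by (rule nn_integral_0_iff_AE) (use that in \<open>simp add: borel_measurable_indicator_iff\<close>)
    also have "\<dots> \<longleftrightarrow> (AE y in K x. y \<in> E)"
      by (intro AE_cong) (auto split: split_indicator)
    finally show ?thesis .
  qed
  then show ?thesis by (auto simp: absorbing_def closed_set_def)
qed

lemma topologically_recurrent_on_iff: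
  assumes Z: "Z \<in> sets borel"
  shows "topologically_recurrent_on K Z E \<longleftrightarrow> E \<subseteq> Z \<and> closed_set K E \<and>
    (\<forall>x\<in>E. \<forall>G. openin (top_of_set Z) G \<longrightarrow> x \<in> G \<longrightarrow> noret K G x = 0)"
  by (auto simp: topologically_recurrent_on_def absorbing_iff topologically_recurrent_at_iff[OF Z])

end

subsection \<open>Switching kernels driven by stacks of increments\<close>

lemma nn_integral_add_measure:
  assumes [measurable_cong]: "sets N = sets M" and f: "f \<in> borel_measurable M"
  shows "(\<integral>\<^sup>+x. f x \<partial>add_measure M N) = (\<integral>\<^sup>+x. f x \<partial>M) + (\<integral>\<^sup>+x. f x \<partial>N)"
  using f
proof (induction rule: borel_measurable_induct)
  case (cong f g)
  then show ?case
    using sets_eq_imp_space_eq[OF assms(1)] by (simp cong: nn_integral_cong_simp)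
next
  case (set A)
  then show ?case using emeasure_add_measure[OF assms(1)] by (simp add: assms(1))
next
  case (mult u c)
  then show ?case by (simp add: nn_integral_cmult distrib_left)
next
  case (add u v)
  then show ?case by (simp add: nn_integral_add ac_simps)
next
  case (seq U)
  have "(\<integral>\<^sup>+x. (SUP i. U i) x \<partial>add_measure M N) = (SUP i. \<integral>\<^sup>+x. U i x \<partial>add_measure M N)"
    unfolding SUP_apply using seq by (intro nn_integral_monotone_convergence_SUP) auto
  also have "\<dots> = (SUP i. (\<integral>\<^sup>+x. U i x \<partial>M) + (\<integral>\<^sup>+x. U i x \<partial>N))"
    using seq by simp
  also have "\<dots> = (SUP i. (\<integral>\<^sup>+x. U i x \<partial>M)) + (SUP i. (\<integral>\<^sup>+x. U i x \<partial>N))"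
    using seq by (intro ennreal_SUP_add) (auto simp: incseq_def le_fun_def intro!: nn_integral_mono)
  also have "\<dots> = (\<integral>\<^sup>+x. (SUP i. U i) x \<partial>M) + (\<integral>\<^sup>+x. (SUP i. U i) x \<partial>N)"
    unfolding SUP_apply using seq by (subst (1 2) nn_integral_monotone_convergence_SUP) auto
  finally show ?case .
qed

primrec dcount :: "real \<Rightarrow> (nat \<Rightarrow> real) \<Rightarrow> (nat \<Rightarrow> real) \<Rightarrow> (nat \<Rightarrow> bool) \<Rightarrow> nat \<Rightarrow> nat" where
  "dcount x a b c 0 = 0"
| "dcount x a b c (Suc n) =
    (let i = dcount x a b c n; y = x + sum a {..<i} + sum b {..<n - i}
     in if y > 0 \<or> y = 0 \<and> c n then Suc i else i)"

text \<open>The position after \<open>n\<close> steps of the switching walk that takes its increments from the stack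
  \<open>a\<close> at positive and from \<open>b\<close> at negative positions; \<open>c\<close> decides at \<open>0\<close>.\<close>

definition spos :: "real \<Rightarrow> (nat \<Rightarrow> real) \<Rightarrow> (nat \<Rightarrow> real) \<Rightarrow> (nat \<Rightarrow> bool) \<Rightarrow> nat \<Rightarrow> real" where
  "spos x a b c n = x + sum a {..<dcount x a b c n} + sum b {..<n - dcount x a b c n}"

lemma dcount_le: "dcount x a b c n \<le> n"
  by (induction n) (auto simp: Let_def)

lemma dcount_Suc:
  "dcount x a b c (Suc n) =
    (if spos x a b c n > 0 \<or> spos x a b c n = 0 \<and> c n then Suc (dcount x a b c n) else dcount x a b c n)"
  by (simp add: spos_def Let_def)

declare dcount.simps(2) [simp del]

text \<open>The Markov property on stacks: the first step pops one increment stack, and what remains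
  is the same dynamics. A coin is discarded at every step, even away from 0, so that the coin
  sequence shifts in all cases.\<close>

lemma dcount_spos_shift:
  assumes y: "y = (if x > 0 \<or> x = 0 \<and> c 0 then x + a 0 else x + b 0)"
    and a': "a' = (if x > 0 \<or> x = 0 \<and> c 0 then a \<circ> Suc else a)"
    and b': "b' = (if x > 0 \<or> x = 0 \<and> c 0 then b else b \<circ> Suc)"
  shows "dcount x a b c (Suc n) = (if x > 0 \<or> x = 0 \<and> c 0 then 1 else 0) + dcount y a' b' (c \<circ> Suc) n"
    and "spos x a b c (Suc n) = spos y a' b' (c \<circ> Suc) n"
proof -
  have sp: "x + sum a {..<(if x > 0 \<or> x = 0 \<and> c 0 then 1 else 0) + i}
      + sum b {..<Suc n - ((if x > 0 \<or> x = 0 \<and> c 0 then 1 else 0) + i)}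
    = y + sum a' {..<i} + sum b' {..<n - i}" if "i \<le> n" for i n
    using that by (auto simp: y a' b' sum.lessThan_Suc_shift Suc_diff_le simp del: sum.lessThan_Suc)
  have d: "dcount x a b c (Suc n) = (if x > 0 \<or> x = 0 \<and> c 0 then 1 else 0) + dcount y a' b' (c \<circ> Suc) n" for n
  proof (induction n)
    case 0 show ?case by (simp add: dcount_Suc spos_def)
  next
    case (Suc n)
    have "spos x a b c (Suc n) = spos y a' b' (c \<circ> Suc) n"
      unfolding spos_def Suc by (rule sp[OF dcount_le])
    then show ?case by (subst (1 2) dcount_Suc) (simp add: Suc o_def)
  qed
  show "dcount x a b c (Suc n) = (if x > 0 \<or> x = 0 \<and> c 0 then 1 else 0) + dcount y a' b' (c \<circ> Suc) n"
    by (rule d)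
  show "spos x a b c (Suc n) = spos y a' b' (c \<circ> Suc) n"
    unfolding spos_def d by (rule sp[OF dcount_le])
qed

section \<open>Coupling of walks driven by common stacks of inward increments\<close>

context
  fixes a b :: "nat \<Rightarrow> real" and c :: "nat \<Rightarrow> bool"
  assumes a: "\<And>n. a n \<le> 0" and b: "\<And>n. 0 \<le> b n"
begin

lemma stack_sum_a: "i \<le> j \<Longrightarrow> sum a {..<j} \<le> sum a {..<i}"
  by (rule lift_Suc_antimono_le[of "\<lambda>i. sum a {..<i}"]) (use a in auto)

lemma stack_sum_b: "i \<le> j \<Longrightarrow> sum b {..<i} \<le> sum b {..<j}"
  by (rule lift_Suc_mono_le[of "\<lambda>i. sum b {..<i}"]) (use b in auto)

text \<open>Each increment of b was taken at a position \<le> 0, and the increments of a taken since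
  then can only lower that value. With its mirror image \<open>dcount_above\<close> this nearly
  determines the two counts, independently of the order of consumption.\<close>

lemma dcount_below:
  "l < n - dcount x a b c n \<Longrightarrow> x + sum a {..<dcount x a b c n} + sum b {..<l} \<le> 0"
proof (induction n)
  case (Suc n)
  show ?case
  proof (cases "spos x a b c n > 0 \<or> spos x a b c n = 0 \<and> c n")
    case True
    then show ?thesis using Suc stack_sum_a[of "dcount x a b c n" "Suc (dcount x a b c n)"]
      by (auto simp: dcount_Suc simp del: sum.lessThan_Suc)
  next
    case False
    then show ?thesis
      using Suc dcount_le[of x a b c n]
      by (cases "l = n - dcount x a b c n") (auto simp: dcount_Suc spos_def)
  qed
qed simp

lemma dcount_above:
  "k < dcount x a b c n \<Longrightarrow> 0 \<le> x + sum a {..<k} + sum b {..<n - dcount x a b c n}"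
proof (induction n)
  case (Suc n)
  show ?case
  proof (cases "spos x a b c n > 0 \<or> spos x a b c n = 0 \<and> c n")
    case True
    then show ?thesis using Suc 
      by (cases "k = dcount x a b c n") (auto simp: dcount_Suc spos_def)
  next
    case False
    then show ?thesis
      using Suc stack_sum_b[of "n - dcount x a b c n" "Suc n - dcount x a b c n"]
      by (auto simp: dcount_Suc Suc_diff_le dcount_le)
  qed
qed simp

text \<open>While the counts agree, both walks have consumed the same increments, so the higher one
  takes from a whenever the lower one does; when they differ, one step can at most close the
  gap.\<close>

lemma dcount_mono: "x \<le> x' \<Longrightarrow> dcount x a b c n \<le> dcount x' a b c n"
proof (induction n)
  case (Suc n)
  then show ?case
    by (cases "dcount x a b c n = dcount x' a b c n") (auto simp: dcount_Suc spos_def)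
qed simp

text \<open>Had the lower walk used fewer increments of a, it would have used more of b, and
  \<open>dcount_below\<close> would bound the upper walk by x' - x. So beyond that height the counts
  agree and the walks are translates of each other.\<close>

lemma spos_coupling_above:
  assumes "x \<le> x'" "spos x' a b c n > x' - x"
  shows "spos x a b c n = spos x' a b c n - (x' - x)"
proof -
  let ?i = "dcount x a b c n" and ?i' = "dcount x' a b c n"
  have "?i = ?i'"
  proof (rule ccontr)
    assume "?i \<noteq> ?i'"
    then have l: "?i < ?i'" using dcount_mono[OF assms(1), of n] by simp
    then have "x + sum a {..<?i} + sum b {..<n - ?i'} \<le> 0"
      using dcount_le[of x' a b c n] by (intro dcount_below) auto
    then show False using assms(2) stack_sum_a[of ?i ?i'] l by (simp add: spos_def)
  qed
  then show ?thesis by (simp add: spos_def)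
qed

lemma spos_coupling_below:
  assumes "x' \<le> x" "spos x' a b c n < x' - x"
  shows "spos x a b c n = spos x' a b c n - (x' - x)"
proof -
  let ?i = "dcount x a b c n" and ?i' = "dcount x' a b c n"
  have "?i = ?i'"
  proof (rule ccontr)
    assume "?i \<noteq> ?i'"
    then have l: "?i' < ?i" using dcount_mono[OF assms(1), of n] by simp
    then have "0 \<le> x + sum a {..<?i'} + sum b {..<n - ?i}"
      using dcount_le[of x a b c n] by (intro dcount_above) auto
    moreover have "sum b {..<n - ?i} \<le> sum b {..<n - ?i'}" using l by (intro stack_sum_b) simp
    ultimately show False using assms(2) unfolding spos_def by linarith
  qed
  then show ?thesis by (simp add: spos_def)
qed

text \<open>The hypotheses exclude every other pair of counts with sum m + n + 2: with one increment
  of a missing the walk is still above 0, with one of b missing it is still below. Hence the order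
  of the increments is irrelevant.\<close>

lemma spos_visit:
  assumes "0 < x + sum a {..<m} + sum b {..<Suc n}" "x + sum a {..<Suc m} + sum b {..<n} < 0"
  shows "spos x a b c (Suc (Suc (m + n))) = x + sum a {..<Suc m} + sum b {..<Suc n}"
proof -
  let ?N = "Suc (Suc (m + n))"
  let ?i = "dcount x a b c ?N"
  have "?i \<le> Suc m"
  proof (rule ccontr)
    assume "\<not> ?i \<le> Suc m"
    then have "0 \<le> x + sum a {..<Suc m} + sum b {..<?N - ?i}" by (intro dcount_above) auto
    moreover have "?N - ?i \<le> n" using \<open>\<not> ?i \<le> Suc m\<close> by auto
    ultimately show False using assms(2) stack_sum_b[of "?N - ?i" n] by linarith
  qed
  moreover have "Suc m \<le> ?i"
  proof (rule ccontr)
    assume *: "\<not> Suc m \<le> ?i"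
    then have "x + sum a {..<?i} + sum b {..<Suc n} \<le> 0" by (intro dcount_below) auto
    then show False using assms(1) stack_sum_a[of ?i m] * by linarith
  qed
  ultimately have "?i = Suc m" by simp
  then show ?thesis by (simp only: spos_def) simp
qed

end

lemma measurable_sum_random:
  assumes [measurable]: "i \<in> N \<rightarrow>\<^sub>M count_space UNIV" "s \<in> N \<rightarrow>\<^sub>M stream_space (borel :: real measure)"
  shows "(\<lambda>\<omega>. sum (snth (s \<omega>)) {..<i \<omega> :: nat}) \<in> borel_measurable N"
  by (rule measurable_compose_countable[where f="\<lambda>i \<omega>. sum (snth (s \<omega>)) {..<i}" and g=i]) measurable

lemma measurable_spos [measurable (raw)]:
  assumes x[measurable]: "x \<in> borel_measurable N"
    and [measurable]: "a \<in> N \<rightarrow>\<^sub>M stream_space (borel :: real measure)" "b \<in> N \<rightarrow>\<^sub>M stream_space (borel :: real measure)"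
      "c \<in> N \<rightarrow>\<^sub>M stream_space (count_space UNIV)"
  shows "(\<lambda>\<omega>. spos (x \<omega>) (snth (a \<omega>)) (snth (b \<omega>)) (snth (c \<omega>)) n) \<in> borel_measurable N"
proof -
  have "(\<lambda>\<omega>. dcount (x \<omega>) (snth (a \<omega>)) (snth (b \<omega>)) (snth (c \<omega>)) n) \<in> N \<rightarrow>\<^sub>M count_space UNIV" for n
  proof (induction n)
    case (Suc n)
    note [measurable] = Suc measurable_sum_random
    show ?case unfolding dcount_Suc spos_def by measurable
  qed simp
  note [measurable] = this measurable_sum_random
  show ?thesis unfolding spos_def by measurable
qed

text \<open>Fubini moves the integral over the head of the popped stream outside. Two orders occur,
  since the popped stream is the outer of the two stacks at positive positions and the inner one at
  negative positions.\<close>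

lemma nn_integral_stack_shift:
  fixes W :: "'a \<Rightarrow> 'c \<Rightarrow> 'a stream \<Rightarrow> 'b \<Rightarrow> ennreal"
  assumes F: "prob_space F" and C: "prob_space C" and B: "prob_space B"
    and m: "(\<lambda>(t, c, a, b). W t c a b) \<in> borel_measurable (F \<Otimes>\<^sub>M C \<Otimes>\<^sub>M stream_space F \<Otimes>\<^sub>M B)"
  shows "(\<integral>\<^sup>+c. \<integral>\<^sup>+a. \<integral>\<^sup>+b. W (shd a) c (stl a) b \<partial>B \<partial>stream_space F \<partial>C)
      = (\<integral>\<^sup>+t. \<integral>\<^sup>+c. \<integral>\<^sup>+a. \<integral>\<^sup>+b. W t c a b \<partial>B \<partial>stream_space F \<partial>C \<partial>F)" (is ?A)
    and "(\<integral>\<^sup>+c. \<integral>\<^sup>+b. \<integral>\<^sup>+a. W (shd a) c (stl a) b \<partial>stream_space F \<partial>B \<partial>C)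
      = (\<integral>\<^sup>+t. \<integral>\<^sup>+c. \<integral>\<^sup>+b. \<integral>\<^sup>+a. W t c a b \<partial>stream_space F \<partial>B \<partial>C \<partial>F)" (is ?B)
proof -
  interpret F: prob_space F by fact
  interpret C: prob_space C by fact
  interpret B: prob_space B by fact
  interpret S: prob_space "stream_space F" by (rule F.prob_space_stream_space)
  interpret FC: pair_sigma_finite F C ..
  interpret FB: pair_sigma_finite F B ..
  have W [measurable]: "(\<lambda>\<omega>. W (t \<omega>) (c \<omega>) (a \<omega>) (b \<omega>)) \<in> borel_measurable N"
    if "t \<in> N \<rightarrow>\<^sub>M F" "c \<in> N \<rightarrow>\<^sub>M C" "a \<in> N \<rightarrow>\<^sub>M stream_space F" "b \<in> N \<rightarrow>\<^sub>M B"
    for N :: "'d measure" and t c a b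
    using measurable_compose[OF measurable_Pair[OF that(1) measurable_Pair[OF that(2) measurable_Pair[OF that(3,4)]]] m]
    by simp
  have 1: "(\<integral>\<^sup>+a. \<integral>\<^sup>+b. W (shd a) c (stl a) b \<partial>B \<partial>stream_space F)
      = (\<integral>\<^sup>+t. \<integral>\<^sup>+a. \<integral>\<^sup>+b. W t c a b \<partial>B \<partial>stream_space F \<partial>F)" if [measurable]: "c \<in> space C" for c
    by (subst F.nn_integral_stream_space) simp_all
  have 2: "(\<integral>\<^sup>+a. W (shd a) c (stl a) b \<partial>stream_space F)
      = (\<integral>\<^sup>+t. \<integral>\<^sup>+a. W t c a b \<partial>stream_space F \<partial>F)" if [measurable]: "c \<in> space C" "b \<in> space B" for c b
    by (subst F.nn_integral_stream_space) simp_all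
  have "(\<integral>\<^sup>+c. \<integral>\<^sup>+a. \<integral>\<^sup>+b. W (shd a) c (stl a) b \<partial>B \<partial>stream_space F \<partial>C)
    = (\<integral>\<^sup>+c. \<integral>\<^sup>+t. \<integral>\<^sup>+a. \<integral>\<^sup>+b. W t c a b \<partial>B \<partial>stream_space F \<partial>F \<partial>C)"
    by (intro nn_integral_cong 1)
  also have "\<dots> = (\<integral>\<^sup>+t. \<integral>\<^sup>+c. \<integral>\<^sup>+a. \<integral>\<^sup>+b. W t c a b \<partial>B \<partial>stream_space F \<partial>C \<partial>F)"
    by (rule FC.Fubini') measurable
  finally show ?A .
  have "(\<integral>\<^sup>+c. \<integral>\<^sup>+b. \<integral>\<^sup>+a. W (shd a) c (stl a) b \<partial>stream_space F \<partial>B \<partial>C)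
    = (\<integral>\<^sup>+c. \<integral>\<^sup>+b. \<integral>\<^sup>+t. \<integral>\<^sup>+a. W t c a b \<partial>stream_space F \<partial>F \<partial>B \<partial>C)"
    by (intro nn_integral_cong 2)
  also have "\<dots> = (\<integral>\<^sup>+c. \<integral>\<^sup>+t. \<integral>\<^sup>+b. \<integral>\<^sup>+a. W t c a b \<partial>stream_space F \<partial>B \<partial>F \<partial>C)"
    by (intro nn_integral_cong FB.Fubini') measurable
  also have "\<dots> = (\<integral>\<^sup>+t. \<integral>\<^sup>+c. \<integral>\<^sup>+b. \<integral>\<^sup>+a. W t c a b \<partial>stream_space F \<partial>B \<partial>C \<partial>F)"
    by (rule FC.Fubini') measurable
  finally show ?B .
qed

locale switching =
  fixes F F' :: "real measure" and \<alpha> :: real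
  assumes F: "prob_space F" and F': "prob_space F'"
    and sets_F [simp, measurable_cong]: "sets F = sets borel"
    and sets_F' [simp, measurable_cong]: "sets F' = sets borel"
    and \<alpha>: "0 \<le> \<alpha>" "\<alpha> \<le> 1"
begin

abbreviation "K \<equiv> switching_kernel F F' \<alpha>"

sublocale prob_kernel K
  by (rule prob_kernel.intro; rule measurable_switching_kernel prob_space_switching_kernel(1))
    (rule F F' sets_F sets_F' \<alpha>)+

lemma nn_integral_K:
  assumes [measurable]: "f \<in> borel_measurable borel"
  shows "(\<integral>\<^sup>+y. f y \<partial>K x) = (if x > 0 then \<integral>\<^sup>+t. f (x + t) \<partial>F else if x < 0 then \<integral>\<^sup>+t. f (x + t) \<partial>F'
    else ennreal \<alpha> * (\<integral>\<^sup>+t. f t \<partial>F) + ennreal (1 - \<alpha>) * (\<integral>\<^sup>+t. f t \<partial>F'))"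
proof -
  have m: "(+) x \<in> F \<rightarrow>\<^sub>M borel" "(+) x \<in> F' \<rightarrow>\<^sub>M borel" "f \<in> borel_measurable F" "f \<in> borel_measurable F'"
      "f \<in> borel_measurable (scale_measure (ennreal \<alpha>) F)"
    by (simp_all add: measurable_cong_sets[OF sets_F refl] measurable_cong_sets[OF sets_F' refl]
        measurable_cong_sets[OF trans[OF sets_scale_measure sets_F] refl])
  have s: "sets (scale_measure (ennreal (1 - \<alpha>)) F') = sets (scale_measure (ennreal \<alpha>) F)" by simp
  show ?thesis
    unfolding switching_kernel_def
    using nn_integral_distr[OF m(1), of f] nn_integral_distr[OF m(2), of f]
      nn_integral_add_measure[OF s m(5)] nn_integral_scale_measure[OF m(3)] nn_integral_scale_measure[OF m(4)]
    by simp
qed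

text \<open>Realises the chain on independent streams, one per half-line and one for the coins at 0,
  so that chains with different starts become functions of the same randomness.\<close>

lemma ret_stack:
  assumes B [measurable]: "B \<in> sets borel"
  shows "ret K B n x = (\<integral>\<^sup>+c. \<integral>\<^sup>+a. \<integral>\<^sup>+b. (\<Prod>k<n. indicator (- B) (spos x (snth a) (snth b) (snth c) (Suc k)))
    \<partial>stream_space F' \<partial>stream_space F \<partial>stream_space (measure_pmf (bernoulli_pmf \<alpha>)))"
proof (induction n arbitrary: x)
  case 0
  interpret F: prob_space "stream_space F" using F by (rule prob_space.prob_space_stream_space)
  interpret F': prob_space "stream_space F'" using F' by (rule prob_space.prob_space_stream_space)
  interpret C: prob_space "stream_space (measure_pmf (bernoulli_pmf \<alpha>))"
    by (rule prob_space.prob_space_stream_space) (rule measure_pmf.prob_space_axioms)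
  show ?case by (simp add: F.emeasure_space_1 F'.emeasure_space_1 C.emeasure_space_1)
next
  case (Suc n)
  let ?b = "measure_pmf (bernoulli_pmf \<alpha>)"
  let ?C = "stream_space ?b" and ?F = "stream_space F" and ?F' = "stream_space F'"
  interpret F: prob_space F by (rule F)
  interpret F': prob_space F' by (rule F')
  interpret SF: prob_space ?F by (rule F.prob_space_stream_space)
  interpret SF': prob_space ?F' by (rule F'.prob_space_stream_space)
  interpret C: prob_space ?C by (rule prob_space.prob_space_stream_space) (rule measure_pmf.prob_space_axioms)
  let ?h = "\<lambda>n x c a b. (\<Prod>k<n. indicator (- B) (spos x (snth a) (snth b) (snth c) (Suc k))) :: ennreal"
  have st: "sets ?F = sets (stream_space borel)" "sets ?F' = sets (stream_space borel)"
    "sets ?C = sets (stream_space (count_space UNIV))"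
    by (rule sets_stream_space_cong; simp)+
  define W where "W y c a b = indicator (- B) y * ?h n y c a b" for y c a b
  have sb: "sets (measure_pmf p) = sets (count_space UNIV)" for p :: "bool pmf" by simp
  note st = sets_stream_space_cong[OF sets_F] sets_stream_space_cong[OF sets_F'] sets_stream_space_cong[OF sb[of "bernoulli_pmf \<alpha>"]]
  have WD: "(\<lambda>(t, c, a, b). W (x + t) c a b) \<in> borel_measurable (F \<Otimes>\<^sub>M ?C \<Otimes>\<^sub>M ?F \<Otimes>\<^sub>M ?F')"
    unfolding measurable_cong_sets[OF sets_pair_measure_cong[OF sets_F sets_pair_measure_cong[OF st(3) sets_pair_measure_cong[OF st(1,2)]]] refl]
    unfolding W_def by measurable
  have WA: "(\<lambda>(t, c, b, a). W (x + t) c a b) \<in> borel_measurable (F' \<Otimes>\<^sub>M ?C \<Otimes>\<^sub>M ?F' \<Otimes>\<^sub>M ?F)"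
    unfolding measurable_cong_sets[OF sets_pair_measure_cong[OF sets_F' sets_pair_measure_cong[OF st(3) sets_pair_measure_cong[OF st(2,1)]]] refl]
    unfolding W_def by measurable
  have hm: "(\<lambda>c. \<integral>\<^sup>+a. \<integral>\<^sup>+b. ?h (Suc n) x c a b \<partial>?F' \<partial>?F) \<in> borel_measurable ?C"
  proof -
    have "(\<lambda>(c, a, b). ?h (Suc n) x c a b) \<in> borel_measurable (?C \<Otimes>\<^sub>M ?F \<Otimes>\<^sub>M ?F')"
      unfolding measurable_cong_sets[OF sets_pair_measure_cong[OF st(3) sets_pair_measure_cong[OF st(1,2)]] refl]
      by measurable
    note m = measurable_compose[OF measurable_Pair[OF _ measurable_Pair] this]
    have "(\<lambda>(c, a). \<integral>\<^sup>+b. ?h (Suc n) x c a b \<partial>?F') \<in> borel_measurable (?C \<Otimes>\<^sub>M ?F)"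
      unfolding split_beta' using m[of "\<lambda>\<omega>. fst (fst \<omega>)" _ "\<lambda>\<omega>. snd (fst \<omega>)" snd]
      by (intro SF'.borel_measurable_nn_integral) (simp add: split_beta')
    then show ?thesis by (intro SF.borel_measurable_nn_integral) simp
  qed
  have hS: "?h (Suc n) x (d ## c) a b = (if x > 0 \<or> x = 0 \<and> d then W (x + shd a) c (stl a) b else W (x + shd b) c a (stl b))" for d c a b
  proof -
    have sn: "snth s \<circ> Suc = snth (stl s)" for s :: "'c stream" by (auto simp: fun_eq_iff)
    show ?thesis
      unfolding prod.lessThan_Suc_shift W_def o_def
      using dcount_spos_shift(2)[of _ x "snth (d ## c)" "snth a" "snth b" _ _] 
      by (auto simp: sn spos_def[of _ _ _ _ 0])
  qed
  have W: "(\<integral>\<^sup>+c. \<integral>\<^sup>+a. \<integral>\<^sup>+b. W y c a b \<partial>?F' \<partial>?F \<partial>?C) = indicator (- B) y * ret K B n y" for y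
    unfolding W_def Suc by (auto split: split_indicator)
  have D: "(\<integral>\<^sup>+c. \<integral>\<^sup>+a. \<integral>\<^sup>+b. W (x + shd a) c (stl a) b \<partial>?F' \<partial>?F \<partial>?C)
    = (\<integral>\<^sup>+t. indicator (- B) (x + t) * ret K B n (x + t) \<partial>F)"
    using nn_integral_stack_shift(1)[OF F C.prob_space_axioms SF'.prob_space_axioms WD] by (simp only: W)
  have A: "(\<integral>\<^sup>+c. \<integral>\<^sup>+a. \<integral>\<^sup>+b. W (x + shd b) c a (stl b) \<partial>?F' \<partial>?F \<partial>?C)
    = (\<integral>\<^sup>+t. indicator (- B) (x + t) * ret K B n (x + t) \<partial>F')"
    using nn_integral_stack_shift(2)[OF F' C.prob_space_axioms SF.prob_space_axioms WA] by (simp only: W)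
  have "(\<integral>\<^sup>+c. \<integral>\<^sup>+a. \<integral>\<^sup>+b. ?h (Suc n) x c a b \<partial>?F' \<partial>?F \<partial>?C)
    = (\<integral>\<^sup>+d. \<integral>\<^sup>+c. \<integral>\<^sup>+a. \<integral>\<^sup>+b. ?h (Suc n) x (d ## c) a b \<partial>?F' \<partial>?F \<partial>?C \<partial>?b)"
    by (rule prob_space.nn_integral_stream_space[OF measure_pmf.prob_space_axioms hm])
  also have "\<dots> = (\<integral>\<^sup>+d. (if x > 0 \<or> x = 0 \<and> d then \<integral>\<^sup>+t. indicator (- B) (x + t) * ret K B n (x + t) \<partial>F
      else \<integral>\<^sup>+t. indicator (- B) (x + t) * ret K B n (x + t) \<partial>F') \<partial>?b)"
  proof (intro nn_integral_cong)
    fix d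
    show "(\<integral>\<^sup>+c. \<integral>\<^sup>+a. \<integral>\<^sup>+b. ?h (Suc n) x (d ## c) a b \<partial>?F' \<partial>?F \<partial>?C)
      = (if x > 0 \<or> x = 0 \<and> d then \<integral>\<^sup>+t. indicator (- B) (x + t) * ret K B n (x + t) \<partial>F
      else \<integral>\<^sup>+t. indicator (- B) (x + t) * ret K B n (x + t) \<partial>F')"
      unfolding hS by (cases "x > 0 \<or> x = 0 \<and> d") (simp_all only: if_True if_False D A)
  qed
  also have "\<dots> = ret K B (Suc n) x"
  proof -
    let ?f = "\<lambda>y. indicator (- B) y * ret K B n y"
    have f: "?f \<in> borel_measurable borel" by measurable
    have "ennreal \<alpha> + ennreal (1 - \<alpha>) = 1" using \<alpha> by (simp flip: ennreal_plus)
    then have e: "ennreal \<alpha> * I + ennreal (1 - \<alpha>) * I = I" for I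
      by (simp flip: distrib_right)
    show ?thesis
      unfolding ret.simps nn_integral_K[OF f] nn_integral_bernoulli_pmf[OF \<alpha> zero_le]
      by (cases "x > 0"; cases "x = 0") (simp_all add: e mult.commute[of _ "ennreal _"])
  qed
  finally show ?case by simp
qed

end

section \<open>Supports and the semigroup of attainable displacements\<close>

definition supp :: "real measure \<Rightarrow> real set" where
  "supp F = msupport UNIV F"

lemma supp_iff: "x \<in> supp F \<longleftrightarrow> (\<forall>e>0. 0 < emeasure F (ball x e))" if "sets F = sets borel"
proof
  assume "x \<in> supp F"
  then show "\<forall>e>0. 0 < emeasure F (ball x e)" by (auto simp: supp_def msupport_def)
next
  assume *: "\<forall>e>0. 0 < emeasure F (ball x e)"
  have "0 < emeasure F G" if "open G" "x \<in> G" for G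
  proof -
    obtain e where "e > 0" "ball x e \<subseteq> G" using \<open>open G\<close> \<open>x \<in> G\<close> openE by blast
    moreover have "G \<in> sets F" using \<open>open G\<close> \<open>sets F = sets borel\<close> by auto
    ultimately show ?thesis using * emeasure_mono[of "ball x e" G F] by (meson less_le_trans)
  qed
  then show "x \<in> supp F" by (auto simp: supp_def msupport_def)
qed

lemma AE_in_supp:
  assumes sF: "sets F = sets borel" shows "AE x in F. x \<in> supp F"
proof -
  let ?C = "{ball x e | x e. e > 0 \<and> emeasure F (ball x e) = 0}"
  obtain C where C: "C \<subseteq> ?C" "countable C" "\<Union>C = \<Union>?C"
    using Lindelof[of ?C] by (auto simp: open_ball)
  have "\<Union>C \<in> null_sets F"
  proof (rule null_sets_UN'[of C "\<lambda>x. x", simplified])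
    show "countable C" by fact
    show "x \<in> null_sets F" if xC: "x \<in> C" for x
    proof -
      obtain y e where "x = ball y e" "emeasure F x = 0" using xC C(1) by fastforce
      then show ?thesis using sF by (auto intro: null_setsI)
    qed
  qed
  moreover have "- supp F \<subseteq> \<Union>C"
  proof
    fix x assume "x \<in> - supp F"
    then obtain e where "e > 0" "emeasure F (ball x e) = 0" using supp_iff[OF sF] by (auto simp: not_less)
    then have "ball x e \<in> ?C" "x \<in> ball x e" by auto
    then show "x \<in> \<Union>C" unfolding C(3) by blast
  qed
  ultimately have "AE x in F. x \<notin> \<Union>C" by (intro AE_not_in)
  then show ?thesis by eventually_elim (use \<open>- supp F \<subseteq> \<Union>C\<close> in auto)
qed

text \<open>The additive semigroup generated by the two supports. The new generator stands in front
  because in \<open>step_sums_near\<close> it is pushed on top of a stack.\<close>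

inductive_set step_sums :: "real measure \<Rightarrow> real measure \<Rightarrow> real set" for F F' where
  zero: "0 \<in> step_sums F F'"
| left: "g \<in> supp F \<Longrightarrow> t \<in> step_sums F F' \<Longrightarrow> g + t \<in> step_sums F F'"
| right: "g \<in> supp F' \<Longrightarrow> t \<in> step_sums F F' \<Longrightarrow> g + t \<in> step_sums F F'"

lemma step_sums_add:
  "s \<in> step_sums F F' \<Longrightarrow> t \<in> step_sums F F' \<Longrightarrow> s + t \<in> step_sums F F'"
  by (induction rule: step_sums.induct) (auto simp: add.assoc intro: step_sums.intros)

text \<open>While the consumed increments sum to about t, the ones next in line are reserved near d
  and e; these become the two last jumps in \<open>spos_visit\<close>.\<close>

definition near_sum :: "real \<Rightarrow> real \<Rightarrow> real \<Rightarrow> nat \<Rightarrow> nat \<Rightarrow> real \<Rightarrow> real stream \<Rightarrow> real stream \<Rightarrow> bool" where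
  "near_sum d e \<eta> m n t a b \<longleftrightarrow>
    \<bar>sum (snth a) {..<m} + sum (snth b) {..<n} - t\<bar> < \<eta> \<and> \<bar>a !! m - d\<bar> < \<eta> \<and> \<bar>b !! n - e\<bar> < \<eta>"

lemma near_sum_Suc:
  assumes "near_sum d e (\<eta> / 2) m n t a b" "u \<in> ball g (\<eta> / 2)"
  shows "near_sum d e \<eta> (Suc m) n (g + t) (u ## a) b" "near_sum d e \<eta> m (Suc n) (g + t) a (u ## b)"
proof -
  have "\<bar>sum (snth a) {..<m} + sum (snth b) {..<n} - t\<bar> < \<eta> / 2" "\<bar>a !! m - d\<bar> < \<eta> / 2" "\<bar>b !! n - e\<bar> < \<eta> / 2"
    "\<bar>g - u\<bar> < \<eta> / 2" using assms by (auto simp: near_sum_def dist_real_def)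
  then show "near_sum d e \<eta> (Suc m) n (g + t) (u ## a) b" "near_sum d e \<eta> m (Suc n) (g + t) a (u ## b)"
    unfolding near_sum_def sum.lessThan_Suc_shift by (simp_all, linarith+)
qed

text \<open>Pushing a generator on top of a stack changes the sum but keeps the reserved increments
  next in line, at the cost of half the tolerance.\<close>

lemma step_sums_near:
  assumes F: "prob_space F" and F': "prob_space F'"
    and sF [measurable_cong]: "sets F = sets borel" and sF' [measurable_cong]: "sets F' = sets borel"
    and d: "d \<in> supp F" and e: "e \<in> supp F'" and t: "t \<in> step_sums F F'" and "0 < \<eta>"
  shows "\<exists>m n. 0 < (\<integral>\<^sup>+a. \<integral>\<^sup>+b. (if near_sum d e \<eta> m n t a b then 1 else 0) \<partial>stream_space F' \<partial>stream_space F)"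
  using t \<open>0 < \<eta>\<close>
proof (induction arbitrary: \<eta> rule: step_sums.induct)
  interpret F: prob_space F by fact
  interpret F': prob_space F' by fact
  interpret SF: prob_space "stream_space F" by (rule F.prob_space_stream_space)
  interpret SF': prob_space "stream_space F'" by (rule F'.prob_space_stream_space)
  interpret P: pair_sigma_finite "stream_space F" "stream_space F'" ..
  have spF: "space F = UNIV" "space F' = UNIV" using sF sF' by (auto dest: sets_eq_imp_space_eq)
  have [measurable]: "(\<lambda>s. s !! n) \<in> borel_measurable (stream_space F)" "(\<lambda>s. s !! n) \<in> borel_measurable (stream_space F')" for n
    using measurable_snth[of n F] measurable_snth[of n F'] unfolding measurable_cong_sets[OF refl sF] measurable_cong_sets[OF refl sF']
    by auto
  have bi: "indicator (ball x r) \<in> borel_measurable F" "indicator (ball x r) \<in> borel_measurable F'" for x :: real and r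
    unfolding measurable_cong_sets[OF sF refl] measurable_cong_sets[OF sF' refl]
    by (rule borel_measurable_indicator; simp)+
  have sh [measurable]: "shd \<in> borel_measurable (stream_space F)" "shd \<in> borel_measurable (stream_space F')"
    using measurable_shd[of F] measurable_shd[of F'] unfolding measurable_cong_sets[OF refl sF] measurable_cong_sets[OF refl sF']
    by auto
  have [measurable]: "(\<lambda>(a, b). if near_sum d e \<eta> m n t a b then 1 else (0::ennreal)) \<in> borel_measurable (stream_space F \<Otimes>\<^sub>M stream_space F')" for \<eta> m n t
    unfolding near_sum_def by measurable
  let ?I = "\<lambda>\<eta> m n t. \<integral>\<^sup>+a. \<integral>\<^sup>+b. (if near_sum d e \<eta> m n t a b then 1 else 0) \<partial>stream_space F' \<partial>stream_space F"
  have m1: "(\<lambda>b. if near_sum d e \<eta> m n t a b then 1 else (0::ennreal)) \<in> borel_measurable (stream_space F')" for a \<eta> m n t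
    unfolding near_sum_def by measurable
  have m2: "(\<lambda>a. \<integral>\<^sup>+b. (if near_sum d e \<eta> m n t a b then 1 else (0::ennreal)) \<partial>stream_space F') \<in> borel_measurable (stream_space F)" for \<eta> m n t
    by measurable
  {
    case zero
    have "(\<integral>\<^sup>+a. \<integral>\<^sup>+b. (if near_sum d e \<eta> 0 0 0 a b then 1 else 0) \<partial>stream_space F' \<partial>stream_space F)
      = (\<integral>\<^sup>+a. \<integral>\<^sup>+b. indicator (ball d \<eta>) (shd a) * indicator (ball e \<eta>) (shd b) \<partial>stream_space F' \<partial>stream_space F)"
      using zero by (intro nn_integral_cong) (auto simp: near_sum_def dist_real_def abs_minus_commute split: split_indicator)
    also have "\<dots> = (\<integral>\<^sup>+a. indicator (ball d \<eta>) (shd a) * emeasure F' (ball e \<eta>) \<partial>stream_space F)"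
    proof -
      have mi: "(\<lambda>b. indicator (ball e \<eta>) (shd b) :: ennreal) \<in> borel_measurable (stream_space F')"
        by (rule measurable_compose[OF sh(2) borel_measurable_indicator]) simp
      show ?thesis
        using F'.nn_integral_stream_space[OF mi] sF'
        by (intro nn_integral_cong) (simp add: nn_integral_cmult[OF mi] SF'.emeasure_space_1)
    qed
    also have "\<dots> = emeasure F (ball d \<eta>) * emeasure F' (ball e \<eta>)"
    proof -
      have mi: "(\<lambda>b. indicator (ball d \<eta>) (shd b) :: ennreal) \<in> borel_measurable (stream_space F)"
        by (rule measurable_compose[OF sh(1) borel_measurable_indicator]) simp
      show ?thesis
        using F.nn_integral_stream_space[OF mi] sF
        by (simp add: nn_integral_multc[OF mi] SF.emeasure_space_1)
    qed
    finally have "?I \<eta> 0 0 0 > 0" using d e zero supp_iff[OF sF] supp_iff[OF sF'] by (simp add: ennreal_zero_less_mult_iff)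
    then show ?case by blast
  next
    case (left g t)
    obtain m n where mn: "?I (\<eta>/2) m n t > 0" using left.IH[of "\<eta>/2"] left.prems by auto
    have "emeasure F (ball g (\<eta>/2)) * ?I (\<eta>/2) m n t
      = (\<integral>\<^sup>+u. indicator (ball g (\<eta>/2)) u * ?I (\<eta>/2) m n t \<partial>F)"
      using sF by (simp add: nn_integral_multc[OF bi(1)])
    also have "\<dots> \<le> (\<integral>\<^sup>+u. \<integral>\<^sup>+a. \<integral>\<^sup>+b. (if near_sum d e \<eta> (Suc m) n (g + t) (u ## a) b then 1 else 0)
        \<partial>stream_space F' \<partial>stream_space F \<partial>F)"
    proof (rule nn_integral_mono)
      fix u
      show "indicator (ball g (\<eta>/2)) u * ?I (\<eta>/2) m n t \<le> (\<integral>\<^sup>+a. \<integral>\<^sup>+b.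
          (if near_sum d e \<eta> (Suc m) n (g + t) (u ## a) b then 1 else 0) \<partial>stream_space F' \<partial>stream_space F)"
      proof (cases "u \<in> ball g (\<eta>/2)")
        case True
        then show ?thesis
          by (auto intro!: nn_integral_mono dest: near_sum_Suc(1)[OF _ True])
      qed simp
    qed
    also have "\<dots> = ?I \<eta> (Suc m) n (g + t)"
      by (rule F.nn_integral_stream_space[OF m2, symmetric])
    finally have le: "emeasure F (ball g (\<eta>/2)) * ?I (\<eta>/2) m n t \<le> ?I \<eta> (Suc m) n (g + t)" .
    have "0 < \<eta>/2" using left.prems by simp
    then have "0 < emeasure F (ball g (\<eta>/2))" using left.hyps(1) unfolding supp_iff[OF sF] by blast
    then have "0 < emeasure F (ball g (\<eta>/2)) * ?I (\<eta>/2) m n t" using mn unfolding ennreal_zero_less_mult_iff by blast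
    then have "?I \<eta> (Suc m) n (g + t) > 0" using le by (rule less_le_trans)
    then show ?case by blast
  next
    case (right g t)
    obtain m n where mn: "?I (\<eta>/2) m n t > 0" using right.IH[of "\<eta>/2"] right.prems by auto
    have "emeasure F' (ball g (\<eta>/2)) * ?I (\<eta>/2) m n t
      = (\<integral>\<^sup>+a. emeasure F' (ball g (\<eta>/2)) * (\<integral>\<^sup>+b. (if near_sum d e (\<eta>/2) m n t a b then 1 else 0) \<partial>stream_space F') \<partial>stream_space F)"
      by (rule nn_integral_cmult[OF m2, symmetric])
    also have "\<dots> \<le> ?I \<eta> m (Suc n) (g + t)"
    proof (rule nn_integral_mono)
      fix a
      have "emeasure F' (ball g (\<eta>/2)) * (\<integral>\<^sup>+b. (if near_sum d e (\<eta>/2) m n t a b then 1 else 0) \<partial>stream_space F')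
        = (\<integral>\<^sup>+u. indicator (ball g (\<eta>/2)) u * (\<integral>\<^sup>+b. (if near_sum d e (\<eta>/2) m n t a b then 1 else 0) \<partial>stream_space F') \<partial>F')"
        using sF' by (simp add: nn_integral_multc[OF bi(2)])
      also have "\<dots> \<le> (\<integral>\<^sup>+u. \<integral>\<^sup>+b. (if near_sum d e \<eta> m (Suc n) (g + t) a (u ## b) then 1 else 0)
          \<partial>stream_space F' \<partial>F')"
      proof (rule nn_integral_mono)
        fix u
        show "indicator (ball g (\<eta>/2)) u * (\<integral>\<^sup>+b. (if near_sum d e (\<eta>/2) m n t a b then 1 else 0) \<partial>stream_space F') \<le> (\<integral>\<^sup>+b.
            (if near_sum d e \<eta> m (Suc n) (g + t) a (u ## b) then 1 else 0) \<partial>stream_space F')"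
        proof (cases "u \<in> ball g (\<eta>/2)")
          case True
          then show ?thesis
            by (auto intro!: nn_integral_mono dest: near_sum_Suc(2)[OF _ True])
        qed simp
      qed
      also have "\<dots> = (\<integral>\<^sup>+b. (if near_sum d e \<eta> m (Suc n) (g + t) a b then 1 else 0) \<partial>stream_space F')"
        by (rule F'.nn_integral_stream_space[OF m1, symmetric])
      finally show "emeasure F' (ball g (\<eta>/2)) * (\<integral>\<^sup>+b. (if near_sum d e (\<eta>/2) m n t a b then 1 else 0) \<partial>stream_space F') \<le> \<dots>" .
    qed
    finally have le: "emeasure F' (ball g (\<eta>/2)) * ?I (\<eta>/2) m n t \<le> ?I \<eta> m (Suc n) (g + t)" .
    have "0 < \<eta>/2" using right.prems by simp
    then have "0 < emeasure F' (ball g (\<eta>/2))" using right.hyps(1) unfolding supp_iff[OF sF'] by blast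
    then have "0 < emeasure F' (ball g (\<eta>/2)) * ?I (\<eta>/2) m n t" using mn unfolding ennreal_zero_less_mult_iff by blast
    then have "?I \<eta> m (Suc n) (g + t) > 0" using le by (rule less_le_trans)
    then show ?case by blast
  }
qed

lemma prod_indicator_eq:
  "(\<Prod>k<n::nat. indicator A (f k)) = (if \<forall>k<n. f k \<in> A then 1 else 0 :: ennreal)"
  by (induction n) (auto simp: less_Suc_eq)

locale inward = switching F F' \<alpha> for F F' \<alpha> +
  assumes F_nonpos: "AE t in F. t \<le> 0" and F'_nonneg: "AE t in F'. 0 \<le> t"
begin

text \<open>Almost surely all increments have the right sign at once; pathwise inequalities from the
  coupling are transferred to \<open>ret\<close> through this lemma.\<close>

lemma ret_stack_mono:
  assumes B: "B \<in> sets borel"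
    and f: "\<And>a b c. (\<And>n. a !! n \<le> 0) \<Longrightarrow> (\<And>n. 0 \<le> b !! n) \<Longrightarrow>
      (\<Prod>k<n. indicator (- B) (spos x (snth a) (snth b) (snth c) (Suc k))) \<le> f a b c"
  shows "ret K B n x \<le> (\<integral>\<^sup>+c. \<integral>\<^sup>+a. \<integral>\<^sup>+b. f a b c
    \<partial>stream_space F' \<partial>stream_space F \<partial>stream_space (measure_pmf (bernoulli_pmf \<alpha>)))"
proof -
  have "AE a in stream_space F. stream_all (\<lambda>t. t \<le> 0) a"
    using prob_space.AE_stream_all[OF F, of "\<lambda>t. t \<le> 0"] F_nonpos by simp
  moreover have "AE b in stream_space F'. stream_all (\<lambda>t. 0 \<le> t) b"
    using prob_space.AE_stream_all[OF F', of "\<lambda>t. 0 \<le> t"] F'_nonneg by simp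
  ultimately show ?thesis
    unfolding ret_stack[OF B]
    by (intro nn_integral_mono nn_integral_mono_AE; elim AE_mp; intro AE_I2 impI)
       (auto intro!: f nn_integral_mono_AE elim!: AE_mp simp: stream_all_def)
qed

text \<open>With common stacks, a visit to B' from x' is at the same time a visit from x to the
  translated point, which lies in B. The strict inequalities on y delimit the range in which the
  coupling is exact.\<close>

lemma ret_coupling:
  assumes B: "B \<in> sets borel" and B': "B' \<in> sets borel"
    and "x \<le> x' \<and> (\<forall>y\<in>B'. x' - x < y \<and> y - (x' - x) \<in> B) \<or>
      x' \<le> x \<and> (\<forall>y\<in>B'. y < x' - x \<and> y - (x' - x) \<in> B)"
  shows "ret K B n x \<le> ret K B' n x'"
  unfolding ret_stack[OF B', of n x']
proof (rule ret_stack_mono[OF B])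
  fix a b c assume ab: "\<And>n. a !! n \<le> (0::real)" "\<And>n. 0 \<le> (b !! n :: real)"
  have "spos x (snth a) (snth b) (snth c) k \<in> B" if "spos x' (snth a) (snth b) (snth c) k \<in> B'" for k
    using assms(3) that spos_coupling_above[OF ab, where x=x and x'=x' and c="snth c" and n=k]
      spos_coupling_below[OF ab, where x=x and x'=x' and c="snth c" and n=k]
    by auto
  then show "(\<Prod>k<n. indicator (- B) (spos x (snth a) (snth b) (snth c) (Suc k)))
      \<le> (\<Prod>k<n. indicator (- B') (spos x' (snth a) (snth b) (snth c) (Suc k)) :: ennreal)"
    by (auto simp: prod_indicator_eq)
qed

lemma noret_coupling:
  assumes "B \<in> sets borel" "B' \<in> sets borel"
    and "x \<le> x' \<and> (\<forall>y\<in>B'. x' - x < y \<and> y - (x' - x) \<in> B) \<or>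
      x' \<le> x \<and> (\<forall>y\<in>B'. y < x' - x \<and> y - (x' - x) \<in> B)"
  shows "noret K B x \<le> noret K B' x'" and "avoid K B x \<le> avoid K B' x'"
proof -
  show *: "noret K B x \<le> noret K B' x'"
    unfolding noret_def by (intro INF_mono') (rule ret_coupling[OF assms])
  show "avoid K B x \<le> avoid K B' x'"
    using * assms(3) avoid_le_noret[of B x] by (cases "x' \<in> B'") (force simp: avoid_notin)+
qed

text \<open>By \<open>spos_visit\<close> the order of increments is immaterial as soon as the two
  last jumps d and e straddle z; the other increments may realise any sum t close to z - x - d -
  e.\<close>

lemma noret_ball_less_1:
  assumes d: "d \<in> supp F" "d < z" and e: "e \<in> supp F'" "z < e" and "0 < \<epsilon>"
    and dense: "\<And>\<eta>. 0 < \<eta> \<Longrightarrow> \<exists>t\<in>step_sums F F'. \<bar>t - (z - x - d - e)\<bar> < \<eta>"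
  shows "noret K (ball z \<epsilon>) x < 1"
proof -
  let ?S = "stream_space F" and ?S' = "stream_space F'" and ?C = "stream_space (measure_pmf (bernoulli_pmf \<alpha>))"
  interpret F: prob_space F by (rule F)
  interpret F': prob_space F' by (rule F')
  interpret SF: prob_space ?S by (rule F.prob_space_stream_space)
  interpret SF': prob_space ?S' by (rule F'.prob_space_stream_space)
  interpret C: prob_space ?C by (rule prob_space.prob_space_stream_space) (rule measure_pmf.prob_space_axioms)
  \<comment> \<open>Four errors below \<eta> add up in the end position, those of t, of the sum and
    of the two last jumps; the factor 5 leaves a margin, also in the two sign conditions of
    \<open>spos_visit\<close>.\<close>
  define \<eta> where "\<eta> = Min {\<epsilon>, z - d, e - z} / 5"
  have \<eta>: "0 < \<eta>" "5 * \<eta> \<le> \<epsilon>" "5 * \<eta> \<le> z - d" "5 * \<eta> \<le> e - z"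
    using assms by (auto simp: \<eta>_def)
  obtain t where t: "t \<in> step_sums F F'" "\<bar>t - (z - x - d - e)\<bar> < \<eta>" using dense[OF \<eta>(1)] by auto
  obtain m n where mn: "0 < (\<integral>\<^sup>+a. \<integral>\<^sup>+b. (if near_sum d e \<eta> m n t a b then 1 else 0) \<partial>?S' \<partial>?S)"
    using step_sums_near[OF F F' sets_F sets_F' d(1) e(1) t(1) \<eta>(1)] by auto
  let ?f = "\<lambda>a b. if near_sum d e \<eta> m n t a b then 1 else (0::ennreal)"
  have [measurable]: "(\<lambda>s. s !! n) \<in> borel_measurable ?S" "(\<lambda>s. s !! n) \<in> borel_measurable ?S'" for n
    using measurable_snth[of n F] measurable_snth[of n F'] unfolding measurable_cong_sets[OF refl sets_F] measurable_cong_sets[OF refl sets_F']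
    by auto
  have [measurable]: "(\<lambda>(a, b). ?f a b) \<in> borel_measurable (?S \<Otimes>\<^sub>M ?S')"
    unfolding near_sum_def by measurable
  have m1: "?f a \<in> borel_measurable ?S'" for a
    unfolding near_sum_def by measurable
  have m2: "(\<lambda>a. \<integral>\<^sup>+b. ?f a b \<partial>?S') \<in> borel_measurable ?S"
    by measurable
  have le1: "(\<integral>\<^sup>+b. ?f a b \<partial>?S') \<le> 1" for a
    using nn_integral_mono[of ?S' "?f a" "\<lambda>_. 1"] SF'.emeasure_space_1 by auto
  have le2: "(\<integral>\<^sup>+a. \<integral>\<^sup>+b. ?f a b \<partial>?S' \<partial>?S) \<le> 1"
    using nn_integral_mono[of ?S "\<lambda>a. \<integral>\<^sup>+b. ?f a b \<partial>?S'" "\<lambda>_. 1"] le1 SF.emeasure_space_1 by auto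
  let ?N = "Suc (Suc (m + n))"
  have "noret K (ball z \<epsilon>) x \<le> ret K (ball z \<epsilon>) ?N x" by (rule noret_le_ret)
  also have "\<dots> \<le> (\<integral>\<^sup>+c. \<integral>\<^sup>+a. \<integral>\<^sup>+b. (1 - ?f a b) \<partial>?S' \<partial>?S \<partial>?C)"
  proof (rule ret_stack_mono)
    fix a b c assume ab: "\<And>n. a !! n \<le> (0::real)" "\<And>n. 0 \<le> (b !! n :: real)"
    show "(\<Prod>k<?N. indicator (- ball z \<epsilon>) (spos x (snth a) (snth b) (snth c) (Suc k))) \<le> 1 - ?f a b"
    proof (cases "near_sum d e \<eta> m n t a b")
      case True
      then have "\<bar>sum (snth a) {..<m} + sum (snth b) {..<n} - t\<bar> < \<eta>" "\<bar>a !! m - d\<bar> < \<eta>" "\<bar>b !! n - e\<bar> < \<eta>"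
        by (auto simp: near_sum_def)
      note e = abs_less_iff[THEN iffD1, OF this(1)] abs_less_iff[THEN iffD1, OF this(2)]
         abs_less_iff[THEN iffD1, OF this(3)] abs_less_iff[THEN iffD1, OF t(2)]
      have "spos x (snth a) (snth b) (snth c) ?N = x + sum (snth a) {..<Suc m} + sum (snth b) {..<Suc n}"
        by (rule spos_visit[OF ab]) (use e \<eta> in auto)
      then have "spos x (snth a) (snth b) (snth c) ?N \<in> ball z \<epsilon>"
        using e \<eta> by (auto simp: dist_real_def abs_less_iff)
      then have "\<exists>k<?N. spos x (snth a) (snth b) (snth c) (Suc k) \<in> ball z \<epsilon>" by blast
      then show ?thesis unfolding prod_indicator_eq by auto
    qed (auto simp: prod_indicator_eq)
  qed simp
  also have "\<dots> = 1 - (\<integral>\<^sup>+a. \<integral>\<^sup>+b. ?f a b \<partial>?S' \<partial>?S)"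
  proof -
    have "(\<integral>\<^sup>+b. (1 - ?f a b) \<partial>?S') = 1 - (\<integral>\<^sup>+b. ?f a b \<partial>?S')" for a
      using le1[of a] m1[of a] SF'.emeasure_space_1
      by (subst nn_integral_diff) (auto simp: top_unique)
    moreover have "(\<integral>\<^sup>+a. (1 - (\<integral>\<^sup>+b. ?f a b \<partial>?S')) \<partial>?S) = 1 - (\<integral>\<^sup>+a. \<integral>\<^sup>+b. ?f a b \<partial>?S' \<partial>?S)"
      using le1 le2 m2 SF.emeasure_space_1
      by (subst nn_integral_diff) (auto simp: top_unique)
    ultimately show ?thesis using C.emeasure_space_1 by simp
  qed
  also have "\<dots> < 1" using mn le2 by (metis ennreal_between ennreal_one_less_top zero_less_one)
  finally show ?thesis .
qed

end

subsection \<open>Optional stopping at ladder times\<close>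

text \<open>One step of the walk killed on leaving the half-line \<open>0 < \<sigma> * y\<close>;
  \<open>down\<close> is the step that leaves it. Hence \<open>down\<close> preceded by n steps of
  \<open>up\<close> describes exit at time n + 1, and a start at 0 is allowed because only the
  position after the step is tested.\<close>

definition up :: "real \<Rightarrow> real measure \<Rightarrow> (real \<Rightarrow> ennreal) \<Rightarrow> real \<Rightarrow> ennreal" where
  "up \<sigma> F g z = (\<integral>\<^sup>+t. indicator {0<..} (\<sigma> * (z + t)) * g (z + t) \<partial>F)"

definition down :: "real \<Rightarrow> real measure \<Rightarrow> (real \<Rightarrow> ennreal) \<Rightarrow> real \<Rightarrow> ennreal" where
  "down \<sigma> F g z = (\<integral>\<^sup>+t. indicator {..0} (\<sigma> * (z + t)) * g (z + t) \<partial>F)"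

lemma nn_integral_shift_measurable [measurable]:
  assumes F: "prob_space F" and [measurable_cong]: "sets F = sets borel"
    and [measurable]: "(g :: real \<Rightarrow> ennreal) \<in> borel_measurable borel"
  shows "(\<lambda>z. \<integral>\<^sup>+t. g (z + t) \<partial>F) \<in> borel_measurable borel"
proof -
  interpret prob_space F by fact
  show ?thesis by measurable
qed

lemma up_measurable:
  assumes F: "prob_space F" and [measurable_cong]: "sets F = sets borel"
    and [measurable]: "g \<in> borel_measurable borel"
  shows "up \<sigma> F g \<in> borel_measurable borel"
proof -
  interpret prob_space F by fact
  show ?thesis unfolding up_def[abs_def] by measurable
qed

lemma down_measurable:
  assumes F: "prob_space F" and [measurable_cong]: "sets F = sets borel"
    and [measurable]: "g \<in> borel_measurable borel"
  shows "down \<sigma> F g \<in> borel_measurable borel"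
proof -
  interpret prob_space F by fact
  show ?thesis unfolding down_def[abs_def] by measurable
qed

lemma up_iter_measurable:
  assumes "prob_space F" "sets F = sets borel" "g \<in> borel_measurable borel"
  shows "(up \<sigma> F ^^ n) g \<in> borel_measurable borel"
  by (induction n) (use assms up_measurable in auto)

lemma up_add:
  assumes [measurable_cong]: "sets F = sets borel"
    and [measurable]: "f \<in> borel_measurable borel" "g \<in> borel_measurable borel"
  shows "up \<sigma> F (\<lambda>z. f z + g z) z = up \<sigma> F f z + up \<sigma> F g z"
  unfolding up_def by (subst nn_integral_add[symmetric]) (auto simp: distrib_left)

lemma up_iter_add:
  assumes "prob_space F" "sets F = sets borel" "f \<in> borel_measurable borel" "g \<in> borel_measurable borel"
  shows "(up \<sigma> F ^^ n) (\<lambda>z. f z + g z) z = (up \<sigma> F ^^ n) f z + (up \<sigma> F ^^ n) g z"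
proof (induction n arbitrary: z)
  case (Suc n)
  then have "(up \<sigma> F ^^ n) (\<lambda>z. f z + g z) = (\<lambda>z. (up \<sigma> F ^^ n) f z + (up \<sigma> F ^^ n) g z)" by blast
  then show ?case using assms by (simp add: up_add up_iter_measurable)
qed simp

lemma up_mono:
  assumes "\<And>y. 0 < \<sigma> * y \<Longrightarrow> f y \<le> g y"
  shows "up \<sigma> F f z \<le> up \<sigma> F g z"
  unfolding up_def by (intro nn_integral_mono) (auto intro!: assms split: split_indicator)

text \<open>After at least one step only positions inside the half-line are evaluated, so the
  comparison is required only there.\<close>

lemma up_iter_mono:
  assumes "\<And>y. 0 < \<sigma> * y \<Longrightarrow> f y \<le> g y"
  shows "(up \<sigma> F ^^ Suc n) f z \<le> (up \<sigma> F ^^ Suc n) g z"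
proof (induction n arbitrary: z)
  case 0 then show ?case by (auto intro!: up_mono assms)
next
  case (Suc n) then show ?case
    unfolding funpow.simps(2)[of "Suc n"] o_apply by (intro up_mono)
qed

lemma up_iter_mono':
  assumes "\<And>y. f y \<le> g y"
  shows "(up \<sigma> F ^^ n) f z \<le> (up \<sigma> F ^^ n) g z"
  by (cases n) (auto intro!: up_iter_mono[simplified] assms)

lemma up_add_down:
  assumes [measurable_cong]: "sets F = sets borel" and [measurable]: "f \<in> borel_measurable borel"
  shows "(\<integral>\<^sup>+t. f (z + t) \<partial>F) = up \<sigma> F f z + down \<sigma> F f z"
  unfolding up_def down_def
  by (subst nn_integral_add[symmetric]) (auto intro!: nn_integral_cong split: split_indicator)

text \<open>\<open>G\<close> is the law of the value of the walk with increments \<open>F\<close> when it first leaves the half-line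
  \<open>0 < \<sigma> * y\<close> after time \<open>0\<close>; the sign \<open>\<sigma>\<close> covers both half-lines.\<close>

locale ladder =
  fixes \<sigma> :: real and F G :: "real measure"
  assumes \<sigma>: "\<sigma> = 1 \<or> \<sigma> = -1"
    and F: "prob_space F" and sF [simp, measurable_cong]: "sets F = sets borel"
    and G: "prob_space G" and sG [simp, measurable_cong]: "sets G = sets borel"
    and ladder_eq: "f \<in> borel_measurable borel \<Longrightarrow> (\<integral>\<^sup>+t. f t \<partial>G) = (\<Sum>n. (up \<sigma> F ^^ n) (down \<sigma> F f) 0)"
    and G_nonzero: "emeasure G {0} < 1"
begin

lemma space_F [simp]: "space F = UNIV" and space_G [simp]: "space G = UNIV"
  using sets_eq_imp_space_eq[OF sF] sets_eq_imp_space_eq[OF sG] by auto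

lemma emeasure_F_UNIV [simp]: "emeasure F UNIV = 1" and emeasure_G_UNIV [simp]: "emeasure G UNIV = 1"
  using prob_space.emeasure_space_1[OF F] prob_space.emeasure_space_1[OF G] by auto

lemma F_measurable [measurable]:
  assumes "g \<in> borel_measurable borel" shows "(\<lambda>z. \<integral>\<^sup>+t. g (z + t) \<partial>F) \<in> borel_measurable borel"
  using F sF assms by (rule nn_integral_shift_measurable)

lemma G_measurable [measurable]:
  assumes "g \<in> borel_measurable borel" shows "(\<lambda>z. \<integral>\<^sup>+t. g (z + t) \<partial>G) \<in> borel_measurable borel"
  using G sG assms by (rule nn_integral_shift_measurable)

lemmas up_m [measurable] = up_measurable[OF F sF] and up_iter_m [measurable] = up_iter_measurable[OF F sF]
  and down_m [measurable] = down_measurable[OF F sF]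

lemma G_le: "AE t in G. \<sigma> * t \<le> 0"
proof -
  have "(\<integral>\<^sup>+t. indicator {t. 0 < \<sigma> * t} t \<partial>G) = (\<Sum>n. (up \<sigma> F ^^ n) (down \<sigma> F (indicator {t. 0 < \<sigma> * t})) 0)"
    by (rule ladder_eq) measurable
  also have "down \<sigma> F (indicator {t. 0 < \<sigma> * t}) = (\<lambda>_. 0)"
    unfolding down_def by (intro ext nn_integral_zero') (auto split: split_indicator)
  also have "(\<Sum>n. (up \<sigma> F ^^ n) (\<lambda>_. 0) 0) = 0"
  proof -
    have "(up \<sigma> F ^^ n) (\<lambda>_. 0) = (\<lambda>_. 0)" for n :: nat
      by (induction n) (auto simp: up_def fun_eq_iff)
    then show ?thesis by simp
  qed
  finally have "(\<integral>\<^sup>+t. indicator {t. 0 < \<sigma> * t} t \<partial>G) = 0" by simp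
  then show ?thesis
    by (subst (asm) nn_integral_0_iff_AE) (auto elim!: eventually_mono split: split_indicator_asm)
qed

lemma walk_step:
  assumes [measurable]: "f \<in> borel_measurable borel"
  shows "(up \<sigma> F ^^ n) (\<lambda>z. \<integral>\<^sup>+t. f (z + t) \<partial>F) 0 = (up \<sigma> F ^^ Suc n) f 0 + (up \<sigma> F ^^ n) (down \<sigma> F f) 0"
proof -
  have "(\<lambda>z. \<integral>\<^sup>+t. f (z + t) \<partial>F) = (\<lambda>z. up \<sigma> F f z + down \<sigma> F f z)"
    by (intro ext up_add_down) auto
  then show ?thesis
    by (simp add: up_iter_add[OF F sF] funpow_swap1)
qed

text \<open>Optional stopping at the earlier of the exit and time N + 1. The comparison starts after
  the first step, because the starting point 0 lies outside the region of subharmonicity.\<close>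

lemma walk_sub:
  assumes [measurable]: "f \<in> borel_measurable borel"
    and f: "\<And>s. 0 < \<sigma> * s \<Longrightarrow> f s \<le> (\<integral>\<^sup>+t. f (s + t) \<partial>F)"
  shows "(\<integral>\<^sup>+t. f t \<partial>F) \<le> (up \<sigma> F ^^ Suc N) f 0 + (\<Sum>n<Suc N. (up \<sigma> F ^^ n) (down \<sigma> F f) 0)"
proof (induction N)
  case 0 then show ?case using walk_step[of f 0] by simp
next
  case (Suc N)
  have "(up \<sigma> F ^^ Suc N) f 0 \<le> (up \<sigma> F ^^ Suc N) (\<lambda>z. \<integral>\<^sup>+t. f (z + t) \<partial>F) 0"
    by (rule up_iter_mono) (rule f)
  also have "\<dots> = (up \<sigma> F ^^ Suc (Suc N)) f 0 + (up \<sigma> F ^^ Suc N) (down \<sigma> F f) 0"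
    by (rule walk_step) simp
  finally show ?case using Suc by (auto simp: ac_simps intro: order_trans add_mono)
qed

lemma walk_super:
  assumes [measurable]: "f \<in> borel_measurable borel"
    and f: "\<And>s. 0 < \<sigma> * s \<Longrightarrow> (\<integral>\<^sup>+t. f (s + t) \<partial>F) \<le> f s"
  shows "(up \<sigma> F ^^ Suc N) f 0 + (\<Sum>n<Suc N. (up \<sigma> F ^^ n) (down \<sigma> F f) 0) \<le> (\<integral>\<^sup>+t. f t \<partial>F)"
proof (induction N)
  case 0 then show ?case using walk_step[of f 0] by simp
next
  case (Suc N)
  have "(up \<sigma> F ^^ Suc (Suc N)) f 0 + (up \<sigma> F ^^ Suc N) (down \<sigma> F f) 0 = (up \<sigma> F ^^ Suc N) (\<lambda>z. \<integral>\<^sup>+t. f (z + t) \<partial>F) 0"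
    by (rule walk_step[symmetric]) simp
  also have "\<dots> \<le> (up \<sigma> F ^^ Suc N) f 0"
    by (rule up_iter_mono) (rule f)
  finally have "(up \<sigma> F ^^ Suc (Suc N)) f 0 + (up \<sigma> F ^^ Suc N) (down \<sigma> F f) 0 + (\<Sum>n<Suc N. (up \<sigma> F ^^ n) (down \<sigma> F f) 0)
      \<le> (up \<sigma> F ^^ Suc N) f 0 + (\<Sum>n<Suc N. (up \<sigma> F ^^ n) (down \<sigma> F f) 0)" by (rule add_right_mono)
  also note Suc
  finally show ?case by (simp only: sum.lessThan_Suc ac_simps)
qed

lemma walk_mass: "(up \<sigma> F ^^ Suc N) (\<lambda>_. 1) 0 + (\<Sum>n<Suc N. (up \<sigma> F ^^ n) (down \<sigma> F (\<lambda>_. 1)) 0) = 1"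
  using walk_sub[of "\<lambda>_. 1" N] walk_super[of "\<lambda>_. 1" N] by (intro antisym) auto

text \<open>G has total mass one, so by \<open>ladder_eq\<close> exit is almost sure and the
  surviving mass tends to 0.\<close>

lemma walk_leaves: "(\<lambda>N. (up \<sigma> F ^^ Suc N) (\<lambda>_. 1) 0) \<longlonglongrightarrow> 0"
proof -
  let ?b = "\<lambda>N. \<Sum>n<Suc N. (up \<sigma> F ^^ n) (down \<sigma> F (\<lambda>_. 1)) 0"
  have "(\<Sum>n. (up \<sigma> F ^^ n) (down \<sigma> F (\<lambda>_. 1)) 0) = 1" using ladder_eq[of "\<lambda>_. 1"] by simp
  then have "?b \<longlonglongrightarrow> 1"
    using LIMSEQ_Suc[OF summable_LIMSEQ[OF summableI, of "\<lambda>n. (up \<sigma> F ^^ n) (down \<sigma> F (\<lambda>_. 1)) 0"]] by simp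
  then have "(\<lambda>N. 1 - ?b N) \<longlonglongrightarrow> 1 - 1"
    by (intro tendsto_diff_ennreal_general tendsto_const) auto
  moreover have "1 - ?b N = (up \<sigma> F ^^ Suc N) (\<lambda>_. 1) 0" for N
  proof -
    have "?b N \<le> 1" using walk_mass[of N] by (metis add.commute le_iff_add)
    then have "?b N \<noteq> \<top>" by (metis ennreal_one_neq_top top_unique)
    then show ?thesis using walk_mass[of N] by (metis ennreal_add_diff_cancel_right)
  qed
  ultimately show ?thesis by simp
qed

lemma shift_pos: "0 \<le> \<sigma> * x \<Longrightarrow> 0 < \<sigma> * s \<Longrightarrow> 0 < \<sigma> * (x + s)"
  by (simp add: distrib_left)

text \<open>Before its ladder time the walk from x stays strictly beyond x, hence inside the
  half-line where \<phi> is subharmonic, even when x = 0. Boundedness of \<phi> makes the surviving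
  part negligible in the limit.\<close>

lemma ladder_sub:
  assumes x: "0 \<le> \<sigma> * x" and [measurable]: "\<phi> \<in> borel_measurable borel" and le1: "\<And>y. \<phi> y \<le> 1"
    and \<phi>: "\<And>y. 0 < \<sigma> * y \<Longrightarrow> \<phi> y \<le> (\<integral>\<^sup>+t. \<phi> (y + t) \<partial>F)"
  shows "(\<integral>\<^sup>+t. \<phi> (x + t) \<partial>F) \<le> (\<integral>\<^sup>+t. \<phi> (x + t) \<partial>G)"
proof -
  let ?f = "\<lambda>s. \<phi> (x + s)"
  have "(\<integral>\<^sup>+t. ?f t \<partial>F) \<le> (up \<sigma> F ^^ Suc N) (\<lambda>_. 1) 0 + (\<integral>\<^sup>+t. ?f t \<partial>G)" for N
  proof -
    have "(\<integral>\<^sup>+t. ?f t \<partial>F) \<le> (up \<sigma> F ^^ Suc N) ?f 0 + (\<Sum>n<Suc N. (up \<sigma> F ^^ n) (down \<sigma> F ?f) 0)"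
      by (rule walk_sub) (use \<phi> shift_pos[OF x] in \<open>auto simp: add.assoc[symmetric]\<close>)
    also have "\<dots> \<le> (up \<sigma> F ^^ Suc N) (\<lambda>_. 1) 0 + (\<integral>\<^sup>+t. ?f t \<partial>G)"
      by (subst ladder_eq) (auto intro!: add_mono up_iter_mono[simplified] le1 sum_le_suminf simp del: sum.lessThan_Suc)
    finally show ?thesis .
  qed
  moreover have "(\<lambda>N. (up \<sigma> F ^^ Suc N) (\<lambda>_. 1) 0 + (\<integral>\<^sup>+t. ?f t \<partial>G)) \<longlonglongrightarrow> 0 + (\<integral>\<^sup>+t. ?f t \<partial>G)"
    by (intro tendsto_add walk_leaves tendsto_const)
  ultimately show ?thesis by (intro LIMSEQ_le_const[where a="\<integral>\<^sup>+t. ?f t \<partial>F"]) auto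
qed

lemma ladder_super:
  assumes x: "0 \<le> \<sigma> * x" and [measurable]: "\<phi> \<in> borel_measurable borel"
    and \<phi>: "\<And>y. 0 < \<sigma> * y \<Longrightarrow> (\<integral>\<^sup>+t. \<phi> (y + t) \<partial>F) \<le> \<phi> y"
  shows "(\<integral>\<^sup>+t. \<phi> (x + t) \<partial>G) \<le> (\<integral>\<^sup>+t. \<phi> (x + t) \<partial>F)"
proof -
  let ?f = "\<lambda>s. \<phi> (x + s)"
  have "(\<Sum>n<N. (up \<sigma> F ^^ n) (down \<sigma> F ?f) 0) \<le> (\<integral>\<^sup>+t. ?f t \<partial>F)" for N
  proof -
    have "(\<Sum>n<N. (up \<sigma> F ^^ n) (down \<sigma> F ?f) 0) \<le> (\<Sum>n<Suc N. (up \<sigma> F ^^ n) (down \<sigma> F ?f) 0)" by simp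
    also have "\<dots> \<le> (up \<sigma> F ^^ Suc N) ?f 0 + \<dots>" by simp
    also have "\<dots> \<le> (\<integral>\<^sup>+t. ?f t \<partial>F)"
      by (rule walk_super) (use \<phi> shift_pos[OF x] in \<open>auto simp: add.assoc[symmetric]\<close>)
    finally show ?thesis .
  qed
  then show ?thesis by (subst ladder_eq) (auto intro: suminf_le_const)
qed

text \<open>As \<phi> vanishes on B, adding the indicator of B keeps it bounded by 1; so the mass
  that sits in B at time n + 1 without having left is missing from the expectation of
  \<phi>.\<close>

lemma walk_hits:
  assumes x: "0 \<le> \<sigma> * x" and [measurable]: "\<phi> \<in> borel_measurable borel" "B \<in> sets borel" and le1: "\<And>y. \<phi> y \<le> 1"
    and \<phi>: "\<And>y. 0 < \<sigma> * y \<Longrightarrow> \<phi> y \<le> (\<integral>\<^sup>+t. \<phi> (y + t) \<partial>F)" and B: "\<And>y. y \<in> B \<Longrightarrow> \<phi> y = 0"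
  shows "(\<integral>\<^sup>+t. \<phi> (x + t) \<partial>F) + (up \<sigma> F ^^ Suc n) (\<lambda>s. indicator B (x + s)) 0 \<le> 1"
proof -
  let ?f = "\<lambda>s. \<phi> (x + s)" and ?i = "\<lambda>s. indicator B (x + s) :: ennreal"
  have "(\<integral>\<^sup>+t. ?f t \<partial>F) \<le> (up \<sigma> F ^^ Suc n) ?f 0 + (\<Sum>k<Suc n. (up \<sigma> F ^^ k) (down \<sigma> F ?f) 0)"
    by (rule walk_sub) (use \<phi> shift_pos[OF x] in \<open>auto simp: add.assoc[symmetric]\<close>)
  also have "\<dots> \<le> (up \<sigma> F ^^ Suc n) ?f 0 + (\<Sum>k<Suc n. (up \<sigma> F ^^ k) (down \<sigma> F (\<lambda>_. 1)) 0)"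
    by (intro add_left_mono sum_mono up_iter_mono')
      (auto simp: down_def intro!: nn_integral_mono le1 split: split_indicator)
  finally have "(\<integral>\<^sup>+t. ?f t \<partial>F) + (up \<sigma> F ^^ Suc n) ?i 0
      \<le> ((up \<sigma> F ^^ Suc n) ?f 0 + (up \<sigma> F ^^ Suc n) ?i 0) + (\<Sum>k<Suc n. (up \<sigma> F ^^ k) (down \<sigma> F (\<lambda>_. 1)) 0)"
    by (simp add: ac_simps add_left_mono)
  also have "(up \<sigma> F ^^ Suc n) ?f 0 + (up \<sigma> F ^^ Suc n) ?i 0 = (up \<sigma> F ^^ Suc n) (\<lambda>s. ?f s + ?i s) 0"
    by (rule up_iter_add[symmetric, OF F sF]) auto
  also have "\<dots> \<le> (up \<sigma> F ^^ Suc n) (\<lambda>_. 1) 0"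
    by (rule up_iter_mono) (use le1 B in \<open>auto split: split_indicator\<close>)
  finally show ?thesis using walk_mass[of n] by (simp add: add_right_mono)
qed

text \<open>The reason is that the walk with increments \<open>G\<close> leaves the half-line almost surely.\<close>

lemma crossing_zero:
  assumes [measurable]: "\<theta> \<in> borel_measurable borel" and le1: "\<And>y. \<theta> y \<le> 1"
    and \<theta>: "\<And>z. 0 < \<sigma> * z \<Longrightarrow> \<theta> z \<le> up \<sigma> G \<theta> z" and z: "0 < \<sigma> * z"
  shows "\<theta> z = 0"
proof -
  \<comment> \<open>G is not concentrated at 0, so steps towards 0 of size at least some \<eta> have
    positive probability.\<close>
  obtain \<eta> where \<eta>: "0 < \<eta>" "emeasure G {t. - \<eta> < \<sigma> * t} < 1"
  proof -
    have "(INF n. emeasure G {t. - inverse (Suc n) < \<sigma> * t}) = emeasure G (\<Inter>n. {t. - inverse (Suc n) < \<sigma> * t})"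
    proof (rule INF_emeasure_decseq)
      show "decseq (\<lambda>n. {t. - inverse (real (Suc n)) < \<sigma> * t})"
      proof (intro decseq_SucI subsetI)
        fix n t
        assume "t \<in> {t. - inverse (real (Suc (Suc n))) < \<sigma> * t}"
        moreover have "inverse (real (Suc (Suc n))) \<le> inverse (real (Suc n))" by (simp add: field_simps)
        ultimately show "t \<in> {t. - inverse (real (Suc n)) < \<sigma> * t}" unfolding mem_Collect_eq by linarith
      qed
      show "emeasure G {t. - inverse (Suc n) < \<sigma> * t} \<noteq> \<infinity>" for n
        using prob_space.emeasure_le_1[OF G, of "{t. - inverse (Suc n) < \<sigma> * t}"] by (auto simp: top_unique)
    qed auto
    also have "\<dots> = emeasure G {0}"
    proof (rule emeasure_eq_AE)
      show "AE t in G. (t \<in> (\<Inter>n. {t. - inverse (real (Suc n)) < \<sigma> * t})) = (t \<in> {0})"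
        using G_le
      proof eventually_elim
        case (elim t)
        have "t = 0" if *: "\<And>n. - inverse (real (Suc n)) < \<sigma> * t"
        proof (rule ccontr)
          assume "t \<noteq> 0"
          then have "0 < - (\<sigma> * t)" using elim \<sigma> by (auto simp: less_le)
          then obtain n where "inverse (real (Suc n)) < - (\<sigma> * t)" using reals_Archimedean by blast
          then show False using *[of n] by simp
        qed
        then show ?case by auto
      qed
    qed auto
    also have "\<dots> < 1" by (rule G_nonzero)
    finally obtain n where "emeasure G {t. - inverse (Suc n) < \<sigma> * t} < 1" by (auto simp: INF_less_iff)
    then show thesis by (intro that[of "inverse (Suc n)"]) auto
  qed
  \<comment> \<open>Induction over strips of width \<eta>: a jump of size at least \<eta> leaves the
    strip inwards, where \<theta> is already 0 or the walk has left, so the supremum over the strip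
    is contracted by the mass of the small jumps.\<close>
  have *: "\<theta> z = 0" if "0 < \<sigma> * z" "\<sigma> * z \<le> real k * \<eta>" for k z
    using that
  proof (induction k arbitrary: z)
    case (Suc k)
    let ?E = "{z. real k * \<eta> < \<sigma> * z \<and> \<sigma> * z \<le> real (Suc k) * \<eta>}"
    let ?s = "SUP z\<in>?E. \<theta> z"
    have "?s \<le> emeasure G {t. - \<eta> < \<sigma> * t} * ?s"
    proof (rule SUP_least)
      fix z assume z: "z \<in> ?E"
      have zp: "0 < \<sigma> * z" using z \<eta> by (auto intro: le_less_trans[rotated])
      have "\<theta> z \<le> up \<sigma> G \<theta> z" by (rule \<theta>[OF zp])
      also have "\<dots> \<le> (\<integral>\<^sup>+t. indicator {t. - \<eta> < \<sigma> * t} t * ?s \<partial>G)"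
        unfolding up_def
      proof (rule nn_integral_mono_AE)
        show "AE t in G. indicator {0<..} (\<sigma> * (z + t)) * \<theta> (z + t) \<le> indicator {t. - \<eta> < \<sigma> * t} t * ?s"
          using G_le
        proof eventually_elim
          case (elim t)
          show ?case
          proof (cases "0 < \<sigma> * (z + t)")
            case True
            show ?thesis
            proof (cases "\<sigma> * (z + t) \<le> real k * \<eta>")
              case True
              then show ?thesis using Suc.IH[of "z + t"] \<open>0 < \<sigma> * (z + t)\<close> by simp
            next
              case False
              then have "z + t \<in> ?E" "- \<eta> < \<sigma> * t" using z elim by (auto simp: algebra_simps)
              then show ?thesis using True by (auto intro: SUP_upper)
            qed
          qed auto
        qed
      qed
      also have "\<dots> = emeasure G {t. - \<eta> < \<sigma> * t} * ?s"
        by (subst nn_integral_multc) auto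
      finally show "\<theta> z \<le> \<dots>" .
    qed
    moreover have "?s \<le> 1" by (intro SUP_least le1)
    ultimately have s0: "?s = 0" using \<eta>(2) by (intro ennreal_le_contract[of ?s "emeasure G {t. - \<eta> < \<sigma> * t}"]) (auto simp: le_less_trans)
    show ?case
    proof (cases "\<sigma> * z \<le> real k * \<eta>")
      case False
      then show ?thesis using SUP_upper[of z ?E \<theta>] s0 Suc.prems by auto
    qed (use Suc in auto)
  qed simp
  obtain k :: nat where "\<sigma> * z / \<eta> \<le> real k" using real_arch_simple by blast
  then show ?thesis using *[of z k] z \<eta>(1) by (simp add: field_simps)
qed

text \<open>Paths still inside after n steps contribute 0, which makes the truncations increase.
  Unlike in \<open>up\<close>, a start outside counts as an immediate exit.\<close>

primrec pass :: "(real \<Rightarrow> ennreal) \<Rightarrow> nat \<Rightarrow> real \<Rightarrow> ennreal" where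
  "pass f 0 z = (if 0 < \<sigma> * z then 0 else f z)"
| "pass f (Suc n) z = (if 0 < \<sigma> * z then \<integral>\<^sup>+t. pass f n (z + t) \<partial>F else f z)"

text \<open>The expected value of \<open>f\<close> where the walk with increments \<open>F\<close> first leaves the half-line.\<close>

definition fpass :: "(real \<Rightarrow> ennreal) \<Rightarrow> real \<Rightarrow> ennreal" where
  "fpass f z = (SUP n. pass f n z)"

lemma pass_m [measurable]:
  assumes [measurable]: "f \<in> borel_measurable borel"
  shows "pass f n \<in> borel_measurable borel"
proof (induction n)
  case 0 show ?case unfolding pass.simps(1)[abs_def] by measurable
next
  case (Suc n)
  note [measurable] = Suc
  show ?case unfolding pass.simps(2)[abs_def] by measurable
qed

lemma fpass_m [measurable]:
  assumes [measurable]: "f \<in> borel_measurable borel"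
  shows "fpass f \<in> borel_measurable borel"
  unfolding fpass_def[abs_def] by measurable

lemma pass_mono: "pass f n z \<le> pass f (Suc n) z"
proof (induction n arbitrary: z)
  case (Suc n)
  then show ?case
    by (subst (1 2) pass.simps(2)) (auto intro!: nn_integral_mono simp del: pass.simps)
qed simp

lemma fpass_out: "\<not> 0 < \<sigma> * z \<Longrightarrow> fpass f z = f z"
proof -
  assume *: "\<not> 0 < \<sigma> * z"
  have "pass f n z = f z" for n using * by (cases n) auto
  then show ?thesis by (simp add: fpass_def)
qed

lemma fpass_in:
  assumes z: "0 < \<sigma> * z" and [measurable]: "f \<in> borel_measurable borel"
  shows "fpass f z = (\<integral>\<^sup>+t. fpass f (z + t) \<partial>F)"
proof -
  have "fpass f z = (SUP n. pass f (Suc n) z)"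
    unfolding fpass_def using pass_mono[of f _ z]
    by (intro antisym SUP_least) (auto intro: SUP_upper2 SUP_upper simp del: pass.simps)
  also have "\<dots> = (SUP n. \<integral>\<^sup>+t. pass f n (z + t) \<partial>F)" using z by simp
  also have "\<dots> = (\<integral>\<^sup>+t. (SUP n. pass f n (z + t)) \<partial>F)"
    by (rule nn_integral_monotone_convergence_SUP[symmetric]) (auto intro!: incseq_SucI le_funI pass_mono simp del: pass.simps)
  finally show ?thesis by (simp add: fpass_def)
qed

lemma nn_F_le_1: "(\<And>t. f t \<le> 1) \<Longrightarrow> (\<integral>\<^sup>+t. f t \<partial>F) \<le> 1"
  using nn_integral_mono[of F f "\<lambda>_. 1"] by simp

lemma fpass_le_1:
  assumes "\<And>y. f y \<le> 1" shows "fpass f z \<le> 1"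
proof -
  have "pass f n z \<le> 1" for n
    by (induction n arbitrary: z) (auto intro!: assms nn_F_le_1)
  then show ?thesis by (auto simp: fpass_def intro: SUP_least)
qed

lemma fpass_le_mult:
  assumes "\<And>y. f y \<le> c * f y" and [measurable]: "f \<in> borel_measurable borel"
  shows "fpass f z \<le> c * fpass f z"
proof -
  have "pass f n z \<le> c * pass f n z" for n
  proof (induction n arbitrary: z)
    case (Suc n)
    have "(\<integral>\<^sup>+t. pass f n (z + t) \<partial>F) \<le> (\<integral>\<^sup>+t. c * pass f n (z + t) \<partial>F)"
      by (intro nn_integral_mono Suc)
    then show ?case using assms by (auto simp: nn_integral_cmult)
  qed (use assms in auto)
  then have "fpass f z \<le> (SUP n. c * pass f n z)" unfolding fpass_def by (intro SUP_mono) auto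
  then show ?thesis by (simp add: fpass_def SUP_mult_left_ennreal)
qed

text \<open>\<open>fpass f\<close> is harmonic for F inside the half-line, so both optional stopping
  inequalities apply to it.\<close>

lemma fpass_ladder:
  assumes [measurable]: "f \<in> borel_measurable borel" and "\<And>y. f y \<le> 1" and "0 \<le> \<sigma> * x"
  shows "(\<integral>\<^sup>+t. fpass f (x + t) \<partial>F) = (\<integral>\<^sup>+t. fpass f (x + t) \<partial>G)"
  by (intro antisym ladder_sub ladder_super assms fpass_le_1)
    (simp_all add: fpass_in[of _ f, symmetric] fpass_le_1[OF assms(2)] assms)

text \<open>The truncated difference vanishes outside the half-line. Inside it is subharmonic for
  the killed ladder walk, because \<open>fpass\<close> is harmonic for G as well by
  \<open>fpass_ladder\<close>; so \<open>crossing_zero\<close> makes it vanish.\<close>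

lemma le_fpass:
  assumes [measurable]: "\<theta> \<in> borel_measurable borel" and le1: "\<And>y. \<theta> y \<le> 1"
    and \<theta>: "\<And>z. 0 < \<sigma> * z \<Longrightarrow> \<theta> z \<le> (\<integral>\<^sup>+t. \<theta> (z + t) \<partial>G)"
  shows "\<theta> z \<le> fpass \<theta> z"
proof (cases "0 < \<sigma> * z")
  case True
  have "\<theta> z - fpass \<theta> z = 0"
  proof (rule crossing_zero[where \<theta>="\<lambda>z. \<theta> z - fpass \<theta> z", OF _ _ _ True])
    show "\<theta> y - fpass \<theta> y \<le> 1" for y using le1[of y] by (meson diff_le_self_ennreal order_trans)
    fix z assume z: "0 < \<sigma> * z"
    have "\<theta> z \<le> (\<integral>\<^sup>+t. \<theta> (z + t) \<partial>G)" by (rule \<theta>[OF z])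
    also have "\<dots> \<le> (\<integral>\<^sup>+t. fpass \<theta> (z + t) + indicator {0<..} (\<sigma> * (z + t)) * (\<theta> (z + t) - fpass \<theta> (z + t)) \<partial>G)"
    proof (rule nn_integral_mono)
      fix t
      have "\<theta> (z + t) \<le> fpass \<theta> (z + t) + (\<theta> (z + t) - fpass \<theta> (z + t))"
        by (cases "fpass \<theta> (z + t) \<le> \<theta> (z + t)") (auto simp: add_diff_inverse_ennreal intro: order_trans[of _ "fpass \<theta> (z + t)"])
      then show "\<theta> (z + t) \<le> fpass \<theta> (z + t) + indicator {0<..} (\<sigma> * (z + t)) * (\<theta> (z + t) - fpass \<theta> (z + t))"
        by (cases "0 < \<sigma> * (z + t)") (auto simp: fpass_out)
    qed
    also have "\<dots> = fpass \<theta> z + up \<sigma> G (\<lambda>z. \<theta> z - fpass \<theta> z) z"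
      unfolding up_def using fpass_ladder[of \<theta> z] fpass_in[OF z, of \<theta>] z le1
      by (subst nn_integral_add) (auto simp: less_imp_le)
    finally show "\<theta> z - fpass \<theta> z \<le> up \<sigma> G (\<lambda>z. \<theta> z - fpass \<theta> z) z"
      using fpass_le_1[of \<theta> z, OF le1] by (auto simp: ennreal_minus_le_iff top_unique)
  qed measurable
  then show ?thesis using diff_eq_0_iff_ennreal by (metis diff_gt_0_iff_gt_ennreal less_irrefl not_le)
qed (simp add: fpass_out)

text \<open>The indicator of the complement of the lattice is subharmonic for increments in the
  lattice, hence lies below its own exit expectation; but exit takes place on the lattice, so
  already the first increment lies on it. This makes the maximality of the span of F and F' usable
  for G and G'.\<close>

lemma lattice_from_ladder:
  assumes "AE t in G. t \<in> lattice_set u"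
  shows "AE t in F. t \<in> lattice_set u"
proof -
  let ?\<theta> = "indicator (- lattice_set u) :: real \<Rightarrow> ennreal"
  have sub: "z + t \<in> lattice_set u \<Longrightarrow> t \<in> lattice_set u \<Longrightarrow> z \<in> lattice_set u" for z t
  proof (cases "u = 0")
    case False
    assume "z + t \<in> lattice_set u" "t \<in> lattice_set u"
    then obtain i j :: int where "z + t = u * of_int i" "t = u * of_int j" using False by (auto simp: lattice_set_def)
    then have "z = u * of_int (i - j)" by (simp add: algebra_simps)
    then show ?thesis using False unfolding lattice_set_def by (metis rangeI)
  qed (simp add: lattice_set_def)
  have "?\<theta> z \<le> fpass ?\<theta> z" for z
  proof (rule le_fpass)
    fix z
    have "?\<theta> z = (\<integral>\<^sup>+t. ?\<theta> z \<partial>G)" by simp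
    also have "\<dots> \<le> (\<integral>\<^sup>+t. ?\<theta> (z + t) \<partial>G)"
    proof (rule nn_integral_mono_AE)
      show "AE t in G. ?\<theta> z \<le> ?\<theta> (z + t)" using assms by eventually_elim (auto split: split_indicator dest: sub)
    qed
    finally show "?\<theta> z \<le> (\<integral>\<^sup>+t. ?\<theta> (z + t) \<partial>G)" .
  qed (auto split: split_indicator)
  then have "(\<integral>\<^sup>+t. ?\<theta> t \<partial>F) \<le> (\<integral>\<^sup>+t. fpass ?\<theta> (0 + t) \<partial>F)" unfolding add_0 by (intro nn_integral_mono)
  also have "\<dots> = (\<integral>\<^sup>+t. fpass ?\<theta> (0 + t) \<partial>G)" by (rule fpass_ladder) (auto split: split_indicator)
  also have "\<dots> = (\<integral>\<^sup>+t. 0 \<partial>G)"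
  proof (rule nn_integral_cong_AE)
    show "AE t in G. fpass ?\<theta> (0 + t) = 0" using assms G_le by eventually_elim (auto simp: fpass_out not_less)
  qed
  finally have "(\<integral>\<^sup>+t. ?\<theta> t \<partial>F) = 0" by simp
  then show ?thesis by (subst (asm) nn_integral_0_iff_AE) (auto elim!: eventually_mono split: split_indicator_asm)
qed

end

subsection \<open>Ladder heights of a random walk\<close>

definition psum :: "(nat \<Rightarrow> real) \<Rightarrow> nat \<Rightarrow> real" where
  "psum p k = (\<Sum>i=1..k. p i)"

text \<open>Common form of \<open>up\<close> and \<open>down\<close> for an arbitrary set C, so that
  weak and strict ladder variables share the same path computations.\<close>

definition wk :: "real set \<Rightarrow> real measure \<Rightarrow> (real \<Rightarrow> ennreal) \<Rightarrow> real \<Rightarrow> ennreal" where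
  "wk C F g z = (\<integral>\<^sup>+t. indicator C (z + t) * g (z + t) \<partial>F)"

lemma up_eq_wk: "up \<sigma> F = wk {y. 0 < \<sigma> * y} F" and down_eq_wk: "down \<sigma> F = wk {y. \<sigma> * y \<le> 0} F"
  by (auto simp: fun_eq_iff up_def down_def wk_def indicator_def)

lemma psum_0 [simp]: "psum p 0 = 0" by (simp add: psum_def)

lemma psum_Suc: "psum p (Suc n) = psum p n + p (Suc n)" by (simp add: psum_def)

lemma psum_upd [simp]: "k \<le> n \<Longrightarrow> psum (p(Suc n := t)) k = psum p k"
  by (auto simp: psum_def intro!: sum.cong)

lemma psum_upd_Suc [simp]: "psum (p(Suc n := t)) (Suc n) = psum p n + t"
  by (simp add: psum_Suc)

lemma indicator_pred_m: "Measurable.pred M P \<Longrightarrow> (indicator {x. P x} :: _ \<Rightarrow> ennreal) \<in> borel_measurable M"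
  by (simp add: indicator_def[abs_def] pred_def measurable_If)

locale step_law =
  fixes F :: "real measure"
  assumes F: "prob_space F" and sF [simp, measurable_cong]: "sets F = sets borel"
begin

sublocale F: prob_space F by (rule F)

abbreviation "Pn n \<equiv> Pi\<^sub>M {1..n::nat} (\<lambda>_. F)"

lemma psum_m [measurable]: "k \<le> n \<Longrightarrow> (\<lambda>p. psum p k) \<in> borel_measurable (Pn n)"
proof -
  assume "k \<le> n"
  then have "(\<lambda>p. p i) \<in> borel_measurable (Pn n)" if "i \<in> {1..k}" for i
    using that measurable_component_singleton[of i "{1..n}" "\<lambda>_. F"] by (simp add: measurable_cong_sets[OF refl sF])
  then show ?thesis unfolding psum_def by (intro borel_measurable_sum)
qed

lemma wk_m [measurable]:
  assumes [measurable]: "C \<in> sets borel" "(\<lambda>(x, z). g x z) \<in> borel_measurable (borel \<Otimes>\<^sub>M borel)"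
  shows "(\<lambda>(x, z). wk C F (g x) z) \<in> borel_measurable (borel \<Otimes>\<^sub>M (borel :: real measure))"
  unfolding wk_def by measurable

lemma wk_iter_m:
  assumes [measurable]: "C \<in> sets borel" "(\<lambda>(x, z). g x z) \<in> borel_measurable (borel \<Otimes>\<^sub>M borel)"
  shows "(\<lambda>(x, z). (wk C F ^^ n) (g x) z) \<in> borel_measurable (borel \<Otimes>\<^sub>M (borel :: real measure))"
proof (induction n)
  case (Suc n)
  from wk_m[OF assms(1) Suc] show ?case by simp
qed simp

lemma Pn_Suc:
  assumes "h \<in> borel_measurable (Pn (Suc n))"
  shows "(\<integral>\<^sup>+p. h p \<partial>Pn (Suc n)) = (\<integral>\<^sup>+p. \<integral>\<^sup>+t. h (p(Suc n := t)) \<partial>F \<partial>Pn n)"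
proof -
  interpret product_sigma_finite "\<lambda>_. F" by standard
  have "{1..Suc n} = insert (Suc n) {1..n}" by auto
  then show ?thesis using assms product_nn_integral_insert[of "{1..n}" "Suc n" h] by simp
qed

text \<open>The Markov property at time m: w depends on the first m increments only, and the j
  increments after them form a fresh walk that is tested against C.\<close>

lemma Pn_block:
  assumes w: "\<And>n. m \<le> n \<Longrightarrow> w \<in> borel_measurable (Pn n)" "\<And>p n t. m \<le> n \<Longrightarrow> w (p(Suc n := t)) = w p"
    and [measurable]: "C \<in> sets borel" and g: "(\<lambda>(x, z). g x z) \<in> borel_measurable (borel \<Otimes>\<^sub>M borel)"
  shows "(\<integral>\<^sup>+p. w p * indicator {p. \<forall>k\<in>{1..j}. psum p (m + k) - psum p m \<in> C} p * g (psum p m) (psum p (m + j) - psum p m) \<partial>Pn (m + j))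
    = (\<integral>\<^sup>+p. w p * (wk C F ^^ j) (g (psum p m)) 0 \<partial>Pn m)"
  using g
proof (induction j arbitrary: g)
  case 0 then show ?case by simp
next
  case (Suc j)
  note [measurable] = Suc.prems
  let ?I = "\<lambda>j p. indicator {p. \<forall>k\<in>{1..j}. psum p (m + k) - psum p m \<in> C} p :: ennreal"
  have I: "?I j \<in> borel_measurable (Pn (m + j))" for j
  proof -
    have "Measurable.pred (Pn (m + j)) (\<lambda>p. \<forall>k\<in>{1..j}. psum p (m + k) - psum p m \<in> C)"
    proof (intro pred_intros_finite)
      fix k assume "k \<in> {1..j}"
      then have [measurable]: "(\<lambda>p. psum p (m + k)) \<in> borel_measurable (Pn (m + j))" "(\<lambda>p. psum p m) \<in> borel_measurable (Pn (m + j))"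
        by - (rule psum_m; simp)+
      show "Measurable.pred (Pn (m + j)) (\<lambda>p. psum p (m + k) - psum p m \<in> C)" by measurable
    qed simp
    then show ?thesis by (simp add: indicator_def pred_def measurable_If)
  qed
  have gm: "(\<lambda>p. g (psum p m) (psum p (m + j) - psum p m)) \<in> borel_measurable (Pn (m + j))" for j
  proof -
    have [measurable]: "(\<lambda>p. psum p (m + j)) \<in> borel_measurable (Pn (m + j))" "(\<lambda>p. psum p m) \<in> borel_measurable (Pn (m + j))"
      by - (rule psum_m; simp)+
    show ?thesis by measurable
  qed
  let ?h = "\<lambda>p. w p * ?I (Suc j) p * g (psum p m) (psum p (m + Suc j) - psum p m)"
  have hm: "?h \<in> borel_measurable (Pn (m + Suc j))"
    by (intro borel_measurable_times_ennreal I gm w) simp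
  have "(\<integral>\<^sup>+p. ?h p \<partial>Pn (m + Suc j)) = (\<integral>\<^sup>+p. \<integral>\<^sup>+t. ?h (p(Suc (m + j) := t)) \<partial>F \<partial>Pn (m + j))"
    using Pn_Suc[OF hm[unfolded add_Suc_right]] unfolding add_Suc_right .
  also have "\<dots> = (\<integral>\<^sup>+p. w p * ?I j p * wk C F (g (psum p m)) (psum p (m + j) - psum p m) \<partial>Pn (m + j))"
  proof (intro nn_integral_cong)
    fix p
    have "?h (p(Suc (m + j) := t)) = w p * ?I j p * (indicator C (psum p (m + j) - psum p m + t) * g (psum p m) (psum p (m + j) - psum p m + t))" for t
    proof -
      have "(\<forall>k\<in>{1..Suc j}. psum (p(Suc (m + j) := t)) (m + k) - psum p m \<in> C) \<longleftrightarrow>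
        (\<forall>k\<in>{1..j}. psum p (m + k) - psum p m \<in> C) \<and> psum p (m + j) + t - psum p m \<in> C"
        by (auto simp: atLeastAtMostSuc_conv)
      moreover have "psum (p(Suc (m + j) := t)) (m + Suc j) = psum p (m + j) + t" "psum (p(Suc (m + j) := t)) m = psum p m"
        by simp_all
      moreover have "w (p(Suc (m + j) := t)) = w p" by (rule w(2)) simp
      moreover have "psum p (m + j) + t - psum p m = psum p (m + j) - psum p m + t" by simp
      ultimately show ?thesis
        by (simp only: indicator_def mem_Collect_eq mult.assoc) (simp only: mult_1_left mult_1_right mult_zero_left mult_zero_right of_bool_conj of_bool_eq mult.assoc)
    qed
    moreover have "(\<lambda>t. indicator C (psum p (m + j) - psum p m + t) * g (psum p m) (psum p (m + j) - psum p m + t)) \<in> borel_measurable F"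
      unfolding measurable_cong_sets[OF sF refl] by measurable
    ultimately show "(\<integral>\<^sup>+t. ?h (p(Suc (m + j) := t)) \<partial>F) = w p * ?I j p * wk C F (g (psum p m)) (psum p (m + j) - psum p m)"
      unfolding wk_def by (simp only: nn_integral_cmult)
  qed
  also have "\<dots> = (\<integral>\<^sup>+p. w p * (wk C F ^^ j) (wk C F (g (psum p m))) 0 \<partial>Pn m)"
    by (rule Suc.IH[of "\<lambda>x. wk C F (g x)"]) measurable
  finally show ?case by (simp add: funpow_swap1)
qed

lemma Pn_walk:
  assumes [measurable]: "C \<in> sets borel" "f \<in> borel_measurable borel"
  shows "(\<integral>\<^sup>+p. indicator {p. \<forall>k\<in>{1..j}. psum p k \<in> C} p * f (psum p j) \<partial>Pn j) = (wk C F ^^ j) f 0"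
proof -
  interpret P0: prob_space "Pn 0" by (rule prob_space_PiM) (rule F)
  have "(\<integral>\<^sup>+p. 1 * indicator {p. \<forall>k\<in>{1..j}. psum p (0 + k) - psum p 0 \<in> C} p * f (psum p (0 + j) - psum p 0) \<partial>Pn (0 + j))
    = (\<integral>\<^sup>+p. 1 * (wk C F ^^ j) f 0 \<partial>Pn 0)"
    by (rule Pn_block[where g="\<lambda>_. f"]) auto
  also have "\<dots> = (wk C F ^^ j) f 0" using P0.emeasure_space_1 by simp
  finally show ?thesis by simp
qed

lemma Pn_exit:
  assumes [measurable]: "C \<in> sets borel" "B \<in> sets borel" "f \<in> borel_measurable borel"
  shows "(\<integral>\<^sup>+p. indicator {p. (\<forall>k\<in>{1..j}. psum p k \<in> C) \<and> psum p (Suc j) \<in> B} p * f (psum p (Suc j)) \<partial>Pn (Suc j))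
    = (wk C F ^^ j) (wk B F f) 0"
proof -
  have [measurable]: "wk B F f \<in> borel_measurable borel" 
    unfolding wk_def[abs_def] by measurable
  let ?h = "\<lambda>p. indicator {p. (\<forall>k\<in>{1..j}. psum p k \<in> C) \<and> psum p (Suc j) \<in> B} p * f (psum p (Suc j)) :: ennreal"
  have hm: "?h \<in> borel_measurable (Pn (Suc j))"
  proof -
    have "Measurable.pred (Pn (Suc j)) (\<lambda>p. \<forall>k\<in>{1..j}. psum p k \<in> C)"
    proof (intro pred_intros_finite)
      fix k assume "k \<in> {1..j}"
      then have [measurable]: "(\<lambda>p. psum p k) \<in> borel_measurable (Pn (Suc j))"
        by - (rule psum_m; simp)+
      show "Measurable.pred (Pn (Suc j)) (\<lambda>p. psum p k \<in> C)" by measurable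
    qed simp
    moreover have [measurable]: "(\<lambda>p. psum p (Suc j)) \<in> borel_measurable (Pn (Suc j))" by (rule psum_m) simp
    ultimately show ?thesis by (simp add: indicator_def pred_def measurable_If)
  qed
  have "(\<integral>\<^sup>+p. ?h p \<partial>Pn (Suc j)) = (\<integral>\<^sup>+p. \<integral>\<^sup>+t. ?h (p(Suc j := t)) \<partial>F \<partial>Pn j)"
    by (rule Pn_Suc[OF hm])
  also have "\<dots> = (\<integral>\<^sup>+p. indicator {p. \<forall>k\<in>{1..j}. psum p k \<in> C} p * wk B F f (psum p j) \<partial>Pn j)"
  proof (intro nn_integral_cong)
    fix p
    have "?h (p(Suc j := t)) = indicator {p. \<forall>k\<in>{1..j}. psum p k \<in> C} p * (indicator B (psum p j + t) * f (psum p j + t))" for t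
      by (auto simp: indicator_def)
    moreover have "(\<lambda>t. indicator B (psum p j + t) * f (psum p j + t)) \<in> borel_measurable F"
      unfolding measurable_cong_sets[OF sF refl] by measurable
    ultimately show "(\<integral>\<^sup>+t. ?h (p(Suc j := t)) \<partial>F) = indicator {p. \<forall>k\<in>{1..j}. psum p k \<in> C} p * wk B F f (psum p j)"
      unfolding wk_def by (simp only: nn_integral_cmult)
  qed
  also have "\<dots> = (wk C F ^^ j) (wk B F f) 0" by (rule Pn_walk) measurable
  finally show ?thesis .
qed

text \<open>The event says that n is a strict record time in the direction \<sigma>; time 0 is a
  record.\<close>

definition rec_int :: "real \<Rightarrow> nat \<Rightarrow> (real \<Rightarrow> ennreal) \<Rightarrow> ennreal" where
  "rec_int \<sigma> n f = (\<integral>\<^sup>+p. indicator {p. \<forall>k<n. \<sigma> * psum p k < \<sigma> * psum p n} p * f (psum p n) \<partial>Pn n)"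

lemma record_m: "m \<le> n \<Longrightarrow> (indicator {p. \<forall>k<m. \<sigma> * psum p k < \<sigma> * psum p m} :: _ \<Rightarrow> ennreal) \<in> borel_measurable (Pn n)"
proof -
  assume mn: "m \<le> n"
  have "Measurable.pred (Pn n) (\<lambda>p. \<forall>k\<in>{..<m}. \<sigma> * psum p k < \<sigma> * psum p m)"
  proof (intro pred_intros_finite)
    fix k assume "k \<in> {..<m}"
    then have [measurable]: "(\<lambda>p. psum p k) \<in> borel_measurable (Pn n)" "(\<lambda>p. psum p m) \<in> borel_measurable (Pn n)"
      using mn by - (rule psum_m; simp)+
    show "Measurable.pred (Pn n) (\<lambda>p. \<sigma> * psum p k < \<sigma> * psum p m)" by measurable
  qed simp
  from indicator_pred_m[OF this] show ?thesis by (simp only: Ball_def lessThan_iff)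
qed

text \<open>Reversing the order of the increments turns records into walks that stay positive.\<close>

lemma rec_int_eq:
  assumes [measurable]: "f \<in> borel_measurable borel"
  shows "rec_int \<sigma> n f = (up \<sigma> F ^^ n) f 0"
proof -
  let ?r = "\<lambda>p. \<lambda>i\<in>{1..n}. p (Suc n - i)"
  let ?h = "\<lambda>p. indicator {p. \<forall>k<n. \<sigma> * psum p k < \<sigma> * psum p n} p * f (psum p n) :: ennreal"
  have [measurable]: "(\<lambda>p. psum p n) \<in> borel_measurable (Pn n)" by (rule psum_m) simp
  have hm: "?h \<in> borel_measurable (Pn n)"
    by (rule borel_measurable_times_ennreal, rule record_m, simp, measurable)
  have rm: "?r \<in> Pn n \<rightarrow>\<^sub>M Pn n"
    by (intro measurable_restrict measurable_component_singleton) auto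
  have "distr (Pn n) (Pn n) ?r = Pn n"
  proof (rule distr_PiM_reindex)
    show "prob_space F" by (rule F)
    show "inj_on (\<lambda>i. Suc n - i) {1..n}" by (auto simp: inj_on_def)
    show "(\<lambda>i. Suc n - i) \<in> {1..n} \<rightarrow> {1..n}" by auto
  qed
  then have "rec_int \<sigma> n f = (\<integral>\<^sup>+p. ?h p \<partial>distr (Pn n) (Pn n) ?r)" by (simp add: rec_int_def)
  also have "\<dots> = (\<integral>\<^sup>+p. ?h (?r p) \<partial>Pn n)" by (subst nn_integral_distr[OF rm]) (simp_all only: measurable_distr_eq1 hm)
  also have "\<dots> = (\<integral>\<^sup>+p. indicator {p. \<forall>k\<in>{1..n}. psum p k \<in> {y. 0 < \<sigma> * y}} p * f (psum p n) \<partial>Pn n)"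
  proof (intro nn_integral_cong)
    fix p :: "nat \<Rightarrow> real"
    define q where "q = ?r p"
    have *: "psum q k = psum p n - psum p (n - k)" if "k \<le> n" for k
      using that
    proof (induction k)
      case (Suc k)
      have "psum p (n - k) = psum p (n - Suc k) + p (n - k)"
        using psum_Suc[of p "n - Suc k"] Suc.prems by (simp add: Suc_diff_Suc)
      moreover have "q (Suc k) = p (n - k)" using Suc.prems by (simp add: q_def)
      ultimately show ?case using Suc by (simp add: psum_Suc)
    qed simp
    have qn: "psum q n = psum p n" using *[of n] by simp
    have "(\<forall>k<n. \<sigma> * psum q k < \<sigma> * psum q n) \<longleftrightarrow> (\<forall>k<n. 0 < \<sigma> * psum p (n - k))"
      unfolding qn by (intro all_cong) (simp add: * right_diff_distrib)
    also have "\<dots> \<longleftrightarrow> (\<forall>k\<in>{1..n}. 0 < \<sigma> * psum p k)"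
    proof safe
      fix k assume *: "\<forall>k<n. 0 < \<sigma> * psum p (n - k)" and k: "k \<in> {1..n}"
      then show "0 < \<sigma> * psum p k" using *[rule_format, of "n - k"] by simp
    qed auto
    finally have eq: "(\<forall>k<n. \<sigma> * psum q k < \<sigma> * psum q n) \<longleftrightarrow> (\<forall>k\<in>{1..n}. 0 < \<sigma> * psum p k)" .
    show "?h (?r p) = indicator {p. \<forall>k\<in>{1..n}. psum p k \<in> {y. 0 < \<sigma> * y}} p * f (psum p n)"
      unfolding q_def[symmetric] indicator_def mem_Collect_eq eq unfolding qn ..
  qed
  also have "\<dots> = (up \<sigma> F ^^ n) f 0"
    unfolding up_eq_wk by (rule Pn_walk) auto
  finally show ?thesis .
qed

text \<open>The part of the law of the first strict ladder height that is attained at time j +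
  1.\<close>

definition height_int :: "real \<Rightarrow> nat \<Rightarrow> (real \<Rightarrow> ennreal) \<Rightarrow> ennreal" where
  "height_int \<sigma> j f = (down \<sigma> F ^^ j) (up \<sigma> F f) 0"

lemma height_int_m:
  assumes [measurable]: "(\<lambda>(x, z). g x z) \<in> borel_measurable (borel \<Otimes>\<^sub>M borel)"
  shows "(\<lambda>x. height_int \<sigma> j (g x)) \<in> borel_measurable (borel :: real measure)"
proof -
  have 1: "(\<lambda>(x, z). up \<sigma> F (g x) z) \<in> borel_measurable (borel \<Otimes>\<^sub>M (borel :: real measure))"
    unfolding up_eq_wk by (rule wk_m) auto
  have [measurable]: "(\<lambda>(x, z). (down \<sigma> F ^^ j) (up \<sigma> F (g x)) z) \<in> borel_measurable (borel \<Otimes>\<^sub>M (borel :: real measure))"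
    unfolding down_eq_wk by (rule wk_iter_m[OF _ 1]) auto
  show ?thesis unfolding height_int_def by measurable
qed

text \<open>Decomposition of a record at the last record before it.\<close>

lemma rec_int_decomp:
  assumes [measurable]: "f \<in> borel_measurable borel" and n: "0 < n"
  shows "rec_int \<sigma> n f = (\<Sum>m<n. rec_int \<sigma> m (\<lambda>x. height_int \<sigma> (n - Suc m) (\<lambda>y. f (x + y))))"
proof -
  let ?E = "\<lambda>m. {p. (\<forall>k<m. \<sigma> * psum p k < \<sigma> * psum p m) \<and> (\<forall>k\<in>{1..n - Suc m}. \<sigma> * (psum p (m + k) - psum p m) \<le> 0)
     \<and> 0 < \<sigma> * (psum p n - psum p m)}"
  have dis: "disjoint_family_on ?E {..<n}"
  proof -
    have False if "p \<in> ?E m" "p \<in> ?E m'" "m < m'" "m' < n" for p m m'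
    proof -
      have "\<sigma> * psum p m < \<sigma> * psum p m'" using that by auto
      moreover have "m' - m \<in> {1..n - Suc m}" using that by auto
      then have "\<sigma> * (psum p (m + (m' - m)) - psum p m) \<le> 0" using that by blast
      ultimately show False using that by (simp add: right_diff_distrib)
    qed
    then have F: "\<not> (p \<in> ?E m \<and> p \<in> ?E m' \<and> m < m' \<and> m' < n)" for p m m' by blast
    show ?thesis unfolding disjoint_family_on_def
    proof (intro ballI impI)
      fix m m' assume m: "m \<in> {..<n}" "m' \<in> {..<n}" "m \<noteq> m'"
      then consider "m < m'" "m' < n" | "m' < m" "m < n" by fastforce
      then show "?E m \<inter> ?E m' = {}"
      proof cases
        case 1 then show ?thesis using F[of _ m m'] by blast
      next
        case 2 then show ?thesis using F[of _ m' m] by blast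
      qed
    qed
  qed
  have un: "(\<Union>m\<in>{..<n}. ?E m) = {p. \<forall>k<n. \<sigma> * psum p k < \<sigma> * psum p n}"
  proof (intro equalityI subsetI)
    fix p assume "p \<in> (\<Union>m\<in>{..<n}. ?E m)"
    then obtain m where m: "m < n" "p \<in> ?E m" by auto
    have "\<sigma> * psum p k < \<sigma> * psum p n" if "k < n" for k
    proof -
      consider "k < m" | "k = m" | "m < k" by linarith
      then have "\<sigma> * psum p k \<le> \<sigma> * psum p m"
      proof cases
        case 3
        then have "k - m \<in> {1..n - Suc m}" using that by auto
        then have "\<sigma> * (psum p (m + (k - m)) - psum p m) \<le> 0" using m by blast
        then show ?thesis using 3 by (simp add: right_diff_distrib)
      qed (use m in \<open>auto intro: less_imp_le\<close>)
      moreover have "\<sigma> * psum p m < \<sigma> * psum p n" using m by (simp add: right_diff_distrib)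
      ultimately show ?thesis by simp
    qed
    then show "p \<in> {p. \<forall>k<n. \<sigma> * psum p k < \<sigma> * psum p n}" by simp
  next
    fix p assume p: "p \<in> {p. \<forall>k<n. \<sigma> * psum p k < \<sigma> * psum p n}"
    let ?M = "Max ((\<lambda>k. \<sigma> * psum p k) ` {..<n})"
    have ne: "(\<lambda>k. \<sigma> * psum p k) ` {..<n} \<noteq> {}" using n by auto
    \<comment> \<open>The first time at which the maximum over all times below n is attained is the
      last record time before n.\<close>
    define m where "m = (LEAST m. m < n \<and> \<sigma> * psum p m = ?M)"
    have "\<exists>m. m < n \<and> \<sigma> * psum p m = ?M" using Max_in[OF _ ne] by auto
    then have "m < n \<and> \<sigma> * psum p m = ?M" unfolding m_def by (rule LeastI_ex)
    then have m: "m < n" "\<sigma> * psum p m = ?M" by auto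
    have max: "\<sigma> * psum p k \<le> \<sigma> * psum p m" if "k < n" for k unfolding m(2) using that by (intro Max_ge) auto
    have "\<sigma> * psum p k < \<sigma> * psum p m" if "k < m" for k
      using not_less_Least[OF that[unfolded m_def]] max[of k] that m by (auto simp: less_le)
    moreover have "\<sigma> * (psum p (m + k) - psum p m) \<le> 0" if "k \<in> {1..n - Suc m}" for k
    proof -
      have "m + k < n" using that m(1) by auto
      then show ?thesis using max[of "m + k"] by (simp add: right_diff_distrib)
    qed
    moreover have "0 < \<sigma> * (psum p n - psum p m)" using p m(1) by (simp add: right_diff_distrib)
    ultimately have "p \<in> ?E m" by blast
    then show "p \<in> (\<Union>m\<in>{..<n}. ?E m)" using m(1) by blast
  qed
  have mn [measurable]: "(\<lambda>p. psum p n) \<in> borel_measurable (Pn n)" by (rule psum_m) simp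
  have Em: "(indicator (?E m) :: _ \<Rightarrow> ennreal) \<in> borel_measurable (Pn n)" if "m < n" for m
  proof -
    have [measurable]: "(\<lambda>p. psum p m) \<in> borel_measurable (Pn n)" using that by (intro psum_m) simp
    have "Measurable.pred (Pn n) (\<lambda>p. \<forall>k\<in>{1..n - Suc m}. \<sigma> * (psum p (m + k) - psum p m) \<le> 0)"
    proof (intro pred_intros_finite)
      fix k assume "k \<in> {1..n - Suc m}"
      then have [measurable]: "(\<lambda>p. psum p (m + k)) \<in> borel_measurable (Pn n)" using that by (intro psum_m) auto
      show "Measurable.pred (Pn n) (\<lambda>p. \<sigma> * (psum p (m + k) - psum p m) \<le> 0)" by measurable
    qed simp
    moreover have "Measurable.pred (Pn n) (\<lambda>p. \<forall>k\<in>{..<m}. \<sigma> * psum p k < \<sigma> * psum p m)"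
    proof (intro pred_intros_finite)
      fix k assume "k \<in> {..<m}"
      then have [measurable]: "(\<lambda>p. psum p k) \<in> borel_measurable (Pn n)" using that by (intro psum_m) auto
      show "Measurable.pred (Pn n) (\<lambda>p. \<sigma> * psum p k < \<sigma> * psum p m)" by measurable
    qed simp
    moreover have "Measurable.pred (Pn n) (\<lambda>p. 0 < \<sigma> * (psum p n - psum p m))" by measurable
    ultimately have "Measurable.pred (Pn n) (\<lambda>p. (\<forall>k\<in>{..<m}. \<sigma> * psum p k < \<sigma> * psum p m) \<and>
        (\<forall>k\<in>{1..n - Suc m}. \<sigma> * (psum p (m + k) - psum p m) \<le> 0) \<and> 0 < \<sigma> * (psum p n - psum p m))"
      by (intro pred_intros_logic)
    from indicator_pred_m[OF this] show ?thesis by (simp only: Ball_def lessThan_iff)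
  qed
  have "rec_int \<sigma> n f = (\<integral>\<^sup>+p. (\<Sum>m<n. indicator (?E m) p) * f (psum p n) \<partial>Pn n)"
    unfolding rec_int_def un[symmetric] by (simp only: indicator_UN_disjoint[OF finite_lessThan dis])
  also have "\<dots> = (\<Sum>m<n. \<integral>\<^sup>+p. indicator (?E m) p * f (psum p n) \<partial>Pn n)"
    unfolding sum_distrib_right by (rule nn_integral_sum, rule borel_measurable_times_ennreal, rule Em, simp, measurable)
  also have "\<dots> = (\<Sum>m<n. rec_int \<sigma> m (\<lambda>x. height_int \<sigma> (n - Suc m) (\<lambda>y. f (x + y))))"
  proof (rule sum.cong)
    fix m assume "m \<in> {..<n}"
    then have m: "m < n" by simp
    define j where "j = n - Suc m"
    have nj: "n = Suc (m + j)" using m by (simp add: j_def)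
    let ?w = "indicator {p. \<forall>k<m. \<sigma> * psum p k < \<sigma> * psum p m} :: (nat \<Rightarrow> real) \<Rightarrow> ennreal"
    let ?g = "\<lambda>x y. f (x + y)"
    let ?J = "\<lambda>p. indicator {p. \<forall>k\<in>{1..j}. psum p (m + k) - psum p m \<in> {y. \<sigma> * y \<le> 0}} p :: ennreal"
    have hm: "(\<lambda>p. indicator (?E m) p * f (psum p n)) \<in> borel_measurable (Pn n)"
      by (rule borel_measurable_times_ennreal, rule Em[OF m], measurable)
    have "(\<integral>\<^sup>+p. indicator (?E m) p * f (psum p n) \<partial>Pn n) = (\<integral>\<^sup>+p. \<integral>\<^sup>+t. indicator (?E m) (p(n := t)) * f (psum (p(n := t)) n) \<partial>F \<partial>Pn (m + j))"
      by (rule Pn_Suc[of _ "m + j", folded nj, OF hm])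
    also have "\<dots> = (\<integral>\<^sup>+p. ?w p * ?J p * up \<sigma> F (?g (psum p m)) (psum p (m + j) - psum p m) \<partial>Pn (m + j))"
    proof (intro nn_integral_cong)
      fix p
      have pu: "psum (p(n := t)) k = psum p k" if "k \<le> m + j" for k t
        using psum_upd[of k "m + j" p t] that unfolding nj[symmetric] by simp
      have pn: "psum (p(n := t)) n = psum p (m + j) + t" for t
        using psum_upd_Suc[of p "m + j" t] unfolding nj[symmetric] by simp
      have "indicator (?E m) (p(n := t)) * f (psum (p(n := t)) n)
        = ?w p * ?J p * (indicator {0<..} (\<sigma> * (psum p (m + j) - psum p m + t)) * ?g (psum p m) (psum p (m + j) - psum p m + t))" for t
      proof -
        have "p(n := t) \<in> ?E m \<longleftrightarrow> (\<forall>k<m. \<sigma> * psum p k < \<sigma> * psum p m) \<and>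
          (\<forall>k\<in>{1..j}. psum p (m + k) - psum p m \<in> {y. \<sigma> * y \<le> 0}) \<and> 0 < \<sigma> * (psum p (m + j) - psum p m + t)"
          unfolding mem_Collect_eq j_def[symmetric] pn
        proof (intro conj_cong ball_cong all_cong refl)
          show "(\<sigma> * psum (p(n := t)) k < \<sigma> * psum (p(n := t)) m) = (\<sigma> * psum p k < \<sigma> * psum p m)" if "k < m" for k
            using that by (simp add: pu)
          show "(\<sigma> * (psum (p(n := t)) (m + k) - psum (p(n := t)) m) \<le> 0) = (\<sigma> * (psum p (m + k) - psum p m) \<le> 0)"
            if "k \<in> {1..j}" for k
            using that by (simp add: pu)
          show "(0 < \<sigma> * (psum p (m + j) + t - psum (p(n := t)) m)) = (0 < \<sigma> * (psum p (m + j) - psum p m + t))"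
            by (simp add: pu algebra_simps)
        qed
        then have "(indicator (?E m) (p(n := t)) :: ennreal) = ?w p * ?J p * indicator {0<..} (\<sigma> * (psum p (m + j) - psum p m + t))"
          by (simp only: indicator_def mem_Collect_eq greaterThan_iff of_bool_conj mult.assoc)
        moreover have "psum p m + (psum p (m + j) - psum p m + t) = psum p (m + j) + t" by simp
        ultimately show ?thesis unfolding pn by (simp only: mult.assoc)
      qed
      moreover have "(\<lambda>t. indicator {0<..} (\<sigma> * (psum p (m + j) - psum p m + t)) * ?g (psum p m) (psum p (m + j) - psum p m + t)) \<in> borel_measurable F"
        unfolding measurable_cong_sets[OF sF refl] by measurable
      ultimately show "(\<integral>\<^sup>+t. indicator (?E m) (p(n := t)) * f (psum (p(n := t)) n) \<partial>F)
        = ?w p * ?J p * up \<sigma> F (?g (psum p m)) (psum p (m + j) - psum p m)"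
        unfolding up_def by (simp only: nn_integral_cmult)
    qed
    also have "\<dots> = (\<integral>\<^sup>+p. ?w p * (wk {y. \<sigma> * y \<le> 0} F ^^ j) (up \<sigma> F (?g (psum p m))) 0 \<partial>Pn m)"
    proof (rule Pn_block)
      show "?w \<in> borel_measurable (Pn n)" if "m \<le> n" for n using that by (rule record_m)
      show "?w (p(Suc n := t)) = ?w p" if "m \<le> n" for p n t using that by (simp add: indicator_def)
      show "(\<lambda>(x, z). up \<sigma> F (\<lambda>y. f (x + y)) z) \<in> borel_measurable (borel \<Otimes>\<^sub>M borel)"
        unfolding up_eq_wk by (rule wk_m) measurable
    qed measurable
    also have "\<dots> = rec_int \<sigma> m (\<lambda>x. height_int \<sigma> (n - Suc m) (\<lambda>y. f (x + y)))"
      unfolding rec_int_def height_int_def down_eq_wk j_def by simp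
    finally show "(\<integral>\<^sup>+p. indicator (?E m) p * f (psum p n) \<partial>Pn n) = \<dots>" .
  qed simp
  finally show ?thesis .
qed

lemma rec_int_0: "rec_int \<sigma> 0 f = f 0"
proof -
  interpret P0: prob_space "Pn 0" by (rule prob_space_PiM) (rule F)
  show ?thesis using P0.emeasure_space_1 by (simp add: rec_int_def)
qed

end

lemma nn_integral_suminf_measure:
  assumes s: "\<And>n. sets (F n) = sets (F 0)" and f: "f \<in> borel_measurable (F 0)"
  shows "(\<integral>\<^sup>+x. f x \<partial>suminf_measure F) = (\<Sum>n. \<integral>\<^sup>+x. f x \<partial>F n)"
  using f
proof (induction rule: borel_measurable_induct)
  case (cong f g)
  have sp: "space (F n) = space (F 0)" for n using sets_eq_imp_space_eq[OF s] .
  have "(\<integral>\<^sup>+x. f x \<partial>F n) = (\<integral>\<^sup>+x. g x \<partial>F n)" for n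
    by (intro nn_integral_cong cong(3)) (simp only: sp[of n])
  moreover have "(\<integral>\<^sup>+x. f x \<partial>suminf_measure F) = (\<integral>\<^sup>+x. g x \<partial>suminf_measure F)"
    by (intro nn_integral_cong) (simp add: cong(3))
  ultimately show ?case using cong(4) by simp
next
  case (set A)
  then show ?case
  proof -
    have "A \<in> sets (F n)" for n unfolding s[of n] by (rule set)
    then show ?thesis using emeasure_suminf_measure[of F A, OF s set] set by simp
  qed
next
  case (mult u c)
  have "u \<in> borel_measurable (F n)" for n using mult(2) measurable_cong_sets[OF s[of n] refl, of "borel :: ennreal measure"] by simp
  then show ?case using mult measurable_cong_sets[OF sets_suminf_measure[of F] refl, of "borel :: ennreal measure"] by (simp add: nn_integral_cmult)
next
  case (add u v)
  have "u \<in> borel_measurable (F n)" "v \<in> borel_measurable (F n)" for n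
    using add measurable_cong_sets[OF s[of n] refl, of "borel :: ennreal measure"] by simp_all
  then show ?case using add measurable_cong_sets[OF sets_suminf_measure[of F] refl, of "borel :: ennreal measure"]
    by (simp add: nn_integral_add suminf_add)
next
  case (seq U)
  have m: "U i \<in> borel_measurable (F n)" "U i \<in> borel_measurable (suminf_measure F)" for n i
    using seq(1)[of i] measurable_cong_sets[OF s[of n] refl, of "borel :: ennreal measure"] measurable_cong_sets[OF sets_suminf_measure[of F] refl, of "borel :: ennreal measure"]
    by simp_all
  have "(\<integral>\<^sup>+x. (SUP i. U i) x \<partial>suminf_measure F) = (SUP i. \<integral>\<^sup>+x. U i x \<partial>suminf_measure F)"
    unfolding SUP_apply using seq m by (intro nn_integral_monotone_convergence_SUP) auto
  also have "\<dots> = (SUP i. \<Sum>n. \<integral>\<^sup>+x. U i x \<partial>F n)" using seq by simp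
  also have "\<dots> = (\<Sum>n. SUP i. \<integral>\<^sup>+x. U i x \<partial>F n)"
    using seq(3) by (intro ennreal_suminf_SUP_eq[symmetric]) (auto simp: incseq_def le_fun_def intro!: nn_integral_mono)
  also have "\<dots> = (\<Sum>n. \<integral>\<^sup>+x. (SUP i. U i) x \<partial>F n)"
    unfolding SUP_apply using seq m by (intro suminf_cong nn_integral_monotone_convergence_SUP[symmetric]) auto
  finally show ?case .
qed

section \<open>Null sets of the renewal measure of the strict ladder heights\<close>

context step_law
begin

lemma rec_int_suminf:
  assumes "\<And>k. g k \<in> borel_measurable borel"
  shows "rec_int \<sigma> m (\<lambda>x. \<Sum>k. g k x) = (\<Sum>k. rec_int \<sigma> m (g k))"
proof -
  have g: "(\<lambda>p. g k (psum p m)) \<in> borel_measurable (Pn m)" for k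
    by (rule measurable_compose[OF psum_m assms]) simp
  have "(\<lambda>p. indicator {p. \<forall>k<m. \<sigma> * psum p k < \<sigma> * psum p m} p * g k (psum p m)) \<in> borel_measurable (Pn m)" for k
    by (rule borel_measurable_times_ennreal[OF record_m g]) simp
  then show ?thesis unfolding rec_int_def ennreal_suminf_cmult[symmetric] by (rule nn_integral_suminf)
qed

context
  fixes \<sigma> :: real and L :: "real measure"
  assumes finL: "finite_measure L" and sL [simp, measurable_cong]: "sets L = sets borel"
    and L: "\<And>f. f \<in> borel_measurable borel \<Longrightarrow> (\<integral>\<^sup>+x. f x \<partial>L) = (\<Sum>j. height_int \<sigma> j f)"
begin

lemma finite_convolution_power: "finite_measure (convolution_power L n) \<and> sets (convolution_power L n) = sets borel"
proof (induction n)
  case 0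
  have "prob_space (return borel (0::real))" by (rule prob_space_return) simp
  then show ?case by (simp add: prob_space.finite_measure)
next
  case (Suc n)
  then show ?case using convolution_finite[OF _ finL sL] by simp
qed

lemmas sets_convolution_power [simp, measurable_cong] = finite_convolution_power[THEN conjunct2]

lemma L_shift_m:
  assumes [measurable]: "f \<in> borel_measurable borel"
  shows "(\<lambda>x. \<integral>\<^sup>+y. f (x + y) \<partial>L) \<in> borel_measurable borel"
proof -
  interpret finite_measure L by (rule finL)
  show ?thesis by measurable
qed

lemma nn_integral_convolution_power_Suc:
  assumes "f \<in> borel_measurable borel"
  shows "(\<integral>\<^sup>+x. f x \<partial>convolution_power L (Suc n)) = (\<integral>\<^sup>+x. \<integral>\<^sup>+y. f (x + y) \<partial>L \<partial>convolution_power L n)"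
  unfolding convolution_power.simps
  by (rule nn_integral_convolution) (use finite_convolution_power finL assms in auto)

text \<open>Grouping records by their rank and grouping them by their time are two decompositions of
  the same occupation measure. A sum of nonnegative terms vanishes only if each term does, so the
  last-record decomposition transfers nullity by induction in either direction;
  \<open>rec_int_eq\<close> then returns from records to killed walks.\<close>

lemma renewal_null_iff:
  assumes "f \<in> borel_measurable borel"
  shows "(\<forall>j. (\<integral>\<^sup>+x. f x \<partial>convolution_power L j) = 0) \<longleftrightarrow> (\<forall>n. (up \<sigma> F ^^ n) f 0 = 0)"
proof -
  have hm: "(\<lambda>x. height_int \<sigma> k (\<lambda>y. f (x + y))) \<in> borel_measurable borel" if [measurable]: "f \<in> borel_measurable borel" for f k
    by (rule height_int_m) measurable
  have Lf: "(\<integral>\<^sup>+y. f (x + y) \<partial>L) = (\<Sum>j. height_int \<sigma> j (\<lambda>y. f (x + y)))" if [measurable]: "f \<in> borel_measurable borel" for f x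
    by (rule L) measurable
  have 1: "rec_int \<sigma> n f = 0" if "\<And>j. (\<integral>\<^sup>+x. f x \<partial>convolution_power L j) = 0" "f \<in> borel_measurable borel" for n f
    using that
  proof (induction n arbitrary: f rule: less_induct)
    case (less n)
    show ?case
    proof (cases "n = 0")
      case True
      then show ?thesis using less.prems(1)[of 0] less.prems(2) by (simp add: rec_int_0 nn_integral_return)
    next
      case False
      have "rec_int \<sigma> m (\<lambda>x. height_int \<sigma> (n - Suc m) (\<lambda>y. f (x + y))) = 0" if m: "m < n" for m
      proof (rule less.IH[OF m _ hm[OF less.prems(2)]])
        fix j
        have "(\<integral>\<^sup>+x. height_int \<sigma> (n - Suc m) (\<lambda>y. f (x + y)) \<partial>convolution_power L j)
          \<le> (\<integral>\<^sup>+x. \<integral>\<^sup>+y. f (x + y) \<partial>L \<partial>convolution_power L j)"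
        proof (intro nn_integral_mono)
          fix x
          show "height_int \<sigma> (n - Suc m) (\<lambda>y. f (x + y)) \<le> (\<integral>\<^sup>+y. f (x + y) \<partial>L)"
            using sum_le_suminf[OF summableI, of "{n - Suc m}" "\<lambda>j. height_int \<sigma> j (\<lambda>y. f (x + y))"]
            unfolding Lf[OF less.prems(2)] by simp
        qed
        also have "\<dots> = 0" using less.prems(1)[of "Suc j"] nn_integral_convolution_power_Suc[OF less.prems(2)] by simp
        finally show "(\<integral>\<^sup>+x. height_int \<sigma> (n - Suc m) (\<lambda>y. f (x + y)) \<partial>convolution_power L j) = 0" by simp
      qed
      then show ?thesis using rec_int_decomp[OF less.prems(2), of n] False by simp
    qed
  qed
  have 2: "(\<integral>\<^sup>+x. f x \<partial>convolution_power L j) = 0" if "\<And>n. rec_int \<sigma> n f = 0" "f \<in> borel_measurable borel" for j f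
    using that
  proof (induction j arbitrary: f)
    case 0
    then show ?case using 0(1)[of 0] by (simp add: rec_int_0 nn_integral_return)
  next
    case (Suc j)
    have "rec_int \<sigma> m (\<lambda>x. \<integral>\<^sup>+y. f (x + y) \<partial>L) = 0" for m
    proof -
      have "rec_int \<sigma> m (\<lambda>x. height_int \<sigma> k (\<lambda>y. f (x + y))) = 0" for k
      proof -
        \<comment> \<open>The wanted term is the summand i = m in the decomposition of a record at
          time m + k + 1.\<close>
        have "(\<Sum>i<Suc (m + k). rec_int \<sigma> i (\<lambda>x. height_int \<sigma> (Suc (m + k) - Suc i) (\<lambda>y. f (x + y)))) = 0"
          using rec_int_decomp[OF Suc.prems(2), of "Suc (m + k)" \<sigma>] Suc.prems(1)[of "Suc (m + k)"] by (simp only: zero_less_Suc)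
        then have "\<forall>i\<in>{..<Suc (m + k)}. rec_int \<sigma> i (\<lambda>x. height_int \<sigma> (Suc (m + k) - Suc i) (\<lambda>y. f (x + y))) = 0"
          by (subst (asm) sum_eq_0_iff) auto
        from this[rule_format, of m] show ?thesis by simp
      qed
      then show ?thesis unfolding Lf[OF Suc.prems(2)] using rec_int_suminf[OF hm[OF Suc.prems(2)], of \<sigma> m] by simp
    qed
    from Suc.IH[OF this L_shift_m[OF Suc.prems(2)]] show ?case
      unfolding nn_integral_convolution_power_Suc[OF Suc.prems(2)] .
  qed
  show ?thesis using 1[OF _ assms] 2[OF _ assms] rec_int_eq[OF assms] by metis
qed

lemma renewal_convolution_null_iff:
  assumes \<phi>: "sigma_finite_measure \<phi>" and s\<phi> [simp, measurable_cong]: "sets \<phi> = sets borel" and N [measurable]: "N \<in> sets borel"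
  shows "emeasure (renewal_measure L \<star> \<phi>) N = 0 \<longleftrightarrow>
    (AE m in \<phi>. \<forall>n. (up \<sigma> F ^^ n) (\<lambda>s. indicator N (m + s)) 0 = 0)"
proof -
  interpret \<phi>: sigma_finite_measure \<phi> by (rule \<phi>)
  have sU: "sets (renewal_measure L) = sets borel" by (simp add: renewal_measure_def)
  have sp: "space (renewal_measure L) = UNIV" "space \<phi> = UNIV"
    using sets_eq_imp_space_eq[OF sU] sets_eq_imp_space_eq[OF s\<phi>] by auto
  have cm: "(\<lambda>(x, y). x + y) \<in> (renewal_measure L \<Otimes>\<^sub>M \<phi>) \<rightarrow>\<^sub>M (borel :: real measure)"
    unfolding measurable_cong_sets[OF sets_pair_measure_cong[OF sU s\<phi>] refl] by measurable
  have "emeasure (renewal_measure L \<star> \<phi>) N = emeasure (renewal_measure L \<Otimes>\<^sub>M \<phi>) ((\<lambda>(x, y). x + y) -` N \<inter> space (renewal_measure L \<Otimes>\<^sub>M \<phi>))"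
    unfolding convolution_def by (rule emeasure_distr[OF cm N])
  also have "\<dots> = (\<integral>\<^sup>+u. \<integral>\<^sup>+m. indicator ((\<lambda>(x, y). x + y) -` N \<inter> space (renewal_measure L \<Otimes>\<^sub>M \<phi>)) (u, m) \<partial>\<phi> \<partial>renewal_measure L)"
    by (rule \<phi>.emeasure_pair_measure) (rule measurable_sets[OF cm N])
  also have "\<dots> = (\<integral>\<^sup>+u. \<integral>\<^sup>+m. indicator N (m + u) \<partial>\<phi> \<partial>renewal_measure L)"
    by (intro nn_integral_cong) (auto simp: space_pair_measure sp indicator_def add.commute)
  also have "\<dots> = (\<Sum>j. \<integral>\<^sup>+u. \<integral>\<^sup>+m. indicator N (m + u) \<partial>\<phi> \<partial>convolution_power L j)"
    unfolding renewal_measure_def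
  proof (rule nn_integral_suminf_measure)
    have "(\<lambda>u. \<integral>\<^sup>+m. indicator N (m + u) \<partial>\<phi>) \<in> borel_measurable (borel :: real measure)" by measurable
    then show "(\<lambda>u. \<integral>\<^sup>+m. indicator N (m + u) \<partial>\<phi>) \<in> borel_measurable (convolution_power L 0)" by simp
  qed simp
  finally have eq: "emeasure (renewal_measure L \<star> \<phi>) N = (\<Sum>j. \<integral>\<^sup>+u. \<integral>\<^sup>+m. indicator N (m + u) \<partial>\<phi> \<partial>convolution_power L j)" .
  have z: "(\<integral>\<^sup>+u. \<integral>\<^sup>+m. indicator N (m + u) \<partial>\<phi> \<partial>convolution_power L j) = 0 \<longleftrightarrow>
    (AE m in \<phi>. (\<integral>\<^sup>+u. indicator N (m + u) \<partial>convolution_power L j) = 0)" for j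
  proof -
    interpret Lj: finite_measure "convolution_power L j" using finite_convolution_power by blast
    interpret P: pair_sigma_finite "convolution_power L j" \<phi> ..
    have m2: "(\<lambda>(u, m). indicator N (m + u) :: ennreal) \<in> borel_measurable (convolution_power L j \<Otimes>\<^sub>M \<phi>)"
      unfolding measurable_cong_sets[OF sets_pair_measure_cong[OF sets_convolution_power s\<phi>] refl] by measurable
    have "(\<integral>\<^sup>+u. \<integral>\<^sup>+m. indicator N (m + u) \<partial>\<phi> \<partial>convolution_power L j) = (\<integral>\<^sup>+m. \<integral>\<^sup>+u. indicator N (m + u) \<partial>convolution_power L j \<partial>\<phi>)"
      by (rule P.Fubini'[OF m2, symmetric])
    moreover have "(\<lambda>m. \<integral>\<^sup>+u. indicator N (m + u) \<partial>convolution_power L j) \<in> borel_measurable \<phi>"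
      unfolding measurable_cong_sets[OF s\<phi> refl] by measurable
    ultimately show ?thesis by (simp only: nn_integral_0_iff_AE)
  qed
  have "emeasure (renewal_measure L \<star> \<phi>) N = 0 \<longleftrightarrow> (\<forall>j. AE m in \<phi>. (\<integral>\<^sup>+u. indicator N (m + u) \<partial>convolution_power L j) = 0)"
    unfolding eq by (subst suminf_eq_zero_iff) (auto simp: z)
  also have "\<dots> \<longleftrightarrow> (AE m in \<phi>. \<forall>j. (\<integral>\<^sup>+u. indicator N (m + u) \<partial>convolution_power L j) = 0)"
    by (simp only: AE_all_countable)
  also have "\<dots> \<longleftrightarrow> (AE m in \<phi>. \<forall>n. (up \<sigma> F ^^ n) (\<lambda>s. indicator N (m + s)) 0 = 0)"
    by (intro AE_cong renewal_null_iff) measurable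
  finally show ?thesis .
qed

end

end

section \<open>Random walks on a probability space and the laws of their ladder heights\<close>

locale walk = prob_space M for M :: "'w measure" +
  fixes X :: "nat \<Rightarrow> 'w \<Rightarrow> real"
  assumes indep: "indep_vars (\<lambda>_. borel) X {1..}"
    and ident: "\<And>n. 1 \<le> n \<Longrightarrow> distr M borel (X n) = distr M borel (X 1)"
begin

lemma X_m: "1 \<le> n \<Longrightarrow> X n \<in> borel_measurable M"
  using indep by (auto simp: indep_vars_def)

lemma partial_sum_m [measurable]: "partial_sum X k \<in> borel_measurable M"
  unfolding partial_sum_def[abs_def] by (intro borel_measurable_sum X_m) auto

definition "FX = distr M borel (X 1)"

lemma sets_FX: "sets FX = sets borel"
  unfolding FX_def by (rule sets_distr)

lemma prob_space_FX: "prob_space FX"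
  unfolding FX_def by (rule prob_space_distr) (rule X_m, simp)

sublocale step_law FX
  by (rule step_law.intro) (rule prob_space_FX, rule sets_FX)

lemma law_Pn:
  assumes f: "f \<in> borel_measurable (Pn (Suc n))"
  shows "(\<integral>\<^sup>+\<omega>. f (\<lambda>i\<in>{1..Suc n}. X i \<omega>) \<partial>M) = (\<integral>\<^sup>+p. f p \<partial>Pn (Suc n))"
proof -
  let ?I = "{1..Suc n}"
  have rv: "random_variable borel (X i)" if "i \<in> ?I" for i using that by (intro X_m) simp
  have "indep_vars (\<lambda>_. borel) X ?I" by (rule indep_vars_subset[OF indep]) auto
  then have "distr M (\<Pi>\<^sub>M i\<in>?I. borel) (\<lambda>x. \<lambda>i\<in>?I. X i x) = (\<Pi>\<^sub>M i\<in>?I. distr M borel (X i))"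
    using indep_vars_iff_distr_eq_PiM'[where I="?I" and X=X and M'="\<lambda>_. borel"] rv by simp
  also have "\<dots> = Pn (Suc n)" unfolding FX_def by (intro PiM_cong refl ident) simp
  finally have d: "distr M (\<Pi>\<^sub>M i\<in>?I. borel) (\<lambda>x. \<lambda>i\<in>?I. X i x) = Pn (Suc n)" .
  have s: "sets (Pn (Suc n)) = sets (\<Pi>\<^sub>M i\<in>?I. borel)" by (intro sets_PiM_cong refl sets_FX)
  have fm: "f \<in> borel_measurable (\<Pi>\<^sub>M i\<in>?I. borel)" using f unfolding measurable_cong_sets[OF s refl] .
  have "(\<integral>\<^sup>+p. f p \<partial>Pn (Suc n)) = (\<integral>\<^sup>+\<omega>. f (\<lambda>i\<in>?I. X i \<omega>) \<partial>M)"
    unfolding d[symmetric] by (rule nn_integral_distr) (use rv fm in \<open>auto intro!: measurable_restrict simp del: atLeastAtMost_iff\<close>)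
  then show ?thesis by simp
qed

lemma psum_X: "k \<le> n \<Longrightarrow> psum (\<lambda>i\<in>{1..n}. X i \<omega>) k = partial_sum X k \<omega>"
  unfolding psum_def partial_sum_def by (rule sum.cong) simp_all

lemma first_value_m [measurable]:
  assumes [measurable]: "B \<in> sets borel"
  shows "first_value B X \<in> borel_measurable M"
proof -
  have "(\<lambda>\<omega>. LEAST k. 1 \<le> k \<and> partial_sum X k \<omega> \<in> B) \<in> M \<rightarrow>\<^sub>M count_space UNIV"
  proof (rule measurable_Least)
    fix k
    show "Measurable.pred M (\<lambda>\<omega>. 1 \<le> k \<and> partial_sum X k \<omega> \<in> B)"
      by (intro pred_intros_logic pred_sets2[OF assms partial_sum_m]) simp
  qed
  from measurable_compose_countable[OF partial_sum_m this] show ?thesis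
    unfolding first_value_def[abs_def] .
qed

text \<open>Summation over the value j + 1 of the first hitting time of B, an event that depends on
  the first j + 1 increments only.\<close>

lemma nn_integral_first_value:
  assumes B [measurable]: "B \<in> sets borel" and f [measurable]: "f \<in> borel_measurable borel"
  shows "(\<integral>\<^sup>+\<omega>. f (first_value B X \<omega>) * indicator {\<omega> \<in> space M. \<exists>k\<ge>1. partial_sum X k \<omega> \<in> B} \<omega> \<partial>M)
    = (\<Sum>j. (wk (- B) FX ^^ j) (wk B FX f) 0)"
proof -
  let ?E = "\<lambda>j. {p. (\<forall>k\<in>{1..j}. psum p k \<in> - B) \<and> psum p (Suc j) \<in> B}"
  let ?h = "\<lambda>j p. indicator (?E j) p * f (psum p (Suc j)) :: ennreal"
  let ?R = "\<lambda>j \<omega>. \<lambda>i\<in>{1..Suc j}. X i \<omega>"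
  have hm: "?h j \<in> borel_measurable (Pn (Suc j))" for j
  proof -
    have "Measurable.pred (Pn (Suc j)) (\<lambda>p. \<forall>k\<in>{1..j}. psum p k \<in> - B)"
    proof (intro pred_intros_finite)
      fix k assume "k \<in> {1..j}"
      then have [measurable]: "(\<lambda>p. psum p k) \<in> borel_measurable (Pn (Suc j))"
        by - (rule psum_m; simp)
      show "Measurable.pred (Pn (Suc j)) (\<lambda>p. psum p k \<in> - B)" by measurable
    qed simp
    moreover have sm [measurable]: "(\<lambda>p. psum p (Suc j)) \<in> borel_measurable (Pn (Suc j))" by (rule psum_m) simp
    moreover have "Measurable.pred (Pn (Suc j)) (\<lambda>p. psum p (Suc j) \<in> B)" by measurable
    ultimately have "Measurable.pred (Pn (Suc j)) (\<lambda>p. (\<forall>k\<in>{1..j}. psum p k \<in> - B) \<and> psum p (Suc j) \<in> B)"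
      by (intro pred_intros_logic)
    then show ?thesis by (intro borel_measurable_times_ennreal indicator_pred_m measurable_compose[OF sm f])
  qed
  have h: "?h j (?R j \<omega>) = indicator {\<omega>. (\<forall>k\<in>{1..j}. partial_sum X k \<omega> \<notin> B) \<and> partial_sum X (Suc j) \<omega> \<in> B} \<omega> * f (partial_sum X (Suc j) \<omega>)" for j \<omega>
  proof -
    have "(\<forall>k\<in>{1..j}. psum (?R j \<omega>) k \<in> - B) \<longleftrightarrow> (\<forall>k\<in>{1..j}. partial_sum X k \<omega> \<notin> B)"
      by (intro ball_cong refl) (subst psum_X; simp)
    then show ?thesis by (simp only: indicator_def mem_Collect_eq psum_X[OF order_refl])
  qed
  have "(\<integral>\<^sup>+\<omega>. f (first_value B X \<omega>) * indicator {\<omega> \<in> space M. \<exists>k\<ge>1. partial_sum X k \<omega> \<in> B} \<omega> \<partial>M)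
    = (\<integral>\<^sup>+\<omega>. (\<Sum>j. ?h j (?R j \<omega>)) \<partial>M)"
  proof (rule nn_integral_cong)
    fix \<omega> assume w: "\<omega> \<in> space M"
    show "f (first_value B X \<omega>) * indicator {\<omega> \<in> space M. \<exists>k\<ge>1. partial_sum X k \<omega> \<in> B} \<omega> = (\<Sum>j. ?h j (?R j \<omega>))"
    proof (cases "\<exists>k\<ge>1. partial_sum X k \<omega> \<in> B")
      case True
      let ?P = "\<lambda>k. 1 \<le> k \<and> partial_sum X k \<omega> \<in> B"
      define l where "l = (LEAST k. ?P k)"
      have l: "1 \<le> l" "partial_sum X l \<omega> \<in> B" using LeastI_ex[OF True] unfolding l_def by auto
      have nl: "\<not> ?P k" if "k < l" for k using that unfolding l_def by (rule not_less_Least)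
      obtain i where i: "l = Suc i" using l(1) by (cases l) auto
      have "?h j (?R j \<omega>) = (if j = i then f (partial_sum X l \<omega>) else 0)" for j
      proof -
        have "((\<forall>k\<in>{1..j}. partial_sum X k \<omega> \<notin> B) \<and> partial_sum X (Suc j) \<omega> \<in> B) \<longleftrightarrow> j = i"
        proof safe
          assume *: "\<forall>k\<in>{1..j}. partial_sum X k \<omega> \<notin> B" "partial_sum X (Suc j) \<omega> \<in> B"
          have "\<not> Suc j < l" using nl[of "Suc j"] *(2) by auto
          moreover have "\<not> l \<le> j" using *(1) l by auto
          ultimately show "j = i" using i by simp
        next
          show "False" if "j = i" "k \<in> {1..i}" "partial_sum X k \<omega> \<in> B" for k using nl[of k] that i by auto
          show "partial_sum X (Suc i) \<omega> \<in> B" using l i by simp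
        qed
        then show ?thesis unfolding h by (simp only: indicator_def mem_Collect_eq i, simp)
      qed
      then have "(\<Sum>j. ?h j (?R j \<omega>)) = (\<Sum>j. if j = i then f (partial_sum X l \<omega>) else 0)" by simp
      also have "\<dots> = f (partial_sum X l \<omega>)"
        using sums_unique[OF sums_single[of i "\<lambda>_. f (partial_sum X l \<omega>)"]] by simp
      finally show ?thesis using True w by (simp add: first_value_def l_def)
    next
      case False
      then have "?h j (?R j \<omega>) = 0" for j unfolding h by (auto simp: indicator_def)
      then have "(\<Sum>j. ?h j (?R j \<omega>)) = 0" by (simp only: suminf_zero)
      then show ?thesis using False by simp
    qed
  qed
  also have "\<dots> = (\<Sum>j. \<integral>\<^sup>+\<omega>. ?h j (?R j \<omega>) \<partial>M)"
  proof (rule nn_integral_suminf)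
    fix j
    have "?R j \<in> M \<rightarrow>\<^sub>M Pn (Suc j)"
    proof (rule measurable_restrict)
      fix i assume "i \<in> {1..Suc j}"
      then have "X i \<in> borel_measurable M" by (intro X_m) simp
      then show "X i \<in> M \<rightarrow>\<^sub>M FX" unfolding measurable_cong_sets[OF refl sets_FX] .
    qed
    from measurable_compose[OF this hm] show "(\<lambda>\<omega>. ?h j (?R j \<omega>)) \<in> borel_measurable M" .
  qed
  also have "\<dots> = (\<Sum>j. (wk (- B) FX ^^ j) (wk B FX f) 0)"
    by (intro suminf_cong) (subst law_Pn[OF hm], rule Pn_exit; measurable)
  finally show ?thesis .
qed

lemma first_value_law_m: "B \<in> sets borel \<Longrightarrow>
    first_value B X \<in> restrict_space M {\<omega> \<in> space M. \<exists>k\<ge>1. partial_sum X k \<omega> \<in> B} \<rightarrow>\<^sub>M borel"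
  by (intro measurable_restrict_space1 first_value_m)

lemma nn_integral_first_value_law:
  assumes B [measurable]: "B \<in> sets borel" and f [measurable]: "f \<in> borel_measurable borel"
  shows "(\<integral>\<^sup>+x. f x \<partial>first_value_law M B X) = (\<Sum>j. (wk (- B) FX ^^ j) (wk B FX f) 0)"
  unfolding first_value_law_def nn_integral_first_value[OF assms, symmetric]
  by (subst nn_integral_distr) (use first_value_law_m[OF B] in \<open>auto simp: nn_integral_restrict_space\<close>)

lemma finite_first_value_law: "finite_measure (first_value_law M B X)" "sets (first_value_law M B X) = sets borel" if B [measurable]: "B \<in> sets borel"
proof -
  show "finite_measure (first_value_law M B X)"
    unfolding first_value_law_def
    by (intro finite_measure.finite_measure_distr finite_measure_restrict_space first_value_law_m) auto
qed (simp add: first_value_law_def)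

lemma renewal_ladder_null_iff:
  assumes "sigma_finite_measure \<phi>" "sets \<phi> = sets borel" "N \<in> sets borel"
  shows "emeasure (renewal_measure (first_value_law M {y. 0 < \<sigma> * y} X) \<star> \<phi>) N = 0 \<longleftrightarrow>
    (AE m in \<phi>. \<forall>n. (up \<sigma> FX ^^ n) (\<lambda>s. indicator N (m + s)) 0 = 0)"
proof (rule renewal_convolution_null_iff[OF _ _ _ assms])
  have B: "{y. 0 < \<sigma> * y} \<in> sets borel" by measurable
  have e: "- {y. 0 < \<sigma> * y} = {y. \<sigma> * y \<le> 0}" by auto
  show "(\<integral>\<^sup>+x. f x \<partial>first_value_law M {y. 0 < \<sigma> * y} X) = (\<Sum>j. height_int \<sigma> j f)" if "f \<in> borel_measurable borel" for f
    unfolding height_int_def up_eq_wk down_eq_wk e[symmetric] by (rule nn_integral_first_value_law[OF B that])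
qed (rule finite_first_value_law, measurable)+

lemma ladder_walk:
  assumes \<sigma>: "\<sigma> = 1 \<or> \<sigma> = -1" and hit: "AE \<omega> in M. \<exists>k\<ge>1. \<sigma> * partial_sum X k \<omega> < 0"
  shows "ladder \<sigma> FX (distr M borel (first_value {y. \<sigma> * y \<le> 0} X))"
proof -
  let ?B = "{y. \<sigma> * y \<le> 0}"
  let ?G = "distr M borel (first_value ?B X)"
  have B [measurable]: "?B \<in> sets borel" by measurable
  have hit': "AE \<omega> in M. \<exists>k\<ge>1. partial_sum X k \<omega> \<in> ?B" using hit by eventually_elim (auto intro: less_imp_le)
  have eq: "(\<integral>\<^sup>+t. f t \<partial>?G) = (\<Sum>n. (up \<sigma> FX ^^ n) (down \<sigma> FX f) 0)" if [measurable]: "f \<in> borel_measurable borel" for f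
  proof -
    have e: "- ?B = {y. 0 < \<sigma> * y}" by auto
    have "(\<integral>\<^sup>+t. f t \<partial>?G) = (\<integral>\<^sup>+\<omega>. f (first_value ?B X \<omega>) \<partial>M)" by (rule nn_integral_distr) measurable
    also have "\<dots> = (\<integral>\<^sup>+\<omega>. f (first_value ?B X \<omega>) * indicator {\<omega> \<in> space M. \<exists>k\<ge>1. partial_sum X k \<omega> \<in> ?B} \<omega> \<partial>M)"
      by (rule nn_integral_cong_AE) (use hit' in \<open>auto elim!: AE_mp\<close>)
    also have "\<dots> = (\<Sum>n. (up \<sigma> FX ^^ n) (down \<sigma> FX f) 0)"
      unfolding up_eq_wk down_eq_wk e[symmetric] by (rule nn_integral_first_value[OF B that])
    finally show ?thesis .
  qed
  \<comment> \<open>A first increment strictly beyond 0 would itself be a nonzero ladder height. If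
    ladder heights were almost surely 0, no increment could have that sign, and the walk would never
    reach the open half-line.\<close>
  have "emeasure ?G {0} < 1"
  proof (rule ccontr)
    assume "\<not> emeasure ?G {0} < 1"
    interpret G: prob_space ?G by (rule prob_space_distr) measurable
    have "emeasure ?G {0} = 1" using \<open>\<not> emeasure ?G {0} < 1\<close> G.emeasure_le_1[of "{0}"] by auto
    then have "AE t in ?G. t \<in> {0}" by (intro G.AE_prob_1) (simp add: measure_def)
    then have d0: "AE \<omega> in M. first_value ?B X \<omega> = 0" by (subst (asm) AE_distr_iff) (auto intro: first_value_m[OF B])
    have "AE \<omega> in M. \<not> \<sigma> * X 1 \<omega> < 0"
      using d0
    proof eventually_elim
      case (elim \<omega>)
      show ?case
      proof
        assume *: "\<sigma> * X 1 \<omega> < 0"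
        then have "(LEAST k. 1 \<le> k \<and> partial_sum X k \<omega> \<in> ?B) = 1"
          by (intro Least_equality) (auto simp: partial_sum_def)
        then show False using elim * by (simp add: first_value_def partial_sum_def)
      qed
    qed
    then have fx: "AE t in distr M borel (X 1). \<not> \<sigma> * t < 0" by (subst AE_distr_iff[OF X_m]) auto
    have "AE \<omega> in M. \<not> \<sigma> * X n \<omega> < 0" if "1 \<le> n" for n
      using fx unfolding ident[OF that, symmetric] by (subst (asm) AE_distr_iff[OF X_m[OF that]]) auto
    then have "AE \<omega> in M. \<forall>n\<in>{1..}. \<not> \<sigma> * X n \<omega> < 0" by (subst AE_ball_countable) auto
    then have "AE \<omega> in M. False" using hit
    proof eventually_elim
      case (elim \<omega>)
      then obtain k where "\<sigma> * partial_sum X k \<omega> < 0" by auto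
      moreover have "0 \<le> \<sigma> * partial_sum X k \<omega>"
        unfolding partial_sum_def sum_distrib_left using elim(1) by (intro sum_nonneg) (auto simp: not_less)
      ultimately show False by simp
    qed
    then show False by simp
  qed
  then show ?thesis
    by (intro ladder.intro \<sigma> eq F) (auto intro!: prob_space_distr first_value_m B)
qed

end

subsection \<open>Irreducibility of the ladder height chain\<close>

lemma AE_of_integral_Compl:
  assumes "sets H = sets borel" "A \<in> sets borel" "(\<integral>\<^sup>+t. indicator (- A) t \<partial>H) = 0"
  shows "AE t in H. t \<in> A"
proof -
  have "- A \<in> sets H" using assms by auto
  then have "emeasure H (- A) = 0" using assms(3) by simp
  then show ?thesis using \<open>- A \<in> sets H\<close> by (intro AE_I[of _ _ "- A"]) auto
qed

lemma lattice_set_pos: "0 < u \<Longrightarrow> x \<in> lattice_set u \<longleftrightarrow> (\<exists>k::int. x = u * of_int k)"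
  by (auto simp: lattice_set_def)

lemma lattice_set_0 [simp]: "lattice_set 0 = UNIV" "0 \<in> lattice_set u"
  by (auto simp: lattice_set_def intro: image_eqI[of _ _ 0])

lemma lattice_set_add: "x \<in> lattice_set u \<Longrightarrow> y \<in> lattice_set u \<Longrightarrow> x + y \<in> lattice_set u"
  unfolding lattice_set_def by (auto simp: distrib_left[symmetric] simp flip: of_int_add)

lemma lattice_set_uminus: "x \<in> lattice_set u \<Longrightarrow> - x \<in> lattice_set u"
  unfolding lattice_set_def by (auto simp: mult_minus_right[symmetric] simp del: mult_minus_right simp flip: of_int_minus)

lemma lattice_set_diff: "x \<in> lattice_set u \<Longrightarrow> y \<in> lattice_set u \<Longrightarrow> x - y \<in> lattice_set u"
  using lattice_set_add[of x u "- y"] lattice_set_uminus[of y u] by simp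

lemma lattice_set_dist:
  assumes "0 < u" "x \<in> lattice_set u" "y \<in> lattice_set u" "\<bar>x - y\<bar> < u" shows "x = y"
proof -
  obtain k :: int where k: "x - y = u * of_int k" using lattice_set_diff[OF assms(2,3)] assms(1) by (auto simp: lattice_set_pos)
  then have "u * \<bar>of_int k\<bar> < u * 1" using assms by (simp add: abs_mult)
  then have "\<bar>k\<bar> < 1" using assms(1) by (simp flip: of_int_abs)
  then show ?thesis using k by simp
qed

lemma closed_lattice_set: "0 \<le> u \<Longrightarrow> closed (lattice_set u)"
proof (cases "u = 0")
  case False
  assume "0 \<le> u"
  then have u: "0 < u" using False by simp
  show ?thesis unfolding closed_sequential_limits
  proof (intro allI impI, elim conjE)
    fix s l assume s: "\<forall>n. s n \<in> lattice_set u" "s \<longlonglongrightarrow> l"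
    then have "Cauchy s" by (intro LIMSEQ_imp_Cauchy)
    then obtain N where "\<And>m n. m \<ge> N \<Longrightarrow> n \<ge> N \<Longrightarrow> dist (s m) (s n) < u" using u metric_CauchyD by blast
    then have "s n = s N" if "n \<ge> N" for n
      using s that lattice_set_dist[OF u, of "s n" "s N"] by (auto simp: dist_real_def)
    then have "s \<longlonglongrightarrow> s N" by (intro tendsto_eventually eventually_sequentiallyI[of N])
    then show "l \<in> lattice_set u" using s LIMSEQ_unique by metis
  qed
qed simp

text \<open>With elements of both signs, a closed semigroup is already a closed group; the dichotomy
  is whether it has arbitrarily small positive elements.\<close>

lemma closed_semigroup_cases:
  fixes C :: "real set"
  assumes cl: "closed C" and add: "\<And>x y. x \<in> C \<Longrightarrow> y \<in> C \<Longrightarrow> x + y \<in> C"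
    and b: "b \<in> C" "b < 0" and c: "c \<in> C" "0 < c"
  shows "C = UNIV \<or> (\<exists>m>0. C = lattice_set m)"
proof -
  have mult: "real (Suc n) * x \<in> C" if "x \<in> C" for n x
  proof (induction n)
    case (Suc n)
    have "real (Suc (Suc n)) * x = real (Suc n) * x + x" by (simp add: algebra_simps)
    then show ?case using add[OF Suc that] by simp
  qed (use that in simp)
  show ?thesis
  proof (cases "\<forall>\<eta>>0. \<exists>x\<in>C. 0 < x \<and> x < \<eta>")
    case True
    have "x \<in> closure C" for x
      unfolding closure_approachable
    proof (intro allI impI)
      fix \<eta> :: real assume "0 < \<eta>"
      then obtain s where s: "s \<in> C" "0 < s" "s < \<eta>" using True by blast
      \<comment> \<open>Copies of b lead far to the left of x; from there copies of the small
        element s climb to within s of x.\<close>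
      obtain n :: nat where "(s - x) / - b < real n" using reals_Archimedean2 by blast
      then have "(s - x) / - b < real (Suc n)" by simp
      then have n: "real (Suc n) * b < x - s" using b(2) by (simp add: field_simps del: of_nat_Suc)
      define k where "k = nat \<lfloor>(x - real (Suc n) * b) / s\<rfloor>"
      have q1: "1 \<le> (x - real (Suc n) * b) / s" using n s by (simp add: field_simps del: of_nat_Suc)
      then have k: "real k \<le> (x - real (Suc n) * b) / s" "(x - real (Suc n) * b) / s < real k + 1" "1 \<le> k"
        unfolding k_def by linarith+
      then obtain j where j: "k = Suc j" by (cases k) auto
      have "real (Suc n) * b + real (Suc j) * s \<in> C" using mult[OF b(1)] mult[OF s(1)] by (intro add)
      moreover have "real k * s \<le> x - real (Suc n) * b" "x - real (Suc n) * b < (real k + 1) * s"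
        using k s by (simp_all add: field_simps del: of_nat_Suc)
      then have "dist (real (Suc n) * b + real (Suc j) * s) x < \<eta>"
        using s unfolding j dist_real_def by (simp add: algebra_simps)
      ultimately show "\<exists>y\<in>C. dist y x < \<eta>" by blast
    qed
    then show ?thesis using cl by auto
  next
    case False
    then obtain \<eta> where \<eta>: "0 < \<eta>" "\<And>x. x \<in> C \<Longrightarrow> 0 < x \<Longrightarrow> \<eta> \<le> x" by (metis not_less)
    let ?P = "C \<inter> {\<eta>..}"
    define m where "m = Inf ?P"
    have P: "?P \<noteq> {}" "bdd_below ?P" "closed ?P" using c \<eta> cl by (auto intro: closed_Int)
    have mC: "m \<in> C" "\<eta> \<le> m" using closed_contains_Inf[OF P] unfolding m_def by auto
    then have m: "0 < m" using \<eta> by simp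
    have least: "m \<le> x" if "x \<in> C" "0 < x" for x
      unfolding m_def using that \<eta> P(2) by (intro cInf_lower) auto
    \<comment> \<open>Adding copies of the least positive element m leads from x into (0, m], where
      m is the only element; so x is a multiple of - m.\<close>
    have neg: "\<exists>j::nat. x = - m * real j \<and> 1 \<le> j" if x: "x \<in> C" "x < 0" for x
    proof -
      define k where "k = nat \<lfloor>- x / m\<rfloor>"
      have "0 \<le> - x / m" using x m by (intro divide_nonneg_pos) auto
      then have k: "real k \<le> - x / m" "- x / m < real k + 1" unfolding k_def by linarith+
      have "x + real (Suc k) * m \<in> C" using mult[OF mC(1)] x by (intro add)
      moreover have "0 < x + real (Suc k) * m" "x + real (Suc k) * m \<le> m" using k m by (simp_all add: field_simps)
      ultimately have "x + real (Suc k) * m = m" using least[of "x + real (Suc k) * m"] by simp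
      then have "x = - m * real k" by (simp add: algebra_simps)
      moreover have "1 \<le> k" using x \<open>x = - m * real k\<close> by (cases k) auto
      ultimately show ?thesis by blast
    qed
    have sub: "x \<in> lattice_set m" if x: "x \<in> C" for x
    proof -
      obtain j :: nat where j: "b = - m * real j" "1 \<le> j" using neg b by blast
      obtain r :: nat where "x / - b < real r" using reals_Archimedean2 by blast
      then have "x / - b < real (Suc r)" by simp
      then have "x + real (Suc r) * b < 0" using b(2) by (simp add: field_simps del: of_nat_Suc)
      moreover have "x + real (Suc r) * b \<in> C" using mult[OF b(1)] x by (intro add)
      ultimately obtain i :: nat where "x + real (Suc r) * b = - m * real i" using neg by blast
      then have "x = m * of_int (int (Suc r * j) - int i)" using j by (simp add: algebra_simps)
      then show ?thesis unfolding lattice_set_pos[OF m] by blast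
    qed
    have minus: "- m \<in> C"
    proof -
      obtain j :: nat where j: "b = - m * real j" "1 \<le> j" using neg b by blast
      show ?thesis
      proof (cases "j = 1")
        case False
        then obtain i where i: "j = Suc (Suc i)" using j by (metis Suc_le_D One_nat_def not0_implies_Suc)
        have "b + real (Suc i) * m \<in> C" using mult[OF mC(1)] b by (intro add)
        then show ?thesis using j i by (simp add: algebra_simps)
      qed (use j b in simp)
    qed
    have "m * of_int k \<in> C" for k :: int
    proof -
      consider "k = 0" | n where "k = int (Suc n)" | n where "k = - int (Suc n)"
        by (metis int_cases2 not0_implies_Suc of_nat_0 neg_0_equal_iff_equal)
      then show ?thesis
      proof cases
        case 1 then show ?thesis using add[OF mC(1) minus] by simp
      next
        case 2 then show ?thesis using mult[OF mC(1), of "nat k - 1"] by (simp add: mult.commute)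
      next
        case (3 n)
        then have "m * of_int k = real (Suc n) * - m"
          by (simp only: of_int_minus of_int_of_nat_eq mult_minus_right) (simp only: mult.commute)
        then show ?thesis using mult[OF minus, of n] by metis
      qed
    qed
    then have "C = lattice_set m" using sub m by (auto simp: lattice_set_pos)
    then show ?thesis using m by blast
  qed
qed

lemma (in prob_kernel) noret_antimono:
  assumes E: "closed_set K E" and [measurable]: "B \<in> sets borel" "B' \<in> sets borel"
    and sub: "\<And>y. y \<in> E \<Longrightarrow> y \<in> B' \<Longrightarrow> y \<in> B" and x: "x \<in> E"
  shows "noret K B x \<le> noret K B' x"
proof -
  have "ret K B n x \<le> ret K B' n x" if "x \<in> E" for n x
    using that
  proof (induction n arbitrary: x)
    case (Suc n)
    have "AE y in K x. y \<in> E" using E Suc.prems by (auto simp: closed_set_def)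
    then show ?case unfolding ret.simps
      by (intro nn_integral_mono_AE) (auto elim!: eventually_mono intro!: Suc.IH dest: sub split: split_indicator)
  qed simp
  then show ?thesis unfolding noret_def using x by (intro INF_mono') auto
qed

locale switch =
  fixes F F' G G' :: "real measure" and \<alpha> d :: real
  assumes Lp: "ladder 1 F G" and Ln: "ladder (-1) F' G'" and \<alpha>: "0 \<le> \<alpha>" "\<alpha> \<le> 1"
    and d: "0 \<le> d" and Fd: "AE t in F. t \<in> lattice_set d" and Fd': "AE t in F'. t \<in> lattice_set d"
    and d_max: "\<And>u. 0 \<le> u \<Longrightarrow> AE t in F. t \<in> lattice_set u \<Longrightarrow> AE t in F'. t \<in> lattice_set u \<Longrightarrow> u \<le> d"
begin

sublocale A: ladder 1 F G by (rule Lp)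
sublocale D: ladder "-1" F' G' by (rule Ln)
sublocale P: switching F F' \<alpha>
  by (intro switching.intro A.F D.F A.sF D.sF \<alpha>)
sublocale Q: inward G G' \<alpha>
proof (intro inward.intro switching.intro inward_axioms.intro A.G D.G A.sG D.sG \<alpha>)
  show "AE t in G. t \<le> 0" using A.G_le by simp
  show "AE t in G'. 0 \<le> t" using D.G_le by simp
qed

abbreviation "Z \<equiv> lattice_set d"

lemma Z_m [measurable]: "Z \<in> sets borel" by simp

text \<open>Stopping cannot create mass off the lattice: the indicator of the complement of Z is
  superharmonic for increments in Z.\<close>

lemma GZ: "AE t in G. t \<in> Z" and GZ': "AE t in G'. t \<in> Z"
proof -
  have g: "AE t in H. t \<in> Z" if "ladder \<sigma> E H" "AE t in E. t \<in> Z" for \<sigma> E H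
  proof -
    interpret l: ladder \<sigma> E H by fact
    let ?\<theta> = "indicator (- Z) :: real \<Rightarrow> ennreal"
    have zero: "(\<integral>\<^sup>+t. ?\<theta> (y + t) \<partial>E) = 0" if "y \<in> Z" for y
    proof -
      have "(\<integral>\<^sup>+t. ?\<theta> (y + t) \<partial>E) = (\<integral>\<^sup>+t. 0 \<partial>E)"
        by (rule nn_integral_cong_AE) (use \<open>AE t in E. t \<in> Z\<close> in eventually_elim, use that in \<open>auto simp: lattice_set_add\<close>)
      then show ?thesis by simp
    qed
    have "(\<integral>\<^sup>+t. ?\<theta> (0 + t) \<partial>H) \<le> (\<integral>\<^sup>+t. ?\<theta> (0 + t) \<partial>E)"
    proof (rule l.ladder_super)
      fix y show "(\<integral>\<^sup>+t. ?\<theta> (y + t) \<partial>E) \<le> ?\<theta> y"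
        using zero[of y] l.nn_F_le_1[of "\<lambda>t. ?\<theta> (y + t)"] by (cases "y \<in> Z") (auto split: split_indicator)
    qed auto
    then have "(\<integral>\<^sup>+t. ?\<theta> t \<partial>H) = 0" using zero[of 0] by simp
    then show ?thesis by (intro AE_of_integral_Compl) auto
  qed
  show "AE t in G. t \<in> Z" "AE t in G'. t \<in> Z" using g[OF Lp Fd] g[OF Ln Fd'] by auto
qed

lemma supp_subset_Z:
  assumes "sets H = sets borel" "AE t in H. t \<in> Z" shows "supp H \<subseteq> Z"
proof
  fix x assume x: "x \<in> supp H"
  show "x \<in> Z"
  proof (rule ccontr)
    assume "x \<notin> Z"
    then have "open (- Z)" "x \<in> - Z" using closed_lattice_set[OF d] by auto
    then have "0 < emeasure H (- Z)" using x by (auto simp: supp_def msupport_def)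
    moreover have "emeasure H (- Z) = 0"
      using assms by (subst (asm) AE_iff_measurable[OF _ refl]) (auto simp: Compl_eq sets_eq_imp_space_eq[OF assms(1)])
    ultimately show False by simp
  qed
qed

lemma closed_set_P: "closed_set P.K Z" and closed_set_Q: "closed_set Q.K Z"
proof -
  have g: "closed_set (switching_kernel H H' \<alpha>) Z" if "switching H H' \<alpha>" and Z: "AE t in H. t \<in> Z" "AE t in H'. t \<in> Z" for H H'
  proof -
    interpret s: switching H H' \<alpha> by fact
    have "AE y in s.K x. y \<in> Z" if "x \<in> Z" for x
    proof -
      have "(\<integral>\<^sup>+y. indicator (- Z) y \<partial>s.K x) = 0"
      proof -
        have 1: "(\<integral>\<^sup>+t. indicator (- Z) (x + t) \<partial>H) = (\<integral>\<^sup>+t. 0 \<partial>H)" if "x \<in> Z" for x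
          by (rule nn_integral_cong_AE) (use Z(1) in eventually_elim, use that in \<open>auto simp: lattice_set_add\<close>)
        have 2: "(\<integral>\<^sup>+t. indicator (- Z) (x + t) \<partial>H') = (\<integral>\<^sup>+t. 0 \<partial>H')" if "x \<in> Z" for x
          by (rule nn_integral_cong_AE) (use Z(2) in eventually_elim, use that in \<open>auto simp: lattice_set_add\<close>)
        show ?thesis using that 1[of x] 2[of x] 1[of 0] 2[of 0] by (subst s.nn_integral_K) auto
      qed
      then show ?thesis by (intro AE_of_integral_Compl) auto
    qed
    then show ?thesis by (simp add: closed_set_def)
  qed
  show "closed_set P.K Z" using g[OF P.switching_axioms Fd Fd'] .
  show "closed_set Q.K Z" using g[OF Q.switching_axioms GZ GZ'] .
qed

lemma supp_sign: "\<exists>g\<in>supp G. g < 0" "\<exists>g\<in>supp G'. 0 < g"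
proof -
  have g: "\<exists>g\<in>supp H. \<sigma> * g < 0" if "ladder \<sigma> E H" for \<sigma> E H
  proof (rule ccontr)
    interpret l: ladder \<sigma> E H by fact
    assume *: "\<not> ?thesis"
    have "AE t in H. t \<in> {0}"
      using l.G_le AE_in_supp[OF l.sG]
    proof eventually_elim
      case (elim t)
      then have "\<sigma> * t = 0" using * by (auto simp: not_less intro: antisym)
      then show ?case using l.\<sigma> by auto
    qed
    then have "emeasure H {0} = emeasure H UNIV" by (intro emeasure_eq_AE) auto
    then show False using l.G_nonzero by simp
  qed
  show "\<exists>g\<in>supp G. g < 0" "\<exists>g\<in>supp G'. 0 < g" using g[OF Lp] g[OF Ln] by auto
qed

text \<open>The closure is the whole line or a lattice of span m. In the second case m \<le> d,
  because G and G', hence F and F', live on that lattice; and m \<ge> d, because m lies in Z. So the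
  closure contains Z in both cases.\<close>

lemma step_sums_dense:
  assumes x: "x \<in> Z" and "0 < \<eta>"
  shows "\<exists>t\<in>step_sums G G'. \<bar>t - x\<bar> < \<eta>"
proof -
  let ?T = "step_sums G G'"
  let ?C = "closure ?T"
  have add: "x + y \<in> ?C" if xy: "x \<in> ?C" "y \<in> ?C" for x y
    unfolding closure_approachable
  proof (intro allI impI)
    fix e :: real assume "0 < e"
    then obtain s t where "s \<in> ?T" "dist s x < e / 2" "t \<in> ?T" "dist t y < e / 2"
      using xy unfolding closure_approachable by (meson half_gt_zero)
    moreover from this have "dist (s + t) (x + y) < e" using dist_triangle_add[of s t x y] by linarith
    ultimately show "\<exists>z\<in>?T. dist z (x + y) < e"
      by (intro bexI[of _ "s + t"] step_sums_add)
  qed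
  have T: "supp G \<subseteq> ?T" "supp G' \<subseteq> ?T"
    using step_sums.left[OF _ step_sums.zero, of _ G G'] step_sums.right[OF _ step_sums.zero, of _ G' G] by auto
  obtain b c where bc: "b \<in> supp G" "b < 0" "c \<in> supp G'" "0 < c" using supp_sign by blast
  have TZ: "t \<in> Z" if "t \<in> ?T" for t
    using that supp_subset_Z[OF A.sG GZ] supp_subset_Z[OF D.sG GZ']
    by (induction rule: step_sums.induct) (auto intro: lattice_set_add)
  have CZ: "?C \<subseteq> Z" using TZ closed_lattice_set[OF d] by (intro closure_minimal) auto
  have "?C = UNIV \<or> (\<exists>m>0. ?C = lattice_set m)"
    using bc T by (intro closed_semigroup_cases[of ?C b c] add closed_closure) (auto intro: closure_subset[THEN subsetD])
  then have "x \<in> ?C"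
  proof
    assume "\<exists>m>0. ?C = lattice_set m"
    then obtain m where m: "0 < m" "?C = lattice_set m" by blast
    have "AE t in G. t \<in> lattice_set m" using AE_in_supp[OF A.sG] by eventually_elim (use T closure_subset m in blast)
    moreover have "AE t in G'. t \<in> lattice_set m" using AE_in_supp[OF D.sG] by eventually_elim (use T closure_subset m in blast)
    ultimately have md: "m \<le> d" using m by (intro d_max A.lattice_from_ladder D.lattice_from_ladder) auto
    have "m \<in> lattice_set m" using m by (auto simp: lattice_set_pos intro: exI[of _ 1])
    then have "m \<in> Z" using CZ m by auto
    then obtain k :: int where k: "m = d * of_int k" using m md by (auto simp: lattice_set_pos)
    then have "1 \<le> k" using m md by (smt (verit) mult_nonneg_nonpos of_int_le_0_iff)
    then have "d * 1 \<le> m" unfolding k using d by (intro mult_left_mono) auto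
    then show ?thesis using md m x by simp
  qed simp
  then show ?thesis using \<open>0 < \<eta>\<close> unfolding closure_approachable by (auto simp: dist_real_def)
qed

lemma ex_supp:
  assumes sH: "sets H = sets borel" and A: "A \<in> sets borel" and "0 < emeasure H A"
  shows "\<exists>t\<in>supp H. t \<in> A"
proof (rule ccontr)
  assume "\<not> ?thesis"
  then have "AE t in H. t \<notin> A" using AE_in_supp[OF sH] by (auto elim!: eventually_mono)
  then have "emeasure H A = 0"
    using A sH sets_eq_imp_space_eq[OF sH] by (subst (asm) AE_iff_measurable[of A]) auto
  then show False using assms by simp
qed

lemma noret_ball:
  assumes x: "x \<in> Z" and z: "z \<in> Z" "0 < emeasure G {..<z}" "0 < emeasure G' {z<..}" and "0 < \<epsilon>"
  shows "noret Q.K (ball z \<epsilon>) x < 1"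
proof -
  obtain a where a: "a \<in> supp G" "a < z" using ex_supp[OF A.sG _ z(2)] by auto
  obtain b where b: "b \<in> supp G'" "z < b" using ex_supp[OF D.sG _ z(3)] by auto
  have "a \<in> Z" "b \<in> Z" using a b supp_subset_Z[OF A.sG GZ] supp_subset_Z[OF D.sG GZ'] by auto
  then have "z - x - a - b \<in> Z" using x z by (intro lattice_set_diff)
  then show ?thesis using step_sums_dense by (intro Q.noret_ball_less_1[OF a b \<open>0 < \<epsilon>\<close>]) auto
qed

text \<open>Coupling replaces continuity: a single start x', moved by \<delta> in the direction of
  the sign of z, dominates all starts within \<delta> of y, so its non-return probability serves as
  q.\<close>

lemma avoid_uniform_dense:
  assumes d0: "d = 0" and z: "z \<noteq> 0" "0 < emeasure G {..<z}" "0 < emeasure G' {z<..}"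
    and B: "B \<in> sets borel" "ball z \<epsilon> \<subseteq> B" "0 < \<epsilon>"
  shows "\<exists>\<delta>>0. \<exists>q<1. \<forall>y'. \<bar>y' - y\<bar> < \<delta> \<longrightarrow> avoid Q.K B y' \<le> q"
proof -
  \<comment> \<open>Shifts are below \<open>2 * \<delta>\<close>. Points within \<delta> of z lie
    beyond the shift because \<open>4 * \<delta> \<le> \<bar>z\<bar>\<close>, and their images stay
    within \<open>3 * \<delta>\<close> of z.\<close>
  define \<delta> where "\<delta> = min \<epsilon> \<bar>z\<bar> / 4"
  have \<delta>: "0 < \<delta>" "4 * \<delta> \<le> \<epsilon>" "4 * \<delta> \<le> \<bar>z\<bar>" using z B by (auto simp: \<delta>_def)
  define x' where "x' = (if 0 < z then y + \<delta> else y - \<delta>)"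
  have lt: "noret Q.K (ball z \<delta>) x' < 1" using z \<delta> d0 by (intro noret_ball) auto
  have "avoid Q.K B y' \<le> noret Q.K (ball z \<delta>) x'" if y': "\<bar>y' - y\<bar> < \<delta>" for y'
  proof -
    have "noret Q.K B y' \<le> noret Q.K (ball z \<delta>) x'"
    proof (rule Q.noret_coupling(1))
      show "y' \<le> x' \<and> (\<forall>w\<in>ball z \<delta>. x' - y' < w \<and> w - (x' - y') \<in> B) \<or>
        x' \<le> y' \<and> (\<forall>w\<in>ball z \<delta>. w < x' - y' \<and> w - (x' - y') \<in> B)"
      proof (cases "0 < z")
        case True
        have "y' \<le> x'" using y' True unfolding x'_def by auto
        moreover have "x' - y' < w \<and> w - (x' - y') \<in> B" if "w \<in> ball z \<delta>" for w
        proof -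
          have w: "\<bar>z - w\<bar> < \<delta>" using that by (simp add: dist_real_def)
          then have "w - (x' - y') \<in> ball z \<epsilon>" using True y' \<delta> unfolding x'_def by (simp add: dist_real_def)
          moreover have "x' - y' < w" using True y' \<delta> w unfolding x'_def by simp
          ultimately show ?thesis using B by blast
        qed
        ultimately show ?thesis by blast
      next
        case False
        have "x' \<le> y'" using y' False unfolding x'_def by auto
        moreover have "w < x' - y' \<and> w - (x' - y') \<in> B" if "w \<in> ball z \<delta>" for w
        proof -
          have w: "\<bar>z - w\<bar> < \<delta>" using that by (simp add: dist_real_def)
          then have "w - (x' - y') \<in> ball z \<epsilon>" using False y' \<delta> unfolding x'_def by (simp add: dist_real_def)
          moreover have "w < x' - y'" using False y' \<delta> w unfolding x'_def by simp
          ultimately show ?thesis using B by blast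
        qed
        ultimately show ?thesis by blast
      qed
    qed (use B in auto)
    then show ?thesis using Q.avoid_le_noret order_trans by blast
  qed
  then show ?thesis using lt \<delta>(1) by blast
qed

end

subsection \<open>Haar measure and supports\<close>

lemma nn_integral_haar:
  assumes "0 < d" and [measurable]: "f \<in> borel_measurable borel"
  shows "(\<integral>\<^sup>+x. f x \<partial>haar_measure d) = ennreal d * (\<integral>\<^sup>+k. f (d * of_int k) \<partial>count_space UNIV)"
proof -
  have "f \<in> borel_measurable (distr (count_space UNIV) borel (\<lambda>k::int. d * of_int k))" by simp
  then show ?thesis using assms(1)
    by (simp add: haar_measure_def nn_integral_scale_measure nn_integral_distr)
qed

lemma emeasure_haar_singleton:
  assumes "0 < d" "z \<in> lattice_set d" shows "emeasure (haar_measure d) {z} = ennreal d"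
proof -
  obtain m :: int where m: "z = d * of_int m" using assms by (auto simp: lattice_set_pos)
  have "emeasure (haar_measure d) {z} = (\<integral>\<^sup>+x. indicator {z} x \<partial>haar_measure d)" by simp
  also have "\<dots> = ennreal d * (\<integral>\<^sup>+k. indicator {z} (d * of_int k) \<partial>count_space UNIV)"
    by (rule nn_integral_haar[OF assms(1)]) simp
  also have "(\<lambda>k::int. indicator {z} (d * of_int k) :: ennreal) = indicator {m}"
    using assms(1) by (auto simp: fun_eq_iff indicator_def m)
  finally show ?thesis by simp
qed

lemma AE_haar: "0 \<le> d \<Longrightarrow> AE x in haar_measure d. x \<in> lattice_set d"
  using emeasure_haar_measure_Compl[of d] by (intro AE_I[of _ _ "- lattice_set d"]) auto

lemma sigma_finite_haar: "0 \<le> d \<Longrightarrow> sigma_finite_measure (haar_measure d)"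
proof (cases "d = 0")
  case True
  then show ?thesis by (simp add: haar_measure_def sigma_finite_lborel)
next
  case False
  assume "0 \<le> d"
  then have d: "0 < d" using False by simp
  have "countable (lattice_set d)" using False by (simp add: lattice_set_def)
  then have c: "countable (insert (- lattice_set d) ((\<lambda>z. {z}) ` lattice_set d))" by simp
  show ?thesis
  proof
    show "\<exists>A. countable A \<and> A \<subseteq> sets (haar_measure d) \<and> \<Union> A = space (haar_measure d) \<and> (\<forall>a\<in>A. emeasure (haar_measure d) a \<noteq> \<infinity>)"
      by (rule exI, intro conjI, rule c)
        (auto simp: emeasure_haar_measure_Compl emeasure_haar_singleton[OF d])
  qed
qed

lemma nn_integral_haar_shift:
  assumes "z \<in> lattice_set d" and [measurable]: "f \<in> borel_measurable borel"
  shows "(\<integral>\<^sup>+x. f (x + z) \<partial>haar_measure d) = (\<integral>\<^sup>+x. f x \<partial>haar_measure d)"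
proof -
  have "(\<integral>\<^sup>+x. f x \<partial>haar_measure d) = (\<integral>\<^sup>+x. f x \<partial>distr (haar_measure d) borel (\<lambda>x. z + x))"
    using haar_measure_translation[OF assms(1)] by simp
  also have "\<dots> = (\<integral>\<^sup>+x. f (z + x) \<partial>haar_measure d)" by (rule nn_integral_distr) auto
  finally show ?thesis by (simp add: add.commute)
qed

lemma closed_supp: "closed (supp \<phi>)"
proof -
  have "- supp \<phi> = \<Union>{G. open G \<and> emeasure \<phi> G = 0}" by (auto simp: supp_def msupport_def)
  then have "open (- supp \<phi>)" by auto
  then show ?thesis unfolding closed_def .
qed

lemma supp_m [measurable]: "supp \<phi> \<in> sets borel"
  using closed_supp by (rule borel_closed)

text \<open>Z is closed and carries the measure, so relative neighbourhoods have the same mass as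
  full ones, and points outside Z have a null neighbourhood.\<close>

lemma msupport_eq_supp:
  assumes "0 \<le> d" and s: "sets \<phi> = sets borel" and Z: "AE x in \<phi>. x \<in> lattice_set d"
  shows "msupport (lattice_set d) \<phi> = supp \<phi>"
proof (intro equalityI subsetI)
  have eq: "emeasure \<phi> (lattice_set d \<inter> T) = emeasure \<phi> T" if "open T" for T
    using Z that s by (intro emeasure_eq_AE) (auto elim!: eventually_mono)
  fix x
  show "x \<in> supp \<phi>" if "x \<in> msupport (lattice_set d) \<phi>"
    unfolding supp_def msupport_def
  proof (intro CollectI conjI UNIV_I allI impI)
    fix G assume "openin (top_of_set UNIV) G" "x \<in> G"
    then have G: "open G" "x \<in> G" by auto
    then have "openin (top_of_set (lattice_set d)) (lattice_set d \<inter> G)" by (auto simp: openin_open)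
    then have "0 < emeasure \<phi> (lattice_set d \<inter> G)" using that G by (auto simp: msupport_def)
    then show "0 < emeasure \<phi> G" using eq[OF G(1)] by simp
  qed
  show "x \<in> msupport (lattice_set d) \<phi>" if x: "x \<in> supp \<phi>"
  proof -
    have "x \<in> lattice_set d"
    proof (rule ccontr)
      assume "x \<notin> lattice_set d"
      then have "open (- lattice_set d)" "x \<in> - lattice_set d" using closed_lattice_set[OF assms(1)] by auto
      then have "0 < emeasure \<phi> (- lattice_set d)" using x by (auto simp: supp_def msupport_def)
      then show False using eq[OF \<open>open (- lattice_set d)\<close>] by simp
    qed
    then show ?thesis using x eq by (auto simp: supp_def msupport_def openin_open)
  qed
qed

lemma emeasure_pos_supp:
  assumes "sets \<phi> = sets borel" "0 < emeasure \<phi> B" "B \<in> sets borel"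
  shows "\<exists>x\<in>B. x \<in> supp \<phi>"
proof (rule ccontr)
  assume "\<not> ?thesis"
  then have "AE x in \<phi>. x \<notin> B" using AE_in_supp[OF assms(1)] by (auto elim!: eventually_mono)
  then have "emeasure \<phi> B = 0"
    using assms sets_eq_imp_space_eq[OF assms(1)] by (subst (asm) AE_iff_measurable[of B]) auto
  then show False using assms by simp
qed

lemma emeasure_supp_ball:
  assumes "x \<in> supp \<phi>" "open T" "x \<in> T" shows "0 < emeasure \<phi> T"
  using assms by (auto simp: supp_def msupport_def)

text \<open>A point t of the support with x + t in U leaves room: for starts near x, a whole ball
  around t is still sent into U.\<close>

lemma shift_open_pos:
  fixes U :: "real set"
  assumes s: "sets H = sets borel" and U: "open U" and pos: "0 < emeasure H {t. x + t \<in> U}"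
  shows "\<exists>\<epsilon>>0. \<forall>x'. \<bar>x' - x\<bar> < \<epsilon> \<longrightarrow> 0 < emeasure H {t. x' + t \<in> U}"
proof -
  have m: "{t. x' + t \<in> U} \<in> sets borel" for x'
  proof -
    have "open ((+) x' -` U)" by (rule open_vimage[OF U]) (intro continuous_intros)
    then show ?thesis by (simp add: vimage_def)
  qed
  obtain t where t: "t \<in> supp H" "x + t \<in> U" using emeasure_pos_supp[OF s pos m] by auto
  obtain e where e: "0 < e" "ball (x + t) e \<subseteq> U" using U t openE by blast
  have "0 < emeasure H {t. x' + t \<in> U}" if x': "\<bar>x' - x\<bar> < e / 2" for x'
  proof -
    have "ball t (e / 2) \<subseteq> {t. x' + t \<in> U}"
    proof
      fix w assume "w \<in> ball t (e / 2)"
      then have "\<bar>t - w\<bar> < e / 2" by (simp add: dist_real_def)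
      then have "x' + w \<in> ball (x + t) e" using x' by (simp add: dist_real_def abs_if split: if_splits)
      then show "w \<in> {t. x' + t \<in> U}" using e by auto
    qed
    then have "emeasure H (ball t (e / 2)) \<le> emeasure H {t. x' + t \<in> U}" using m s by (intro emeasure_mono) auto
    moreover have "0 < emeasure H (ball t (e / 2))" using t e by (intro emeasure_supp_ball) auto
    ultimately show ?thesis by (rule less_le_trans[rotated])
  qed
  then show ?thesis using e by (intro exI[of _ "e / 2"]) auto
qed

context switching
begin

text \<open>Absorption passes from almost every to every point of the support since the kernel
  is lower semicontinuous on open sets away from \<open>0\<close>.\<close>

lemma closed_set_supp:
  assumes s: "sets \<phi> = sets borel"
    and ac: "\<And>N. N \<in> sets borel \<Longrightarrow> emeasure \<phi> N = 0 \<Longrightarrow> AE x in \<phi>. emeasure (K x) N = 0"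
    and zero: "0 < emeasure \<phi> {0} \<or> (\<forall>\<epsilon>>0. 0 < emeasure \<phi> {0<..<\<epsilon>} \<and> 0 < emeasure \<phi> {-\<epsilon><..<0})"
  shows "closed_set K (supp \<phi>)"
proof -
  let ?U = "- supp \<phi>"
  have U: "open ?U" using closed_supp by auto
  then have Um [measurable]: "?U \<in> sets borel" by simp
  have "emeasure \<phi> ?U = 0"
    using AE_in_supp[OF s] s by (subst (asm) AE_iff_measurable[of ?U]) (auto simp: sets_eq_imp_space_eq[OF s])
  then have ae: "AE x in \<phi>. emeasure (K x) ?U = 0" by (intro ac Um)
  have no: False if "B \<in> sets borel" "0 < emeasure \<phi> B" "\<And>x. x \<in> B \<Longrightarrow> 0 < emeasure (K x) ?U" for B
  proof -
    have "AE x in \<phi>. x \<notin> B" using ae by eventually_elim (use that in force)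
    then have "emeasure \<phi> B = 0" using that s by (subst (asm) AE_iff_measurable[of B]) (auto simp: sets_eq_imp_space_eq[OF s])
    then show False using that by simp
  qed
  have m: "{t. x + t \<in> ?U} \<in> sets borel" for x
  proof -
    have "open ((+) x -` ?U)" by (rule open_vimage[OF U]) (intro continuous_intros)
    then show ?thesis by (simp add: vimage_def)
  qed
  have KU: "emeasure (K x) ?U = (if x > 0 then emeasure F {t. x + t \<in> ?U} else if x < 0 then emeasure F' {t. x + t \<in> ?U}
      else ennreal \<alpha> * emeasure F ?U + ennreal (1 - \<alpha>) * emeasure F' ?U)" for x
  proof -
    have i: "(\<integral>\<^sup>+t. indicator ?U (x + t) \<partial>H) = emeasure H {t. x + t \<in> ?U}" if "sets H = sets borel" for H
    proof -
      have "(\<integral>\<^sup>+t. indicator ?U (x + t) \<partial>H) = (\<integral>\<^sup>+t. indicator {t. x + t \<in> ?U} t \<partial>H)"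
        by (intro nn_integral_cong) (auto split: split_indicator)
      also have "\<dots> = emeasure H {t. x + t \<in> ?U}" using m[of x] that by (intro nn_integral_indicator) simp
      finally show ?thesis .
    qed
    have "emeasure (K x) ?U = (\<integral>\<^sup>+y. indicator ?U y \<partial>K x)" by simp
    also have "\<dots> = (if x > 0 then \<integral>\<^sup>+t. indicator ?U (x + t) \<partial>F else if x < 0 then \<integral>\<^sup>+t. indicator ?U (x + t) \<partial>F'
      else ennreal \<alpha> * (\<integral>\<^sup>+t. indicator ?U t \<partial>F) + ennreal (1 - \<alpha>) * (\<integral>\<^sup>+t. indicator ?U t \<partial>F'))"
      by (rule nn_integral_K) measurable
    finally show ?thesis using i[OF sets_F] i[OF sets_F'] by simp
  qed
  have "emeasure (K x) ?U = 0" if x: "x \<in> supp \<phi>" for x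
  proof (rule ccontr)
    assume "emeasure (K x) ?U \<noteq> 0"
    then have pos: "0 < emeasure (K x) ?U" by (simp add: zero_less_iff_neq_zero)
    consider "0 < x" | "x < 0" | "x = 0" by linarith
    then show False
    proof cases
      case 1
      then have "0 < emeasure F {t. x + t \<in> ?U}" using pos by (simp add: KU)
      from shift_open_pos[OF sets_F U this] obtain \<epsilon> where e: "0 < \<epsilon>"
        "\<And>x'. \<bar>x' - x\<bar> < \<epsilon> \<Longrightarrow> 0 < emeasure F {t. x' + t \<in> ?U}" by blast
      show False
      proof (rule no[of "ball x (min \<epsilon> x)"])
        show "0 < emeasure \<phi> (ball x (min \<epsilon> x))" using 1 e by (intro emeasure_supp_ball[OF x]) auto
        show "0 < emeasure (K x') ?U" if "x' \<in> ball x (min \<epsilon> x)" for x'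
          using that e(2)[of x'] 1 by (auto simp: KU dist_real_def)
      qed simp
    next
      case 2
      then have "0 < emeasure F' {t. x + t \<in> ?U}" using pos by (simp add: KU)
      from shift_open_pos[OF sets_F' U this] obtain \<epsilon> where e: "0 < \<epsilon>"
        "\<And>x'. \<bar>x' - x\<bar> < \<epsilon> \<Longrightarrow> 0 < emeasure F' {t. x' + t \<in> ?U}" by blast
      show False
      proof (rule no[of "ball x (min \<epsilon> (- x))"])
        show "0 < emeasure \<phi> (ball x (min \<epsilon> (- x)))" using 2 e by (intro emeasure_supp_ball[OF x]) auto
        show "0 < emeasure (K x') ?U" if "x' \<in> ball x (min \<epsilon> (- x))" for x'
          using that e(2)[of x'] 2 by (auto simp: KU dist_real_def)
      qed simp
    next
      \<comment> \<open>At 0 the kernel mixes both laws. Without an atom at 0, the law that charges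
        the complement of the support still does so from points close to 0 on its own side, and
        these have positive mass.\<close>
      case 3
      show False using zero
      proof
        assume "0 < emeasure \<phi> {0}"
        then show False using pos 3 by (intro no[of "{0}"]) auto
      next
        assume z: "\<forall>\<epsilon>>0. 0 < emeasure \<phi> {0<..<\<epsilon>} \<and> 0 < emeasure \<phi> {-\<epsilon><..<0}"
        have "0 < emeasure F {t. 0 + t \<in> ?U} \<or> 0 < emeasure F' {t. 0 + t \<in> ?U}"
        proof -
          have "{t. 0 + t \<in> ?U} = ?U" by auto
          then show ?thesis using pos 3 by (simp only: KU) (auto simp: zero_less_iff_neq_zero)
        qed
        then show False
        proof
          assume "0 < emeasure F {t. 0 + t \<in> ?U}"
          from shift_open_pos[OF sets_F U this] obtain \<epsilon> where e: "0 < \<epsilon>"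
            "\<And>x'. \<bar>x' - 0\<bar> < \<epsilon> \<Longrightarrow> 0 < emeasure F {t. x' + t \<in> ?U}" by blast
          then show False using z by (intro no[of "{0<..<\<epsilon>}"]) (auto simp: KU)
        next
          assume "0 < emeasure F' {t. 0 + t \<in> ?U}"
          from shift_open_pos[OF sets_F' U this] obtain \<epsilon> where e: "0 < \<epsilon>"
            "\<And>x'. \<bar>x' - 0\<bar> < \<epsilon> \<Longrightarrow> 0 < emeasure F' {t. x' + t \<in> ?U}" by blast
          then show False using z by (intro no[of "{-\<epsilon><..<0}"]) (auto simp: KU)
        qed
      qed
    qed
  qed
  then have "AE y in K x. y \<in> supp \<phi>" if "x \<in> supp \<phi>" for x
    using that by (intro AE_I[of _ _ ?U]) (auto simp: Um)
  then show ?thesis by (simp add: closed_set_def)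
qed

end

subsection \<open>The invariant measure of the ladder height chain\<close>

context switch
begin

sublocale PG: prob_space G by (rule A.G)
sublocale PG': prob_space G' by (rule D.G)

definition "p = measure G {..<0}"
definition "p' = measure G' {0<..}"
definition "a = p * \<alpha> / (p * \<alpha> + p' * (1 - \<alpha>))"

definition dens :: "real \<Rightarrow> real" where
  "dens y = measure G {..<y} + measure G' {y<..} - 1 + a * measure G {y} + (1 - a) * measure G' {y}"

definition nu :: "real measure" where
  "nu = density (haar_measure d) (\<lambda>x. ennreal (dens x))"

lemma G_nonpos: "AE t in G. t \<le> 0" and G'_nonneg: "AE t in G'. 0 \<le> t"
  using A.G_le D.G_le by auto

lemma p_pos: "0 < p" and p'_pos: "0 < p'" and G_zero: "measure G {0} = 1 - p" and G'_zero: "measure G' {0} = 1 - p'"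
proof -
  have "p + measure G {0} = measure G ({..<0} \<union> {0})" unfolding p_def by (rule PG.finite_measure_Union[symmetric]) auto
  also have "\<dots> = 1" using G_nonpos by (subst PG.prob_eq_1) (auto elim!: eventually_mono)
  finally show g: "measure G {0} = 1 - p" by simp
  then show "0 < p" using A.G_nonzero by (simp add: PG.emeasure_eq_measure)
  have "p' + measure G' {0} = measure G' ({0<..} \<union> {0})" unfolding p'_def by (rule PG'.finite_measure_Union[symmetric]) auto
  also have "\<dots> = 1" using G'_nonneg by (subst PG'.prob_eq_1) (auto elim!: eventually_mono)
  finally show g': "measure G' {0} = 1 - p'" by simp
  then show "0 < p'" using D.G_nonzero by (simp add: PG'.emeasure_eq_measure)
qed

lemma c_pos: "0 < p * \<alpha> + p' * (1 - \<alpha>)"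
  using p_pos p'_pos \<alpha> by (cases "\<alpha> = 0") (auto intro: add_pos_nonneg)

lemma a_bounds: "0 \<le> a" "a \<le> 1" and one_minus_a: "1 - a = p' * (1 - \<alpha>) / (p * \<alpha> + p' * (1 - \<alpha>))"
  using c_pos p_pos p'_pos \<alpha> unfolding a_def by (auto simp: field_simps)

lemma G_above: "0 < y \<Longrightarrow> measure G {..<y} = 1" "0 < y \<Longrightarrow> measure G {y} = 0"
  and G'_below: "y < 0 \<Longrightarrow> measure G' {y<..} = 1" "y < 0 \<Longrightarrow> measure G' {y} = 0"
proof -
  show "measure G {..<y} = 1" if "0 < y" using G_nonpos that by (subst PG.prob_eq_1) (auto elim!: eventually_mono)
  show "measure G' {y<..} = 1" if "y < 0" using G'_nonneg that by (subst PG'.prob_eq_1) (auto elim!: eventually_mono)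
  show "measure G {y} = 0" if "0 < y" using G_nonpos that by (subst PG.prob_eq_0) (auto elim!: eventually_mono)
  show "measure G' {y} = 0" if "y < 0" using G'_nonneg that by (subst PG'.prob_eq_0) (auto elim!: eventually_mono)
qed

lemma dens_pos_half: "0 < y \<Longrightarrow> dens y = measure G' {y<..} + (1 - a) * measure G' {y}"
  and dens_neg_half: "y < 0 \<Longrightarrow> dens y = measure G {..<y} + a * measure G {y}"
  by (simp_all add: dens_def G_above G'_below)

lemma dens_zero: "dens 0 = p * p' / (p * \<alpha> + p' * (1 - \<alpha>))"
proof -
  let ?c = "p * \<alpha> + p' * (1 - \<alpha>)"
  have "dens 0 = p * (1 - a) + a * p'"
    by (simp add: dens_def G_zero G'_zero algebra_simps flip: p_def p'_def)
  also have "p * (1 - a) = p * (p' * (1 - \<alpha>)) / ?c" by (simp add: one_minus_a)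
  also have "a * p' = p * \<alpha> * p' / ?c" by (simp add: a_def)
  also have "p * (p' * (1 - \<alpha>)) / ?c + p * \<alpha> * p' / ?c = (p * (p' * (1 - \<alpha>)) + p * \<alpha> * p') / ?c"
    by (rule add_divide_distrib[symmetric])
  also have "p * (p' * (1 - \<alpha>)) + p * \<alpha> * p' = p * p'" by (simp add: algebra_simps)
  finally show ?thesis .
qed

lemma dens_nonneg: "0 \<le> dens y"
  using dens_pos_half[of y] dens_neg_half[of y] dens_zero p_pos p'_pos c_pos a_bounds
  by (cases "y = 0"; cases "0 < y") (auto intro!: add_nonneg_nonneg)

text \<open>The point 0 is split with two different weights: \<open>salpha\<close> is the weight
  that the kernel gives to the first law, whereas \<open>sa\<close> is the one for which the density
  becomes a difference of distribution functions.\<close>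

definition sa :: "real \<Rightarrow> real" where "sa x = indicator {0<..} x + a * indicator {0} x"
definition salpha :: "real \<Rightarrow> real" where "salpha x = indicator {0<..} x + \<alpha> * indicator {0} x"

lemma sa_m [measurable]: "sa \<in> borel_measurable borel" and salpha_m [measurable]: "salpha \<in> borel_measurable borel"
  unfolding sa_def[abs_def] salpha_def[abs_def] by measurable

lemma sa_bounds: "0 \<le> sa x" "sa x \<le> 1" and salpha_bounds: "0 \<le> salpha x" "salpha x \<le> 1"
  using a_bounds \<alpha> by (auto simp: sa_def salpha_def indicator_def)

definition gA :: "real \<Rightarrow> real" where "gA y = (\<integral>t. sa (y - t) \<partial>G)"
definition gB :: "real \<Rightarrow> real" where "gB y = (\<integral>t. sa (y - t) \<partial>G')"

lemma gA_m [measurable]: "gA \<in> borel_measurable borel" and gB_m [measurable]: "gB \<in> borel_measurable borel"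
proof -
  show "gA \<in> borel_measurable borel" unfolding gA_def[abs_def] by measurable
  show "gB \<in> borel_measurable borel" unfolding gB_def[abs_def] by measurable
qed

lemma sa_integrable: "integrable G (\<lambda>t. sa (y - t))" "integrable G' (\<lambda>t. sa (y - t))"
proof -
  show "integrable G (\<lambda>t. sa (y - t))" by (rule PG.integrable_const_bound[of _ 1]) (use sa_bounds in auto)
  show "integrable G' (\<lambda>t. sa (y - t))" by (rule PG'.integrable_const_bound[of _ 1]) (use sa_bounds in auto)
qed

lemma sa_split: "sa (y - t) = indicator {..<y} t + a * indicator {y} t"
  by (auto simp: sa_def indicator_def)

lemma gA_eq: "gA y = measure G {..<y} + a * measure G {y}" and gB_eq: "gB y = measure G' {..<y} + a * measure G' {y}"
proof -
  show "gA y = measure G {..<y} + a * measure G {y}" unfolding gA_def sa_split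
    by (subst Bochner_Integration.integral_add) (auto simp: PG.emeasure_eq_measure)
  show "gB y = measure G' {..<y} + a * measure G' {y}" unfolding gB_def sa_split
    by (subst Bochner_Integration.integral_add) (auto simp: PG'.emeasure_eq_measure)
qed

text \<open>The indicator of the interval from D to A' is a difference of two steps. A step at t
  takes the value a at t itself, whence for D < A' the weight a at D and 1 - a at A'.\<close>

lemma dens_eq: "dens y = gA y - gB y"
proof -
  have "measure G' ({..<y} \<union> {y} \<union> {y<..}) = measure G' ({..<y} \<union> {y}) + measure G' {y<..}"
    by (rule PG'.finite_measure_Union) auto
  moreover have "measure G' ({..<y} \<union> {y}) = measure G' {..<y} + measure G' {y}"
    by (rule PG'.finite_measure_Union) auto
  moreover have "{..<y} \<union> {y} \<union> {y<..} = UNIV" by auto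
  moreover have "measure G' UNIV = 1" using PG'.prob_space by simp
  ultimately have "measure G' {y<..} = 1 - measure G' {..<y} - measure G' {y}" by simp
  then show ?thesis unfolding gA_eq gB_eq dens_def by (simp add: algebra_simps)
qed

lemma dens_m [measurable]: "dens \<in> borel_measurable borel"
  unfolding dens_eq[abs_def] by measurable

text \<open>This is the origin of a: at 0 the identities read
  \<open>\<alpha> * dens 0 = a * p'\<close> and
  \<open>(1 - \<alpha>) * dens 0 = (1 - a) * p\<close>, which hold for this value only. They give
  the densities of nu where the kernel steps with the first and with the second law.\<close>

lemma salpha_dens: "salpha y * dens y = sa y - gB y" "(1 - salpha y) * dens y = gA y - sa y"
proof -
  have "gA y = 1" if "0 < y" using that by (simp add: gA_eq G_above)
  moreover have "gB y = 0" if "y < 0"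
  proof -
    have "measure G' {..<y} = 0" using G'_nonneg that by (subst PG'.prob_eq_0) (auto elim!: eventually_mono)
    then show ?thesis using that by (simp add: gB_eq G'_below)
  qed
  moreover have "gB 0 = a * (1 - p')" 
  proof -
    have "measure G' {..<0} = 0" using G'_nonneg by (subst PG'.prob_eq_0) (auto elim!: eventually_mono)
    then show ?thesis by (simp add: gB_eq G'_zero)
  qed
  moreover have "gA 0 = p + a * (1 - p)" by (simp add: gA_eq G_zero p_def)
  moreover have "\<alpha> * dens 0 = a * p'" "(1 - \<alpha>) * dens 0 = (1 - a) * p"
    unfolding dens_zero one_minus_a by (simp_all add: a_def)
  ultimately show "salpha y * dens y = sa y - gB y" "(1 - salpha y) * dens y = gA y - sa y"
    using dens_eq[of y] by (cases "y = 0"; cases "0 < y"; simp add: salpha_def sa_def algebra_simps)+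
qed

lemma nn_integral_Q_salpha:
  assumes [measurable]: "f \<in> borel_measurable borel"
  shows "(\<integral>\<^sup>+y. f y \<partial>Q.K x) = ennreal (salpha x) * (\<integral>\<^sup>+t. f (x + t) \<partial>G) + ennreal (1 - salpha x) * (\<integral>\<^sup>+t. f (x + t) \<partial>G')"
  by (subst Q.nn_integral_K) (auto simp: salpha_def indicator_def)

lemma nu_sets [simp, measurable_cong]: "sets nu = sets borel"
  by (simp add: nu_def)

lemma nn_integral_nu:
  assumes [measurable]: "f \<in> borel_measurable borel"
  shows "(\<integral>\<^sup>+x. f x \<partial>nu) = (\<integral>\<^sup>+x. ennreal (dens x) * f x \<partial>haar_measure d)"
  unfolding nu_def by (rule nn_integral_density) measurable

text \<open>Both sides equal the expected integral of \<open>f\<close> over the interval between \<open>D\<close> and \<open>A'\<close>.\<close>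

lemma nu_invariant:
  assumes f [measurable]: "f \<in> borel_measurable borel"
  shows "(\<integral>\<^sup>+x. \<integral>\<^sup>+y. f y \<partial>Q.K x \<partial>nu) = (\<integral>\<^sup>+x. f x \<partial>nu)"
proof -
  let ?l = "haar_measure d"
  interpret l: sigma_finite_measure ?l by (rule sigma_finite_haar[OF d])
  have shift: "(\<integral>\<^sup>+x. ennreal (r x) * (\<integral>\<^sup>+t. f (x + t) \<partial>H) \<partial>?l) = (\<integral>\<^sup>+x. f x * (\<integral>\<^sup>+t. ennreal (r (x - t)) \<partial>H) \<partial>?l)"
    if H: "prob_space H" and sH [simp, measurable_cong]: "sets H = sets borel" and HZ: "AE t in H. t \<in> Z"
      and r [measurable]: "r \<in> borel_measurable borel" for r :: "real \<Rightarrow> real" and H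
  proof -
    interpret H: prob_space H by fact
    interpret lH: pair_sigma_finite ?l H ..
    interpret Hl: pair_sigma_finite H ?l ..
    have "(\<integral>\<^sup>+x. ennreal (r x) * (\<integral>\<^sup>+t. f (x + t) \<partial>H) \<partial>?l) = (\<integral>\<^sup>+x. \<integral>\<^sup>+t. ennreal (r x) * f (x + t) \<partial>H \<partial>?l)"
      by (intro nn_integral_cong nn_integral_cmult[symmetric]) measurable
    also have "\<dots> = (\<integral>\<^sup>+t. \<integral>\<^sup>+x. ennreal (r x) * f (x + t) \<partial>?l \<partial>H)"
      by (rule Hl.Fubini') measurable
    also have "\<dots> = (\<integral>\<^sup>+t. \<integral>\<^sup>+x. ennreal (r (x - t)) * f x \<partial>?l \<partial>H)"
    proof (rule nn_integral_cong_AE)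
      show "AE t in H. (\<integral>\<^sup>+x. ennreal (r x) * f (x + t) \<partial>?l) = (\<integral>\<^sup>+x. ennreal (r (x - t)) * f x \<partial>?l)"
        using HZ
      proof eventually_elim
        case (elim t)
        show ?case using nn_integral_haar_shift[OF elim, of "\<lambda>x. ennreal (r (x - t)) * f x"] by simp
      qed
    qed
    also have "\<dots> = (\<integral>\<^sup>+x. \<integral>\<^sup>+t. ennreal (r (x - t)) * f x \<partial>H \<partial>?l)"
      by (rule lH.Fubini') measurable
    also have "\<dots> = (\<integral>\<^sup>+x. f x * (\<integral>\<^sup>+t. ennreal (r (x - t)) \<partial>H) \<partial>?l)"
      by (intro nn_integral_cong) (subst nn_integral_multc, auto simp: mult.commute)
    finally show ?thesis .
  qed
  let ?r1 = "\<lambda>x. sa x - gB x" and ?r2 = "\<lambda>x. gA x - sa x"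
  have r1: "0 \<le> ?r1 y" for y using salpha_dens(1)[of y] dens_nonneg[of y] salpha_bounds[of y] by (metis mult_nonneg_nonneg)
  have r2: "0 \<le> ?r2 y" for y using salpha_dens(2)[of y] dens_nonneg[of y] salpha_bounds[of y] by (metis mult_nonneg_nonneg diff_ge_0_iff_ge)
  have gb: "0 \<le> gA y" "gA y \<le> 1" "0 \<le> gB y" "gB y \<le> 1" for y
    using r1[of y] r2[of y] sa_bounds[of y] PG.integral_le_const[OF sa_integrable(1), of y 1] sa_bounds
    unfolding gB_def gA_def by (auto intro!: integral_nonneg_AE)
  have int: "integrable G (\<lambda>t. gB (y - t))" "integrable G' (\<lambda>t. gA (y - t))" for y
    by (rule PG.integrable_const_bound[of _ 1] PG'.integrable_const_bound[of _ 1]; use gb in simp)+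
  \<comment> \<open>Both sides are the expectation of \<open>sa (y - D - A')\<close> for independent
    D and A'. This cross term cancels when the contributions of the two half-lines are
    added.\<close>
  have comm: "(\<integral>t. gB (y - t) \<partial>G) = (\<integral>t. gA (y - t) \<partial>G')" for y
  proof -
    interpret GG: pair_prob_space G G' ..
    have "integrable (G \<Otimes>\<^sub>M G') (\<lambda>(t, t'). sa (y - t - t'))"
      by (rule GG.integrable_const_bound[of _ 1]) (use sa_bounds in auto)
    from GG.Fubini_integral[OF this] show ?thesis
      unfolding gA_def gB_def by (simp add: algebra_simps)
  qed
  have s1: "(\<integral>\<^sup>+t. ennreal (?r1 (y - t)) \<partial>G) = ennreal (gA y - (\<integral>t. gB (y - t) \<partial>G))" for y
    by (subst nn_integral_eq_integral) (use r1 sa_integrable int in \<open>auto simp: gA_def\<close>)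
  have s2: "(\<integral>\<^sup>+t. ennreal (?r2 (y - t)) \<partial>G') = ennreal ((\<integral>t. gA (y - t) \<partial>G') - gB y)" for y
    by (subst nn_integral_eq_integral) (use r2 sa_integrable int in \<open>auto simp: gB_def\<close>)
  have n1: "0 \<le> gA y - (\<integral>t. gB (y - t) \<partial>G)" for y
  proof -
    have "0 \<le> (\<integral>t. ?r1 (y - t) \<partial>G)" using r1 by (intro integral_nonneg_AE) auto
    then show ?thesis using sa_integrable int by (simp add: gA_def)
  qed
  have n2: "0 \<le> (\<integral>t. gA (y - t) \<partial>G') - gB y" for y
  proof -
    have "0 \<le> (\<integral>t. ?r2 (y - t) \<partial>G')" using r2 by (intro integral_nonneg_AE) auto
    then show ?thesis using sa_integrable int by (simp add: gB_def)
  qed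
  have "(\<integral>\<^sup>+x. \<integral>\<^sup>+y. f y \<partial>Q.K x \<partial>nu) = (\<integral>\<^sup>+x. ennreal (dens x) * (\<integral>\<^sup>+y. f y \<partial>Q.K x) \<partial>?l)"
    by (rule nn_integral_nu) measurable
  also have "\<dots> = (\<integral>\<^sup>+x. ennreal (?r1 x) * (\<integral>\<^sup>+t. f (x + t) \<partial>G) + ennreal (?r2 x) * (\<integral>\<^sup>+t. f (x + t) \<partial>G') \<partial>?l)"
    unfolding salpha_dens[symmetric] nn_integral_Q_salpha[OF f]
    by (intro nn_integral_cong) (simp add: ennreal_mult dens_nonneg salpha_bounds distrib_left ac_simps)
  also have "\<dots> = (\<integral>\<^sup>+x. ennreal (?r1 x) * (\<integral>\<^sup>+t. f (x + t) \<partial>G) \<partial>?l) + (\<integral>\<^sup>+x. ennreal (?r2 x) * (\<integral>\<^sup>+t. f (x + t) \<partial>G') \<partial>?l)"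
    by (rule nn_integral_add) measurable
  also have "\<dots> = (\<integral>\<^sup>+x. f x * ennreal (gA x - (\<integral>t. gB (x - t) \<partial>G)) \<partial>?l) + (\<integral>\<^sup>+x. f x * ennreal ((\<integral>t. gA (x - t) \<partial>G') - gB x) \<partial>?l)"
    by (subst (1 2) shift) (use A.G D.G GZ GZ' in \<open>simp_all add: s1 s2\<close>)
  also have "\<dots> = (\<integral>\<^sup>+x. f x * ennreal (gA x - (\<integral>t. gB (x - t) \<partial>G)) + f x * ennreal ((\<integral>t. gA (x - t) \<partial>G') - gB x) \<partial>?l)"
    by (rule nn_integral_add[symmetric]) measurable
  also have "\<dots> = (\<integral>\<^sup>+x. ennreal (dens x) * f x \<partial>?l)"
  proof (intro nn_integral_cong)
    fix x
    have "ennreal (gA x - (\<integral>t. gB (x - t) \<partial>G)) + ennreal ((\<integral>t. gA (x - t) \<partial>G') - gB x) = ennreal (dens x)"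
      using n1[of x] n2[of x] comm[of x] by (simp add: dens_eq flip: ennreal_plus)
    then show "f x * ennreal (gA x - (\<integral>t. gB (x - t) \<partial>G)) + f x * ennreal ((\<integral>t. gA (x - t) \<partial>G') - gB x) = ennreal (dens x) * f x"
      by (simp add: mult.commute flip: distrib_left)
  qed
  also have "\<dots> = (\<integral>\<^sup>+x. f x \<partial>nu)" by (rule nn_integral_nu[symmetric]) measurable
  finally show ?thesis .
qed

end

context prob_kernel
begin

lemma AE_avoid_of_noret:
  assumes B [measurable]: "B \<in> sets borel" and "\<not> noret K B x < 1"
  shows "AE y in K x. \<not> avoid K B y < 1"
proof -
  have "1 \<le> (\<integral>\<^sup>+y. avoid K B y \<partial>K x)" using assms noret_eq[OF B] by (simp add: not_less)
  moreover have "(\<integral>\<^sup>+y. avoid K B y \<partial>K x) + (\<integral>\<^sup>+y. (1 - avoid K B y) \<partial>K x) = 1"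
    by (subst nn_integral_add[symmetric]) (auto simp: avoid_le_1 add_diff_inverse_ennreal)
  ultimately have "(\<integral>\<^sup>+y. (1 - avoid K B y) \<partial>K x) = 0"
    using nn_K_le[of "avoid K B" 1 x] avoid_le_1
    by (metis (no_types, lifting) add.right_neutral antisym ennreal_add_left_cancel ennreal_one_neq_top infinity_ennreal_def)
  then have "AE y in K x. 1 - avoid K B y = 0" by (subst (asm) nn_integral_0_iff_AE) auto
  then show ?thesis by eventually_elim (metis diff_gt_0_iff_gt_ennreal less_irrefl)
qed

lemma noret_less_1:
  assumes B: "B \<in> sets borel" and A: "A \<in> sets borel" "0 < emeasure (K x) A" "\<And>y. y \<in> A \<Longrightarrow> avoid K B y < 1"
  shows "noret K B x < 1"
proof (rule ccontr)
  assume "\<not> ?thesis"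
  from AE_avoid_of_noret[OF B this] have "AE y in K x. y \<notin> A" by eventually_elim (use A in blast)
  then have "emeasure (K x) A = 0" using A by (subst (asm) AE_iff_measurable[of A]) auto
  then show False using A by simp
qed

end

section \<open>The support of nu and the accessibility of its points\<close>

context switch
begin

abbreviation "E \<equiv> supp nu"

lemma nu_AE_Z: "AE x in nu. x \<in> Z"
  unfolding nu_def by (subst AE_density) (use AE_haar[OF d] in \<open>auto elim!: eventually_mono\<close>)

lemma E_subset_Z: "E \<subseteq> Z"
  using supp_subset_Z[OF nu_sets nu_AE_Z] .

lemma nu_pos:
  assumes S: "S \<in> sets borel" "0 < emeasure (haar_measure d) S" "\<And>x. x \<in> S \<Longrightarrow> 0 < dens x"
  shows "0 < emeasure nu S"
proof (rule ccontr)
  assume "\<not> ?thesis"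
  then have "emeasure nu S = 0" by (simp add: zero_less_iff_neq_zero)
  then have "AE x in nu. x \<notin> S" using S by (subst AE_iff_measurable[of S]) (auto simp: nu_def)
  then have "AE x in haar_measure d. 0 < ennreal (dens x) \<longrightarrow> x \<notin> S"
    unfolding nu_def by (subst (asm) AE_density) measurable
  then have "AE x in haar_measure d. x \<notin> S" by eventually_elim (use S(3) in auto)
  then have "emeasure (haar_measure d) S = 0" using S(1) by (subst (asm) AE_iff_measurable[of S]) auto
  then show False using S by simp
qed

lemma nu_atom: "0 < d \<Longrightarrow> y \<in> Z \<Longrightarrow> 0 < dens y \<Longrightarrow> 0 < emeasure nu {y}"
  by (rule nu_pos) (auto simp: emeasure_haar_singleton)

text \<open>On a lattice a ball of radius d contains a single state, so every point of the support
  is an atom.\<close>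

lemma atom_dens: "0 < d \<Longrightarrow> y \<in> E \<Longrightarrow> 0 < dens y" and atom_nu: "0 < d \<Longrightarrow> y \<in> E \<Longrightarrow> 0 < emeasure nu {y}"
proof -
  assume d: "0 < d" and y: "y \<in> E"
  have yZ: "y \<in> Z" using y E_subset_Z by auto
  have "emeasure nu (ball y d) = emeasure nu {y}"
    using nu_AE_Z lattice_set_dist[OF d _ yZ] d
    by (intro emeasure_eq_AE) (auto elim!: eventually_mono simp: dist_real_def abs_minus_commute)
  then show pos: "0 < emeasure nu {y}" using emeasure_supp_ball[OF y, of "ball y d"] d by simp
  show "0 < dens y"
  proof (rule ccontr)
    assume "\<not> 0 < dens y"
    then have "ennreal (dens y) = 0" by (simp add: ennreal_eq_0_iff)
    then have "emeasure nu {y} = 0" unfolding nu_def by (subst emeasure_density) (auto simp: nn_integral_0_iff_AE indicator_def)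
    then show False using pos by simp
  qed
qed

lemma interval_nu:
  assumes "d = 0" "u < v" "\<And>w. u < w \<Longrightarrow> w < v \<Longrightarrow> 0 < dens w"
  shows "0 < emeasure nu {u<..<v}"
  by (rule nu_pos) (use assms in \<open>auto simp: haar_measure_def\<close>)

lemma dens_below:
  assumes "t \<in> supp G" "t < y" "y \<le> 0" shows "0 < dens y"
proof (cases "y = 0")
  case True
  then show ?thesis using dens_zero p_pos p'_pos c_pos by simp
next
  case False
  have "0 < emeasure G {..<y}" using assms by (intro emeasure_supp_ball[of t]) auto
  then show ?thesis using False assms dens_neg_half[of y] a_bounds by (auto simp: PG.emeasure_eq_measure intro!: add_pos_nonneg)
qed

lemma dens_above:
  assumes "t \<in> supp G'" "y < t" "0 \<le> y" shows "0 < dens y"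
proof (cases "y = 0")
  case True
  then show ?thesis using dens_zero p_pos p'_pos c_pos by simp
next
  case False
  have "0 < emeasure G' {y<..}" using assms by (intro emeasure_supp_ball[of t]) auto
  then show ?thesis using False assms dens_pos_half[of y] a_bounds by (auto simp: PG'.emeasure_eq_measure intro!: add_pos_nonneg)
qed

text \<open>A jump t that carries a positive state across 0 lands in (t, 0], and there the density
  is positive. Intervals next to y are used without a lattice, the atom at y otherwise.\<close>

lemma in_E_below:
  assumes t: "t \<in> supp G" "t < y" "y \<le> 0" "y \<in> Z" shows "y \<in> E"
proof -
  have "0 < emeasure nu T" if T: "open T" "y \<in> T" for T
  proof (cases "d = 0")
    case True
    obtain e where e: "0 < e" "ball y e \<subseteq> T" using T openE by blast
    have "0 < emeasure nu {max t (y - e)<..<y}" using True t e dens_below[OF t(1)] by (intro interval_nu) auto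
    also have "\<dots> \<le> emeasure nu T" using e T by (intro emeasure_mono) (auto simp: dist_real_def subset_iff)
    finally show ?thesis .
  next
    case False
    then have "0 < emeasure nu {y}" using d t dens_below[OF t(1-3)] by (intro nu_atom) auto
    also have "\<dots> \<le> emeasure nu T" using T by (intro emeasure_mono) auto
    finally show ?thesis .
  qed
  then show ?thesis by (auto simp: supp_def msupport_def)
qed

lemma in_E_above:
  assumes t: "t \<in> supp G'" "y < t" "0 \<le> y" "y \<in> Z" shows "y \<in> E"
proof -
  have "0 < emeasure nu T" if T: "open T" "y \<in> T" for T
  proof (cases "d = 0")
    case True
    obtain e where e: "0 < e" "ball y e \<subseteq> T" using T openE by blast
    have "0 < emeasure nu {y<..<min t (y + e)}" using True t e dens_above[OF t(1)] by (intro interval_nu) auto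
    also have "\<dots> \<le> emeasure nu T" using e T by (intro emeasure_mono) (auto simp: dist_real_def subset_iff)
    finally show ?thesis .
  next
    case False
    then have "0 < emeasure nu {y}" using d t dens_above[OF t(1-3)] by (intro nu_atom) auto
    also have "\<dots> \<le> emeasure nu T" using T by (intro emeasure_mono) auto
    finally show ?thesis .
  qed
  then show ?thesis by (auto simp: supp_def msupport_def)
qed

lemma zero_in_E: "0 \<in> E"
  using supp_sign(1) in_E_below[of _ 0] by auto

text \<open>The alternative that \<open>closed_set_supp\<close> requires at the discontinuity 0 of
  the kernel.\<close>

lemma nu_zero: "0 < emeasure nu {0} \<or> (\<forall>\<epsilon>>0. 0 < emeasure nu {0<..<\<epsilon>} \<and> 0 < emeasure nu {-\<epsilon><..<0})"
proof (cases "d = 0")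
  case True
  obtain t t' where t: "t \<in> supp G" "t < 0" "t' \<in> supp G'" "0 < t'" using supp_sign by blast
  have "0 < emeasure nu {0<..<\<epsilon>} \<and> 0 < emeasure nu {-\<epsilon><..<0}" if "0 < \<epsilon>" for \<epsilon>
  proof
    have "0 < emeasure nu {0<..<min \<epsilon> t'}" using True t that dens_above[OF t(3)] by (intro interval_nu) auto
    also have "\<dots> \<le> emeasure nu {0<..<\<epsilon>}" by (intro emeasure_mono) auto
    finally show "0 < emeasure nu {0<..<\<epsilon>}" .
    have "0 < emeasure nu {max (-\<epsilon>) t<..<0}" using True t that dens_below[OF t(1)] by (intro interval_nu) auto
    also have "\<dots> \<le> emeasure nu {-\<epsilon><..<0}" by (intro emeasure_mono) auto
    finally show "0 < emeasure nu {-\<epsilon><..<0}" .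
  qed
  then show ?thesis by blast
next
  case False
  then show ?thesis using d atom_nu[OF _ zero_in_E] by auto
qed

lemma nu_null_Q:
  assumes N [measurable]: "N \<in> sets borel" and "emeasure nu N = 0"
  shows "AE x in nu. emeasure (Q.K x) N = 0"
proof -
  have "(\<integral>\<^sup>+x. emeasure (Q.K x) N \<partial>nu) = (\<integral>\<^sup>+x. \<integral>\<^sup>+y. indicator N y \<partial>Q.K x \<partial>nu)"
    by (intro nn_integral_cong) simp
  also have "\<dots> = 0" using assms nu_invariant[of "indicator N"] by simp
  finally show ?thesis
    using measurable_emeasure_kernel[OF Q.K_meas N] by (subst (asm) nn_integral_0_iff_AE) auto
qed

lemma closed_set_E: "closed_set Q.K E"
  by (rule Q.closed_set_supp[OF nu_sets nu_null_Q nu_zero])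

text \<open>Off the countably many atoms of the two laws, a positive density at z means that G
  charges the points below z and G' those above, which is what \<open>noret_ball\<close>
  needs.\<close>

lemma good_target:
  assumes d0: "d = 0" and B: "B \<in> sets borel" "0 < emeasure nu B"
  shows "\<exists>z\<in>B. z \<noteq> 0 \<and> 0 < emeasure G {..<z} \<and> 0 < emeasure G' {z<..}"
proof -
  let ?S = "{0} \<union> {x. measure G {x} \<noteq> 0} \<union> {x. measure G' {x} \<noteq> 0}"
  have "countable ?S" using PG.countable_support PG'.countable_support by auto
  then have S: "AE x in lborel. x \<notin> ?S" by (intro AE_not_in countable_imp_null_set_lborel)
  have "\<exists>z\<in>B. z \<notin> ?S \<and> 0 < dens z"
  proof (rule ccontr)
    assume "\<not> ?thesis"
    then have "AE x in lborel. 0 < ennreal (dens x) \<longrightarrow> x \<notin> B" using S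
      by - (erule eventually_mono, auto)
    then have "AE x in nu. x \<notin> B" unfolding nu_def haar_measure_def using d0 by (subst AE_density) auto
    then have "emeasure nu B = 0" using B by (subst (asm) AE_iff_measurable[of B]) (auto simp: nu_def)
    then show False using B by simp
  qed
  then obtain z where z: "z \<in> B" "z \<noteq> 0" "measure G {z} = 0" "measure G' {z} = 0" "0 < dens z" by auto
  have "0 < measure G {..<z}" "0 < measure G' {z<..}"
    using z dens_pos_half[of z] dens_neg_half[of z] G_above[of z] G'_below[of z] by (cases "0 < z"; auto)+
  then show ?thesis using z by (auto simp: PG.emeasure_eq_measure PG'.emeasure_eq_measure)
qed

lemma zero_target: "0 < emeasure G {..<0}" "0 < emeasure G' {0<..}"
  using p_pos p'_pos by (auto simp: PG.emeasure_eq_measure PG'.emeasure_eq_measure p_def p'_def)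

text \<open>Without a lattice, z can be replaced by a good target nearby. On a lattice uniformity is
  free, but z may be an extreme point with no mass strictly beyond it; the route then leads through
  0, from which z is reached in one jump.\<close>

lemma avoid_uniform:
  assumes T: "open T" "z \<in> T" "z \<in> E" and B: "B \<in> sets borel" "Z \<inter> T \<subseteq> B" and y: "y \<in> Z"
  shows "\<exists>\<delta>>0. \<exists>q<1. \<forall>y'\<in>Z. \<bar>y' - y\<bar> < \<delta> \<longrightarrow> avoid Q.K B y' \<le> q"
proof (cases "d = 0")
  case True
  have "T \<in> sets borel" using T by auto
  then obtain w where w: "w \<in> T" "w \<noteq> 0" "0 < emeasure G {..<w}" "0 < emeasure G' {w<..}"
    using good_target[OF True, of T] emeasure_supp_ball[OF T(3,1,2)] by auto
  obtain e where e: "0 < e" "ball w e \<subseteq> T" using T w openE by blast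
  then have "ball w e \<subseteq> B" using B True by auto
  from avoid_uniform_dense[OF True w(2-4) B(1) this e(1), of y] show ?thesis by blast
next
  case False
  then have d0: "0 < d" using d by simp
  have zZ: "z \<in> Z" using T E_subset_Z by auto
  have zB: "z \<in> B" using T B zZ by auto
  have near: "noret Q.K A x < 1" if "x \<in> Z" "w \<in> Z" "w \<in> A" "A \<in> sets borel" "0 < emeasure G {..<w}" "0 < emeasure G' {w<..}" for x w A
  proof -
    have "noret Q.K A x \<le> noret Q.K (ball w d) x"
      by (rule Q.noret_antimono[OF closed_set_Q])
        (use that lattice_set_dist[OF d0] in \<open>auto simp: dist_real_def abs_minus_commute\<close>)
    also have "\<dots> < 1" using that d0 by (intro noret_ball) auto
    finally show ?thesis .
  qed
  have 0: "avoid Q.K {0} x < 1" if "x \<in> Z" for x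
    by (rule le_less_trans[OF Q.avoid_le_noret near[OF that, of 0]]) (use zero_target in auto)
  have z0: "avoid Q.K B 0 < 1"
  proof -
    have "noret Q.K B 0 < 1"
    proof (cases "0 < emeasure G {..<z} \<and> 0 < emeasure G' {z<..}")
      case True
      then show ?thesis using zZ zB B by (intro near) auto
    next
      case False
      have dz: "0 < dens z" by (rule atom_dens[OF d0 T(3)])
      have "0 < emeasure (Q.K 0) {z}"
      proof -
        have k: "emeasure (Q.K 0) {z} = ennreal \<alpha> * emeasure G {z} + ennreal (1 - \<alpha>) * emeasure G' {z}"
          using Q.nn_integral_K[of "indicator {z}" 0] by simp
        consider "z = 0" | "0 < z" | "z < 0" by linarith
        then show ?thesis
        proof cases
          case 1 then show ?thesis using False zero_target by auto
        next
          case 2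
          then have "measure G' {z<..} = 0" using False G_above(1)[OF 2]
            by (auto simp: PG.emeasure_eq_measure PG'.emeasure_eq_measure not_less measure_le_0_iff)
          \<comment> \<open>With no mass of G' beyond z, the density at z comes from the atom alone.
            A positive factor 1 - a excludes \<alpha> = 1, so from 0 the second law may be
            chosen.\<close>
          then have "0 < (1 - a) * measure G' {z}" using dz dens_pos_half[OF 2] by simp
          then have "0 < measure G' {z}" "a \<noteq> 1" using a_bounds by (auto simp: zero_less_mult_iff)
          moreover from this have "\<alpha> < 1" using \<alpha> p_pos by (auto simp: a_def less_le)
          ultimately have "0 < ennreal (1 - \<alpha>) * emeasure G' {z}"
            by (auto simp: ennreal_zero_less_mult_iff PG'.emeasure_eq_measure)
          then show ?thesis unfolding k by (simp add: add_nonneg_pos)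
        next
          case 3
          then have "measure G {..<z} = 0" using False G'_below(1)[OF 3]
            by (auto simp: PG.emeasure_eq_measure PG'.emeasure_eq_measure not_less measure_le_0_iff)
          then have "0 < a * measure G {z}" using dz dens_neg_half[OF 3] by simp
          then have "0 < measure G {z}" "a \<noteq> 0" using a_bounds by (auto simp: zero_less_mult_iff)
          moreover from this have "0 < \<alpha>" using \<alpha> by (auto simp: a_def less_le)
          ultimately have "0 < ennreal \<alpha> * emeasure G {z}"
            by (auto simp: ennreal_zero_less_mult_iff PG.emeasure_eq_measure)
          then show ?thesis unfolding k by (simp add: add_pos_nonneg)
        qed
      qed
      then show ?thesis using zB by (intro Q.noret_less_1[OF B(1), of "{z}"]) auto
    qed
    then show ?thesis using Q.avoid_le_noret le_less_trans by blast
  qed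
  have "avoid Q.K B y < 1"
    by (rule Q.avoid_less_1_trans[OF _ B(1) closed_set_Q y 0[OF y]]) (use z0 in auto)
  moreover have "y' = y" if "y' \<in> Z" "\<bar>y' - y\<bar> < d" for y' using lattice_set_dist[OF d0] that y by auto
  ultimately show ?thesis using d0 by (intro exI[of _ d] conjI exI[of _ "avoid Q.K B y"]) auto
qed

text \<open>When the chain crosses \<open>0\<close>, it enters the support of \<open>\<nu>\<close>.\<close>

lemma avoid_E: "x \<in> Z \<Longrightarrow> avoid Q.K E x = 0"
proof -
  let ?\<theta> = "\<lambda>x. indicator Z x * avoid Q.K E x"
  have le1: "?\<theta> y \<le> 1" for y using Q.avoid_le_1[of E y] by (auto split: split_indicator)
  have pos: "?\<theta> z \<le> up 1 G ?\<theta> z" if z: "0 < 1 * z" for z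
  proof (cases "z \<in> Z")
    case True
    have "?\<theta> z = avoid Q.K E z" using True by simp
    also have "\<dots> \<le> (\<integral>\<^sup>+y. avoid Q.K E y \<partial>Q.K z)" by (rule Q.avoid_subharmonic) simp
    also have "\<dots> = (\<integral>\<^sup>+t. avoid Q.K E (z + t) \<partial>G)" using z by (subst Q.nn_integral_K) auto
    also have "\<dots> \<le> up 1 G ?\<theta> z"
      unfolding up_def
    proof (rule nn_integral_mono_AE)
      show "AE t in G. avoid Q.K E (z + t) \<le> indicator {0<..} (1 * (z + t)) * ?\<theta> (z + t)"
        using GZ AE_in_supp[OF A.sG]
      proof eventually_elim
        case (elim t)
        have "z + t \<in> Z" using elim True by (intro lattice_set_add)
        then show ?case using in_E_below[of t "z + t"] elim z by (cases "0 < z + t") auto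
      qed
    qed
    finally show ?thesis .
  qed simp
  have neg: "?\<theta> z \<le> up (-1) G' ?\<theta> z" if z: "0 < -1 * z" for z
  proof (cases "z \<in> Z")
    case True
    have "?\<theta> z = avoid Q.K E z" using True by simp
    also have "\<dots> \<le> (\<integral>\<^sup>+y. avoid Q.K E y \<partial>Q.K z)" by (rule Q.avoid_subharmonic) simp
    also have "\<dots> = (\<integral>\<^sup>+t. avoid Q.K E (z + t) \<partial>G')" using z by (subst Q.nn_integral_K) auto
    also have "\<dots> \<le> up (-1) G' ?\<theta> z"
      unfolding up_def
    proof (rule nn_integral_mono_AE)
      show "AE t in G'. avoid Q.K E (z + t) \<le> indicator {0<..} (-1 * (z + t)) * ?\<theta> (z + t)"
        using GZ' AE_in_supp[OF D.sG]
      proof eventually_elim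
        case (elim t)
        have "z + t \<in> Z" using elim True by (intro lattice_set_add)
        then show ?case using in_E_above[of t "z + t"] elim z by (cases "z + t < 0") auto
      qed
    qed
    finally show ?thesis .
  qed simp
  assume x: "x \<in> Z"
  consider "0 < x" | "x < 0" | "x = 0" by linarith
  then show ?thesis
  proof cases
    case 1
    have "?\<theta> x = 0" by (rule A.crossing_zero[OF _ le1 pos]) (use 1 in auto)
    then show ?thesis using x by simp
  next
    case 2
    have "?\<theta> x = 0" by (rule D.crossing_zero[OF _ le1 neg]) (use 2 in auto)
    then show ?thesis using x by simp
  qed (simp add: zero_in_E)
qed

end

subsection \<open>Finite crossing flux implies recurrence\<close>

context switch
begin

text \<open>Crossings are counted weakly, landing at 0 included, and every step from 0 counts as
  one; so cutting a path at its crossings leaves pieces inside the open half-lines.\<close>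

definition cross :: "real \<Rightarrow> ennreal" where
  "cross x = (if 0 < x then \<integral>\<^sup>+t. indicator {..0} (x + t) \<partial>G
     else if x < 0 then \<integral>\<^sup>+t. indicator {0..} (x + t) \<partial>G' else 1)"

lemma cross_m [measurable]: "cross \<in> borel_measurable borel"
  unfolding cross_def[abs_def] by measurable

text \<open>Expected number of crossings before the return to \<open>B\<close>, truncated at time \<open>n\<close>.\<close>

primrec crossings :: "real set \<Rightarrow> nat \<Rightarrow> real \<Rightarrow> ennreal" where
  "crossings B 0 x = 0"
| "crossings B (Suc n) x = cross x + (\<integral>\<^sup>+y. indicator (- B) y * crossings B n y \<partial>Q.K x)"

definition "total_crossings B x = (SUP n. crossings B n x)"

lemma crossings_m [measurable]:
  assumes [measurable]: "B \<in> sets borel"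
  shows "crossings B n \<in> borel_measurable borel"
proof (induction n)
  case 0 show ?case unfolding crossings.simps(1)[abs_def] by measurable
next
  case (Suc n)
  note [measurable] = Suc
  show ?case unfolding crossings.simps(2)[abs_def] by measurable
qed

lemma total_crossings_m [measurable]:
  assumes [measurable]: "B \<in> sets borel"
  shows "total_crossings B \<in> borel_measurable borel"
  unfolding total_crossings_def[abs_def] by measurable

lemma crossings_mono: "crossings B n x \<le> crossings B (Suc n) x"
proof (induction n arbitrary: x)
  case (Suc n) then show ?case
    by (subst (1 2) crossings.simps(2)) (intro add_left_mono nn_integral_mono mult_left_mono, auto simp del: crossings.simps)
qed simp

lemma total_crossings_eq:
  assumes [measurable]: "B \<in> sets borel"
  shows "total_crossings B x = cross x + (\<integral>\<^sup>+y. indicator (- B) y * total_crossings B y \<partial>Q.K x)"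
proof -
  have inc: "incseq (\<lambda>n y. indicator (- B) y * crossings B n y)"
    by (intro incseq_SucI le_funI mult_left_mono crossings_mono) auto
  have "total_crossings B x = (SUP n. crossings B (Suc n) x)"
    unfolding total_crossings_def
  proof (intro antisym SUP_least)
    show "crossings B n x \<le> (SUP n. crossings B (Suc n) x)" for n
      by (rule order_trans[OF crossings_mono]) (rule SUP_upper, simp)
    show "crossings B (Suc n) x \<le> (SUP n. crossings B n x)" for n by (rule SUP_upper) simp
  qed
  also have "\<dots> = cross x + (SUP n. \<integral>\<^sup>+y. indicator (- B) y * crossings B n y \<partial>Q.K x)"
    unfolding crossings.simps add.commute[of "cross x"] by (rule ennreal_SUP_add_left) simp
  also have "(SUP n. \<integral>\<^sup>+y. indicator (- B) y * crossings B n y \<partial>Q.K x) = (\<integral>\<^sup>+y. (SUP n. indicator (- B) y * crossings B n y) \<partial>Q.K x)"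
    by (rule nn_integral_monotone_convergence_SUP[OF inc, symmetric]) measurable
  also have "\<dots> = (\<integral>\<^sup>+y. indicator (- B) y * total_crossings B y \<partial>Q.K x)"
    unfolding total_crossings_def by (intro nn_integral_cong) (auto split: split_indicator)
  finally show ?thesis .
qed

text \<open>By invariance of \<open>\<nu>\<close>, the crossings counted from the last visit to \<open>B\<close> cost at most one unit of flux.\<close>

lemma crossings_flux:
  assumes B [measurable]: "B \<in> sets borel" and fin: "(\<integral>\<^sup>+x. cross x \<partial>nu) < \<infinity>"
  shows "(\<integral>\<^sup>+x. indicator B x * total_crossings B x \<partial>nu) < \<infinity>"
proof -
  let ?I = "\<integral>\<^sup>+x. cross x \<partial>nu"
  have step: "(\<integral>\<^sup>+x. crossings B (Suc n) x \<partial>nu) = ?I + (\<integral>\<^sup>+x. indicator (- B) x * crossings B n x \<partial>nu)" for n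
    unfolding crossings.simps using nu_invariant[of "\<lambda>y. indicator (- B) y * crossings B n y"]
    by (subst nn_integral_add) auto
  have f: "(\<integral>\<^sup>+x. crossings B n x \<partial>nu) < \<infinity>" for n
  proof (induction n)
    case (Suc n)
    have "(\<integral>\<^sup>+x. indicator (- B) x * crossings B n x \<partial>nu) \<le> (\<integral>\<^sup>+x. crossings B n x \<partial>nu)"
      by (intro nn_integral_mono) (auto split: split_indicator)
    then have "(\<integral>\<^sup>+x. indicator (- B) x * crossings B n x \<partial>nu) < \<infinity>" using Suc by (rule le_less_trans)
    then show ?case unfolding step using fin by (simp add: less_top)
  qed simp
  have "(\<integral>\<^sup>+x. indicator B x * crossings B n x \<partial>nu) \<le> ?I" for n
  proof -
    let ?c = "\<integral>\<^sup>+x. indicator (- B) x * crossings B n x \<partial>nu"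
    \<comment> \<open>The term \<open>?c\<close> occurs on both sides and must be finite to be
      cancelled; this is why the count is truncated at time n.\<close>
    have cf: "?c < \<infinity>"
      by (rule le_less_trans[OF _ f[of n]]) (auto intro!: nn_integral_mono split: split_indicator)
    have "(\<integral>\<^sup>+x. indicator B x * crossings B n x \<partial>nu) + ?c \<le> (\<integral>\<^sup>+x. indicator B x * crossings B (Suc n) x \<partial>nu) + (\<integral>\<^sup>+x. indicator (- B) x * crossings B (Suc n) x \<partial>nu)"
      by (intro add_mono nn_integral_mono mult_left_mono crossings_mono) auto
    also have "\<dots> = (\<integral>\<^sup>+x. crossings B (Suc n) x \<partial>nu)"
      by (subst nn_integral_add[symmetric]) (auto intro!: nn_integral_cong split: split_indicator simp del: crossings.simps)
    also have "\<dots> = ?I + ?c" by (rule step)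
    finally show ?thesis using cf by (simp add: less_top[symmetric] ennreal_add_left_cancel_le add.commute[of _ ?c])
  qed
  then have "(SUP n. \<integral>\<^sup>+x. indicator B x * crossings B n x \<partial>nu) \<le> ?I" by (intro SUP_least)
  moreover have "(SUP n. \<integral>\<^sup>+x. indicator B x * crossings B n x \<partial>nu) = (\<integral>\<^sup>+x. (SUP n. indicator B x * crossings B n x) \<partial>nu)"
    by (rule nn_integral_monotone_convergence_SUP[symmetric])
      (auto intro!: incseq_SucI le_funI mult_left_mono crossings_mono simp del: crossings.simps)
  moreover have "(\<integral>\<^sup>+x. (SUP n. indicator B x * crossings B n x) \<partial>nu) = (\<integral>\<^sup>+x. indicator B x * total_crossings B x \<partial>nu)"
    unfolding total_crossings_def by (intro nn_integral_cong) (auto split: split_indicator)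
  ultimately show ?thesis using fin by (metis le_less_trans)
qed

text \<open>Induction on m pays for each further multiple of \<open>noret\<close> with one crossing.
  The defect \<theta> between the two sides is at most 1 by the previous case, and off 0 it is
  subharmonic for the walk killed at the crossing, so \<open>crossing_zero\<close> makes it
  vanish.\<close>

lemma noret_crossings:
  assumes B [measurable]: "B \<in> sets borel"
  shows "of_nat m * noret Q.K B x \<le> total_crossings B x"
proof (induction m arbitrary: x)
  case (Suc m)
  let ?v = "noret Q.K B" and ?u = "total_crossings B"
  have v1: "?v y \<le> 1" for y by (rule Q.noret_le_1)
  have vS: "of_nat (Suc m) * ?v y \<le> ?u y + 1" for y
    using add_mono[OF Suc[of y] v1[of y]] by (simp add: distrib_right add.commute)
  have veq: "of_nat (Suc m) * ?v y = (\<integral>\<^sup>+w. indicator (- B) w * (of_nat (Suc m) * ?v w) \<partial>Q.K y)" for y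
  proof -
    have "of_nat (Suc m) * ?v y = of_nat (Suc m) * (\<integral>\<^sup>+w. avoid Q.K B w \<partial>Q.K y)" using Q.noret_eq[OF B] by simp
    also have "\<dots> = (\<integral>\<^sup>+w. of_nat (Suc m) * avoid Q.K B w \<partial>Q.K y)" by (rule nn_integral_cmult[symmetric]) measurable
    also have "\<dots> = (\<integral>\<^sup>+w. indicator (- B) w * (of_nat (Suc m) * ?v w) \<partial>Q.K y)"
      by (intro nn_integral_cong) (simp add: avoid_def ac_simps)
    finally show ?thesis .
  qed
  define \<theta> where "\<theta> y = of_nat (Suc m) * ?v y - ?u y" for y
  have [measurable]: "\<theta> \<in> borel_measurable borel" unfolding \<theta>_def[abs_def] by measurable
  have ntop: "of_nat (Suc m) * ?v y \<noteq> \<top>" for y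
    using v1[of y] by (simp only: ennreal_mult_eq_top_iff) (auto simp: top_unique)
  have \<theta>1: "\<theta> y \<le> 1" for y
    unfolding \<theta>_def using vS[of y] ntop by (simp only: ennreal_minus_le_iff) simp
  have v\<theta>: "of_nat (Suc m) * ?v y \<le> ?u y + \<theta> y" for y
    unfolding \<theta>_def by (cases "?u y \<le> of_nat (Suc m) * ?v y")
      (auto simp: add_diff_inverse_ennreal intro: order_trans[of _ "?u y"])
  have \<theta>I: "\<theta> z \<le> c" if "of_nat (Suc m) * ?v z \<le> ?u z + c" for z c
    unfolding \<theta>_def using that ntop by (simp only: ennreal_minus_le_iff) simp
  have pos: "\<theta> z \<le> up 1 G \<theta> z" if z: "0 < 1 * z" for z
  proof (rule \<theta>I)
    have "of_nat (Suc m) * ?v z \<le> (\<integral>\<^sup>+w. indicator {..0} w + (indicator (- B) w * ?u w + indicator {0<..} w * \<theta> w) \<partial>Q.K z)"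
      unfolding veq[of z]
    proof (rule nn_integral_mono)
      fix w show "indicator (- B) w * (of_nat (Suc m) * ?v w) \<le> indicator {..0} w + (indicator (- B) w * ?u w + indicator {0<..} w * \<theta> w)"
        using vS[of w] v\<theta>[of w] by (cases "0 < w"; cases "w \<in> B") (auto simp: add.commute)
    qed
    also have "\<dots> = (\<integral>\<^sup>+w. indicator {..0} w \<partial>Q.K z) + ((\<integral>\<^sup>+w. indicator (- B) w * ?u w \<partial>Q.K z) + (\<integral>\<^sup>+w. indicator {0<..} w * \<theta> w \<partial>Q.K z))"
      by (simp add: nn_integral_add)
    also have "(\<integral>\<^sup>+w. indicator {..0} w \<partial>Q.K z) = cross z"
      using Q.nn_integral_K[of "indicator {..0}" z] z by (simp add: cross_def)
    also have "(\<integral>\<^sup>+w. indicator {0<..} w * \<theta> w \<partial>Q.K z) = up 1 G \<theta> z"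
      using Q.nn_integral_K[of "\<lambda>w. indicator {0<..} w * \<theta> w" z] z by (simp add: up_def)
    finally show "of_nat (Suc m) * ?v z \<le> ?u z + up 1 G \<theta> z"
      unfolding total_crossings_eq[OF B, of z] by (simp add: add.assoc)
  qed
  have neg: "\<theta> z \<le> up (-1) G' \<theta> z" if z: "0 < -1 * z" for z
  proof (rule \<theta>I)
    have "of_nat (Suc m) * ?v z \<le> (\<integral>\<^sup>+w. indicator {0..} w + (indicator (- B) w * ?u w + indicator {..<0} w * \<theta> w) \<partial>Q.K z)"
      unfolding veq[of z]
    proof (rule nn_integral_mono)
      fix w show "indicator (- B) w * (of_nat (Suc m) * ?v w) \<le> indicator {0..} w + (indicator (- B) w * ?u w + indicator {..<0} w * \<theta> w)"
        using vS[of w] v\<theta>[of w] by (cases "w < 0"; cases "w \<in> B") (auto simp: add.commute)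
    qed
    also have "\<dots> = (\<integral>\<^sup>+w. indicator {0..} w \<partial>Q.K z) + ((\<integral>\<^sup>+w. indicator (- B) w * ?u w \<partial>Q.K z) + (\<integral>\<^sup>+w. indicator {..<0} w * \<theta> w \<partial>Q.K z))"
      by (simp add: nn_integral_add)
    also have "(\<integral>\<^sup>+w. indicator {0..} w \<partial>Q.K z) = cross z"
      using Q.nn_integral_K[of "indicator {0..}" z] z by (simp add: cross_def)
    also have "(\<integral>\<^sup>+w. indicator {..<0} w * \<theta> w \<partial>Q.K z) = up (-1) G' \<theta> z"
    proof -
      have "(\<integral>\<^sup>+w. indicator {..<0} w * \<theta> w \<partial>Q.K z) = (\<integral>\<^sup>+t. indicator {..<0} (z + t) * \<theta> (z + t) \<partial>G')"
        using Q.nn_integral_K[of "\<lambda>w. indicator {..<0} w * \<theta> w" z] z by simp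
      also have "\<dots> = up (-1) G' \<theta> z"
        unfolding up_def by (intro nn_integral_cong) (auto simp: indicator_def)
      finally show ?thesis .
    qed
    finally show "of_nat (Suc m) * ?v z \<le> ?u z + up (-1) G' \<theta> z"
      unfolding total_crossings_eq[OF B, of z] by (simp add: add.assoc)
  qed
  consider "0 < x" | "x < 0" | "x = 0" by linarith
  then show ?case
  proof cases
    case 1
    have "\<theta> x = 0" by (rule A.crossing_zero[OF _ \<theta>1 pos]) (use 1 in auto)
    then show ?thesis using v\<theta>[of x] by simp
  next
    case 2
    have "\<theta> x = 0" by (rule D.crossing_zero[OF _ \<theta>1 neg]) (use 2 in auto)
    then show ?thesis using v\<theta>[of x] by simp
  next
    case 3
    \<comment> \<open>At 0 the extra unit is paid at once by \<open>cross 0 = 1\<close>.\<close>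
    have "of_nat (Suc m) * ?v 0 \<le> (\<integral>\<^sup>+w. 1 + indicator (- B) w * ?u w \<partial>Q.K 0)"
      unfolding veq[of 0]
      by (intro nn_integral_mono) (use vS in \<open>auto split: split_indicator simp: add.commute\<close>)
    also have "\<dots> = ?u 0"
      unfolding total_crossings_eq[OF B, of 0] by (subst nn_integral_add) (auto simp: cross_def)
    finally show ?thesis using 3 by simp
  qed
qed simp

lemma noret_zero_of_crossings:
  assumes B: "B \<in> sets borel" and "total_crossings B x < \<infinity>"
  shows "noret Q.K B x = 0"
proof (rule ccontr)
  assume ne: "noret Q.K B x \<noteq> 0"
  have "noret Q.K B x \<noteq> \<top>" using Q.noret_le_1[of B x] by (auto simp: top_unique)
  then obtain r where r: "noret Q.K B x = ennreal r" "0 < r"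
    using ne by (cases "noret Q.K B x") (auto simp: ennreal_eq_0_iff less_le)
  obtain s where s: "total_crossings B x = ennreal s" "0 \<le> s" using assms(2) by (cases "total_crossings B x") auto
  obtain m :: nat where m: "s < real m * r" using reals_Archimedean3[OF r(2)] by blast
  have "ennreal (real m * r) \<le> ennreal s"
    using noret_crossings[OF B, of m x] r s by (simp add: ennreal_mult ennreal_of_nat_eq_real_of_nat)
  then show False using m s r by (simp add: ennreal_le_iff)
qed

lemma AE_recurrent:
  assumes B [measurable]: "B \<in> sets borel" and fin: "(\<integral>\<^sup>+x. cross x \<partial>nu) < \<infinity>"
  shows "AE x in nu. x \<in> B \<longrightarrow> noret Q.K B x = 0"
proof -
  have "AE x in nu. indicator B x * total_crossings B x \<noteq> \<infinity>"
    by (rule nn_integral_PInf_AE) (use crossings_flux[OF B fin] in auto)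
  then show ?thesis
    by eventually_elim (auto intro!: noret_zero_of_crossings[OF B] simp: less_top)
qed

text \<open>Recurrence extends from almost every point to all points by coupling with the same stacks of increments.\<close>

lemma recurrent_inner:
  assumes d0: "d = 0" and fin: "(\<integral>\<^sup>+x. cross x \<partial>nu) < \<infinity>"
    and x: "0 < x \<and> (\<exists>t\<in>supp G'. x < t) \<or> x < 0 \<and> (\<exists>t\<in>supp G. t < x)"
    and B: "open B" "x \<in> B"
  shows "noret Q.K B x = 0"
proof -
  obtain e where e: "0 < e" "ball x e \<subseteq> B" using B openE by blast
  have Bm: "B \<in> sets borel" using B by simp
  have no: "\<exists>x'\<in>C. noret Q.K C x' = 0" if C: "C \<in> sets borel" "0 < emeasure nu C" for C
  proof (rule ccontr)
    assume *: "\<not> ?thesis"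
    have "AE x in nu. x \<notin> C" using AE_recurrent[OF C(1) fin] by eventually_elim (use * in blast)
    then have "emeasure nu C = 0" using C by (subst (asm) AE_iff_measurable[of C]) (auto simp: nu_def)
    then show False using C by simp
  qed
  from x show ?thesis
  proof
    assume "0 < x \<and> (\<exists>t\<in>supp G'. x < t)"
    then obtain t where t: "0 < x" "t \<in> supp G'" "x < t" by blast
    \<comment> \<open>The bound by x keeps the targets farther from 0 than the shift x' - x, the
      bound by e keeps the translated points in B, and the bound by t - x keeps the density positive
      up to x + r.\<close>
    define r where "r = min (min x e) (t - x)"
    have r: "0 < r" "r \<le> x" "r \<le> e" "r \<le> t - x" using t e by (auto simp: r_def)
    have "0 < emeasure nu {x<..<x + r}" using dens_above[OF t(2)] t r by (intro interval_nu[OF d0]) auto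
    from no[OF _ this] obtain x' where x': "x < x'" "x' < x + r" "noret Q.K {x<..<x + r} x' = 0" by auto
    have "noret Q.K B x \<le> noret Q.K {x<..<x + r} x'"
      by (rule Q.noret_coupling(1)[OF Bm]) (use x' r e in \<open>auto simp: dist_real_def subset_iff\<close>)
    then show ?thesis using x' by simp
  next
    assume "x < 0 \<and> (\<exists>t\<in>supp G. t < x)"
    then obtain t where t: "x < 0" "t \<in> supp G" "t < x" by blast
    define r where "r = min (min (- x) e) (x - t)"
    have r: "0 < r" "r \<le> - x" "r \<le> e" "r \<le> x - t" using t e by (auto simp: r_def)
    have "0 < emeasure nu {x - r<..<x}" using dens_below[OF t(2)] t r by (intro interval_nu[OF d0]) auto
    from no[OF _ this] obtain x' where x': "x - r < x'" "x' < x" "noret Q.K {x - r<..<x} x' = 0" by auto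
    have "noret Q.K B x \<le> noret Q.K {x - r<..<x} x'"
      by (rule Q.noret_coupling(1)[OF Bm]) (use x' r e in \<open>auto simp: dist_real_def subset_iff\<close>)
    then show ?thesis using x' by simp
  qed
qed

text \<open>Left out are 0 and the extreme points of the support, since the coupling needs charged
  points on the outer side.\<close>

definition "interior_pts = {x. 0 < x \<and> (\<exists>t\<in>supp G'. x < t) \<or> x < 0 \<and> (\<exists>t\<in>supp G. t < x)}"

lemma open_inner: "open interior_pts"
proof -
  have "interior_pts = {0<..} \<inter> (\<Union>t\<in>supp G'. {..<t}) \<union> {..<0} \<inter> (\<Union>t\<in>supp G. {t<..})" by (auto simp: interior_pts_def)
  then show ?thesis by (simp only:) (intro open_Un open_Int open_UN ballI open_greaterThan open_lessThan)
qed

text \<open>Besides 0 at most one point remains on each side: beyond a positive point that G' does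
  not exceed, the density vanishes, and likewise below 0.\<close>

lemma finite_outer: "finite (E - interior_pts)"
proof -
  have one: "finite S" if "\<And>x y. x \<in> S \<Longrightarrow> y \<in> S \<Longrightarrow> x < y \<Longrightarrow> False" for S :: "real set"
  proof (cases "S = {}")
    case False
    then obtain s where "s \<in> S" by auto
    then have "S \<subseteq> {s}" using that by (metis insertI1 linorder_neqE_linordered_idom subsetI)
    then show ?thesis by (rule finite_subset) simp
  qed simp
  have up: False if x: "x \<in> E - interior_pts" "0 < x" "x < y" "y \<in> E" for x y
  proof -
    have "AE t in G'. t \<le> x" using AE_in_supp[OF D.sG] by eventually_elim (use x in \<open>auto simp: interior_pts_def not_less\<close>)
    then have "measure G' {w<..} = 0 \<and> measure G' {w} = 0" if "x < w" for w
      using that by (intro conjI; subst PG'.prob_eq_0) (auto elim!: eventually_mono)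
    then have "dens w = 0" if "x < w" for w using that x dens_pos_half[of w] by simp
    then have z: "ennreal (dens w) * indicator {x<..} w = 0" for w by (cases "x < w") simp_all
    have "emeasure nu {x<..} = 0" unfolding nu_def by (subst emeasure_density) (simp_all add: z)
    then show False using emeasure_supp_ball[of y nu "{x<..}"] x by simp
  qed
  have lo: False if x: "x \<in> E - interior_pts" "x < 0" "y < x" "y \<in> E" for x y
  proof -
    have "AE t in G. x \<le> t" using AE_in_supp[OF A.sG] by eventually_elim (use x in \<open>auto simp: interior_pts_def not_less\<close>)
    then have "measure G {..<w} = 0 \<and> measure G {w} = 0" if "w < x" for w
      using that by (intro conjI; subst PG.prob_eq_0) (auto elim!: eventually_mono)
    then have "dens w = 0" if "w < x" for w using that x dens_neg_half[of w] by simp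
    then have z: "ennreal (dens w) * indicator {..<x} w = 0" for w by (cases "w < x") simp_all
    have "emeasure nu {..<x} = 0" unfolding nu_def by (subst emeasure_density) (simp_all add: z)
    then show False using emeasure_supp_ball[of y nu "{..<x}"] x by simp
  qed
  have "finite {x \<in> E - interior_pts. 0 < x}"
    by (rule one) (erule CollectE, erule CollectE, rule up, auto)
  moreover have "finite {x \<in> E - interior_pts. x < 0}"
    by (rule one) (erule CollectE, erule CollectE, rule lo, auto)
  moreover have "E - interior_pts \<subseteq> {x \<in> E - interior_pts. 0 < x} \<union> {x \<in> E - interior_pts. x < 0} \<union> {0}" by auto
  ultimately show ?thesis by (meson finite.emptyI finite_UnI finite_insert finite_subset)
qed

lemma openin_Z_m: "openin (top_of_set Z) T \<Longrightarrow> T \<in> sets borel"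
  by (auto simp: openin_open)

text \<open>On a lattice, almost everywhere means everywhere on the support. Otherwise interior
  points return to small balls around themselves and hit T from there; for the finitely many
  remaining points strict inequality is already uniform, and the zero-one law concludes.\<close>

lemma Q_recurrent:
  assumes fin: "(\<integral>\<^sup>+x. cross x \<partial>nu) < \<infinity>" and x: "x \<in> E" and T: "openin (top_of_set Z) T" "x \<in> T"
  shows "noret Q.K T x = 0"
proof (cases "d = 0")
  case False
  then have d0: "0 < d" using d by simp
  have "AE y in nu. y \<in> {x} \<longrightarrow> noret Q.K {x} y = 0" by (rule AE_recurrent[OF _ fin]) simp
  then have "noret Q.K {x} x = 0"
  proof (rule contrapos_pp)
    assume ne: "noret Q.K {x} x \<noteq> 0"
    show "\<not> (AE y in nu. y \<in> {x} \<longrightarrow> noret Q.K {x} y = 0)"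
    proof
      assume "AE y in nu. y \<in> {x} \<longrightarrow> noret Q.K {x} y = 0"
      then have "AE y in nu. y \<notin> {x}" by eventually_elim (use ne in auto)
      then have "emeasure nu {x} = 0" by (subst (asm) AE_iff_measurable[of "{x}"]) (auto simp: nu_def)
      then show False using atom_nu[OF d0 x] by simp
    qed
  qed
  moreover have "noret Q.K T x \<le> noret Q.K {x} x"
    by (rule Q.noret_antimono[OF closed_set_Q]) (use T openin_Z_m x E_subset_Z in auto)
  ultimately show ?thesis by simp
next
  case True
  have oT: "open T" and mT: "T \<in> sets borel" using T True by auto
  have inn: "avoid Q.K T y = 0" if y: "y \<in> interior_pts" for y
  proof -
    obtain \<delta> q where dq: "0 < \<delta>" "q < 1" "\<And>y'. \<bar>y' - y\<bar> < \<delta> \<Longrightarrow> avoid Q.K T y' \<le> q"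
      using avoid_uniform[OF oT T(2) x mT, of y] True by auto
    obtain e where e: "0 < e" "ball y e \<subseteq> interior_pts" using open_inner y openE by blast
    let ?A = "ball y (min \<delta> e)"
    show ?thesis
    proof (rule Q.recurrent_hits[OF Q.closed_set_UNIV, of ?A])
      show "noret Q.K ?A z = 0" if "z \<in> ?A" for z
        by (rule recurrent_inner[OF True fin]) (use e that in \<open>auto simp: interior_pts_def\<close>)
      show "avoid Q.K T z \<le> q" if "z \<in> ?A" for z using dq(3)[of z] that by (auto simp: dist_real_def abs_minus_commute)
      show "y \<in> ?A" using dq e by simp
    qed (use dq mT in auto)
  qed
  have lt: "avoid Q.K T y < 1" for y
  proof -
    obtain \<delta> q where "0 < \<delta>" "q < 1" "\<And>y'. \<bar>y' - y\<bar> < \<delta> \<Longrightarrow> avoid Q.K T y' \<le> q"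
      using avoid_uniform[OF oT T(2) x mT, of y] True by auto
    then show ?thesis using le_less_trans[of _ q 1] by simp
  qed
  have zero: "avoid Q.K T y = 0" if "y \<in> E" for y
  proof (rule Q.avoid_zero[OF closed_set_E mT _ _ that])
    let ?q = "Max (insert 0 (avoid Q.K T ` (E - interior_pts)))"
    have fi: "finite (insert 0 (avoid Q.K T ` (E - interior_pts)))" using finite_outer by simp
    show "avoid Q.K T w \<le> ?q" if "w \<in> E" for w
    proof (cases "w \<in> interior_pts")
      case False then show ?thesis using that fi by (intro Max_ge) auto
    qed (simp add: inn)
    show "?q < 1" using fi lt by (subst Max_less_iff) auto
  qed
  have "noret Q.K T x = (\<integral>\<^sup>+y. avoid Q.K T y \<partial>Q.K x)" by (rule Q.noret_eq[OF mT])
  also have "\<dots> = (\<integral>\<^sup>+y. 0 \<partial>Q.K x)"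
  proof (rule nn_integral_cong_AE)
    have "AE y in Q.K x. y \<in> E" using closed_set_E x by (auto simp: closed_set_def)
    then show "AE y in Q.K x. avoid Q.K T y = 0" by eventually_elim (rule zero)
  qed
  finally show ?thesis by simp
qed

section \<open>Comparison of the crossing flux with the ladder integral\<close>

definition "hh x = ennreal (measure G {..- x} * measure G' {x..})"

lemma hh_m [measurable]: "hh \<in> borel_measurable borel"
proof -
  have "mono (\<lambda>x. measure G {..x})" by (intro monoI PG.finite_measure_mono) auto
  then have [measurable]: "(\<lambda>x. measure G {..x}) \<in> borel_measurable borel" by (rule borel_measurable_mono)
  have "mono (\<lambda>x. measure G' {- x..})" by (intro monoI PG'.finite_measure_mono) auto
  then have m: "(\<lambda>x. measure G' {- x..}) \<in> borel_measurable borel" by (rule borel_measurable_mono)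
  have [measurable]: "(\<lambda>x. measure G' {x..}) \<in> borel_measurable borel"
    using measurable_compose[OF borel_measurable_uminus[OF measurable_ident] m] by simp
  show ?thesis unfolding hh_def[abs_def] by measurable
qed

lemma hh_antimono: "x \<le> y \<Longrightarrow> hh y \<le> hh x"
  unfolding hh_def by (intro ennreal_leI mult_mono PG.finite_measure_mono PG'.finite_measure_mono) auto

text \<open>A state x > 0 has density at most P(A' \<ge> x) and crosses with probability P(D \<le> -
  x); the product is the integrand of the ladder integral. Below 0 the roles are exchanged.\<close>

lemma dens_cross_le: "ennreal (dens x) * cross x \<le> hh \<bar>x\<bar>"
proof -
  have shift: "(\<integral>\<^sup>+t. indicator {..0} (x + t) \<partial>G) = ennreal (measure G {..-x})"
    "(\<integral>\<^sup>+t. indicator {0..} (x + t) \<partial>G') = ennreal (measure G' {-x..})"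
  proof -
    have "(\<integral>\<^sup>+t. indicator {..0} (x + t) \<partial>G) = (\<integral>\<^sup>+t. indicator {..-x} t \<partial>G)"
      by (intro nn_integral_cong) (auto simp: indicator_def)
    then show "(\<integral>\<^sup>+t. indicator {..0} (x + t) \<partial>G) = ennreal (measure G {..-x})" by (simp add: PG.emeasure_eq_measure)
    have "(\<integral>\<^sup>+t. indicator {0..} (x + t) \<partial>G') = (\<integral>\<^sup>+t. indicator {-x..} t \<partial>G')"
      by (intro nn_integral_cong) (auto simp: indicator_def)
    then show "(\<integral>\<^sup>+t. indicator {0..} (x + t) \<partial>G') = ennreal (measure G' {-x..})" by (simp add: PG'.emeasure_eq_measure)
  qed
  consider "0 < x" | "x < 0" | "x = 0" by linarith
  then show ?thesis
  proof cases
    case 1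
    have "dens x \<le> measure G' {x<..} + 1 * measure G' {x}"
      unfolding dens_pos_half[OF 1] using a_bounds by (intro add_left_mono mult_right_mono) auto
    also have "\<dots> = measure G' ({x<..} \<union> {x})" by (subst PG'.finite_measure_Union) auto
    also have "{x<..} \<union> {x} = {x..}" by auto
    finally have "ennreal (dens x) * cross x \<le> ennreal (measure G' {x..}) * ennreal (measure G {..-x})"
      using 1 shift by (auto simp: cross_def intro!: mult_right_mono)
    then show ?thesis using 1 by (simp add: hh_def ennreal_mult mult.commute)
  next
    case 2
    have "dens x \<le> measure G {..<x} + 1 * measure G {x}"
      unfolding dens_neg_half[OF 2] using a_bounds by (intro add_left_mono mult_right_mono) auto
    also have "\<dots> = measure G ({..<x} \<union> {x})" by (subst PG.finite_measure_Union) auto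
    also have "{..<x} \<union> {x} = {..x}" by auto
    finally have "ennreal (dens x) * cross x \<le> ennreal (measure G {..x}) * ennreal (measure G' {-x..})"
      using 2 shift by (auto simp: cross_def intro!: mult_right_mono)
    then show ?thesis using 2 by (simp add: hh_def ennreal_mult)
  next
    case 3
    have "measure G {..0} = 1" using G_nonpos by (subst PG.prob_eq_1) auto
    moreover have "measure G' {0..} = 1" using G'_nonneg by (subst PG'.prob_eq_1) auto
    moreover have "dens 0 \<le> 1"
    proof -
      have "gA 0 \<le> 1" unfolding gA_def using sa_bounds by (intro PG.integral_le_const sa_integrable) auto
      moreover have "0 \<le> gB 0" unfolding gB_def using sa_bounds by (intro integral_nonneg_AE) auto
      ultimately show ?thesis by (simp add: dens_eq)
    qed
    ultimately show ?thesis using 3 by (simp add: hh_def cross_def)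
  qed
qed

text \<open>On a lattice, the sum over the positive multiples of d is a lower Riemann sum of the
  decreasing integrand; the term at 0 is finite and is added separately.\<close>

lemma flux_finite:
  assumes fin: "(\<integral>\<^sup>+x\<in>{0..}. hh x \<partial>lborel) < \<infinity>"
  shows "(\<integral>\<^sup>+x. cross x \<partial>nu) < \<infinity>"
proof -
  let ?J = "\<integral>\<^sup>+x\<in>{0..}. hh x \<partial>lborel"
  have [measurable]: "(\<lambda>x. hh \<bar>x\<bar>) \<in> borel_measurable borel" by measurable
  have "(\<integral>\<^sup>+x. cross x \<partial>nu) = (\<integral>\<^sup>+x. ennreal (dens x) * cross x \<partial>haar_measure d)" by (rule nn_integral_nu) measurable
  also have "\<dots> \<le> (\<integral>\<^sup>+x. hh \<bar>x\<bar> \<partial>haar_measure d)" by (intro nn_integral_mono dens_cross_le)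
  also have "\<dots> < \<infinity>"
  proof (cases "d = 0")
    case True
    have "(\<integral>\<^sup>+x. hh \<bar>x\<bar> \<partial>lborel) \<le> (\<integral>\<^sup>+x. hh x * indicator {0..} x + hh (- x) * indicator {0..} (- x) \<partial>lborel)"
      by (intro nn_integral_mono) (auto simp: indicator_def)
    also have "\<dots> = ?J + (\<integral>\<^sup>+x. hh (- x) * indicator {0..} (- x) \<partial>lborel)"
      by (rule nn_integral_add) measurable
    also have "(\<integral>\<^sup>+x. hh (- x) * indicator {0..} (- x) \<partial>lborel) = ?J"
      using nn_integral_real_affine[of "\<lambda>x. hh x * indicator {0..} x" "-1" 0] by simp
    finally show ?thesis using fin True by (simp add: haar_measure_def le_less_trans)
  next
    case False
    then have d0: "0 < d" using d by simp
    let ?S = "\<Sum>n. ennreal d * hh (d * real (Suc n))"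
    have "?S \<le> ?J"
    proof -
      let ?A = "\<lambda>n. {d * real n<..d * real (Suc n)}"
      have "?S \<le> (\<Sum>n. \<integral>\<^sup>+x. hh x * indicator (?A n) x \<partial>lborel)"
      proof (intro suminf_le)
        fix n
        have "ennreal d * hh (d * real (Suc n)) = (\<integral>\<^sup>+x. hh (d * real (Suc n)) * indicator (?A n) x \<partial>lborel)"
          using d0 by (simp add: nn_integral_cmult_indicator mult.commute algebra_simps)
        also have "\<dots> \<le> (\<integral>\<^sup>+x. hh x * indicator (?A n) x \<partial>lborel)"
          by (intro nn_integral_mono) (auto simp: indicator_def intro: hh_antimono)
        finally show "ennreal d * hh (d * real (Suc n)) \<le> \<dots>" .
      qed auto
      also have "\<dots> = (\<integral>\<^sup>+x. (\<Sum>n. hh x * indicator (?A n) x) \<partial>lborel)"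
        by (rule nn_integral_suminf[symmetric]) measurable
      also have "\<dots> \<le> ?J"
      proof (intro nn_integral_mono)
        fix x :: real
        have dis: "disjoint_family ?A"
        proof -
          have "?A m \<inter> ?A n = {}" if "m < n" for m n
          proof -
            have "d * real (Suc m) \<le> d * real n" using that d0 by (intro mult_left_mono) auto
            then show ?thesis by auto
          qed
          then show ?thesis unfolding disjoint_family_on_def by (metis inf_commute linorder_neqE_nat)
        qed
        have "(\<Sum>n. hh x * indicator (?A n) x) = hh x * indicator (\<Union>n. ?A n) x"
          using suminf_indicator[OF dis, of x] by (simp only: ennreal_suminf_cmult)
        also have "\<dots> \<le> hh x * indicator {0..} x"
        proof (intro mult_left_mono)
          have "x \<ge> 0" if "x \<in> (\<Union>n. ?A n)"
          proof -
            obtain n where "d * real n < x" using \<open>x \<in> (\<Union>n. ?A n)\<close> by auto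
            moreover have "0 \<le> d * real n" using d0 by simp
            ultimately show ?thesis by linarith
          qed
          then show "indicator (\<Union>n. ?A n) x \<le> (indicator {0..} x :: ennreal)" by (auto simp: indicator_def)
        qed simp
        finally show "(\<Sum>n. hh x * indicator (?A n) x) \<le> hh x * indicator {0..} x" .
      qed
      finally show ?thesis .
    qed
    have S: "?S = ennreal d * (\<Sum>n. hh (d * real (Suc n)))" by simp
    have bij: "bij_betw (\<lambda>n. int n + 1) UNIV {1..}" "bij_betw (\<lambda>n. - (int n + 1)) UNIV {..-1}"
    proof -
      show "bij_betw (\<lambda>n. int n + 1) UNIV {1..}"
        by (rule bij_betw_byWitness[where f'="\<lambda>k. nat (k - 1)"]) auto
      show "bij_betw (\<lambda>n. - (int n + 1)) UNIV {..-1}"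
        by (rule bij_betw_byWitness[where f'="\<lambda>k. nat (- k - 1)"]) auto
    qed
    let ?f = "\<lambda>k::int. hh \<bar>d * of_int k\<bar>"
    have sp: "(\<integral>\<^sup>+k. ?f k \<partial>count_space {1..}) = (\<Sum>n. hh (d * real (Suc n)))"
    proof -
      have "(\<integral>\<^sup>+k. ?f k \<partial>count_space {1..}) = (\<integral>\<^sup>+n. ?f (int n + 1) \<partial>count_space UNIV)"
        by (rule nn_integral_bij_count_space[OF bij(1), symmetric])
      also have "\<dots> = (\<Sum>n. ?f (int n + 1))" by (rule nn_integral_count_space_nat)
      also have "\<dots> = (\<Sum>n. hh (d * real (Suc n)))"
        using d0 by (intro suminf_cong arg_cong[where f=hh]) (simp add: abs_mult algebra_simps)
      finally show ?thesis .
    qed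
    have sn: "(\<integral>\<^sup>+k. ?f k \<partial>count_space {..-1}) = (\<Sum>n. hh (d * real (Suc n)))"
    proof -
      have "(\<integral>\<^sup>+k. ?f k \<partial>count_space {..-1}) = (\<integral>\<^sup>+n. ?f (- (int n + 1)) \<partial>count_space UNIV)"
        by (rule nn_integral_bij_count_space[OF bij(2), symmetric])
      also have "\<dots> = (\<Sum>n. ?f (- (int n + 1)))" by (rule nn_integral_count_space_nat)
      also have "\<dots> = (\<Sum>n. hh (d * real (Suc n)))"
      proof (intro suminf_cong arg_cong[where f=hh])
        fix n
        have "d * of_int (- (int n + 1)) = - (d * real (Suc n))" by (simp add: algebra_simps)
        then show "\<bar>d * of_int (- (int n + 1))\<bar> = d * real (Suc n)" using d0 by (simp only: abs_minus_cancel) simp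
      qed
      finally show ?thesis .
    qed
    have "(\<integral>\<^sup>+k. ?f k \<partial>count_space UNIV) \<le> (\<integral>\<^sup>+k. ?f k * indicator {0} k + (?f k * indicator {1..} k + ?f k * indicator {..-1} k) \<partial>count_space UNIV)"
      by (intro nn_integral_mono) (auto simp: indicator_def)
    also have "\<dots> = (\<integral>\<^sup>+k. ?f k * indicator {0} k \<partial>count_space UNIV) + ((\<integral>\<^sup>+k. ?f k * indicator {1..} k \<partial>count_space UNIV) + (\<integral>\<^sup>+k. ?f k * indicator {..-1} k \<partial>count_space UNIV))"
      by (simp add: nn_integral_add)
    also have "(\<integral>\<^sup>+k. ?f k * indicator {1..} k \<partial>count_space UNIV) = (\<integral>\<^sup>+k. ?f k \<partial>count_space {1..})"
      by (simp add: nn_integral_count_space_indicator mult.commute)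
    also have "(\<integral>\<^sup>+k. ?f k * indicator {..-1} k \<partial>count_space UNIV) = (\<integral>\<^sup>+k. ?f k \<partial>count_space {..-1})"
      by (simp add: nn_integral_count_space_indicator mult.commute)
    also have "(\<integral>\<^sup>+k. ?f k * indicator {0} k \<partial>count_space UNIV) = hh 0" by simp
    finally have le: "(\<integral>\<^sup>+k. ?f k \<partial>count_space UNIV) \<le> hh 0 + ((\<Sum>n. hh (d * real (Suc n))) + (\<Sum>n. hh (d * real (Suc n))))"
      unfolding sp sn .
    have "(\<integral>\<^sup>+x. hh \<bar>x\<bar> \<partial>haar_measure d) = ennreal d * (\<integral>\<^sup>+k. ?f k \<partial>count_space UNIV)" by (rule nn_integral_haar[OF d0]) measurable
    also have "\<dots> \<le> ennreal d * (hh 0 + ((\<Sum>n. hh (d * real (Suc n))) + (\<Sum>n. hh (d * real (Suc n)))))"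
      by (intro mult_left_mono le) simp
    also have "\<dots> = ennreal d * hh 0 + (?S + ?S)" unfolding S by (simp add: distrib_left)
    also have "\<dots> \<le> ennreal d * hh 0 + (?J + ?J)" using \<open>?S \<le> ?J\<close> by (intro add_mono) auto
    also have "\<dots> < \<infinity>" using fin by (simp add: hh_def ennreal_mult_less_top less_top)
    finally show ?thesis .
  qed
  finally show ?thesis .
qed

end

subsection \<open>Transfer of recurrence between the two chains\<close>

context ladder
begin

text \<open>The mass in N at time n of the walk from m that has stayed strictly beyond m since time
  0, that is, of an excursion that has not yet reached its ladder time.\<close>

definition hits :: "nat \<Rightarrow> real \<Rightarrow> real set \<Rightarrow> ennreal" where
  "hits n m N = (up \<sigma> F ^^ n) (\<lambda>s. indicator N (m + s)) 0"

lemma hits_0 [simp]: "hits 0 m N = indicator N m"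
  by (simp add: hits_def)

lemma up_iter_cmult:
  assumes [measurable]: "f \<in> borel_measurable borel"
  shows "(up \<sigma> F ^^ n) (\<lambda>z. c * f z) z = c * (up \<sigma> F ^^ n) f z"
proof (induction n arbitrary: z)
  case (Suc n)
  have [measurable]: "(up \<sigma> F ^^ n) f \<in> borel_measurable borel" by (rule up_iter_measurable[OF F sF]) measurable
  have "(up \<sigma> F ^^ n) (\<lambda>z. c * f z) = (\<lambda>z. c * (up \<sigma> F ^^ n) f z)" using Suc by auto
  then have "(up \<sigma> F ^^ Suc n) (\<lambda>z. c * f z) z = up \<sigma> F (\<lambda>z. c * (up \<sigma> F ^^ n) f z) z" by simp
  also have "\<dots> = (\<integral>\<^sup>+t. c * (indicator {0<..} (\<sigma> * (z + t)) * (up \<sigma> F ^^ n) f (z + t)) \<partial>F)"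
    unfolding up_def[of _ _ "\<lambda>z. c * (up \<sigma> F ^^ n) f z"] by (intro nn_integral_cong) (simp only: mult.left_commute)
  also have "\<dots> = c * up \<sigma> F ((up \<sigma> F ^^ n) f) z"
    unfolding up_def[of _ _ "(up \<sigma> F ^^ n) f"] by (rule nn_integral_cmult) measurable
  finally show ?case by simp
qed simp

text \<open>Mass that enters N at the next step either continues the excursion, and is seen by
  \<open>hits\<close>, or is a ladder position, and is seen by G. Both vanish, so the excursion is
  almost never at a point of N'.\<close>

lemma hits_step:
  assumes m: "0 \<le> \<sigma> * m" and [measurable]: "N \<in> sets borel" "N' \<in> sets borel"
    and h: "\<And>n. hits n m N = 0" and g: "(\<integral>\<^sup>+t. indicator N (m + t) \<partial>G) = 0"
    and N': "\<And>y. 0 < \<sigma> * y \<Longrightarrow> y \<in> N' \<Longrightarrow> (\<integral>\<^sup>+t. indicator N (y + t) \<partial>F) \<noteq> 0"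
  shows "(\<integral>\<^sup>+t. indicator N (m + t) \<partial>F) = 0" and "hits (Suc n) m N' = 0"
proof -
  let ?f = "\<lambda>s. indicator N (m + s) :: ennreal"
  have d: "(up \<sigma> F ^^ n) (down \<sigma> F ?f) 0 = 0" for n
  proof -
    have "(\<Sum>n. (up \<sigma> F ^^ n) (down \<sigma> F ?f) 0) = 0" using ladder_eq[of ?f] g by simp
    moreover have "(up \<sigma> F ^^ n) (down \<sigma> F ?f) 0 \<le> (\<Sum>n. (up \<sigma> F ^^ n) (down \<sigma> F ?f) 0)"
      by (rule order_trans[OF _ sum_le_suminf[of _ "{n}"]]) auto
    ultimately show ?thesis by simp
  qed
  have w: "(up \<sigma> F ^^ n) (\<lambda>z. \<integral>\<^sup>+t. ?f (z + t) \<partial>F) 0 = 0" for n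
    using walk_step[of ?f n] d[of n] h[of "Suc n"] by (simp add: hits_def del: funpow.simps)
  show "(\<integral>\<^sup>+t. indicator N (m + t) \<partial>F) = 0" using w[of 0] by simp
  \<comment> \<open>Multiplication by \<top> turns mere positivity of the probability of entering N
    into a bound for the indicator of N'.\<close>
  have "hits (Suc n) m N' \<le> (up \<sigma> F ^^ Suc n) (\<lambda>z. \<top> * (\<integral>\<^sup>+t. ?f (z + t) \<partial>F)) 0"
    unfolding hits_def
  proof (rule up_iter_mono)
    fix y assume "0 < \<sigma> * y"
    then have "0 < \<sigma> * (m + y)" using m by (rule shift_pos[rotated])
    then show "indicator N' (m + y) \<le> \<top> * (\<integral>\<^sup>+t. indicator N (m + (y + t)) \<partial>F)"
      using N'[of "m + y"] by (cases "m + y \<in> N'") (simp_all add: add.assoc ennreal_top_mult)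
  qed
  also have "\<dots> = \<top> * (up \<sigma> F ^^ Suc n) (\<lambda>z. \<integral>\<^sup>+t. ?f (z + t) \<partial>F) 0"
    by (rule up_iter_cmult) measurable
  finally show "hits (Suc n) m N' = 0" unfolding w by simp
qed

lemma hits_lattice:
  assumes AE: "AE t in F. t \<in> lattice_set u" and m: "m \<in> lattice_set u"
  shows "hits n m (- lattice_set u) = 0"
proof -
  have "z \<in> lattice_set u \<Longrightarrow> (up \<sigma> F ^^ n) (\<lambda>s. indicator (- lattice_set u) (m + s)) z = 0" for z
  proof (induction n arbitrary: z)
    case 0 then show ?case using lattice_set_add[OF m 0] by simp
  next
    case (Suc n)
    define h where "h = (up \<sigma> F ^^ n) (\<lambda>s. indicator (- lattice_set u) (m + s))"
    have "up \<sigma> F h z = (\<integral>\<^sup>+t. 0 \<partial>F)" unfolding up_def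
    proof (rule nn_integral_cong_AE)
      show "AE t in F. indicator {0<..} (\<sigma> * (z + t)) * h (z + t) = 0" using AE
        by eventually_elim (simp add: h_def Suc.IH[OF lattice_set_add[OF Suc.prems]])
    qed
    then show ?case by (simp add: h_def)
  qed
  then show ?thesis by (simp add: hits_def)
qed

text \<open>Nearby starts use the same increments, so it suffices to reach T with room to spare. The
  sets of points with room 1 / (j + 1) exhaust T, and countable subadditivity gives one of them
  positive mass.\<close>

lemma hits_near:
  assumes T: "open T" and pos: "hits n m T \<noteq> 0"
  shows "\<exists>\<epsilon>>0. \<exists>c>0. \<forall>x. \<bar>x - m\<bar> < \<epsilon> \<longrightarrow> c \<le> hits n x T"
proof -
  interpret step_law F by (rule step_law.intro[OF F sF])
  define T' where "T' j = {y. ball y (1 / Suc j) \<subseteq> T}" for j :: nat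
  have "T' j = - (\<Union>z\<in>- T. ball z (1 / Suc j))" for j
    unfolding T'_def subset_iff mem_ball by (auto simp: dist_commute)
  moreover have "open (\<Union>z\<in>- T. ball z (1 / Suc j))" for j by auto
  ultimately have "closed (T' j)" for j by (simp add: closed_def)
  then have [measurable]: "T' j \<in> sets borel" for j by (rule borel_closed)
  have [measurable]: "T \<in> sets borel" using T by simp
  have "\<exists>j. hits n m (T' j) \<noteq> 0"
  proof (rule ccontr)
    assume "\<not> ?thesis"
    then have z: "rec_int \<sigma> n (\<lambda>s. indicator (T' j) (m + s)) = 0" for j
      by (subst rec_int_eq) (auto simp: hits_def)
    have "hits n m T \<le> (up \<sigma> F ^^ n) (\<lambda>s. \<Sum>j. indicator (T' j) (m + s)) 0"
      unfolding hits_def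
    proof (rule up_iter_mono')
      fix s show "indicator T (m + s) \<le> (\<Sum>j. indicator (T' j) (m + s) :: ennreal)"
      proof (cases "m + s \<in> T")
        case True
        then obtain e where e: "0 < e" "ball (m + s) e \<subseteq> T" using T openE by blast
        then obtain j where "1 / real (Suc j) < e" using reals_Archimedean[OF e(1)] by (auto simp: inverse_eq_divide)
        then have "ball (m + s) (1 / real (Suc j)) \<subseteq> ball (m + s) e" by (intro subset_ball less_imp_le)
        then have "m + s \<in> T' j" using e(2) by (simp add: T'_def)
        then have "1 \<le> (\<Sum>i\<in>{j}. indicator (T' i) (m + s) :: ennreal)" by simp
        also have "\<dots> \<le> (\<Sum>i. indicator (T' i) (m + s))" by (rule sum_le_suminf) auto
        finally show ?thesis using True by simp
      qed simp
    qed
    also have "\<dots> = rec_int \<sigma> n (\<lambda>s. \<Sum>j. indicator (T' j) (m + s))" by (rule rec_int_eq[symmetric]) measurable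
    also have "\<dots> = (\<Sum>j. rec_int \<sigma> n (\<lambda>s. indicator (T' j) (m + s)))" by (rule rec_int_suminf) measurable
    finally show False using pos by (simp add: z)
  qed
  then obtain j where j: "hits n m (T' j) \<noteq> 0" by auto
  have "hits n m (T' j) \<le> hits n x T" if x: "\<bar>x - m\<bar> < 1 / Suc j" for x
    unfolding hits_def
  proof (rule up_iter_mono')
    fix s
    have "x + s \<in> ball (m + s) (1 / Suc j)" using x by (simp add: dist_real_def)
    then have "x + s \<in> T" if "m + s \<in> T' j"
      using that unfolding T'_def by blast
    then show "indicator (T' j) (m + s) \<le> (indicator T (x + s) :: ennreal)" by (simp add: indicator_def)
  qed
  then show ?thesis using j by (intro exI[of _ "1 / real (Suc j)"] conjI exI[of _ "hits n m (T' j)"]) (simp_all add: zero_less_iff_neq_zero)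
qed

end

context switch
begin

lemma nn_integral_P_salpha:
  assumes [measurable]: "f \<in> borel_measurable borel"
  shows "(\<integral>\<^sup>+y. f y \<partial>P.K x) = ennreal (salpha x) * (\<integral>\<^sup>+t. f (x + t) \<partial>F) + ennreal (1 - salpha x) * (\<integral>\<^sup>+t. f (x + t) \<partial>F')"
  by (subst P.nn_integral_K) (auto simp: salpha_def indicator_def)

lemma salpha_sign: "0 < salpha m \<Longrightarrow> 0 \<le> m" "salpha m < 1 \<Longrightarrow> m \<le> 0"
  by (rule ccontr, simp add: salpha_def)+

text \<open>Each half-line contributes its ladder inequality; at 0 both laws enter, with the same
  weights for P and Q.\<close>

lemma nn_integral_P_le_Q:
  assumes [measurable]: "\<phi> \<in> borel_measurable borel" and le1: "\<And>y. \<phi> y \<le> 1"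
    and sub: "\<And>y. \<phi> y \<le> (\<integral>\<^sup>+z. \<phi> z \<partial>P.K y)"
  shows "(\<integral>\<^sup>+y. \<phi> y \<partial>P.K x) \<le> (\<integral>\<^sup>+y. \<phi> y \<partial>Q.K x)"
proof -
  have "(\<integral>\<^sup>+t. \<phi> (x + t) \<partial>F) \<le> (\<integral>\<^sup>+t. \<phi> (x + t) \<partial>G)" if "0 < salpha x"
  proof (rule A.ladder_sub)
    show "\<phi> y \<le> (\<integral>\<^sup>+t. \<phi> (y + t) \<partial>F)" if "0 < 1 * y" for y
      using sub[of y] P.nn_integral_K[OF assms(1), of y] that by simp
  qed (use le1 salpha_sign(1)[OF that] in auto)
  moreover have "(\<integral>\<^sup>+t. \<phi> (x + t) \<partial>F') \<le> (\<integral>\<^sup>+t. \<phi> (x + t) \<partial>G')" if "salpha x < 1"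
  proof (rule D.ladder_sub)
    show "\<phi> y \<le> (\<integral>\<^sup>+t. \<phi> (y + t) \<partial>F')" if "0 < -1 * y" for y
      using sub[of y] P.nn_integral_K[OF assms(1), of y] that by simp
  qed (use le1 salpha_sign(2)[OF that] in auto)
  moreover have "c = 0 \<Longrightarrow> ennreal c * u \<le> ennreal c * v" "u \<le> v \<Longrightarrow> ennreal c * u \<le> ennreal c * v" for c u v
    by (simp_all add: mult_left_mono)
  moreover have "0 < salpha x \<or> salpha x = 0" "salpha x < 1 \<or> 1 - salpha x = 0" using salpha_bounds[of x] by auto
  ultimately show ?thesis
    unfolding nn_integral_P_salpha[OF assms(1)] nn_integral_Q_salpha[OF assms(1)] by (metis add_mono)
qed

text \<open>The ladder chain sees only some positions of the path and so avoids A more easily;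
  analytically, \<open>avoid P.K A\<close> is subharmonic for Q and vanishes on A.\<close>

lemma avoid_P_le_Q:
  assumes [measurable]: "A \<in> sets borel" and x: "x \<in> Z"
  shows "avoid P.K A x \<le> avoid Q.K A x"
proof -
  have "avoid P.K A x \<le> 0 + 1 * avoid Q.K A x"
  proof (rule Q.subharmonic_le_avoid[OF closed_set_Q _ _ _ _ _ x])
    fix y show "avoid P.K A y \<le> (\<integral>\<^sup>+z. avoid P.K A z \<partial>Q.K y)"
      by (rule order_trans[OF P.avoid_subharmonic nn_integral_P_le_Q])
        (auto intro: P.avoid_le_1 P.avoid_subharmonic)
  qed (auto intro: P.avoid_le_1)
  then show ?thesis by simp
qed

lemma sigma_finite_nu: "sigma_finite_measure nu"
proof -
  interpret sigma_finite_measure "haar_measure d" by (rule sigma_finite_haar[OF d])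
  show ?thesis unfolding nu_def by (subst sigma_finite_iff_density_finite) auto
qed

end

text \<open>U and V stand for the two renewal measures. They are recorded through the null sets of
  their convolutions, which is the information that the support of mu depends on.\<close>

locale switch_renewal = switch +
  fixes U V :: "real measure"
  assumes U_null: "\<And>\<phi> N. sigma_finite_measure \<phi> \<Longrightarrow> sets \<phi> = sets borel \<Longrightarrow> N \<in> sets borel \<Longrightarrow>
      emeasure (U \<star> \<phi>) N = 0 \<longleftrightarrow> (AE m in \<phi>. \<forall>n. (up 1 F ^^ n) (\<lambda>s. indicator N (m + s)) 0 = 0)"
    and V_null: "\<And>\<phi> N. sigma_finite_measure \<phi> \<Longrightarrow> sets \<phi> = sets borel \<Longrightarrow> N \<in> sets borel \<Longrightarrow>
      emeasure (V \<star> \<phi>) N = 0 \<longleftrightarrow> (AE m in \<phi>. \<forall>n. (up (-1) F' ^^ n) (\<lambda>s. indicator N (m + s)) 0 = 0)"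
begin

definition mu :: "real measure" where
  "mu = add_measure (U \<star> pos_part_measure \<alpha> nu) (V \<star> neg_part_measure \<alpha> nu)"

lemma mu_sets [simp, measurable_cong]: "sets mu = sets borel"
  by (simp add: mu_def)

abbreviation "S \<equiv> supp mu"

text \<open>mu charges the sets that are charged by excursions started from nu: excursions above
  from the part weighted by \<open>salpha\<close>, below from the complementary part.\<close>

lemma mu_null_iff:
  assumes [measurable]: "N \<in> sets borel"
  shows "emeasure mu N = 0 \<longleftrightarrow> (AE m in nu. (0 < salpha m \<longrightarrow> (\<forall>n. A.hits n m N = 0)) \<and>
    (salpha m < 1 \<longrightarrow> (\<forall>n. D.hits n m N = 0)))"
proof -
  interpret nu: sigma_finite_measure nu by (rule sigma_finite_nu)
  have pp: "pos_part_measure \<alpha> nu = density nu (\<lambda>x. ennreal (salpha x))"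
    by (simp add: pos_part_measure_def salpha_def[abs_def])
  have np: "neg_part_measure \<alpha> nu = density nu (\<lambda>x. ennreal (1 - salpha x))"
    unfolding neg_part_measure_def by (intro arg_cong[where f="density nu"] ext) (auto simp: salpha_def indicator_def)
  have sp: "sigma_finite_measure (pos_part_measure \<alpha> nu)" "sigma_finite_measure (neg_part_measure \<alpha> nu)"
    unfolding pp np by (subst nu.sigma_finite_iff_density_finite; auto)+
  have ss: "sets (pos_part_measure \<alpha> nu) = sets borel" "sets (neg_part_measure \<alpha> nu) = sets borel"
    unfolding pp np by simp_all
  have "emeasure mu N = emeasure (U \<star> pos_part_measure \<alpha> nu) N + emeasure (V \<star> neg_part_measure \<alpha> nu) N"
    unfolding mu_def by (rule emeasure_add_measure) auto
  then have "emeasure mu N = 0 \<longleftrightarrow> emeasure (U \<star> pos_part_measure \<alpha> nu) N = 0 \<and> emeasure (V \<star> neg_part_measure \<alpha> nu) N = 0"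
    by simp
  also have "\<dots> \<longleftrightarrow> (AE m in nu. 0 < salpha m \<longrightarrow> (\<forall>n. A.hits n m N = 0)) \<and> (AE m in nu. salpha m < 1 \<longrightarrow> (\<forall>n. D.hits n m N = 0))"
  proof (intro arg_cong2[where f="(\<and>)"])
    show "emeasure (U \<star> pos_part_measure \<alpha> nu) N = 0 \<longleftrightarrow> (AE m in nu. 0 < salpha m \<longrightarrow> (\<forall>n. A.hits n m N = 0))"
      unfolding U_null[OF sp(1) ss(1) assms] unfolding pp A.hits_def by (subst AE_density) (simp_all add: ennreal_less_zero_iff)
    show "emeasure (V \<star> neg_part_measure \<alpha> nu) N = 0 \<longleftrightarrow> (AE m in nu. salpha m < 1 \<longrightarrow> (\<forall>n. D.hits n m N = 0))"
      unfolding V_null[OF sp(2) ss(2) assms] unfolding np D.hits_def by (subst AE_density) (simp_all add: ennreal_less_zero_iff)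
  qed
  finally show ?thesis by (simp only: AE_conj_iff)
qed

lemma nu_null_of_mu:
  assumes [measurable]: "N \<in> sets borel" and "emeasure mu N = 0"
  shows "emeasure nu N = 0"
proof -
  have "AE m in nu. m \<notin> N" using assms(2) unfolding mu_null_iff[OF assms(1)]
  proof eventually_elim
    fix m assume *: "(0 < salpha m \<longrightarrow> (\<forall>n. A.hits n m N = 0)) \<and> (salpha m < 1 \<longrightarrow> (\<forall>n. D.hits n m N = 0))"
    have "0 < salpha m \<or> salpha m < 1" by linarith
    then have "A.hits 0 m N = 0 \<or> D.hits 0 m N = 0" using * by blast
    then show "m \<notin> N" by (simp add: indicator_eq_0_iff)
  qed
  then show ?thesis by (subst (asm) AE_iff_measurable[of N]) (auto simp: nu_def)
qed

lemma E_subset_S: "E \<subseteq> S"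
proof
  fix x assume "x \<in> E"
  then have "0 < emeasure mu (ball x e)" if "0 < e" for e
    using nu_null_of_mu[of "ball x e"] that by (auto simp: supp_iff zero_less_iff_neq_zero)
  then show "x \<in> S" by (simp add: supp_iff)
qed

lemma mu_AE_Z: "AE x in mu. x \<in> Z"
proof -
  have "emeasure mu (- Z) = 0"
    by (subst mu_null_iff) (use nu_AE_Z in \<open>auto elim!: eventually_mono simp: A.hits_lattice[OF Fd] D.hits_lattice[OF Fd']\<close>)
  then show ?thesis by (intro AE_I[of _ _ "- Z"]) auto
qed

lemma S_subset_Z: "S \<subseteq> Z"
  by (rule supp_subset_Z[OF mu_sets mu_AE_Z])

text \<open>A P-step from a point of an excursion either continues the excursion, which is covered
  by nullity for mu, or ends it at a Q-successor of its start, which is covered by the invariance of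
  nu under Q.\<close>

lemma mu_null_P:
  assumes N [measurable]: "N \<in> sets borel" and null: "emeasure mu N = 0"
  shows "AE x in mu. emeasure (P.K x) N = 0"
proof -
  have em: "emeasure (P.K y) N = (\<integral>\<^sup>+z. indicator N z \<partial>P.K y)" for y by simp
  define N' where "N' = {y. emeasure (P.K y) N \<noteq> 0}"
  have N' [measurable]: "N' \<in> sets borel" unfolding N'_def em by measurable
  have "AE m in nu. (0 < salpha m \<longrightarrow> (\<forall>n. A.hits n m N = 0)) \<and> (salpha m < 1 \<longrightarrow> (\<forall>n. D.hits n m N = 0))"
    using null by (simp only: mu_null_iff[OF N])
  moreover have "AE m in nu. emeasure (Q.K m) N = 0" by (rule nu_null_Q[OF N nu_null_of_mu[OF N null]])
  ultimately have "AE m in nu. (0 < salpha m \<longrightarrow> (\<forall>n. A.hits n m N' = 0)) \<and> (salpha m < 1 \<longrightarrow> (\<forall>n. D.hits n m N' = 0))"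
  proof eventually_elim
    fix m assume h: "(0 < salpha m \<longrightarrow> (\<forall>n. A.hits n m N = 0)) \<and> (salpha m < 1 \<longrightarrow> (\<forall>n. D.hits n m N = 0))"
      and q: "emeasure (Q.K m) N = 0"
    have "(\<integral>\<^sup>+z. indicator N z \<partial>Q.K m) = 0" using q by simp
    then have "ennreal (salpha m) * (\<integral>\<^sup>+t. indicator N (m + t) \<partial>G) + ennreal (1 - salpha m) * (\<integral>\<^sup>+t. indicator N (m + t) \<partial>G') = 0"
      by (subst (asm) nn_integral_Q_salpha) simp_all
    then have g: "0 < salpha m \<Longrightarrow> (\<integral>\<^sup>+t. indicator N (m + t) \<partial>G) = 0" "salpha m < 1 \<Longrightarrow> (\<integral>\<^sup>+t. indicator N (m + t) \<partial>G') = 0"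
      by (simp_all add: ennreal_eq_0_iff not_le)
    have a: "(\<integral>\<^sup>+t. indicator N (m + t) \<partial>F) = 0" "A.hits (Suc n) m N' = 0" if s: "0 < salpha m" for n
    proof -
      have N'a: "(\<integral>\<^sup>+t. indicator N (y + t) \<partial>F) \<noteq> 0" if "0 < 1 * y" "y \<in> N'" for y
        using that unfolding N'_def em by (subst (asm) P.nn_integral_K) auto
      have m0: "0 \<le> 1 * m" and hA: "A.hits k m N = 0" for k using salpha_sign(1)[OF s] h s by auto
      show "(\<integral>\<^sup>+t. indicator N (m + t) \<partial>F) = 0" "A.hits (Suc n) m N' = 0"
        using A.hits_step[OF m0 N N' hA g(1)[OF s] N'a] by auto
    qed
    have b: "(\<integral>\<^sup>+t. indicator N (m + t) \<partial>F') = 0" "D.hits (Suc n) m N' = 0" if s: "salpha m < 1" for n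
    proof -
      have N'a: "(\<integral>\<^sup>+t. indicator N (y + t) \<partial>F') \<noteq> 0" if "0 < -1 * y" "y \<in> N'" for y
        using that unfolding N'_def em by (subst (asm) P.nn_integral_K) auto
      have m0: "0 \<le> -1 * m" and hA: "D.hits k m N = 0" for k using salpha_sign(2)[OF s] h s by auto
      show "(\<integral>\<^sup>+t. indicator N (m + t) \<partial>F') = 0" "D.hits (Suc n) m N' = 0"
        using D.hits_step[OF m0 N N' hA g(2)[OF s] N'a] by auto
    qed
    have "(\<integral>\<^sup>+z. indicator N z \<partial>P.K m) = 0"
      by (subst nn_integral_P_salpha) (use a(1) b(1) salpha_bounds[of m] in \<open>auto simp: ennreal_eq_0_iff less_le\<close>)
    then have "m \<notin> N'" by (simp add: N'_def)
    then have "A.hits n m N' = 0" if "0 < salpha m" for n using a(2)[OF that] by (cases n) auto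
    moreover have "D.hits n m N' = 0" if "salpha m < 1" for n using b(2)[OF that] \<open>m \<notin> N'\<close> by (cases n) auto
    ultimately show "(0 < salpha m \<longrightarrow> (\<forall>n. A.hits n m N' = 0)) \<and> (salpha m < 1 \<longrightarrow> (\<forall>n. D.hits n m N' = 0))" by blast
  qed
  then have "emeasure mu N' = 0" by (simp only: mu_null_iff[OF N'])
  then show ?thesis by (intro AE_I[of _ _ N']) (auto simp: N'_def)
qed

lemma closed_set_S: "closed_set P.K S"
proof (rule P.closed_set_supp[OF mu_sets mu_null_P])
  have le: "0 < emeasure nu B \<Longrightarrow> 0 < emeasure mu B" if "B \<in> sets borel" for B
    using nu_null_of_mu[OF that] by (auto simp: zero_less_iff_neq_zero)
  show "0 < emeasure mu {0} \<or> (\<forall>\<epsilon>>0. 0 < emeasure mu {0<..<\<epsilon>} \<and> 0 < emeasure mu {-\<epsilon><..<0})"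
    using nu_zero le by auto
qed

end

lemma ennreal_average_less:
  fixes q g h :: ennreal
  assumes "q < 1" "0 < g" "g + h = 1"
  shows "q * g + h < 1"
proof -
  have g1: "g < \<top>" and h1: "h < \<top>" using assms(3) by (auto simp: less_top[symmetric])
  have "q * g < 1 * g" using assms(1,2) g1 by (intro ennreal_mult_strict_right_mono) auto
  then have "q * g + h < g + h" using h1 by (simp add: add.commute[of _ h] ennreal_add_left_cancel_less)
  then show ?thesis using assms(3) by simp
qed

context switch
begin

text \<open>Recurrence brings the chain back to a neighbourhood of y on which A is hit with
  probability at least 1 - q. Formulated for any kernel whose avoidance is dominated by that of Q,
  so that it serves both chains.\<close>

lemma avoid_zero_of_recurrent:
  assumes E': "closed_set K E'" "E' \<subseteq> Z" and K: "prob_kernel K"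
    and le: "\<And>y. y \<in> Z \<Longrightarrow> avoid K A y \<le> avoid Q.K A y"
    and rec: "\<And>y T. y \<in> E' \<Longrightarrow> openin (top_of_set Z) T \<Longrightarrow> y \<in> T \<Longrightarrow> noret K T y = 0"
    and A: "openin (top_of_set Z) A" "z \<in> A" "z \<in> E" and y: "y \<in> E'"
  shows "avoid K A y = 0"
proof -
  interpret prob_kernel K by fact
  obtain T where T: "open T" "A = Z \<inter> T" using A(1) by (auto simp: openin_open)
  have Am: "A \<in> sets borel" using A(1) by (rule openin_Z_m)
  have yZ: "y \<in> Z" using y E'(2) by auto
  obtain \<delta> q where dq: "0 < \<delta>" "q < 1" "\<And>y'. y' \<in> Z \<Longrightarrow> \<bar>y' - y\<bar> < \<delta> \<Longrightarrow> avoid Q.K A y' \<le> q"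
    using avoid_uniform[OF T(1) _ A(3) Am _ yZ] A(2) T(2) by auto
  let ?C = "Z \<inter> ball y \<delta>"
  have C: "openin (top_of_set Z) ?C" by (auto simp: openin_open)
  show ?thesis
  proof (rule recurrent_hits[OF E'(1) openin_Z_m[OF C] Am _ _ dq(2)])
    show "noret K ?C w = 0" if "w \<in> ?C" "w \<in> E'" for w by (rule rec[OF that(2) C that(1)])
    show "avoid K A w \<le> q" if "w \<in> ?C" "w \<in> E'" for w
      using le[of w] dq(3)[of w] that by (auto simp: dist_real_def abs_minus_commute intro: order_trans)
    show "y \<in> ?C" using yZ dq(1) by simp
  qed (rule y)
qed

lemma openin_singleton: "0 < d \<Longrightarrow> m \<in> Z \<Longrightarrow> openin (top_of_set Z) {m}"
proof -
  assume *: "0 < d" "m \<in> Z"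
  have "{m} = Z \<inter> ball m d"
    using * lattice_set_dist[OF *(1) _ *(2)] by (auto simp: dist_real_def abs_minus_commute)
  then show ?thesis by (auto simp: openin_open)
qed

lemma noret_zero_of_avoid:
  assumes "prob_kernel K" "closed_set K C" "B \<in> sets borel" "\<And>y. y \<in> C \<Longrightarrow> avoid K B y = 0" "x \<in> C"
  shows "noret K B x = 0"
proof -
  interpret prob_kernel K by fact
  have "noret K B x = (\<integral>\<^sup>+y. avoid K B y \<partial>K x)" by (rule noret_eq[OF assms(3)])
  also have "\<dots> = (\<integral>\<^sup>+y. 0 \<partial>K x)"
  proof (rule nn_integral_cong_AE)
    have "AE y in K x. y \<in> C" using assms(2,5) by (auto simp: closed_set_def)
    then show "AE y in K x. avoid K B y = 0" by eventually_elim (rule assms(4))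
  qed
  finally show ?thesis by simp
qed

end

context switch_renewal
begin

text \<open>Without a lattice nu has no atom at 0, so 0 can be excluded as a start; on either side
  of it the kernel uses a single law, which permits moving the start.\<close>

lemma charge_E:
  assumes T: "T \<in> sets borel" "0 < emeasure mu T"
  shows "\<exists>m\<in>E. (d = 0 \<longrightarrow> m \<noteq> 0) \<and>
    (0 < salpha m \<and> (\<exists>n. A.hits n m T \<noteq> 0) \<or> salpha m < 1 \<and> (\<exists>n. D.hits n m T \<noteq> 0))"
proof (rule ccontr)
  assume no: "\<not> ?thesis"
  have "AE m in nu. d = 0 \<longrightarrow> m \<noteq> 0"
  proof (cases "d = 0")
    case True
    have "AE x in lborel. x \<noteq> (0::real)" by (rule AE_lborel_singleton)
    then show ?thesis unfolding nu_def haar_measure_def using True by (subst AE_density) auto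
  qed simp
  moreover have "AE m in nu. m \<in> E" by (rule AE_in_supp[OF nu_sets])
  ultimately have "AE m in nu. (0 < salpha m \<longrightarrow> (\<forall>n. A.hits n m T = 0)) \<and> (salpha m < 1 \<longrightarrow> (\<forall>n. D.hits n m T = 0))"
    by eventually_elim (use no in blast)
  then have "emeasure mu T = 0" by (simp only: mu_null_iff[OF T(1)])
  then show False using T(2) by simp
qed

text \<open>Some excursion from a point m of supp nu charges T, which pushes the avoidance
  probability at m below 1. On a lattice the point m is itself open; otherwise
  \<open>hits_near\<close> extends the bound to starts near m on the same side of 0.\<close>

lemma excursion:
  assumes T: "openin (top_of_set Z) T" "0 < emeasure mu T"
  shows "\<exists>A m q. openin (top_of_set Z) A \<and> m \<in> A \<and> m \<in> E \<and> q < 1 \<and> (\<forall>x\<in>A. avoid P.K T x \<le> q)"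
proof -
  have Tm [measurable]: "T \<in> sets borel" by (rule openin_Z_m[OF T(1)])
  let ?\<phi> = "avoid P.K T"
  have sub: "?\<phi> y \<le> (\<integral>\<^sup>+z. ?\<phi> z \<partial>P.K y)" for y by (rule P.avoid_subharmonic[OF Tm])
  have Pin: "?\<phi> x \<le> ennreal (salpha x) * (\<integral>\<^sup>+t. ?\<phi> (x + t) \<partial>F) + ennreal (1 - salpha x) * (\<integral>\<^sup>+t. ?\<phi> (x + t) \<partial>F')" for x
    using sub[of x] by (subst (asm) nn_integral_P_salpha) measurable
  have A: "(\<integral>\<^sup>+t. ?\<phi> (x + t) \<partial>F) + A.hits (Suc n) x T \<le> 1" if "0 \<le> x" for x n
    unfolding A.hits_def
  proof (rule A.walk_hits)
    show "?\<phi> y \<le> (\<integral>\<^sup>+t. ?\<phi> (y + t) \<partial>F)" if "0 < 1 * y" for y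
      using sub[of y] that by (subst (asm) P.nn_integral_K) auto
  qed (use that in \<open>auto intro: P.avoid_le_1\<close>)
  have D: "(\<integral>\<^sup>+t. ?\<phi> (x + t) \<partial>F') + D.hits (Suc n) x T \<le> 1" if "x \<le> 0" for x n
    unfolding D.hits_def
  proof (rule D.walk_hits)
    show "?\<phi> y \<le> (\<integral>\<^sup>+t. ?\<phi> (y + t) \<partial>F')" if "0 < -1 * y" for y
      using sub[of y] that by (subst (asm) P.nn_integral_K) auto
  qed (use that in \<open>auto intro: P.avoid_le_1\<close>)
  have lt: "u < 1" if "u + c \<le> 1" "c \<noteq> 0" for u c :: ennreal
  proof (rule ccontr)
    assume "\<not> u < 1"
    then have "1 + c \<le> 1 + 0" using that(1) by (metis add_mono_thms_linordered_semiring(3) add.right_neutral not_less order_trans)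
    then show False using that(2) by (simp only: ennreal_add_left_cancel_le) simp
  qed
  have I1: "(\<integral>\<^sup>+t. ?\<phi> (x + t) \<partial>F) \<le> 1" "(\<integral>\<^sup>+t. ?\<phi> (x + t) \<partial>F') \<le> 1" for x
    by (intro A.nn_F_le_1 D.nn_F_le_1 P.avoid_le_1)+
  obtain m where m: "m \<in> E" "d = 0 \<Longrightarrow> m \<noteq> 0"
    and h: "0 < salpha m \<and> (\<exists>n. A.hits n m T \<noteq> 0) \<or> salpha m < 1 \<and> (\<exists>n. D.hits n m T \<noteq> 0)"
    using charge_E[OF Tm T(2)] by blast
  show ?thesis
  proof (cases "m \<in> T")
    case True
    then show ?thesis using T(1) m(1) by (intro exI[of _ T] exI[of _ m] exI[of _ 0]) auto
  next
    case mT: False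
    have h': "0 < salpha m \<and> (\<exists>n. A.hits (Suc n) m T \<noteq> 0) \<or> salpha m < 1 \<and> (\<exists>n. D.hits (Suc n) m T \<noteq> 0)"
      using h mT A.hits_0 D.hits_0 by (metis indicator_simps(2) not0_implies_Suc)
    show ?thesis
    proof (cases "d = 0")
      case False
      then have d0: "0 < d" using d by simp
      have ss: "ennreal (salpha m) + ennreal (1 - salpha m) = 1"
        using salpha_bounds[of m] by (simp add: ennreal_plus[symmetric] del: ennreal_plus)
      \<comment> \<open>Here m may be 0, where both laws occur; it is enough that one of them has
        positive weight and an integral below 1.\<close>
      have "ennreal (salpha m) * (\<integral>\<^sup>+t. ?\<phi> (m + t) \<partial>F) + ennreal (1 - salpha m) * (\<integral>\<^sup>+t. ?\<phi> (m + t) \<partial>F') < 1"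
        using h'
      proof (elim disjE conjE exE)
        fix n assume s: "0 < salpha m" and n: "A.hits (Suc n) m T \<noteq> 0"
        have "(\<integral>\<^sup>+t. ?\<phi> (m + t) \<partial>F) < 1" by (rule lt[OF A n]) (rule salpha_sign(1)[OF s])
        then have "(\<integral>\<^sup>+t. ?\<phi> (m + t) \<partial>F) * ennreal (salpha m) + ennreal (1 - salpha m) < 1"
          by (rule ennreal_average_less) (use s ss in \<open>auto simp: ennreal_less_zero_iff\<close>)
        moreover have "ennreal (1 - salpha m) * (\<integral>\<^sup>+t. ?\<phi> (m + t) \<partial>F') \<le> ennreal (1 - salpha m) * 1"
          by (intro mult_left_mono I1) simp
        ultimately show ?thesis by (simp add: mult.commute) (meson add_left_mono le_less_trans)
      next
        fix n assume s: "salpha m < 1" and n: "D.hits (Suc n) m T \<noteq> 0"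
        have "(\<integral>\<^sup>+t. ?\<phi> (m + t) \<partial>F') < 1" by (rule lt[OF D n]) (rule salpha_sign(2)[OF s])
        then have "(\<integral>\<^sup>+t. ?\<phi> (m + t) \<partial>F') * ennreal (1 - salpha m) + ennreal (salpha m) < 1"
          by (rule ennreal_average_less) (use s ss in \<open>auto simp: ennreal_less_zero_iff add.commute\<close>)
        moreover have "ennreal (salpha m) * (\<integral>\<^sup>+t. ?\<phi> (m + t) \<partial>F) \<le> ennreal (salpha m) * 1"
          by (intro mult_left_mono I1) simp
        ultimately show ?thesis by (simp add: mult.commute add.commute) (meson add_right_mono le_less_trans)
      qed
      then have "?\<phi> m < 1" using Pin[of m] by (rule le_less_trans[rotated])
      then show ?thesis
        using openin_singleton[OF d0] m(1) E_subset_Z by (intro exI[of _ "{m}"] exI[of _ m] exI[of _ "?\<phi> m"]) auto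
    next
      case True
      then have oT: "open T" using T(1) by simp
      have sm: "1 - c < 1" if "0 < c" for c :: ennreal
        using that by (intro ennreal_between) auto
      have le: "u \<le> 1 - c" if "u + h \<le> 1" "c \<le> h" for u h c :: ennreal
        using that by (metis add.commute add_left_mono ennreal_le_minus_iff order_trans)
      have "(\<exists>n. 0 < m \<and> A.hits n m T \<noteq> 0 \<and> 0 < n) \<or> (\<exists>n. m < 0 \<and> D.hits n m T \<noteq> 0 \<and> 0 < n)"
        using h' m(2)[OF True] salpha_sign[of m] by (metis less_le zero_less_Suc)
      then show ?thesis
      proof (elim disjE exE conjE)
        fix n assume m0: "0 < m" and n: "A.hits n m T \<noteq> 0" "0 < n"
        obtain \<epsilon> c where ec: "0 < \<epsilon>" "0 < c" "\<And>x. \<bar>x - m\<bar> < \<epsilon> \<Longrightarrow> c \<le> A.hits n x T"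
          using A.hits_near[OF oT n(1)] by blast
        have "?\<phi> x \<le> 1 - c" if x: "x \<in> ball m \<epsilon> \<inter> {0<..}" for x
        proof -
          have "?\<phi> x \<le> (\<integral>\<^sup>+t. ?\<phi> (x + t) \<partial>F)" using sub[of x] x by (subst (asm) P.nn_integral_K) auto
          also have "\<dots> \<le> 1 - c"
            by (rule le[OF A[of x "n - 1"]]) (use x ec(3)[of x] n(2) in \<open>auto simp: dist_real_def abs_minus_commute\<close>)
          finally show ?thesis .
        qed
        then show ?thesis using True m(1) m0 ec(1) sm[OF ec(2)]
          by (intro exI[of _ "ball m \<epsilon> \<inter> {0<..}"] exI[of _ m] exI[of _ "1 - c"]) auto
      next
        fix n assume m0: "m < 0" and n: "D.hits n m T \<noteq> 0" "0 < n"
        obtain \<epsilon> c where ec: "0 < \<epsilon>" "0 < c" "\<And>x. \<bar>x - m\<bar> < \<epsilon> \<Longrightarrow> c \<le> D.hits n x T"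
          using D.hits_near[OF oT n(1)] by blast
        have "?\<phi> x \<le> 1 - c" if x: "x \<in> ball m \<epsilon> \<inter> {..<0}" for x
        proof -
          have "?\<phi> x \<le> (\<integral>\<^sup>+t. ?\<phi> (x + t) \<partial>F')" using sub[of x] x by (subst (asm) P.nn_integral_K) auto
          also have "\<dots> \<le> 1 - c"
            by (rule le[OF D[of x "n - 1"]]) (use x ec(3)[of x] n(2) in \<open>auto simp: dist_real_def abs_minus_commute\<close>)
          finally show ?thesis .
        qed
        then show ?thesis using True m(1) m0 ec(1) sm[OF ec(2)]
          by (intro exI[of _ "ball m \<epsilon> \<inter> {..<0}"] exI[of _ m] exI[of _ "1 - c"]) auto
      qed
    qed
  qed
qed

text \<open>The ladder chain reaches the set A of \<open>excursion\<close> from all of Z, and from A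
  the walk hits T with probability at least 1 - q; so the Q-subharmonic function
  \<open>avoid P.K T\<close> is contracted to 0. All of Z is needed because supp mu may exceed supp
  nu.\<close>

theorem P_recurrent_of_Q:
  assumes rec: "\<And>y T. y \<in> E \<Longrightarrow> openin (top_of_set Z) T \<Longrightarrow> y \<in> T \<Longrightarrow> noret Q.K T y = 0"
    and x: "x \<in> S" and T: "openin (top_of_set Z) T" "x \<in> T"
  shows "noret P.K T x = 0"
proof -
  have Tm [measurable]: "T \<in> sets borel" by (rule openin_Z_m[OF T(1)])
  have "S = msupport Z mu" by (rule msupport_eq_supp[OF d mu_sets mu_AE_Z, symmetric])
  then have "0 < emeasure mu T" using x T by (auto simp: msupport_def)
  from excursion[OF T(1) this] obtain A m q where A: "openin (top_of_set Z) A" "m \<in> A" "m \<in> E"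
    and q: "q < 1" "\<And>x. x \<in> A \<Longrightarrow> avoid P.K T x \<le> q" by blast
  have Am: "A \<in> sets borel" by (rule openin_Z_m[OF A(1)])
  have AE: "avoid Q.K A y = 0" if "y \<in> E" for y
    by (rule avoid_zero_of_recurrent[OF closed_set_E E_subset_Z Q.prob_kernel_axioms order_refl rec A that])
  \<comment> \<open>From outside supp nu the chain first enters it, by \<open>avoid_E\<close>, and
    there A is already known to be hit.\<close>
  have AZ: "avoid Q.K A y = 0" if y: "y \<in> Z" for y
  proof -
    have "avoid Q.K A y \<le> 0 + 1 * avoid Q.K E y"
      by (rule Q.subharmonic_le_avoid[OF closed_set_Q]) (use Am y in \<open>auto intro: Q.avoid_le_1 Q.avoid_subharmonic simp: AE\<close>)
    then show ?thesis using avoid_E[OF y] by simp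
  qed
  let ?\<phi> = "avoid P.K T"
  have "?\<phi> y = 0" if y: "y \<in> Z" for y
  proof (rule Q.subharmonic_zero[OF closed_set_Q Am])
    show "?\<phi> y \<le> (\<integral>\<^sup>+z. ?\<phi> z \<partial>Q.K y)" for y
      by (rule order_trans[OF P.avoid_subharmonic nn_integral_P_le_Q])
        (auto intro: P.avoid_le_1 P.avoid_subharmonic)
    show "?\<phi> y \<le> q * (SUP x\<in>Z. ?\<phi> x)" if "y \<in> Z" "y \<in> A" for y
    proof -
      have "?\<phi> y \<le> (SUP x\<in>Z. ?\<phi> x) * ?\<phi> y" by (rule P.avoid_le_sup_mult[OF closed_set_P Tm that(1)])
      also have "\<dots> \<le> (SUP x\<in>Z. ?\<phi> x) * q" by (intro mult_left_mono q(2) that(2)) simp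
      finally show ?thesis by (simp add: mult.commute)
    qed
  qed (use y q AZ in \<open>auto intro: P.avoid_le_1\<close>)
  then show ?thesis using S_subset_Z x by (intro noret_zero_of_avoid[OF P.prob_kernel_axioms closed_set_P Tm]) auto
qed

text \<open>Conversely, a \<open>Q\<close>-subharmonic \<open>\<phi>\<close> is dominated by the \<open>P\<close>-subharmonic expectation \<open>\<psi>\<close> of \<open>\<phi>\<close> at
  the next ladder time.\<close>

theorem Q_recurrent_of_P:
  assumes rec: "\<And>y T. y \<in> S \<Longrightarrow> openin (top_of_set Z) T \<Longrightarrow> y \<in> T \<Longrightarrow> noret P.K T y = 0"
    and x: "x \<in> E" and T: "openin (top_of_set Z) T" "x \<in> T"
  shows "noret Q.K T x = 0"
proof -
  have Tm [measurable]: "T \<in> sets borel" by (rule openin_Z_m[OF T(1)])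
  obtain W where W: "open W" "T = Z \<inter> W" using T(1) by (auto simp: openin_open)
  \<comment> \<open>The complement of supp nu is added to the target so that \<phi> vanishes there;
    starting in the support, which is closed for Q, this does not change the probability of
    avoidance.\<close>
  define B where "B = T \<union> - E"
  have Bm [measurable]: "B \<in> sets borel" unfolding B_def by measurable
  define \<phi> where "\<phi> = avoid Q.K B"
  have \<phi>m [measurable]: "\<phi> \<in> borel_measurable borel" unfolding \<phi>_def by measurable
  have \<phi>1: "\<phi> y \<le> 1" for y unfolding \<phi>_def by (rule Q.avoid_le_1)
  have \<phi>Q: "\<phi> y \<le> (\<integral>\<^sup>+z. \<phi> z \<partial>Q.K y)" for y unfolding \<phi>_def by (rule Q.avoid_subharmonic[OF Bm])
  have unif: "\<exists>\<delta>>0. \<exists>q<1. \<forall>y'\<in>Z. \<bar>y' - y\<bar> < \<delta> \<longrightarrow> \<phi> y' \<le> q" if "y \<in> Z" for y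
    unfolding \<phi>_def by (rule avoid_uniform[OF W(1) _ x Bm _ that]) (use T W in \<open>auto simp: B_def\<close>)
  have \<phi>A: "\<phi> z \<le> (\<integral>\<^sup>+t. \<phi> (z + t) \<partial>G)" if "0 < 1 * z" for z
    using \<phi>Q[of z] that by (subst (asm) Q.nn_integral_K) auto
  have \<phi>D: "\<phi> z \<le> (\<integral>\<^sup>+t. \<phi> (z + t) \<partial>G')" if "0 < -1 * z" for z
    using \<phi>Q[of z] that by (subst (asm) Q.nn_integral_K) auto
  have leA: "\<phi> z \<le> A.fpass \<phi> z" for z by (rule A.le_fpass[OF \<phi>m \<phi>1 \<phi>A])
  have leD: "\<phi> z \<le> D.fpass \<phi> z" for z by (rule D.le_fpass[OF \<phi>m \<phi>1 \<phi>D])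
  \<comment> \<open>\<open>fpass\<close> regards 0 as already outside and would return \<phi> 0
    there. One step of Q is taken instead; this keeps \<phi> \<le> \<psi>, and
    \<open>fpass_ladder\<close> makes \<psi> subharmonic for P at 0 as well.\<close>
  define \<psi> where "\<psi> z = (if 0 < z then A.fpass \<phi> z else if z < 0 then D.fpass \<phi> z else \<integral>\<^sup>+y. \<phi> y \<partial>Q.K 0)" for z
  have [measurable]: "\<psi> \<in> borel_measurable borel" unfolding \<psi>_def[abs_def] by measurable
  have \<phi>\<psi>: "\<phi> z \<le> \<psi> z" for z
    using leA[of z] leD[of z] \<phi>Q[of 0] by (cases "z = 0") (auto simp: \<psi>_def)
  have A\<psi>: "A.fpass \<phi> z \<le> \<psi> z" for z
    using A.fpass_out[of z \<phi>] \<phi>\<psi>[of z] by (cases "0 < z") (auto simp: \<psi>_def)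
  have D\<psi>: "D.fpass \<phi> z \<le> \<psi> z" for z
    using D.fpass_out[of z \<phi>] \<phi>\<psi>[of z] by (cases "z < 0") (auto simp: \<psi>_def)
  have \<psi>1: "\<psi> z \<le> 1" for z
    unfolding \<psi>_def using A.fpass_le_1[OF \<phi>1] D.fpass_le_1[OF \<phi>1] Q.nn_K_le[OF \<phi>1] by auto
  have \<psi>P: "\<psi> z \<le> (\<integral>\<^sup>+y. \<psi> y \<partial>P.K z)" for z
  proof -
    consider "0 < z" | "z < 0" | "z = 0" by linarith
    then show ?thesis
    proof cases
      case 1
      then have "\<psi> z = (\<integral>\<^sup>+t. A.fpass \<phi> (z + t) \<partial>F)" using A.fpass_in[OF _ \<phi>m, of z] by (simp add: \<psi>_def)
      also have "\<dots> \<le> (\<integral>\<^sup>+t. \<psi> (z + t) \<partial>F)" by (intro nn_integral_mono A\<psi>)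
      finally show ?thesis using 1 by (subst P.nn_integral_K) auto
    next
      case 2
      then have "\<psi> z = (\<integral>\<^sup>+t. D.fpass \<phi> (z + t) \<partial>F')" using D.fpass_in[OF _ \<phi>m, of z] by (simp add: \<psi>_def)
      also have "\<dots> \<le> (\<integral>\<^sup>+t. \<psi> (z + t) \<partial>F')" by (intro nn_integral_mono D\<psi>)
      finally show ?thesis using 2 by (subst P.nn_integral_K) auto
    next
      case 3
      have "(\<integral>\<^sup>+t. \<phi> t \<partial>G) \<le> (\<integral>\<^sup>+t. A.fpass \<phi> (0 + t) \<partial>G)" by (intro nn_integral_mono) (simp add: leA)
      also have "\<dots> = (\<integral>\<^sup>+t. A.fpass \<phi> (0 + t) \<partial>F)" by (rule A.fpass_ladder[OF \<phi>m \<phi>1, symmetric]) simp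
      also have "\<dots> \<le> (\<integral>\<^sup>+t. \<psi> t \<partial>F)" by (intro nn_integral_mono) (simp add: A\<psi>)
      finally have a: "(\<integral>\<^sup>+t. \<phi> t \<partial>G) \<le> (\<integral>\<^sup>+t. \<psi> t \<partial>F)" .
      have "(\<integral>\<^sup>+t. \<phi> t \<partial>G') \<le> (\<integral>\<^sup>+t. D.fpass \<phi> (0 + t) \<partial>G')" by (intro nn_integral_mono) (simp add: leD)
      also have "\<dots> = (\<integral>\<^sup>+t. D.fpass \<phi> (0 + t) \<partial>F')" by (rule D.fpass_ladder[OF \<phi>m \<phi>1, symmetric]) simp
      also have "\<dots> \<le> (\<integral>\<^sup>+t. \<psi> t \<partial>F')" by (intro nn_integral_mono) (simp add: D\<psi>)
      finally have b: "(\<integral>\<^sup>+t. \<phi> t \<partial>G') \<le> (\<integral>\<^sup>+t. \<psi> t \<partial>F')" .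
      have "\<psi> z = ennreal \<alpha> * (\<integral>\<^sup>+t. \<phi> t \<partial>G) + ennreal (1 - \<alpha>) * (\<integral>\<^sup>+t. \<phi> t \<partial>G')"
        using 3 Q.nn_integral_K[OF \<phi>m, of 0] by (simp add: \<psi>_def)
      also have "\<dots> \<le> ennreal \<alpha> * (\<integral>\<^sup>+t. \<psi> t \<partial>F) + ennreal (1 - \<alpha>) * (\<integral>\<^sup>+t. \<psi> t \<partial>F')"
        by (intro add_mono mult_left_mono a b) auto
      finally show ?thesis using 3 by (subst P.nn_integral_K) auto
    qed
  qed
  define s where "s = (SUP x\<in>S. \<psi> x)"
  \<comment> \<open>The zero-one law for \<phi> is stated with the larger supremum s of \<psi>, so
    that it passes through the expectations defining \<psi> and yields the contraction for
    \<psi>.\<close>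
  have \<phi>s: "\<phi> y \<le> s * \<phi> y" for y
  proof (cases "y \<in> E")
    case True
    have "\<phi> y \<le> (SUP x\<in>E. \<phi> x) * \<phi> y" unfolding \<phi>_def by (rule Q.avoid_le_sup_mult[OF closed_set_E Bm True])
    also have "\<dots> \<le> s * \<phi> y"
      unfolding s_def by (intro mult_right_mono SUP_mono) (use E_subset_S \<phi>\<psi> in auto)
    finally show ?thesis .
  next
    case False then show ?thesis unfolding \<phi>_def by (simp add: B_def)
  qed
  have \<psi>s: "\<psi> y \<le> s * \<psi> y" for y
  proof -
    have "(\<integral>\<^sup>+z. \<phi> z \<partial>Q.K 0) \<le> (\<integral>\<^sup>+z. s * \<phi> z \<partial>Q.K 0)" by (intro nn_integral_mono \<phi>s)
    also have "\<dots> = s * (\<integral>\<^sup>+z. \<phi> z \<partial>Q.K 0)" by (rule nn_integral_cmult) measurable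
    finally show ?thesis using A.fpass_le_mult[OF \<phi>s \<phi>m, of y] D.fpass_le_mult[OF \<phi>s \<phi>m, of y] by (simp add: \<psi>_def)
  qed
  \<comment> \<open>The set on which \<psi> is uniformly below 1 is the single point 0 on a lattice.
    Otherwise it consists of starts just above 0: their ladder jump lands with positive probability
    near a negative point g of supp G, where \<phi> is at most some q < 1.\<close>
  have "\<exists>A m q. openin (top_of_set Z) A \<and> m \<in> A \<and> m \<in> E \<and> q < 1 \<and> (\<forall>x\<in>A. \<psi> x \<le> q)"
  proof (cases "d = 0")
    case False
    then have d0: "0 < d" using d by simp
    have "\<phi> y < 1" if "y \<in> Z" for y
    proof -
      obtain \<delta> q where "0 < \<delta>" "q < 1" "\<And>y'. y' \<in> Z \<Longrightarrow> \<bar>y' - y\<bar> < \<delta> \<Longrightarrow> \<phi> y' \<le> q" using unif[OF \<open>y \<in> Z\<close>] by blast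
      then show ?thesis using le_less_trans[of "\<phi> y" q 1] that by simp
    qed
    moreover have "emeasure (Q.K 0) Z = 1"
    proof -
      have "AE y in Q.K 0. y \<in> Z" using closed_set_Q by (simp add: closed_set_def)
      then show ?thesis using Q.K_prob[of 0] by (intro prob_space.emeasure_eq_1_AE) auto
    qed
    ultimately have "noret Q.K B 0 < 1"
      by (intro Q.noret_less_1[OF Bm Z_m]) (auto simp: \<phi>_def)
    then have "\<psi> 0 < 1" using Q.noret_eq[OF Bm, of 0] by (simp add: \<psi>_def \<phi>_def)
    then show ?thesis using openin_singleton[OF d0, of 0] zero_in_E
      by (intro exI[of _ "{0}"] exI[of _ 0] exI[of _ "\<psi> 0"]) auto
  next
    case True
    obtain g where g: "g \<in> supp G" "g < 0" using supp_sign(1) by auto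
    obtain g' where g': "g' \<in> supp G'" "0 < g'" using supp_sign(2) by auto
    obtain \<delta> q where dq: "0 < \<delta>" "q < 1" "\<And>y'. \<bar>y' - g\<bar> < \<delta> \<Longrightarrow> \<phi> y' \<le> q"
      using unif[of g] True by auto
    define r where "r = min (\<delta> / 2) (- g / 2)"
    have r: "0 < r" "r \<le> \<delta> / 2" "r \<le> - g / 2" using dq(1) g(2) by (auto simp: r_def)
    let ?C = "ball g r"
    have ms: "emeasure G ?C + emeasure G (- ?C) = 1"
      using emeasure_Un_null_set plus_emeasure[of ?C G "- ?C"] by simp
    have pos: "0 < emeasure G ?C" using emeasure_supp_ball[OF g(1), of ?C] r by simp
    have "\<psi> z \<le> q * emeasure G ?C + emeasure G (- ?C)" if z: "z \<in> {0<..<r}" for z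
    proof -
      have "\<psi> z = (\<integral>\<^sup>+t. A.fpass \<phi> (z + t) \<partial>F)" using A.fpass_in[OF _ \<phi>m, of z] z by (simp add: \<psi>_def)
      also have "\<dots> = (\<integral>\<^sup>+t. A.fpass \<phi> (z + t) \<partial>G)" by (rule A.fpass_ladder[OF \<phi>m \<phi>1]) (use z in simp)
      also have "\<dots> \<le> (\<integral>\<^sup>+t. q * indicator ?C t + indicator (- ?C) t \<partial>G)"
      proof (rule nn_integral_mono)
        fix t show "A.fpass \<phi> (z + t) \<le> q * indicator ?C t + indicator (- ?C) t"
        proof (cases "t \<in> ?C")
          case C: True
          then have "\<bar>t - g\<bar> < r" by (simp add: dist_real_def)
          then have "z + t < 0" "\<bar>z + t - g\<bar> < \<delta>" using z r by auto
          then show ?thesis using C dq(3)[of "z + t"] A.fpass_out[of "z + t" \<phi>] by simp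
        qed (simp add: A.fpass_le_1[OF \<phi>1])
      qed
      also have "\<dots> = (\<integral>\<^sup>+t. q * indicator ?C t \<partial>G) + (\<integral>\<^sup>+t. indicator (- ?C) t \<partial>G)"
        by (rule nn_integral_add)
          (intro borel_measurable_times_ennreal borel_measurable_const borel_measurable_indicator, simp_all)
      also have "\<dots> = q * emeasure G ?C + emeasure G (- ?C)" by (simp add: nn_integral_cmult_indicator)
      finally show ?thesis .
    qed
    moreover have "q * emeasure G ?C + emeasure G (- ?C) < 1" by (rule ennreal_average_less[OF dq(2) pos ms])
    moreover have "min g' r / 2 \<in> {0<..<r}" using g' r by auto
    moreover have "min g' r / 2 \<in> E" by (rule in_E_above[OF g'(1)]) (use g' r True in auto)
    ultimately show ?thesis using True
      by (intro exI[of _ "{0<..<r}"] exI[of _ "min g' r / 2"] exI[of _ "q * emeasure G ?C + emeasure G (- ?C)"]) auto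
  qed
  then obtain A m q where A: "openin (top_of_set Z) A" "m \<in> A" "m \<in> E" and q: "q < 1" "\<And>x. x \<in> A \<Longrightarrow> \<psi> x \<le> q" by blast
  have Am: "A \<in> sets borel" by (rule openin_Z_m[OF A(1)])
  have AS: "avoid P.K A y = 0" if "y \<in> S" for y
    by (rule avoid_zero_of_recurrent[OF closed_set_S S_subset_Z P.prob_kernel_axioms avoid_P_le_Q[OF Am] rec A that])
  have "\<psi> y = 0" if "y \<in> S" for y
  proof (rule P.subharmonic_zero[OF closed_set_S Am])
    show "\<psi> y \<le> q * (SUP x\<in>S. \<psi> x)" if "y \<in> S" "y \<in> A" for y
    proof -
      have "\<psi> y \<le> s * \<psi> y" by (rule \<psi>s)
      also have "\<dots> \<le> s * q" by (intro mult_left_mono q(2) that(2)) simp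
      finally show ?thesis by (simp add: mult.commute s_def)
    qed
  qed (use q AS \<psi>P \<psi>1 that in auto)
  then have "avoid Q.K B y = 0" if "y \<in> E" for y
    using \<phi>\<psi>[of y] E_subset_S that by (auto simp: \<phi>_def)
  then have "noret Q.K B x = 0" by (rule noret_zero_of_avoid[OF Q.prob_kernel_axioms closed_set_E Bm _ x])
  moreover have "noret Q.K T x \<le> noret Q.K B x"
    by (rule Q.noret_antimono[OF closed_set_E Tm Bm _ x]) (auto simp: B_def)
  ultimately show ?thesis by simp
qed

end

subsection \<open>The moment condition\<close>

text \<open>The minimum of two positive numbers is at most any weighted geometric mean of them; for
  other signs the left side is 0.\<close>

lemma rpow_min_le:
  assumes "0 \<le> r" "r \<le> 1"
  shows "ennreal (min (- t) u) \<le> ennreal (rpow \<bar>t\<bar> r) * ennreal (rpow u (1 - r))"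
proof (cases "t < 0 \<and> 0 < u")
  case False
  then have "min (- t) u \<le> 0" by auto
  then show ?thesis by (simp add: ennreal_neg)
next
  case True
  define m where "m = min (- t) u"
  have m: "0 < m" "m \<le> \<bar>t\<bar>" "m \<le> u" using True by (auto simp: m_def)
  have rp: "rpow v s = v powr s" if "0 < v" for v s using that by (simp add: rpow_def)
  have "m = m powr r * m powr (1 - r)" using m(1) by (simp add: powr_add[symmetric])
  also have "\<dots> \<le> \<bar>t\<bar> powr r * u powr (1 - r)"
    using m assms by (intro mult_mono powr_mono2) auto
  finally have "m \<le> rpow \<bar>t\<bar> r * rpow u (1 - r)" using True by (simp add: rp)
  then show ?thesis using True by (simp add: m_def[symmetric] ennreal_mult[symmetric] rp ennreal_leI)
qed

context switch
begin

text \<open>By Tonelli the ladder integral is the expectation of \<open>min (- D) A'\<close> for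
  independent D and A', and \<open>rpow_min_le\<close> splits it into the product of the two
  moments.\<close>

lemma hh_moment:
  assumes r: "0 \<le> r" "r \<le> 1"
  shows "(\<integral>\<^sup>+x\<in>{0..}. hh x \<partial>lborel) \<le> (\<integral>\<^sup>+t. ennreal (rpow \<bar>t\<bar> r) \<partial>G) * (\<integral>\<^sup>+t. ennreal (rpow t (1 - r)) \<partial>G')"
proof -
  define f :: "real \<Rightarrow> real \<Rightarrow> real \<Rightarrow> ennreal" where "f x t u = (if 0 \<le> x \<and> x \<le> - t \<and> x \<le> u then 1 else 0)" for x t u
  interpret LG: pair_sigma_finite lborel G by unfold_locales
  interpret LG': pair_sigma_finite lborel G' by unfold_locales
  have rm [measurable]: "(\<lambda>x. rpow x s) \<in> borel_measurable borel" for s unfolding rpow_def by measurable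
  have hx: "hh x * indicator {0..} x = (\<integral>\<^sup>+t. \<integral>\<^sup>+u. f x t u \<partial>G' \<partial>G)" for x
  proof -
    have "(\<integral>\<^sup>+u. f x t u \<partial>G') = indicator {0..} x * emeasure G' {x..} * indicator {..-x} t" for t
    proof -
      have "(\<integral>\<^sup>+u. f x t u \<partial>G') = (\<integral>\<^sup>+u. indicator {0..} x * indicator {..-x} t * indicator {x..} u \<partial>G')"
        by (intro nn_integral_cong) (auto simp: f_def indicator_def)
      also have "\<dots> = indicator {0..} x * indicator {..-x} t * emeasure G' {x..}"
        by (rule nn_integral_cmult_indicator) simp
      finally show ?thesis by (simp only: ac_simps)
    qed
    then have "(\<integral>\<^sup>+t. \<integral>\<^sup>+u. f x t u \<partial>G' \<partial>G) = indicator {0..} x * emeasure G' {x..} * emeasure G {..-x}"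
      by (simp add: nn_integral_cmult_indicator)
    then show ?thesis
      by (simp add: hh_def PG.emeasure_eq_measure PG'.emeasure_eq_measure ennreal_mult ac_simps)
  qed
  have "(\<integral>\<^sup>+x\<in>{0..}. hh x \<partial>lborel) = (\<integral>\<^sup>+x. \<integral>\<^sup>+t. \<integral>\<^sup>+u. f x t u \<partial>G' \<partial>G \<partial>lborel)" by (simp only: hx)
  also have "\<dots> = (\<integral>\<^sup>+t. \<integral>\<^sup>+x. \<integral>\<^sup>+u. f x t u \<partial>G' \<partial>lborel \<partial>G)"
    by (rule LG.Fubini'[symmetric]) (unfold f_def, measurable)
  also have "\<dots> = (\<integral>\<^sup>+t. \<integral>\<^sup>+u. \<integral>\<^sup>+x. f x t u \<partial>lborel \<partial>G' \<partial>G)"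
    by (intro nn_integral_cong LG'.Fubini'[symmetric]) (unfold f_def, measurable)
  also have "\<dots> \<le> (\<integral>\<^sup>+t. \<integral>\<^sup>+u. ennreal (rpow \<bar>t\<bar> r) * ennreal (rpow u (1 - r)) \<partial>G' \<partial>G)"
  proof (intro nn_integral_mono)
    fix t u
    have "(\<integral>\<^sup>+x. f x t u \<partial>lborel) = (\<integral>\<^sup>+x. indicator {0..min (- t) u} x \<partial>lborel)"
      by (intro nn_integral_cong) (auto simp: f_def indicator_def)
    also have "\<dots> = ennreal (min (- t) u)" by (simp add: emeasure_lborel_Icc_eq ennreal_neg not_le)
    also have "\<dots> \<le> ennreal (rpow \<bar>t\<bar> r) * ennreal (rpow u (1 - r))" by (rule rpow_min_le[OF r])
    finally show "(\<integral>\<^sup>+x. f x t u \<partial>lborel) \<le> \<dots>" .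
  qed
  also have "\<dots> = (\<integral>\<^sup>+t. ennreal (rpow \<bar>t\<bar> r) \<partial>G) * (\<integral>\<^sup>+t. ennreal (rpow t (1 - r)) \<partial>G')"
    by (subst nn_integral_cmult, measurable, subst nn_integral_multc, measurable)
  finally show ?thesis .
qed

end

subsection \<open>The span of the walk\<close>

text \<open>The maximum that defines the span is attained: the candidates are bounded because the
  first law is not concentrated at 0, and along candidates u converging to the supremum the integers
  t / u converge to an integer.\<close>

lemma lattice_span_greatest:
  assumes F: "prob_space F" "sets F = sets borel" and F': "prob_space F'" "sets F' = sets borel"
    and nz: "\<not> (AE t in F. t = 0)"
  defines "d \<equiv> lattice_span F F'"
  shows "0 \<le> d" "AE t in F. t \<in> lattice_set d" "AE t in F'. t \<in> lattice_set d"
    "\<And>u. 0 \<le> u \<Longrightarrow> AE t in F. t \<in> lattice_set u \<Longrightarrow> AE t in F'. t \<in> lattice_set u \<Longrightarrow> u \<le> d"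
proof -
  interpret F: prob_space F by fact
  interpret F': prob_space F' by fact
  define R where "R u \<longleftrightarrow> 0 \<le> u \<and> (AE t in F. t \<in> lattice_set u) \<and> (AE t in F'. t \<in> lattice_set u)" for u
  have R: "0 \<le> u \<and> measure F (lattice_set u) * measure F' (lattice_set u) = 1 \<longleftrightarrow> R u" for u
  proof -
    have L: "lattice_set u \<in> sets F" "lattice_set u \<in> sets F'" using F(2) F'(2) by simp_all
    have "x * y = 1 \<longleftrightarrow> x = 1 \<and> y = 1" if "0 \<le> x" "x \<le> 1" "0 \<le> y" "y \<le> 1" for x y :: real
      using that mult_left_le[of y x] mult_left_le[of x y] by (auto simp: mult.commute)
    then show ?thesis unfolding R_def
      by (simp add: F.prob_eq_1[OF L(1), symmetric] F'.prob_eq_1[OF L(2), symmetric])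
  qed
  \<comment> \<open>Nonzero points of a lattice have modulus at least u, so candidates of unbounded
    size would force the first law to be concentrated at 0.\<close>
  have small: "AE t in F. \<bar>t\<bar> < u \<longrightarrow> t = 0" if "R u" "0 < u" for u
  proof -
    have "AE t in F. t \<in> lattice_set u" using that by (simp add: R_def)
    then show ?thesis
      by eventually_elim (use lattice_set_dist[OF that(2), of _ 0] in auto)
  qed
  obtain c where c: "\<And>u. R u \<Longrightarrow> u \<le> c"
  proof (rule ccontr)
    assume "\<not> thesis"
    then have "\<exists>u. R u \<and> real n < u" for n :: nat using that[of "real n"] by (meson not_le)
    then obtain u where u: "\<And>n. R (u n)" "\<And>n. real n < u n" by metis
    have "AE t in F. \<forall>n. \<bar>t\<bar> < u n \<longrightarrow> t = 0"
      unfolding AE_all_countable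
    proof
      fix n show "AE t in F. \<bar>t\<bar> < u n \<longrightarrow> t = 0"
        by (rule small[OF u(1)]) (use u(2)[of n] in linarith)
    qed
    then have "AE t in F. t = 0"
    proof eventually_elim
      fix t assume *: "\<forall>n. \<bar>t\<bar> < u n \<longrightarrow> t = 0"
      obtain n :: nat where "\<bar>t\<bar> < real n" using reals_Archimedean2 by blast
      then show "t = 0" using * u(2)[of n] by (meson less_trans)
    qed
    then show False using nz by simp
  qed
  have R0: "R 0" by (simp add: R_def)
  have bdd: "bdd_above (Collect R)" unfolding bdd_above_def using c by blast
  define s where "s = Sup (Collect R)"
  have le: "u \<le> s" if "R u" for u unfolding s_def by (rule cSup_upper) (use that bdd in auto)
  have Rs: "R s"
  proof (cases "s = 0")
    case False
    then have s0: "0 < s" using le[OF R0] by simp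
    have "\<exists>u. R u \<and> s - s / real (n + 2) < u" for n
    proof -
      have "s - s / real (n + 2) < s" using s0 by simp
      then have "\<exists>u\<in>Collect R. s - s / real (n + 2) < u"
        using less_cSupD[of "Collect R" "s - s / real (n + 2)"] R0 unfolding s_def[symmetric] by blast
      then show ?thesis by simp
    qed
    then obtain u where u: "\<And>n. R (u n)" "\<And>n. s - s / real (n + 2) < u n" by metis
    have up: "0 < u n" for n
    proof -
      have "s / real (n + 2) \<le> s / 1" using s0 by (intro divide_left_mono) auto
      then show ?thesis using u(2)[of n] by simp
    qed
    have lim: "u \<longlonglongrightarrow> s"
    proof (rule tendsto_sandwich)
      have "(\<lambda>n. 1 / real (n + 2)) \<longlonglongrightarrow> 0" using LIMSEQ_ignore_initial_segment[OF lim_inverse_n', of 2] by simp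
      from tendsto_diff[OF tendsto_const tendsto_mult[OF tendsto_const this, of s], of s]
      show "(\<lambda>n. s - s / real (n + 2)) \<longlonglongrightarrow> s" by simp
      show "\<forall>\<^sub>F n in sequentially. s - s / real (n + 2) \<le> u n" using u(2) by (simp add: less_imp_le)
      show "\<forall>\<^sub>F n in sequentially. u n \<le> s" using le u(1) by simp
    qed simp
    have limit: "t \<in> lattice_set s" if t: "\<And>n. t \<in> lattice_set (u n)" for t
    proof -
      have "t / u n \<in> \<int>" for n
      proof -
        obtain k :: int where "t = u n * of_int k" using t[of n] unfolding lattice_set_pos[OF up[of n]] by (elim exE)
        then show ?thesis using up[of n] by simp
      qed
      moreover have "(\<lambda>n. t / u n) \<longlonglongrightarrow> t / s" using lim s0 by (intro tendsto_divide tendsto_const) auto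
      ultimately have "t / s \<in> \<int>"
        by (rule closed_sequentially[OF closed_Ints])
      then obtain k :: int where "t / s = of_int k" by (auto elim: Ints_cases)
      then have "t = s * of_int k" using s0 by (simp add: field_simps)
      then show ?thesis unfolding lattice_set_pos[OF s0] by (rule exI)
    qed
    have "AE t in F. \<forall>n. t \<in> lattice_set (u n)" "AE t in F'. \<forall>n. t \<in> lattice_set (u n)"
      unfolding AE_all_countable using u(1) by (auto simp: R_def)
    then have "AE t in F. t \<in> lattice_set s" "AE t in F'. t \<in> lattice_set s"
      by - (erule eventually_mono, simp add: limit)+
    then show ?thesis using s0 by (simp add: R_def)
  qed (use R0 in simp)
  have "d = s" unfolding d_def lattice_span_def R using Rs le by (rule Greatest_equality)
  then have "R d" "\<And>u. R u \<Longrightarrow> u \<le> d" using Rs le by auto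
  then show "0 \<le> d" "AE t in F. t \<in> lattice_set d" "AE t in F'. t \<in> lattice_set d"
    "\<And>u. 0 \<le> u \<Longrightarrow> AE t in F. t \<in> lattice_set u \<Longrightarrow> AE t in F'. t \<in> lattice_set u \<Longrightarrow> u \<le> d"
    by (simp_all add: R_def)
qed

text \<open>Extracts the independence of each single sequence from that of the joint family over the
  sum type.\<close>

lemma (in prob_space) indep_vars_reindex_inj:
  assumes f: "inj f" and indep: "indep_vars (\<lambda>_. N) Y (f ` I)"
  shows "indep_vars (\<lambda>_. N) (\<lambda>i. Y (f i)) I"
  unfolding indep_vars_def2
proof (intro conjI ballI)
  show "random_variable N (Y (f i))" if "i \<in> I" for i using indep that by (auto simp: indep_vars_def2)
  have *: "indep_sets (\<lambda>i. {Y i -` A \<inter> space M |A. A \<in> sets N}) (f ` I)" using indep by (simp add: indep_vars_def2)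
  show "indep_sets (\<lambda>i. {Y (f i) -` A \<inter> space M |A. A \<in> sets N}) I"
  proof (rule indep_setsI)
    show "{Y (f i) -` A \<inter> space M |A. A \<in> sets N} \<subseteq> events" if "i \<in> I" for i
      using * that by (auto simp: indep_sets_def)
    fix A J assume J: "J \<noteq> {}" "J \<subseteq> I" "finite J" and A: "\<forall>j\<in>J. A j \<in> {Y (f j) -` A \<inter> space M |A. A \<in> sets N}"
    have "prob (\<Inter>j\<in>f ` J. A (inv f j)) = (\<Prod>j\<in>f ` J. prob (A (inv f j)))"
      by (rule indep_setsD[OF *]) (use J A f in auto)
    then show "prob (\<Inter>j\<in>J. A j) = (\<Prod>j\<in>J. prob (A j))"
      using f by (simp add: prod.reindex inj_on_subset[OF f])
  qed
qed

lemma iid_pair_walks: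
  assumes "prob_space M" "iid_pair M X X'"
  shows "walk M X" "walk M X'"
proof -
  interpret prob_space M by fact
  have i: "indep_vars (\<lambda>_. borel) (case_sum X X') ({1..} <+> {1..})" using assms(2) by (simp add: iid_pair_def)
  have a: "indep_vars (\<lambda>_. borel) (\<lambda>i. case_sum X X' (Inl i)) {1..}"
    by (rule indep_vars_reindex_inj[OF inj_Inl indep_vars_subset[OF i]]) auto
  have b: "indep_vars (\<lambda>_. borel) (\<lambda>i. case_sum X X' (Inr i)) {1..}"
    by (rule indep_vars_reindex_inj[OF inj_Inr indep_vars_subset[OF i]]) auto
  have c: "distr M borel (X n) = distr M borel (X 1)" "distr M borel (X' n) = distr M borel (X' 1)" if "1 \<le> n" for n
    using assms(2) that unfolding iid_pair_def by blast+
  show "walk M X"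
    by (intro walk.intro walk_axioms.intro assms(1)) (rule a[unfolded sum.case], erule c(1))
  show "walk M X'"
    by (intro walk.intro walk_axioms.intro assms(1)) (rule b[unfolded sum.case], erule c(2))
qed

lemma AE_negative_time:
  fixes S :: "nat \<Rightarrow> 'w \<Rightarrow> real"
  assumes "AE \<omega> in M. liminf (\<lambda>n. ereal (S n \<omega>)) = -\<infinity>"
  shows "AE \<omega> in M. \<exists>k\<ge>1. S k \<omega> < 0"
  using assms
proof eventually_elim
  fix \<omega> assume *: "liminf (\<lambda>n. ereal (S n \<omega>)) = -\<infinity>"
  show "\<exists>k\<ge>1. S k \<omega> < 0"
  proof (rule ccontr)
    assume "\<not> ?thesis"
    then have "\<forall>\<^sub>F n in sequentially. (0 :: ereal) \<le> ereal (S n \<omega>)"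
      by (intro eventually_sequentiallyI[of 1]) (auto simp: not_less)
    then have "(0 :: ereal) \<le> liminf (\<lambda>n. ereal (S n \<omega>))" by (rule Liminf_bounded)
    then show False using * by simp
  qed
qed

lemma AE_positive_time:
  fixes S :: "nat \<Rightarrow> 'w \<Rightarrow> real"
  assumes "AE \<omega> in M. limsup (\<lambda>n. ereal (S n \<omega>)) = \<infinity>"
  shows "AE \<omega> in M. \<exists>k\<ge>1. 0 < S k \<omega>"
  using assms
proof eventually_elim
  fix \<omega> assume *: "limsup (\<lambda>n. ereal (S n \<omega>)) = \<infinity>"
  show "\<exists>k\<ge>1. 0 < S k \<omega>"
  proof (rule ccontr)
    assume "\<not> ?thesis"
    then have "\<forall>\<^sub>F n in sequentially. ereal (S n \<omega>) \<le> 0"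
      by (intro eventually_sequentiallyI[of 1]) (auto simp: not_less)
    then have "limsup (\<lambda>n. ereal (S n \<omega>)) \<le> 0" by (rule Limsup_bounded)
    then show False using * by simp
  qed
qed

theorem theorem3:
  fixes M :: "'w measure" and X X' :: "nat \<Rightarrow> 'w \<Rightarrow> real" and \<alpha> :: real
  assumes "prob_space M"
    and "iid_pair M X X'"
    and "\<not> (AE \<omega> in M. X 1 \<omega> = 0)"
    and "\<not> (AE \<omega> in M. X' 1 \<omega> = 0)"
    and "0 \<le> \<alpha>" and "\<alpha> \<le> 1"
    and "AE \<omega> in M. liminf (\<lambda>n. ereal (partial_sum X n \<omega>)) = -\<infinity>"
    and "AE \<omega> in M. limsup (\<lambda>n. ereal (partial_sum X' n \<omega>)) = \<infinity>"
  shows "(ladder_integral M X X' < \<infinity> \<longrightarrow>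
            topologically_recurrent_on (walk_kernel M X X' \<alpha>) (state_space M X X')
              (msupport (state_space M X X') (mu_measure M X X' \<alpha>)))
       \<and> ((\<exists>r\<in>{0..1}.
              (\<integral>\<^sup>+\<omega>. ennreal (rpow \<bar>weak_descent X \<omega>\<bar> r) \<partial>M)
            + (\<integral>\<^sup>+\<omega>. ennreal (rpow (weak_ascent X' \<omega>) (1 - r)) \<partial>M) < \<infinity>)
          \<longrightarrow> ladder_integral M X X' < \<infinity>)
       \<and> (topologically_recurrent_on (walk_kernel M X X' \<alpha>) (state_space M X X')
              (msupport (state_space M X X') (mu_measure M X X' \<alpha>))
          \<longleftrightarrow> topologically_recurrent_on (ladder_kernel M X X' \<alpha>) (state_space M X X')
              (msupport (state_space M X X') (nu_measure M X X' \<alpha>)))"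
proof -
  have "walk M X" "walk M X'" by (rule iid_pair_walks[OF assms(1,2)])+
  interpret W: walk M X by fact
  interpret W': walk M X' by fact
  define F where "F = distr M borel (X 1)"
  define F' where "F' = distr M borel (X' 1)"
  define G where "G = distr M borel (weak_descent X)"
  define G' where "G' = distr M borel (weak_ascent X')"
  define d where "d = walk_span M X X'"
  have FX: "W.FX = F" "W'.FX = F'" by (simp_all only: W.FX_def W'.FX_def F_def F'_def)
  have F: "prob_space F" "sets F = sets borel" and F': "prob_space F'" "sets F' = sets borel"
    using W.prob_space_FX W'.prob_space_FX by (auto simp only: FX F_def F'_def sets_distr)
  have half: "{y::real. 1 * y \<le> 0} = {..0}" "{y::real. -1 * y \<le> 0} = {0..}"
    "{y::real. 0 < 1 * y} = {0<..}" "{y::real. 0 < -1 * y} = {..<0}" by auto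
  have Dm [measurable]: "weak_descent X \<in> borel_measurable M" unfolding weak_descent_def by measurable
  have Am [measurable]: "weak_ascent X' \<in> borel_measurable M" unfolding weak_ascent_def by measurable
  have hit: "AE \<omega> in M. \<exists>k\<ge>1. 1 * partial_sum X k \<omega> < 0" "AE \<omega> in M. \<exists>k\<ge>1. -1 * partial_sum X' k \<omega> < 0"
    using AE_negative_time[OF assms(7)] AE_positive_time[OF assms(8)] by simp_all
  have Lp: "ladder 1 F G"
    using W.ladder_walk[OF _ hit(1)] unfolding FX half G_def weak_descent_def by simp
  have Ln: "ladder (-1) F' G'"
    using W'.ladder_walk[OF _ hit(2)] unfolding FX half G'_def weak_ascent_def by simp
  have "X 1 \<in> borel_measurable M" by (rule W.X_m) simp
  then have nz: "\<not> (AE t in F. t = 0)" using assms(3) unfolding F_def by (subst AE_distr_iff) auto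
  note span = lattice_span_greatest[OF F F' nz, folded d_def[unfolded walk_span_def, folded F_def F'_def]]
  interpret S: switch_renewal F F' G G' \<alpha> d "U_plus M X" "U_minus M X'"
  proof (intro switch_renewal.intro switch.intro switch_renewal_axioms.intro)
    show "ladder 1 F G" "ladder (-1) F' G'" "0 \<le> \<alpha>" "\<alpha> \<le> 1" by (fact Lp Ln assms(5,6))+
    show "0 \<le> d" "AE t in F. t \<in> lattice_set d" "AE t in F'. t \<in> lattice_set d" by (fact span(1-3))+
    show "u \<le> d" if "0 \<le> u" "AE t in F. t \<in> lattice_set u" "AE t in F'. t \<in> lattice_set u" for u
      using that by (rule span(4))
    fix \<phi> :: "real measure" and N :: "real set" assume \<phi>: "sigma_finite_measure \<phi>" "sets \<phi> = sets borel" "N \<in> sets borel"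
    show "emeasure (U_plus M X \<star> \<phi>) N = 0 \<longleftrightarrow> (AE m in \<phi>. \<forall>n. (up 1 F ^^ n) (\<lambda>s. indicator N (m + s)) 0 = 0)"
      using W.renewal_ladder_null_iff[OF \<phi>, of 1] unfolding FX half U_plus_def .
    show "emeasure (U_minus M X' \<star> \<phi>) N = 0 \<longleftrightarrow> (AE m in \<phi>. \<forall>n. (up (-1) F' ^^ n) (\<lambda>s. indicator N (m + s)) 0 = 0)"
      using W'.renewal_ladder_null_iff[OF \<phi>, of "-1"] unfolding FX half U_minus_def .
  qed
  have mG: "measure G B = \<P>(\<omega> in M. weak_descent X \<omega> \<in> B)" "measure G' B = \<P>(\<omega> in M. weak_ascent X' \<omega> \<in> B)"
    if "B \<in> sets borel" for B
    unfolding G_def G'_def using that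
    by (subst measure_distr; auto intro!: arg_cong[where f="measure M"])+
  have Z: "state_space M X X' = S.Z" by (simp add: state_space_def d_def)
  have K: "walk_kernel M X X' \<alpha> = S.P.K" "ladder_kernel M X X' \<alpha> = S.Q.K"
    by (simp_all add: walk_kernel_def ladder_kernel_def F_def F'_def G_def G'_def)
  have nu: "nu_measure M X X' \<alpha> = S.nu"
    unfolding nu_measure_def Let_def S.nu_def S.dens_def S.a_def S.p_def S.p'_def d_def[symmetric]
    by (simp add: mG)
  have mu: "mu_measure M X X' \<alpha> = S.mu" by (simp add: mu_measure_def S.mu_def nu)
  have I: "ladder_integral M X X' = (\<integral>\<^sup>+x\<in>{0..}. S.hh x \<partial>lborel)"
    unfolding ladder_integral_def S.hh_def by (simp add: mG)
  have ms: "msupport S.Z S.nu = S.E" "msupport S.Z S.mu = S.S"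
    by (rule msupport_eq_supp[OF S.d]; simp add: S.nu_AE_Z S.mu_AE_Z)+
  have rP: "topologically_recurrent_on S.P.K S.Z S.S \<longleftrightarrow>
      (\<forall>x\<in>S.S. \<forall>T. openin (top_of_set S.Z) T \<longrightarrow> x \<in> T \<longrightarrow> noret S.P.K T x = 0)"
    using S.S_subset_Z S.closed_set_S by (subst S.P.topologically_recurrent_on_iff) auto
  have rQ: "topologically_recurrent_on S.Q.K S.Z S.E \<longleftrightarrow>
      (\<forall>x\<in>S.E. \<forall>T. openin (top_of_set S.Z) T \<longrightarrow> x \<in> T \<longrightarrow> noret S.Q.K T x = 0)"
    using S.E_subset_Z S.closed_set_E by (subst S.Q.topologically_recurrent_on_iff) auto
  have PQ: "topologically_recurrent_on S.P.K S.Z S.S \<longleftrightarrow> topologically_recurrent_on S.Q.K S.Z S.E"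
    unfolding rP rQ by (intro iffI ballI allI impI; erule S.P_recurrent_of_Q[rotated] S.Q_recurrent_of_P[rotated], assumption+, blast)
  have a: "topologically_recurrent_on S.Q.K S.Z S.E" if "ladder_integral M X X' < \<infinity>"
    unfolding rQ using S.Q_recurrent[OF S.flux_finite] that unfolding I by blast
  have m: "ladder_integral M X X' < \<infinity>"
    if r: "r \<in> {0..1}" and fin: "(\<integral>\<^sup>+\<omega>. ennreal (rpow \<bar>weak_descent X \<omega>\<bar> r) \<partial>M)
            + (\<integral>\<^sup>+\<omega>. ennreal (rpow (weak_ascent X' \<omega>) (1 - r)) \<partial>M) < \<infinity>" for r
  proof -
    have [measurable]: "(\<lambda>x. rpow x s) \<in> borel_measurable borel" for s unfolding rpow_def by measurable
    have "ladder_integral M X X' \<le> (\<integral>\<^sup>+t. ennreal (rpow \<bar>t\<bar> r) \<partial>G) * (\<integral>\<^sup>+t. ennreal (rpow t (1 - r)) \<partial>G')"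
      unfolding I by (rule S.hh_moment) (use r in auto)
    also have "\<dots> = (\<integral>\<^sup>+\<omega>. ennreal (rpow \<bar>weak_descent X \<omega>\<bar> r) \<partial>M) * (\<integral>\<^sup>+\<omega>. ennreal (rpow (weak_ascent X' \<omega>) (1 - r)) \<partial>M)"
      unfolding G_def G'_def by (simp add: nn_integral_distr)
    also have "\<dots> < \<infinity>" using fin by (simp add: ennreal_mult_less_top)
    finally show ?thesis .
  qed
  show ?thesis unfolding Z K nu mu ms using a PQ m by blast
qed

end
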